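(* (i) The Poisson flows are exactly (up to isomorphism) the tail boundary flows of sequences $(\mu_n)_{n\in\mathbb{N}}$ of probability measures on $\mathbb{R}$ such that the support of every $\mu_n$ consists of two points and $\sup_{n\in\mathbb{N}}\operatorname{Var}\mu_n<+\infty$. (ii) The Poisson flows of positive type are exactly (up to isomorphism) the tail boundary flows of sequences $(\mu_n)_{n\in\mathbb{N}}$ of probability measures on $\mathbb{R}$ such that, for every $n$, the support of $\mu_n$ consists of two points $a_n<b_n$ with $\mu_n(\{a_n\})\geq\mu_n(\{b_n\})$, and $\sup_{n\in\mathbb{N}}\operatorname{Var}\mu_n<+\infty$.
   Context: A flow is a nonsingular action of $\mathbb{R}$ on a standard measure space; $\operatorname{Var}\mu$ denotes the variance of $\mu$. Tail boundary flow: let $(\mu_n)_{n\geq1}$ be Borel probability measures on $\mathbb{R}$. Put $(\Omega,\mu)=\prod_{k\geq1}(\mathbb{R},\mu_k)$ and $(\Omega_n,\widetilde{\mu}_n)=\prod_{k\geq n+1}(\mathbb{R},\mu_k)$, let $\mu_0$ be a probability measure on $\mathbb{R}$ equivalent to Lebesgue measure, and define the nonsingular maps $\pi_n:(\mathbb{R}\times\Omega,\mu_0\times\mu)\to(\mathbb{R}\times\Omega_n,\mu_0\times\widetilde{\mu}_n)$ by $\pi_n(t,\omega)=(t+\omega_1+\cdots+\omega_n,\omega_{n+1},\omega_{n+2},\ldots)$. Let $A_n=\{F\circ\pi_n: F\in L^\infty(\mathbb{R}\times\Omega_n)\}\subset L^\infty(\mathbb{R}\times\Omega)$ and $A=\bigcap_{n\geq0}A_n$.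 The tail boundary flow of $(\mu_n)_n$ is the (ergodic) action of $\mathbb{R}$ on $A$ induced by translation in the first variable, $(s\cdot F)(t,\omega)=F(t-s,\omega)$. Actions of $\mathbb{R}$ on abelian von Neumann algebras with separable predual are identified with flows on standard measure spaces. For a finite positive measure $\mu$ on $\mathbb{R}$, the compound Poisson distribution is the probability measure $\mathcal{E}(\mu)=\exp(-\mu(\mathbb{R}))\bigl(\delta_0+\sum_{k=1}^\infty\frac{1}{k!}\mu^{*k}\bigr)$. A Poisson flow is any ergodic flow that is isomorphic to the tail boundary flow of a sequence of compound Poisson distributions on $\mathbb{R}$; it is of positive type if these compound Poisson distributions can be chosen with support in $[0,+\infty)$. *)

theory Defs
  imports "HOL-Probability.Probability"
begin

section \<open>Flows on standard measure spaces\<close>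

definition standard_borel :: "'a measure \<Rightarrow> bool" where
  "standard_borel M \<longleftrightarrow>
     (\<exists>X. completely_metrizable_space X \<and> separable_space X \<and> topspace X = space M \<and>
          sets M = sigma_sets (topspace X) {U. openin X U})"

definition standard_measure_space :: "'a measure \<Rightarrow> bool" where
  "standard_measure_space M \<longleftrightarrow> standard_borel M \<and> sigma_finite_measure M"

definition nonsingular_flow :: "'a measure \<Rightarrow> (real \<Rightarrow> 'a \<Rightarrow> 'a) \<Rightarrow> bool" where
  "nonsingular_flow M T \<longleftrightarrow>
     standard_measure_space M \<and>
     (\<lambda>(s, x). T s x) \<in> measurable (borel \<Otimes>\<^sub>M M) M \<and>
     (\<forall>x\<in>space M. T 0 x = x) \<and>
     (\<forall>s t. \<forall>x\<in>space M. T (s + t) x = T s (T t x)) \<and>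
     (\<forall>s. \<forall>N\<in>sets M. T s -` N \<inter> space M \<in> null_sets M \<longleftrightarrow> N \<in> null_sets M)"


section \<open>Actions of the real line on algebras of essentially bounded functions\<close>

text \<open>
  Elements of the algebra \<open>L\<^sup>\<infinity>(M)\<close> are given by representing functions, so that equality of
  elements is equality almost everywhere. An \<open>linf_action\<close> is an action of the real line on a
  subalgebra \<open>alg\<close> of \<open>L\<^sup>\<infinity>(base)\<close>, where \<open>alg\<close> contains all representatives of its elements.
  Both flows (acting on all of \<open>L\<^sup>\<infinity>\<close>) and tail boundary flows are of this form; this is the
  identification of flows with actions on abelian von Neumann algebras.
\<close>

definition Linf :: "'a measure \<Rightarrow> ('a \<Rightarrow> complex) set" where
  "Linf M = {f \<in> borel_measurable M. \<exists>C. AE x in M. cmod (f x) \<le> C}"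

record 'a linf_action =
  base :: "'a measure"
  alg :: "('a \<Rightarrow> complex) set"
  act :: "real \<Rightarrow> ('a \<Rightarrow> complex) \<Rightarrow> 'a \<Rightarrow> complex"

definition flow_action :: "'a measure \<Rightarrow> (real \<Rightarrow> 'a \<Rightarrow> 'a) \<Rightarrow> 'a linf_action" where
  "flow_action M T = \<lparr>base = M, alg = Linf M, act = (\<lambda>s f x. f (T (- s) x))\<rparr>"

definition ergodic_action :: "'a linf_action \<Rightarrow> bool" where
  "ergodic_action Z \<longleftrightarrow>
     (\<forall>f\<in>alg Z. (\<forall>s. AE x in base Z. act Z s f x = f x) \<longrightarrow> (\<exists>c. AE x in base Z. f x = c))"

text \<open>
  Isomorphism: an equivariant \<open>*\<close>-isomorphism of the algebras (which, between von Neumann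
  algebras, is automatically normal). The second and third condition say that \<open>\<Phi>\<close> is well defined
  and injective, respectively surjective, on classes modulo null sets.
\<close>

definition isomorphic_actions :: "'a linf_action \<Rightarrow> 'b linf_action \<Rightarrow> bool" where
  "isomorphic_actions Z W \<longleftrightarrow>
     (\<exists>\<Phi>. (\<forall>f\<in>alg Z. \<Phi> f \<in> alg W) \<and>
          (\<forall>f\<in>alg Z. \<forall>g\<in>alg Z.
             (AE x in base Z. f x = g x) \<longleftrightarrow> (AE y in base W. \<Phi> f y = \<Phi> g y)) \<and>
          (\<forall>h\<in>alg W. \<exists>f\<in>alg Z. AE y in base W. \<Phi> f y = h y) \<and>
          (\<forall>f\<in>alg Z. \<forall>g\<in>alg Z. AE y in base W. \<Phi> (\<lambda>x. f x + g x) y = \<Phi> f y + \<Phi> g y) \<and>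
          (\<forall>f\<in>alg Z. \<forall>g\<in>alg Z. AE y in base W. \<Phi> (\<lambda>x. f x * g x) y = \<Phi> f y * \<Phi> g y) \<and>
          (\<forall>c. \<forall>f\<in>alg Z. AE y in base W. \<Phi> (\<lambda>x. c * f x) y = c * \<Phi> f y) \<and>
          (\<forall>f\<in>alg Z. AE y in base W. \<Phi> (\<lambda>x. cnj (f x)) y = cnj (\<Phi> f y)) \<and>
          (\<forall>s. \<forall>f\<in>alg Z. AE y in base W. \<Phi> (act Z s f) y = act W s (\<Phi> f) y))"


section \<open>Tail boundary flows\<close>

text \<open>
  Sequences are indexed from 0, so \<open>\<mu> k\<close> is the law of the coordinate \<open>\<omega> k\<close>, and the product
  over the coordinates \<open>k \<ge> n\<close> is reindexed by \<open>k \<mapsto> n + k\<close>. The probability measure on the first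
  factor is the standard normal distribution; only its null sets matter below, so any other
  probability measure equivalent to Lebesgue measure gives the same tail boundary flow.
\<close>

definition path_space :: "(nat \<Rightarrow> real measure) \<Rightarrow> (real \<times> (nat \<Rightarrow> real)) measure" where
  "path_space \<mu> = density lborel std_normal_density \<Otimes>\<^sub>M PiM UNIV \<mu>"

definition tail_map :: "nat \<Rightarrow> real \<times> (nat \<Rightarrow> real) \<Rightarrow> real \<times> (nat \<Rightarrow> real)" where
  "tail_map n = (\<lambda>(t, \<omega>). (t + (\<Sum>k<n. \<omega> k), \<lambda>k. \<omega> (n + k)))"

definition tail_algebra_at ::
    "(nat \<Rightarrow> real measure) \<Rightarrow> nat \<Rightarrow> (real \<times> (nat \<Rightarrow> real) \<Rightarrow> complex) set" where
  "tail_algebra_at \<mu> n =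
     {H \<in> Linf (path_space \<mu>).
        \<exists>F \<in> Linf (path_space (\<lambda>k. \<mu> (n + k))). AE z in path_space \<mu>. H z = F (tail_map n z)}"

definition tail_boundary_flow ::
    "(nat \<Rightarrow> real measure) \<Rightarrow> (real \<times> (nat \<Rightarrow> real)) linf_action" where
  "tail_boundary_flow \<mu> =
     \<lparr>base = path_space \<mu>,
      alg = (\<Inter>n. tail_algebra_at \<mu> n),
      act = (\<lambda>s F (t, \<omega>). F (t - s, \<omega>))\<rparr>"


section \<open>Compound Poisson distributions and Poisson flows\<close>

definition measure_support :: "real measure \<Rightarrow> real set" where
  "measure_support \<mu> = {x. \<forall>U. open U \<longrightarrow> x \<in> U \<longrightarrow> emeasure \<mu> U > 0}"

fun convolution_power :: "real measure \<Rightarrow> nat \<Rightarrow> real measure" where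
  "convolution_power \<mu> 0 = return borel 0"
| "convolution_power \<mu> (Suc k) = convolution \<mu> (convolution_power \<mu> k)"

definition compound_poisson :: "real measure \<Rightarrow> real measure" where
  "compound_poisson \<mu> = measure_of UNIV (sets borel)
     (\<lambda>A. ennreal (exp (- measure \<mu> UNIV)) *
        (emeasure (return borel 0) A +
         (\<Sum>k. ennreal (1 / fact (Suc k)) * emeasure (convolution_power \<mu> (Suc k)) A)))"

definition is_compound_poisson :: "real measure \<Rightarrow> bool" where
  "is_compound_poisson \<nu> \<longleftrightarrow> (\<exists>\<mu>. finite_borel_measure \<mu> \<and> \<nu> = compound_poisson \<mu>)"

text \<open>
  The following two predicates are applied both to flows (through \<open>flow_action\<close>) and to tail
  boundary flows.
\<close>

definition poisson_flow :: "'a linf_action \<Rightarrow> bool" where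
  "poisson_flow Z \<longleftrightarrow>
     ergodic_action Z \<and>
     (\<exists>\<nu>. (\<forall>n. is_compound_poisson (\<nu> n)) \<and> isomorphic_actions Z (tail_boundary_flow \<nu>))"

definition poisson_flow_positive_type :: "'a linf_action \<Rightarrow> bool" where
  "poisson_flow_positive_type Z \<longleftrightarrow>
     ergodic_action Z \<and>
     (\<exists>\<nu>. (\<forall>n. is_compound_poisson (\<nu> n) \<and> measure_support (\<nu> n) \<subseteq> {0..}) \<and>
          isomorphic_actions Z (tail_boundary_flow \<nu>))"


section \<open>Sequences of two-point distributions\<close>

definition bounded_variances :: "(nat \<Rightarrow> real measure) \<Rightarrow> bool" where
  "bounded_variances \<mu> \<longleftrightarrow> bdd_above (range (\<lambda>n. prob_space.variance (\<mu> n) (\<lambda>x. x)))"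

definition two_point_sequence :: "(nat \<Rightarrow> real measure) \<Rightarrow> bool" where
  "two_point_sequence \<mu> \<longleftrightarrow>
     (\<forall>n. real_distribution (\<mu> n) \<and> card (measure_support (\<mu> n)) = 2)"

definition left_heavy_two_point_sequence :: "(nat \<Rightarrow> real measure) \<Rightarrow> bool" where
  "left_heavy_two_point_sequence \<mu> \<longleftrightarrow>
     (\<forall>n. real_distribution (\<mu> n) \<and>
          (\<exists>a b. a < b \<and> measure_support (\<mu> n) = {a, b} \<and>
                 measure (\<mu> n) {a} \<ge> measure (\<mu> n) {b}))"

end

theory Submission
 imports Defs
begin

text \<open>
 A tail boundary flow acts on bounded functions of \<open>(t, \<omega>)\<close> that do not change when mass is moved between
 \<open>t\<close> and a coordinate of \<open>\<omega>\<close>. Coupling two sequences coordinatewise identifies their flows as soon as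
 the differences, up to constants and to integer multiples of a common period \<open>a\<close> of the flows, have
 almost surely convergent sums along a subsequence.

 A compound Poisson law is approximated by one with finitely many jump sizes. Splitting the rates gives
 multiples of Poisson variables with small rates \<open>p\<close>, and replacing these by Bernoulli variables costs \<open>p\<^sup>2\<close>.

 Conversely, translate the two-point laws to \<open>{0, c}\<close> with \<open>p = P(c) \<le> 1/2\<close> and \<open>p c\<^sup>2\<close> bounded. If independent
 exchanges of atoms with probabilities \<open>q\<close> shift the walk by \<open>d\<close>, modulo periods, and \<open>\<Sum> q d\<^sup>2\<close> diverges over the \<open>d\<close> close to
 \<open>d\<^sub>0\<close>, then an integration by parts shows that \<open>d\<^sub>0\<close> is a period, and that all numbers are periods if
 \<open>d\<^sub>0 = 0\<close>. If all numbers are periods, the flow is trivial. Otherwise the periods form a discrete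
 group generated by some \<open>a \<ge> 0\<close>; sort the coordinates into cells by the size of \<open>p\<close> and of \<open>c\<close> modulo \<open>a\<close>. The values
 in an infinite cell can only accumulate at 0 modulo \<open>a\<close>, and exchanging pairs taken symmetrically around the
 median of a finite cell bounds the variance of its values. Hence \<open>c\<close> may be replaced by a constant on each cell,
 modulo \<open>a\<close>. By the Stein-Chen bound the number of successes in a finite cell is Poisson up to an error
 of at most the largest \<open>p\<close>, which is summable over the cells.
\<close>

text \<open>The two directions are not symmetric. Starting from Poisson laws, the rates may be split
  as finely as desired, so the squares become summable. Starting from two-point laws, the
  \<open>p k\<close> are given and \<open>\<Sum>k. (p k)\<^sup>2\<close> may diverge; coordinates
  must be added up before they are compared with Poisson variables. Since \<open>p c\<^sup>2\<close>
  is bounded, the coordinates with \<open>p\<close> near \<open>2 ^ - j\<close> have jumps of size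
  \<open>O(2 ^ (j / 2))\<close> and meet only that many cells of fixed width, so the largest
  \<open>p\<close> of the cells have a finite sum. The obstacle is that jumps in a cell are only
  nearly equal, and making them equal costs their variance weighted by \<open>p\<close>. A divergent
  total cost would make every number a period or force a nonzero period no larger than the cell
  width. This is why the width \<open>l\<close> is smaller than every nonzero period, and why the
  case in which all numbers are periods is split off.\<close>

section \<open>Resampling coordinates of a product space\<close>

lemma measurable_override_on [measurable (raw)]:
 assumes "f \<in> measurable N (PiM UNIV M)" "g \<in> measurable N (PiM UNIV M)"
 shows "(\<lambda>z. override_on (f z) (g z) U) \<in> measurable N (PiM UNIV M)"
proof (rule measurable_PiM_single')
 fix i
 show "(\<lambda>z. override_on (f z) (g z) U i) \<in> measurable N (M i)"
  using assms by (cases "i \<in> U") (auto simp: override_on_def intro: measurable_compose[OF _ measurable_component_singleton])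
next
 show "(\<lambda>z i. override_on (f z) (g z) U i) \<in> space N \<rightarrow> (\<Pi>\<^sub>E i\<in>UNIV. space (M i))"
  using assms[THEN measurable_space] by (auto simp: override_on_def space_PiM PiE_iff)
qed

text \<open>\<open>override_on y x U\<close> keeps \<open>x\<close> on \<open>U\<close> and takes an
  independent copy elsewhere. A cylinder event splits into its conditions on \<open>U\<close>, which
  fall on \<open>x\<close>, and the others, which fall on \<open>y\<close>, so the product formula
  is unchanged.\<close>

lemma distr_override_on:
 fixes M :: "'i \<Rightarrow> 'b measure"
 assumes M: "\<And>i. prob_space (M i)"
 defines "P \<equiv> PiM UNIV M"
 shows "distr (P \<Otimes>\<^sub>M P) P (\<lambda>(x, y). override_on y x U) = P"
proof (rule measure_eqI_PiM_infinite[symmetric, where I=UNIV and M=M])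
 interpret P: prob_space P unfolding P_def by (intro prob_space_PiM M)
 interpret PP: pair_prob_space P P ..
 show "finite_measure P" by unfold_locales
 show "sets P = sets (PiM UNIV M)" "sets (distr (P \<Otimes>\<^sub>M P) P (\<lambda>(x, y). override_on y x U)) = sets (PiM UNIV M)"
  by (simp_all add: P_def)
 fix A J assume J: "finite J" "J \<subseteq> UNIV" and A: "\<And>i. i \<in> J \<Longrightarrow> A i \<in> sets (M i)"
 have [measurable]: "(\<lambda>(x, y). override_on y x U) \<in> measurable (P \<Otimes>\<^sub>M P) P"
  unfolding P_def by measurable
 let ?E = "\<lambda>J. prod_emb UNIV M J (Pi\<^sub>E J A)"
 have E[measurable]: "K \<subseteq> J \<Longrightarrow> ?E K \<in> sets P" for K
  using J A finite_subset[of K J] unfolding P_def by (intro sets_PiM_I) auto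
 have "distr (P \<Otimes>\<^sub>M P) P (\<lambda>(x, y). override_on y x U) (?E J)
   = emeasure (P \<Otimes>\<^sub>M P) ((\<lambda>(x, y). override_on y x U) -` ?E J \<inter> space (P \<Otimes>\<^sub>M P))"
  by (intro emeasure_distr) auto
 also have "(\<lambda>(x, y). override_on y x U) -` ?E J \<inter> space (P \<Otimes>\<^sub>M P) = ?E (J \<inter> U) \<times> ?E (J - U)"
  by (auto simp: prod_emb_def space_pair_measure P_def space_PiM PiE_iff override_on_def split: if_splits)
 also have "emeasure (P \<Otimes>\<^sub>M P) ... = emeasure P (?E (J \<inter> U)) * emeasure P (?E (J - U))"
  by (intro P.emeasure_pair_measure_Times E) auto
 also have "... = (\<Prod>i\<in>J \<inter> U. M i (A i)) * (\<Prod>i\<in>J - U. M i (A i))"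
  unfolding P_def using J A by (subst (1 2) emeasure_PiM_emb[OF M]) auto
 also have "... = (\<Prod>i\<in>J. M i (A i))"
  using J by (subst prod.union_disjoint[symmetric]) (auto simp: Int_Diff_Un)
 also have "... = emeasure P (?E J)"
  unfolding P_def using J A by (subst emeasure_PiM_emb[OF M]) auto
 finally show "emeasure P (?E J) = distr (P \<Otimes>\<^sub>M P) P (\<lambda>(x, y). override_on y x U) (?E J)"
  by simp
qed

text \<open>A probabilistic form of the approximation of events by finitely many coordinates. The
  events with this property contain those read from one coordinate \<open>i\<close>, where the
  difference is empty once \<open>i \<in> U n\<close>, and they form a \<sigma>-algebra.\<close>

lemma resample_sets_tendsto:
 fixes M :: "'i \<Rightarrow> 'b measure" and U :: "nat \<Rightarrow> 'i set"
 assumes M: "\<And>i. prob_space (M i)" and U: "incseq U" "(\<Union>n. U n) = UNIV"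
 defines "P \<equiv> PiM UNIV M"
 assumes A: "A \<in> sets P"
 shows "(\<lambda>n. measure (P \<Otimes>\<^sub>M P) {z \<in> space (P \<Otimes>\<^sub>M P). (fst z \<in> A) \<noteq> (override_on (snd z) (fst z) (U n) \<in> A)}) \<longlonglongrightarrow> 0"
proof -
 interpret P: prob_space P unfolding P_def by (intro prob_space_PiM M)
 interpret PP: pair_prob_space P P ..
 have ov[measurable]: "(\<lambda>z. override_on (snd z) (fst z) V) \<in> measurable (P \<Otimes>\<^sub>M P) P" for V
  unfolding P_def by measurable
 define D where "D n A = {z \<in> space (P \<Otimes>\<^sub>M P). (fst z \<in> A) \<noteq> (override_on (snd z) (fst z) (U n) \<in> A)}" for n A
 have D[measurable]: "D n A \<in> sets (P \<Otimes>\<^sub>M P)" if [measurable]: "A \<in> sets P" for n A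
 proof -
  have "D n A = (fst -` A \<inter> space (P \<Otimes>\<^sub>M P) - (\<lambda>z. override_on (snd z) (fst z) (U n)) -` A \<inter> space (P \<Otimes>\<^sub>M P))
    \<union> ((\<lambda>z. override_on (snd z) (fst z) (U n)) -` A \<inter> space (P \<Otimes>\<^sub>M P) - fst -` A \<inter> space (P \<Otimes>\<^sub>M P))"
   unfolding D_def by auto
  also have "... \<in> sets (P \<Otimes>\<^sub>M P)"
   using measurable_sets[OF ov that] measurable_sets[OF measurable_fst that] by auto
  finally show ?thesis .
 qed
 have ovm: "measure (P \<Otimes>\<^sub>M P) {z \<in> space (P \<Otimes>\<^sub>M P). override_on (snd z) (fst z) V \<in> A} = measure P A"
  if [measurable]: "A \<in> sets P" for A V
 proof -
  have "measure P A = measure (distr (P \<Otimes>\<^sub>M P) P (\<lambda>(x, y). override_on y x V)) A"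
   unfolding P_def distr_override_on[OF M] ..
  also have "... = measure (P \<Otimes>\<^sub>M P) {z \<in> space (P \<Otimes>\<^sub>M P). override_on (snd z) (fst z) V \<in> A}"
   by (subst measure_distr) (auto simp: split_beta' vimage_def Int_def conj_commute)
  finally show ?thesis ..
 qed
 have fstm: "measure (P \<Otimes>\<^sub>M P) {z \<in> space (P \<Otimes>\<^sub>M P). fst z \<in> A} = measure P A"
  if [measurable]: "A \<in> sets P" for A
 proof -
  have "{z \<in> space (P \<Otimes>\<^sub>M P). fst z \<in> A} = A \<times> space P"
   using sets.sets_into_space[OF that] by (auto simp: space_pair_measure)
  then show ?thesis
   by (simp add: measure_def P.emeasure_pair_measure_Times P.emeasure_space_1)
 qed
 have "A \<in> sigma_sets (space P) {{f\<in>(\<Pi>\<^sub>E i\<in>UNIV. space (M i)). f i \<in> A} | i A. i \<in> UNIV \<and> A \<in> sets (M i)}"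
  using A unfolding P_def sets_PiM_single by (simp add: space_PiM)
 then have "A \<in> sets P \<and> (\<lambda>n. measure (P \<Otimes>\<^sub>M P) (D n A)) \<longlonglongrightarrow> 0"
 proof induction
  case (Basic a)
  then obtain i B where a: "a = {f\<in>(\<Pi>\<^sub>E i\<in>UNIV. space (M i)). f i \<in> B}" and B: "B \<in> sets (M i)" by auto
  have aP: "a \<in> sets P" unfolding a P_def sets_PiM_single using B by (intro sigma_sets.Basic) auto
  from U obtain N where "i \<in> U N" by auto
  then have "i \<in> U n" if "N \<le> n" for n using U that by (auto simp: incseq_def)
  then have "D n a = {}" if "N \<le> n" for n
   using that unfolding D_def a by (auto simp: override_on_def space_pair_measure P_def space_PiM PiE_iff)
  then have "\<forall>\<^sub>F n in sequentially. measure (P \<Otimes>\<^sub>M P) (D n a) = 0"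
   unfolding eventually_sequentially by (intro exI[of _ N]) simp
  then show ?case using aP by (simp add: tendsto_eventually)
 next
  case Empty
  then show ?case by (simp add: D_def)
 next
  case (Compl a)
  have "D n (space P - a) = D n a" for n
   using measurable_space[OF ov] unfolding D_def by (auto simp: space_pair_measure)
  then show ?case using Compl by auto
 next
  case (Union a)
  then have [measurable]: "\<And>i. a i \<in> sets P" and lim: "\<And>i. (\<lambda>n. measure (P \<Otimes>\<^sub>M P) (D n (a i))) \<longlonglongrightarrow> 0" by auto
  define S where "S = (\<Union>i. a i)"
  define B where "B m = (\<Union>i<m. a i)" for m :: nat
  have [measurable]: "S \<in> sets P" "B m \<in> sets P" for m unfolding S_def B_def by auto
  have BS: "B m \<subseteq> S" for m unfolding B_def S_def by auto
  \<comment> \<open>A countable union is cut after \<open>m\<close> sets. The remainder is counted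
    twice because the original point and the resampled one both have law \<open>P\<close>.\<close>
  have bound: "measure (P \<Otimes>\<^sub>M P) (D n S) \<le> (\<Sum>i<m. measure (P \<Otimes>\<^sub>M P) (D n (a i))) + 2 * measure P (S - B m)" for n m
  proof -
   have "D n S \<subseteq> (\<Union>i<m. D n (a i)) \<union> {z \<in> space (P \<Otimes>\<^sub>M P). fst z \<in> S - B m}
     \<union> {z \<in> space (P \<Otimes>\<^sub>M P). override_on (snd z) (fst z) (U n) \<in> S - B m}"
    unfolding D_def B_def S_def by auto
   then have "measure (P \<Otimes>\<^sub>M P) (D n S) \<le> measure (P \<Otimes>\<^sub>M P) ((\<Union>i<m. D n (a i)) \<union> {z \<in> space (P \<Otimes>\<^sub>M P). fst z \<in> S - B m}
     \<union> {z \<in> space (P \<Otimes>\<^sub>M P). override_on (snd z) (fst z) (U n) \<in> S - B m})"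
    by (intro PP.finite_measure_mono) auto
   also have "... \<le> measure (P \<Otimes>\<^sub>M P) (\<Union>i<m. D n (a i)) + measure (P \<Otimes>\<^sub>M P) {z \<in> space (P \<Otimes>\<^sub>M P). fst z \<in> S - B m}
     + measure (P \<Otimes>\<^sub>M P) {z \<in> space (P \<Otimes>\<^sub>M P). override_on (snd z) (fst z) (U n) \<in> S - B m}"
    by (intro order_trans[OF measure_Un_le] add_mono order_refl) auto
   also have "measure (P \<Otimes>\<^sub>M P) (\<Union>i<m. D n (a i)) \<le> (\<Sum>i<m. measure (P \<Otimes>\<^sub>M P) (D n (a i)))"
    by (intro measure_UNION_le) auto
   finally show ?thesis
    using fstm[of "S - B m"] ovm[of "S - B m" "U n"] by simp
  qed
  have "(\<lambda>m. measure P (B m)) \<longlonglongrightarrow> measure P (\<Union>m. B m)"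
   by (intro P.finite_Lim_measure_incseq) (auto simp: incseq_def B_def intro!: bexI dest: less_le_trans)
  also have "(\<Union>m. B m) = S" unfolding B_def S_def by auto
  finally have "(\<lambda>m. measure P S - measure P (B m)) \<longlonglongrightarrow> 0"
   by (auto intro!: tendsto_eq_intros)
  then have Sm: "(\<lambda>m. measure P (S - B m)) \<longlonglongrightarrow> 0"
   using BS by (subst P.finite_measure_Diff) auto
  have "(\<lambda>n. measure (P \<Otimes>\<^sub>M P) (D n S)) \<longlonglongrightarrow> 0"
  proof (rule LIMSEQ_I)
   fix r :: real assume "0 < r"
   with LIMSEQ_D[OF Sm, of "r/4"] obtain m where m: "measure P (S - B m) < r / 4" by (auto simp: measure_nonneg)
   have "(\<lambda>n. \<Sum>i<m. measure (P \<Otimes>\<^sub>M P) (D n (a i))) \<longlonglongrightarrow> (\<Sum>i<m. 0)"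
    by (intro tendsto_sum lim)
   from LIMSEQ_D[OF this, of "r/4"] \<open>0 < r\<close> obtain N where N: "\<And>n. N \<le> n \<Longrightarrow> (\<Sum>i<m. measure (P \<Otimes>\<^sub>M P) (D n (a i))) < r/4"
    by (auto simp: sum_nonneg)
   show "\<exists>no. \<forall>n\<ge>no. norm (measure (P \<Otimes>\<^sub>M P) (D n S) - 0) < r"
   proof (intro exI allI impI)
    fix n assume "N \<le> n"
    then show "norm (measure (P \<Otimes>\<^sub>M P) (D n S) - 0) < r"
     using bound[of n m] N[of n] m \<open>0 < r\<close> by (simp add: measure_nonneg)
   qed
  qed
  then show ?case unfolding S_def by auto
 qed
 then show ?thesis unfolding D_def by simp
qed

text \<open>Averaging over the second copy would give the conditional expectation given the
  coordinates in \<open>U n\<close>; with the copy kept, none has to be introduced. Resampling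
  preserves the law, so the error is at most twice the L1 norm and approximation by simple functions
  suffices.\<close>

lemma resample_tendsto_L1:
 fixes M :: "'i \<Rightarrow> 'b measure" and U :: "nat \<Rightarrow> 'i set" and h :: "('i \<Rightarrow> 'b) \<Rightarrow> complex"
 assumes M: "\<And>i. prob_space (M i)" and U: "incseq U" "(\<Union>n. U n) = UNIV"
 defines "P \<equiv> PiM UNIV M"
 assumes h: "integrable P h"
 shows "(\<lambda>n. \<integral>z. cmod (h (fst z) - h (override_on (snd z) (fst z) (U n))) \<partial>(P \<Otimes>\<^sub>M P)) \<longlonglongrightarrow> 0"
proof -
 interpret P: prob_space P unfolding P_def by (intro prob_space_PiM M)
 interpret PP: pair_prob_space P P ..
 have ov[measurable]: "(\<lambda>z. override_on (snd z) (fst z) V) \<in> measurable (P \<Otimes>\<^sub>M P) P" for V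
  unfolding P_def by measurable
 have dov: "distr (P \<Otimes>\<^sub>M P) P (\<lambda>z. override_on (snd z) (fst z) V) = P" for V
  unfolding P_def using distr_override_on[OF M, where U=V] by (simp add: split_beta')
 have dfst: "distr (P \<Otimes>\<^sub>M P) P fst = P"
  by (rule P.distr_pair_fst)
 have i1: "integrable (P \<Otimes>\<^sub>M P) (\<lambda>z. f (fst z))" if f: "integrable P f" for f :: "_ \<Rightarrow> complex"
  using f dfst integrable_distr[OF measurable_fst, of P P f] by simp
 have i2: "integrable (P \<Otimes>\<^sub>M P) (\<lambda>z. f (override_on (snd z) (fst z) V))" if f: "integrable P f" for f :: "_ \<Rightarrow> complex" and V :: "'i set"
  using f dov[of V] integrable_distr[OF ov, of V f] by simp
 have e1: "(\<integral>z. cmod (f (fst z)) \<partial>(P \<Otimes>\<^sub>M P)) = (\<integral>x. cmod (f x) \<partial>P)" if f: "integrable P f" for f :: "_ \<Rightarrow> complex"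
  using f integral_distr[OF measurable_fst, of "\<lambda>x. cmod (f x)" P P] dfst by simp
 have e2: "(\<integral>z. cmod (f (override_on (snd z) (fst z) V)) \<partial>(P \<Otimes>\<^sub>M P)) = (\<integral>x. cmod (f x) \<partial>P)"
  if f: "integrable P f" for f :: "_ \<Rightarrow> complex" and V :: "'i set"
  using f integral_distr[OF ov, of "\<lambda>x. cmod (f x)" V] dov[of V] by simp
 define D where "D n f = (\<integral>z. cmod (f (fst z) - f (override_on (snd z) (fst z) (U n))) \<partial>(P \<Otimes>\<^sub>M P))" for n and f :: "_ \<Rightarrow> complex"
 have D0: "0 \<le> D n f" for n f unfolding D_def by simp
 have Dadd: "D n (\<lambda>x. f x + g x) \<le> D n f + D n g" if "integrable P f" "integrable P g" for n f g
 proof -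
  have "D n (\<lambda>x. f x + g x) \<le> (\<integral>z. cmod (f (fst z) - f (override_on (snd z) (fst z) (U n)))
    + cmod (g (fst z) - g (override_on (snd z) (fst z) (U n))) \<partial>(P \<Otimes>\<^sub>M P))"
   unfolding D_def using that i1 i2
   by (intro integral_mono integrable_norm Bochner_Integration.integrable_add Bochner_Integration.integrable_diff)
     (auto intro: order_trans[OF _ norm_triangle_ineq] simp: algebra_simps)
  also have "... = D n f + D n g"
   unfolding D_def using that i1 i2
   by (intro Bochner_Integration.integral_add integrable_norm Bochner_Integration.integrable_diff) auto
  finally show ?thesis .
 qed
 have Dle: "D n f \<le> 2 * (\<integral>x. cmod (f x) \<partial>P)" if f: "integrable P f" for n f
 proof -
  have "D n f \<le> (\<integral>z. cmod (f (fst z)) + cmod (f (override_on (snd z) (fst z) (U n))) \<partial>(P \<Otimes>\<^sub>M P))"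
   unfolding D_def using f i1 i2
   by (intro integral_mono integrable_norm Bochner_Integration.integrable_add Bochner_Integration.integrable_diff norm_triangle_ineq4) auto
  also have "... = 2 * (\<integral>x. cmod (f x) \<partial>P)"
   using f i1 i2 e1 e2 by (subst Bochner_Integration.integral_add) auto
  finally show ?thesis .
 qed
 from h have "(\<lambda>n. D n h) \<longlonglongrightarrow> 0"
 proof (induction rule: integrable_induct)
  case (base A c)
  have [measurable]: "A \<in> sets P" by fact
  have "D n (\<lambda>x. indicator A x *\<^sub>R c) = cmod c * measure (P \<Otimes>\<^sub>M P) {z \<in> space (P \<Otimes>\<^sub>M P). (fst z \<in> A) \<noteq> (override_on (snd z) (fst z) (U n) \<in> A)}" for n
  proof -
   let ?S = "{z \<in> space (P \<Otimes>\<^sub>M P). (fst z \<in> A) \<noteq> (override_on (snd z) (fst z) (U n) \<in> A)}"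
   have "D n (\<lambda>x. indicator A x *\<^sub>R c) = (\<integral>z. cmod c * indicator ?S z \<partial>(P \<Otimes>\<^sub>M P))"
    unfolding D_def by (intro Bochner_Integration.integral_cong) (auto simp: indicator_def)
   then show ?thesis by simp
  qed
  then show ?case
   using tendsto_mult_right_zero[OF resample_sets_tendsto[OF M U, where A=A], where c="cmod c"] base by (simp add: P_def)
 next
  case (add f g)
  show ?case
   by (rule tendsto_sandwich[OF _ _ tendsto_const tendsto_add_zero[OF add(3,4)]])
     (auto simp: D0 Dadd add)
 next
  case (lim f s)
  have "(\<lambda>i. \<integral>x. cmod (f x - s i x) \<partial>P) \<longlonglongrightarrow> (\<integral>x. 0 \<partial>P)"
  proof (rule integral_dominated_convergence[where w="\<lambda>x. 3 * cmod (f x)"])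
   show "integrable P (\<lambda>x. 3 * cmod (f x))" using lim by auto
   show "AE x in P. (\<lambda>i. cmod (f x - s i x)) \<longlonglongrightarrow> 0"
   proof (rule AE_I2)
    fix x assume "x \<in> space P"
    from tendsto_norm[OF tendsto_diff[OF tendsto_const lim.hyps(2)[OF this], of "f x"]]
    show "(\<lambda>i. cmod (f x - s i x)) \<longlonglongrightarrow> 0" by simp
   qed
   show "AE x in P. norm (cmod (f x - s i x)) \<le> 3 * cmod (f x)" for i
    using lim.hyps(3)[of _ i] by (intro AE_I2) (auto intro!: order_trans[OF norm_triangle_ineq4])
  qed (use lim in auto)
  then have to0: "(\<lambda>i. \<integral>x. cmod (f x - s i x) \<partial>P) \<longlonglongrightarrow> 0" by simp
  show ?case
  proof (rule LIMSEQ_I)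
   fix r :: real assume r: "0 < r"
   with LIMSEQ_D[OF to0, of "r/4"] obtain i where i: "(\<integral>x. cmod (f x - s i x) \<partial>P) < r / 4" by auto
   from LIMSEQ_D[OF lim.IH[of i], of "r/4"] r obtain N where N: "\<And>n. N \<le> n \<Longrightarrow> D n (s i) < r / 4" using D0 by auto
   have "D n f < r" if "N \<le> n" for n
   proof -
    have "D n f = D n (\<lambda>x. s i x + (f x - s i x))" by simp
    also have "... \<le> D n (s i) + D n (\<lambda>x. f x - s i x)" using lim by (intro Dadd) auto
    also have "D n (\<lambda>x. f x - s i x) \<le> 2 * (\<integral>x. cmod (f x - s i x) \<partial>P)" using lim by (intro Dle) auto
    finally show ?thesis using i N[OF that] r by simp
   qed
   then show "\<exists>no. \<forall>n\<ge>no. norm (D n f - 0) < r" using D0 by auto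
  qed
 qed
 then show ?thesis unfolding D_def .
qed

section \<open>Null sets over a Gaussian time axis\<close>

abbreviation gauss :: "real measure" where
 "gauss \<equiv> density lborel std_normal_density"

lemma prob_space_gauss: "prob_space gauss"
 using prob_space_normal_density[of 1 0] by simp

lemma AE_gauss: "(AE t in gauss. P t) \<longleftrightarrow> (AE t in lborel. P t)"
 by (subst AE_density) (auto simp: normal_density_pos)

lemma (in prob_space) norm_expectation_le:
 fixes f :: "'a \<Rightarrow> 'b::{banach, second_countable_topology}"
 assumes "f \<in> borel_measurable M" "\<And>x. x \<in> space M \<Longrightarrow> norm (f x) \<le> C"
 shows "norm (expectation f) \<le> C"
proof -
 obtain x where "x \<in> space M" using not_empty by blast
 then have "0 \<le> C" using assms(2) norm_ge_zero order_trans by blast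
 have "norm (expectation f) \<le> expectation (\<lambda>x. norm (f x))" by simp
 also have "... \<le> expectation (\<lambda>_. C)"
  using assms using \<open>0 \<le> C\<close> by (intro integral_mono integrable_const_bound[where B=C]) (auto intro!: AE_I2)
 finally show ?thesis by (simp add: prob_space)
qed

lemma AE_gauss_pair:
 assumes \<Omega>: "prob_space \<Omega>" and P: "{z \<in> space (gauss \<Otimes>\<^sub>M \<Omega>). P z} \<in> sets (gauss \<Otimes>\<^sub>M \<Omega>)"
 shows "(AE z in gauss \<Otimes>\<^sub>M \<Omega>. P z) \<longleftrightarrow> (AE w in \<Omega>. AE t in lborel. P (t, w))"
proof -
 interpret \<Omega>: prob_space \<Omega> by fact
 interpret g: prob_space gauss by (rule prob_space_gauss)
 interpret pair_prob_space gauss \<Omega> ..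
 have "(AE z in gauss \<Otimes>\<^sub>M \<Omega>. P z) \<longleftrightarrow> (AE t in gauss. AE w in \<Omega>. P (t, w))"
  using AE_pair_iff[of "\<lambda>t w. P (t, w)"] P by simp
 also have "... \<longleftrightarrow> (AE w in \<Omega>. AE t in gauss. P (t, w))"
  using AE_commute[of "\<lambda>t w. P (t, w)"] P by simp
 finally show ?thesis by (simp add: AE_gauss)
qed

lemma AE_lborel_translate:
 fixes c :: real
 assumes [measurable]: "{t. P t} \<in> sets borel"
 shows "(AE t in lborel. P (t + c)) \<longleftrightarrow> (AE t in lborel. P t)"
proof -
 have "(AE t in lborel. P t) \<longleftrightarrow> (AE t in distr lborel borel (\<lambda>t. c + t). P t)"
  by (subst lborel_distr_plus) simp
 also have "... \<longleftrightarrow> (AE t in lborel. P (c + t))"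
  by (subst AE_distr_iff) (auto simp: assms)
 finally show ?thesis by (simp add: add.commute)
qed

text \<open>The map \<open>(t, w) \<mapsto> (t + Z w, X w)\<close> neither creates nor destroys null
  sets: on each fibre a translation preserves Lebesgue null sets, and \<open>X\<close> carries the
  law of \<open>\<Omega>\<close> to \<open>M\<close>. This is how a random time shift enters an
  isomorphism of flows.\<close>

lemma AE_push:
 assumes \<Omega>: "prob_space \<Omega>" and X[measurable]: "X \<in> measurable \<Omega> M" and dX: "distr \<Omega> M X = M"
  and Z[measurable]: "Z \<in> borel_measurable \<Omega>"
  and P: "{z \<in> space (gauss \<Otimes>\<^sub>M M). P z} \<in> sets (gauss \<Otimes>\<^sub>M M)"
 shows "(AE z in gauss \<Otimes>\<^sub>M M. P z) \<longleftrightarrow> (AE z in gauss \<Otimes>\<^sub>M \<Omega>. P (fst z + Z (snd z), X (snd z)))"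
proof -
 interpret \<Omega>: prob_space \<Omega> by fact
 have M: "prob_space M" using \<Omega>.prob_space_distr[OF X] dX by simp
 interpret M: prob_space M by fact
 have sec: "{t. P (t, x)} \<in> sets borel" if "x \<in> space M" for x
 proof -
  have "(\<lambda>t. (t, x)) \<in> measurable borel (gauss \<Otimes>\<^sub>M M)" using that by measurable
  from measurable_sets[OF this P] that show ?thesis
   by (simp add: space_pair_measure vimage_def)
 qed
 \<comment> \<open>Measurability of the set of good fibres, needed to move the outer quantifier
   through \<open>distr\<close>.\<close>
 have P2: "{w \<in> space M. AE t in lborel. P (t, w)} \<in> sets M"
 proof -
  have *: "(\<lambda>z. (snd z, fst z)) \<in> measurable (M \<Otimes>\<^sub>M lborel) (gauss \<Otimes>\<^sub>M M)" by measurable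
  have "{z \<in> space (M \<Otimes>\<^sub>M lborel). P (snd z, fst z)} = (\<lambda>z. (snd z, fst z)) -` {z \<in> space (gauss \<Otimes>\<^sub>M M). P z} \<inter> space (M \<Otimes>\<^sub>M lborel)"
   by (auto simp: space_pair_measure)
  also have "... \<in> sets (M \<Otimes>\<^sub>M lborel)" by (rule measurable_sets[OF * P])
  finally have "{z \<in> space (M \<Otimes>\<^sub>M lborel). P (snd z, fst z)} \<in> sets (M \<Otimes>\<^sub>M lborel)" .
  then have "{z \<in> space (M \<Otimes>\<^sub>M lborel). \<not> P (snd z, fst z)} \<in> sets (M \<Otimes>\<^sub>M lborel)"
   by (rule sets.sets_Collect_neg)
  note lborel.measurable_emeasure_Pair[OF this]
  then have "{w \<in> space M. emeasure lborel (Pair w -` {z \<in> space (M \<Otimes>\<^sub>M lborel). \<not> P (snd z, fst z)}) = 0} \<in> sets M"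
   by simp
  also have "{w \<in> space M. emeasure lborel (Pair w -` {z \<in> space (M \<Otimes>\<^sub>M lborel). \<not> P (snd z, fst z)}) = 0} =
   {w \<in> space M. AE t in lborel. P (t, w)}"
  proof (intro Collect_cong conj_cong refl)
   fix w assume w: "w \<in> space M"
   have "{t. \<not> P (t, w)} \<in> sets lborel" using sets.compl_sets[of "{t. P (t, w)}" borel] sec[OF w]
    by (simp add: Compl_eq_Diff_UNIV[symmetric] Collect_neg_eq)
   then have "(AE t in lborel. P (t, w)) \<longleftrightarrow> emeasure lborel {t. \<not> P (t, w)} = 0"
    by (intro AE_iff_measurable) auto
   also have "{t. \<not> P (t, w)} = Pair w -` {z \<in> space (M \<Otimes>\<^sub>M lborel). \<not> P (snd z, fst z)}"
    using w by (auto simp: space_pair_measure)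
   finally show "(emeasure lborel (Pair w -` {z \<in> space (M \<Otimes>\<^sub>M lborel). \<not> P (snd z, fst z)}) = 0) = (AE t in lborel. P (t, w))"
    by simp
  qed
  finally show ?thesis .
 qed
 have P3: "{z \<in> space (gauss \<Otimes>\<^sub>M \<Omega>). P (fst z + Z (snd z), X (snd z))} \<in> sets (gauss \<Otimes>\<^sub>M \<Omega>)"
 proof -
  have *: "(\<lambda>z. (fst z + Z (snd z), X (snd z))) \<in> measurable (gauss \<Otimes>\<^sub>M \<Omega>) (gauss \<Otimes>\<^sub>M M)" by measurable
  have "{z \<in> space (gauss \<Otimes>\<^sub>M \<Omega>). P (fst z + Z (snd z), X (snd z))} =
   (\<lambda>z. (fst z + Z (snd z), X (snd z))) -` {z \<in> space (gauss \<Otimes>\<^sub>M M). P z} \<inter> space (gauss \<Otimes>\<^sub>M \<Omega>)"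
   using measurable_space[OF *] by auto
  then show ?thesis using measurable_sets[OF * P] by simp
 qed
 have "(AE z in gauss \<Otimes>\<^sub>M M. P z) \<longleftrightarrow> (AE w in distr \<Omega> M X. AE t in lborel. P (t, w))"
  unfolding AE_gauss_pair[OF M P] dX ..
 also have "... \<longleftrightarrow> (AE w in \<Omega>. AE t in lborel. P (t, X w))"
  by (rule AE_distr_iff[OF X P2])
 also have "... \<longleftrightarrow> (AE w in \<Omega>. AE t in lborel. P (t + Z w, X w))"
  by (intro AE_cong AE_lborel_translate[symmetric] sec measurable_space[OF X])
 also have "... \<longleftrightarrow> (AE z in gauss \<Otimes>\<^sub>M \<Omega>. P (fst z + Z (snd z), X (snd z)))"
  by (simp add: AE_gauss_pair[OF \<Omega> P3])
 finally show ?thesis .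
qed

section \<open>Exact tail functions\<close>

text \<open>Invariance and boundedness are demanded at every point, with no reference to a measure.
  The same function can thus be used under two different sequences of laws, which an almost sure
  condition would not allow.\<close>

definition tailfun :: "(real \<times> (nat \<Rightarrow> real) \<Rightarrow> complex) \<Rightarrow> bool" where
 "tailfun G \<longleftrightarrow> G \<in> borel_measurable (borel \<Otimes>\<^sub>M PiM UNIV (\<lambda>_. borel)) \<and> bounded (range G) \<and>
   (\<forall>t x n y. G (t, x) = G (t + x n - y, x(n := y)))"

text \<open>Levy's upward theorem, weakened to a subsequence: the conditional expectations converge
  in L1 by resampling, and then almost surely along a subsequence. \<open>E n\<close> is a separate
  parameter because a usable formula for the conditional expectation may hold only almost
  surely.\<close>

lemma levy_subsequence:
 fixes M :: "nat \<Rightarrow> 'b measure" and U :: "nat \<Rightarrow> nat set" and H :: "real \<times> (nat \<Rightarrow> 'b) \<Rightarrow> complex"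
 assumes M: "\<And>i. prob_space (M i)" and U: "incseq U" "(\<Union>n. U n) = UNIV"
 defines "P \<equiv> PiM UNIV M"
 assumes H[measurable]: "H \<in> borel_measurable (borel \<Otimes>\<^sub>M P)" and C: "\<And>z. cmod (H z) \<le> C"
  and E: "\<And>n. AE z in gauss \<Otimes>\<^sub>M P. (\<integral>w. H (fst z, override_on w (snd z) (U n)) \<partial>P) = E n z"
 shows "\<exists>r::nat \<Rightarrow> nat. strict_mono r \<and> (AE z in gauss \<Otimes>\<^sub>M P. (\<lambda>n. E (r n) z) \<longlonglongrightarrow> H z)"
proof -
 interpret P: prob_space P unfolding P_def by (intro prob_space_PiM M)
 interpret g: prob_space gauss by (rule prob_space_gauss)
 interpret gP: pair_prob_space gauss P ..
 interpret PP: pair_prob_space P P ..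
 have [measurable]: "(\<lambda>z. override_on (f z) (g z) V) \<in> measurable N P" if "f \<in> measurable N P" "g \<in> measurable N P" for f g N V
  using that unfolding P_def by measurable
 have C0: "0 \<le> C" using C[of undefined] norm_ge_zero order_trans by blast
 define e where "e n z = (\<integral>w. H (fst z, override_on w (snd z) (U n)) \<partial>P)" for n z
 have [measurable]: "e n \<in> borel_measurable (gauss \<Otimes>\<^sub>M P)" for n
  unfolding e_def by measurable
 have ie: "cmod (e n z) \<le> C" if "z \<in> space (gauss \<Otimes>\<^sub>M P)" for n z
 proof -
  have [measurable]: "snd z \<in> space P" using that by (auto simp: space_pair_measure)
  show ?thesis unfolding e_def by (intro P.norm_expectation_le C) measurable
 qed
 have He: "cmod (H z - e n z) \<le> 2 * C" if "z \<in> space (gauss \<Otimes>\<^sub>M P)" for n z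
  using norm_triangle_ineq4[of "H z" "e n z"] C[of z] ie[OF that, of n] by linarith
 define D where "D n t = (\<integral>z. cmod (H (t, fst z) - H (t, override_on (snd z) (fst z) (U n))) \<partial>(P \<Otimes>\<^sub>M P))" for n t
 have Dm[measurable]: "D n \<in> borel_measurable borel" for n
  unfolding D_def by measurable
 have Hb: "cmod (H a - H b) \<le> 2 * C" for a b
  using norm_triangle_ineq4[of "H a" "H b"] C[of a] C[of b] by linarith
 have D2: "D n t \<le> 2 * C" for n t
 proof -
  have "D n t \<le> (\<integral>z. 2 * C \<partial>(P \<Otimes>\<^sub>M P))" unfolding D_def
   by (intro integral_mono PP.integrable_const_bound[where B="2 * C"]) (auto simp: Hb C0)
  then show ?thesis by (simp add: PP.prob_space)
 qed
 have D0: "0 \<le> D n t" for n t unfolding D_def by simp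
 have "(\<lambda>n. D n t) \<longlonglongrightarrow> 0" for t
  unfolding D_def P_def
  by (intro resample_tendsto_L1 M U) (auto simp flip: P_def intro!: P.integrable_const_bound[where B=C] C)
 then have "(\<lambda>n. \<integral>t. D n t \<partial>gauss) \<longlonglongrightarrow> (\<integral>t. 0 \<partial>gauss)"
  by (intro integral_dominated_convergence[where w="\<lambda>_. 2 * C"]) (auto simp: D0 D2 C0)
 then have ID: "(\<lambda>n. \<integral>t. D n t \<partial>gauss) \<longlonglongrightarrow> 0" by simp
 \<comment> \<open>\<open>e n\<close> is an average over the second copy, so its distance to
   \<open>H\<close> is at most the average distance between the values at a point and at its
   resampled version.\<close>
 have le: "(\<integral>z. cmod (H z - e n z) \<partial>(gauss \<Otimes>\<^sub>M P)) \<le> (\<integral>t. D n t \<partial>gauss)" for n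
 proof -
  have int: "integrable (gauss \<Otimes>\<^sub>M P) (\<lambda>z. cmod (H z - e n z))"
   by (intro gP.integrable_const_bound[where B="2 * C"] AE_I2) (auto simp: He)
  have "(\<integral>z. cmod (H z - e n z) \<partial>(gauss \<Otimes>\<^sub>M P)) = (\<integral>t. (\<integral>w. cmod (H (t, w) - e n (t, w)) \<partial>P) \<partial>gauss)"
   using gP.integral_fst'[OF int] by simp
  also have "... \<le> (\<integral>t. D n t \<partial>gauss)"
  proof (intro integral_mono)
   show "integrable gauss (\<lambda>t. \<integral>w. cmod (H (t, w) - e n (t, w)) \<partial>P)"
    using gP.integrable_fst'[OF int] by simp
   show "integrable gauss (D n)"
    by (intro g.integrable_const_bound[where B="2 * C"]) (auto simp: D0 D2)
   fix t
   have "cmod (H (t, w) - e n (t, w)) \<le> (\<integral>w'. cmod (H (t, w) - H (t, override_on w' w (U n))) \<partial>P)" if "w \<in> space P" for w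
   proof -
    have [measurable]: "w \<in> space P" by fact
    have i: "integrable P (\<lambda>w'. H (t, override_on w' w (U n)))"
     by (intro P.integrable_const_bound[where B=C]) (auto simp: C)
    have "H (t, w) - e n (t, w) = (\<integral>w'. H (t, w) - H (t, override_on w' w (U n)) \<partial>P)"
     unfolding e_def using i by (simp add: P.prob_space)
    then show ?thesis by (simp add: integral_norm_bound)
   qed
   then have "(\<integral>w. cmod (H (t, w) - e n (t, w)) \<partial>P) \<le> (\<integral>w. (\<integral>w'. cmod (H (t, w) - H (t, override_on w' w (U n))) \<partial>P) \<partial>P)"
   proof (intro integral_mono)
    show "integrable P (\<lambda>w. cmod (H (t, w) - e n (t, w)))"
     by (intro P.integrable_const_bound[where B="2 * C"] AE_I2) (auto intro!: He simp: space_pair_measure)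
    have "integrable (P \<Otimes>\<^sub>M P) (\<lambda>z. cmod (H (t, fst z) - H (t, override_on (snd z) (fst z) (U n))))"
     by (intro PP.integrable_const_bound[where B="2 * C"]) (auto simp: Hb C0)
    from PP.integrable_fst'[OF this]
    show "integrable P (\<lambda>w. \<integral>w'. cmod (H (t, w) - H (t, override_on w' w (U n))) \<partial>P)" by simp
   qed
   also have "... = D n t"
   proof -
    have "integrable (P \<Otimes>\<^sub>M P) (\<lambda>z. cmod (H (t, fst z) - H (t, override_on (snd z) (fst z) (U n))))"
     by (intro PP.integrable_const_bound[where B="2 * C"]) (auto simp: Hb C0)
    from PP.integral_fst'[OF this] show ?thesis unfolding D_def by simp
   qed
   finally show "(\<integral>w. cmod (H (t, w) - e n (t, w)) \<partial>P) \<le> D n t" .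
  qed
  finally show ?thesis .
 qed
 have "(\<lambda>n. \<integral>z. norm (H z - e n z) \<partial>(gauss \<Otimes>\<^sub>M P)) \<longlonglongrightarrow> 0"
  by (rule tendsto_sandwich[OF _ _ tendsto_const ID]) (auto simp: le)
 then have "\<exists>r::nat \<Rightarrow> nat. strict_mono r \<and> (AE z in gauss \<Otimes>\<^sub>M P. (\<lambda>n. H z - e (r n) z) \<longlonglongrightarrow> 0)"
  by (intro tendsto_L1_AE_subseq)
    (auto intro!: gP.integrable_const_bound[where B="2 * C"] AE_I2 He)
 then obtain r :: "nat \<Rightarrow> nat" where r: "strict_mono r" "AE z in gauss \<Otimes>\<^sub>M P. (\<lambda>n. H z - e (r n) z) \<longlonglongrightarrow> 0" by auto
 have "AE z in gauss \<Otimes>\<^sub>M P. \<forall>n. e n z = E n z"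
  using E by (simp add: AE_all_countable e_def)
 with r(2) have "AE z in gauss \<Otimes>\<^sub>M P. (\<lambda>n. E (r n) z) \<longlonglongrightarrow> H z"
 proof eventually_elim
  case (elim z)
  from tendsto_diff[OF tendsto_const elim(1), of "H z"] elim(2) show ?case by simp
 qed
 with r(1) show ?thesis by blast
qed

text \<open>\<open>lim\<close> assigns one fixed value to all divergent sequences, so this function
  is defined everywhere and can be invariant also where the limit does not exist.\<close>

definition tail_lim :: "(nat \<Rightarrow> nat) \<Rightarrow> (nat \<Rightarrow> real \<Rightarrow> complex) \<Rightarrow> real \<times> (nat \<Rightarrow> real) \<Rightarrow> complex" where
 "tail_lim r G z = lim (\<lambda>n. G (r n) (fst z + (\<Sum>j<r n. snd z j)))"

text \<open>Replacing coordinate \<open>n\<close> by \<open>y\<close> and correcting the time leaves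
  \<open>t + (\<Sum>j<r m. x j)\<close> unchanged as soon as \<open>n < r m\<close>. The two
  sequences agree eventually and share their limit or their divergence.\<close>

lemma tailfun_tail_lim:
 assumes G[measurable]: "\<And>n. G n \<in> borel_measurable borel" and C: "\<And>n x. cmod (G n x) \<le> C" and r: "strict_mono r"
 shows "tailfun (tail_lim r G)"
 unfolding tailfun_def
proof (intro conjI allI)
 show "tail_lim r G \<in> borel_measurable (borel \<Otimes>\<^sub>M PiM UNIV (\<lambda>_. borel))"
  unfolding tail_lim_def by measurable
 \<comment> \<open>The value of \<open>lim\<close> on a divergent sequence; it has to be included in
   the bound.\<close>
 let ?junk = "THE L::complex. False"
 have "cmod (tail_lim r G z) \<le> max C (cmod ?junk)" for z
 proof (cases "convergent (\<lambda>n. G (r n) (fst z + (\<Sum>j<r n. snd z j)))")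
  case True
  then have "(\<lambda>n. G (r n) (fst z + (\<Sum>j<r n. snd z j))) \<longlonglongrightarrow> tail_lim r G z"
   unfolding tail_lim_def by (simp add: convergent_LIMSEQ_iff)
  then have "cmod (tail_lim r G z) \<le> C"
   by (intro LIMSEQ_le_const2[OF tendsto_norm]) (auto simp: C)
  then show ?thesis by simp
 next
  case False
  then have "tail_lim r G z = ?junk"
   unfolding tail_lim_def lim_def convergent_def by (intro arg_cong[where f=The] ext) auto
  then show ?thesis by simp
 qed
 then show "bounded (range (tail_lim r G))" unfolding bounded_iff by blast
 fix t :: real and x :: "nat \<Rightarrow> real" and n y
 have "\<forall>\<^sub>F m in sequentially. G (r m) (t + (\<Sum>j<r m. x j)) = G (r m) (t + x n - y + (\<Sum>j<r m. (x(n := y)) j))"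
 proof (rule eventually_sequentiallyI)
  fix m assume "Suc n \<le> m"
  then have n: "n < r m" using seq_suble[OF r, of m] by simp
  have "(\<Sum>j<r m. (x(n := y)) j) = y + (\<Sum>j\<in>{..<r m}-{n}. x j)"
   using n by (subst sum.remove[of _ n]) (auto intro!: sum.cong)
  moreover have "(\<Sum>j<r m. x j) = x n + (\<Sum>j\<in>{..<r m}-{n}. x j)"
   using n by (subst sum.remove[of _ n]) auto
  ultimately show "G (r m) (t + (\<Sum>j<r m. x j)) = G (r m) (t + x n - y + (\<Sum>j<r m. (x(n := y)) j))"
   by (simp add: algebra_simps)
 qed
 from tendsto_cong[OF this] show "tail_lim r G (t, x) = tail_lim r G (t + x n - y, x(n := y))"
  unfolding tail_lim_def lim_def by simp
qed

text \<open>The analogue of \<open>tailfun\<close> for a product of arbitrary spaces in which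
  coordinate \<open>n\<close> moves the walk by \<open>f n\<close>. Couplings need it because one of
  their coordinates carries several variables at once.\<close>

definition step_invariant :: "(nat \<Rightarrow> 'b measure) \<Rightarrow> (nat \<Rightarrow> 'b \<Rightarrow> real) \<Rightarrow> (real \<times> (nat \<Rightarrow> 'b) \<Rightarrow> complex) \<Rightarrow> bool" where
 "step_invariant M f K \<longleftrightarrow> (\<forall>t. \<forall>w\<in>space (PiM UNIV M). \<forall>n. \<forall>y\<in>space (M n). K (t, w) = K (t + f n (w n) - f n y, w(n := y)))"

lemma step_invariant_override:
 assumes K: "step_invariant M f K" and w: "w \<in> space (PiM UNIV M)" "w' \<in> space (PiM UNIV M)" and "finite U"
 shows "K (t, override_on w' w U) = K (t + (\<Sum>i\<in>U. f i (w i)) - (\<Sum>i\<in>U. f i (w' i)), w')"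
 using \<open>finite U\<close>
proof (induction U arbitrary: t)
 case empty
 then show ?case by (simp add: override_on_def)
next
 case (insert i U)
 have sp: "override_on w' w (insert i U) \<in> space (PiM UNIV M)"
  using w by (auto simp: space_PiM PiE_iff override_on_def)
 have wi: "w' i \<in> space (M i)" using w by (auto simp: space_PiM PiE_iff)
 have "K (t, override_on w' w (insert i U)) = K (t + f i (w i) - f i (w' i), (override_on w' w (insert i U))(i := w' i))"
  using K sp wi unfolding step_invariant_def by (auto simp: override_on_def)
 also have "(override_on w' w (insert i U))(i := w' i) = override_on w' w U"
  using insert by (auto simp: override_on_def fun_eq_iff)
 finally show ?case using insert by (simp add: algebra_simps)
qed

text \<open>By invariance, overriding the coordinates outside \<open>U n\<close> amounts to a time
  shift that involves the given path only through its sum over \<open>U n\<close>. So the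
  conditional expectation of \<open>K\<close> is a function of \<open>t\<close> plus this partial
  sum, and Levy's theorem recovers \<open>K\<close> from these functions. With blocks
  \<open>J\<close>, this shows that \<open>K\<close> depends, up to null sets, only on the time and
  the block sums.\<close>

lemma step_invariant_AE_tailfun:
 fixes M :: "nat \<Rightarrow> 'b measure" and J :: "nat \<Rightarrow> nat set" and K :: "real \<times> (nat \<Rightarrow> 'b) \<Rightarrow> complex"
 assumes M: "\<And>i. prob_space (M i)" and f[measurable]: "\<And>i. f i \<in> borel_measurable (M i)"
  and J: "\<And>j. finite (J j)" "disjoint_family J" "(\<Union>j. J j) = UNIV"
 defines "P \<equiv> PiM UNIV M"
 assumes K[measurable]: "K \<in> borel_measurable (borel \<Otimes>\<^sub>M P)" and C: "\<And>z. cmod (K z) \<le> C"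
  and inv: "step_invariant M f K"
 obtains G r where "\<And>n. G n \<in> borel_measurable borel" "\<And>n x. cmod (G n x) \<le> C" "strict_mono r"
  "\<And>n x. G n x = (\<integral>w. K (x - (\<Sum>i\<in>(\<Union>j<n. J j). f i (w i)), w) \<partial>P)"
  "AE z in gauss \<Otimes>\<^sub>M P. (\<lambda>n. G (r n) (fst z + (\<Sum>j<r n. \<Sum>i\<in>J j. f i (snd z i)))) \<longlonglongrightarrow> K z"
  "tailfun (tail_lim r G)"
  "AE z in gauss \<Otimes>\<^sub>M P. K z = tail_lim r G (fst z, \<lambda>j. \<Sum>i\<in>J j. f i (snd z i))"
proof -
 interpret P: prob_space P unfolding P_def by (intro prob_space_PiM M)
 define U where "U n = (\<Union>j<n. J j)" for n
 have fi[measurable]: "(\<lambda>w. f i (w i)) \<in> borel_measurable P" for i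
  unfolding P_def by measurable
 define G where "G n x = (\<integral>w. K (x - (\<Sum>i\<in>U n. f i (w i)), w) \<partial>P)" for n x
 have Gm[measurable]: "G n \<in> borel_measurable borel" for n unfolding G_def by measurable
 have GC: "cmod (G n x) \<le> C" for n x
  unfolding G_def by (intro P.norm_expectation_le C) measurable
 have Ufin: "finite (U n)" for n unfolding U_def using J by auto
 have Uinc: "incseq U" unfolding U_def incseq_def by fastforce
 have Uun: "(\<Union>n. U n) = UNIV" unfolding U_def using J(3) by fastforce
 have sumU: "(\<Sum>i\<in>U n. g i) = (\<Sum>j<n. \<Sum>i\<in>J j. g i)" for n and g :: "nat \<Rightarrow> real"
  unfolding U_def using J by (subst sum.UNION_disjoint) (auto simp: disjoint_family_on_def)
 have "\<exists>r::nat \<Rightarrow> nat. strict_mono r \<and> (AE z in gauss \<Otimes>\<^sub>M P. (\<lambda>n. G (r n) (fst z + (\<Sum>i\<in>U (r n). f i (snd z i)))) \<longlonglongrightarrow> K z)"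
  unfolding P_def
 proof (rule levy_subsequence[where U=U and C=C])
  fix n
  show "AE z in gauss \<Otimes>\<^sub>M PiM UNIV M. (\<integral>w. K (fst z, override_on w (snd z) (U n)) \<partial>PiM UNIV M) = G n (fst z + (\<Sum>i\<in>U n. f i (snd z i)))"
  proof (rule AE_I2)
   fix z assume "z \<in> space (gauss \<Otimes>\<^sub>M PiM UNIV M)"
   then have z: "snd z \<in> space (PiM UNIV M)" by (auto simp: space_pair_measure)
   show "(\<integral>w. K (fst z, override_on w (snd z) (U n)) \<partial>PiM UNIV M) = G n (fst z + (\<Sum>i\<in>U n. f i (snd z i)))"
    unfolding G_def P_def
    by (intro Bochner_Integration.integral_cong refl step_invariant_override[OF inv z] Ufin)
  qed
 qed (use M Uinc Uun C in \<open>auto simp flip: P_def\<close>)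
 then obtain r where r: "strict_mono r"
  and conv: "AE z in gauss \<Otimes>\<^sub>M P. (\<lambda>n. G (r n) (fst z + (\<Sum>i\<in>U (r n). f i (snd z i)))) \<longlonglongrightarrow> K z" by auto
 have conv': "AE z in gauss \<Otimes>\<^sub>M P. (\<lambda>n. G (r n) (fst z + (\<Sum>j<r n. \<Sum>i\<in>J j. f i (snd z i)))) \<longlonglongrightarrow> K z"
  using conv by (simp add: sumU)
 then have "AE z in gauss \<Otimes>\<^sub>M P. K z = tail_lim r G (fst z, \<lambda>j. \<Sum>i\<in>J j. f i (snd z i))"
  by eventually_elim (simp add: tail_lim_def limI)
 with r Gm GC conv' show thesis
  by (intro that[of G r] tailfun_tail_lim[where C=C]) (auto simp: G_def U_def)
qed

lemma norm_lim_le: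
 fixes X :: "nat \<Rightarrow> complex"
 assumes "\<And>n. cmod (X n) \<le> C"
 shows "cmod (lim X) \<le> max C (cmod (THE L. False))"
proof (cases "convergent X")
 case True
 then have "X \<longlonglongrightarrow> lim X" by (simp add: convergent_LIMSEQ_iff)
 then have "cmod (lim X) \<le> C" by (intro LIMSEQ_le_const2[OF tendsto_norm]) (auto simp: assms)
 then show ?thesis by simp
next
 case False
 then have "lim X = (THE L. False)" unfolding lim_def convergent_def by (intro arg_cong[where f=The] ext) auto
 then show ?thesis by simp
qed

lemma measurable_PiM_borelI:
 assumes "\<And>k. (\<lambda>z. f z k) \<in> borel_measurable N"
 shows "f \<in> measurable N (PiM UNIV (\<lambda>_. borel))"
 by (rule measurable_PiM_single') (use assms in auto)

lemma tailfun_measurable: "tailfun G \<Longrightarrow> G \<in> borel_measurable (borel \<Otimes>\<^sub>M PiM UNIV (\<lambda>_. borel))"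
 and tailfun_step: "tailfun G \<Longrightarrow> G (t, x) = G (t + x n - y, x(n := y))"
 by (auto simp: tailfun_def)

lemma tailfun_boundedE:
 assumes "tailfun G" obtains C where "0 \<le> C" "\<And>z. cmod (G z) \<le> C"
proof -
 from assms obtain C where "\<And>z. cmod (G z) \<le> C" unfolding tailfun_def bounded_iff by auto
 moreover from this[of undefined] have "0 \<le> C" using norm_ge_zero order_trans by blast
 ultimately show ?thesis using that by blast
qed

lemma tailfunI:
 assumes "G \<in> borel_measurable (borel \<Otimes>\<^sub>M PiM UNIV (\<lambda>_. borel))" "\<And>z. cmod (G z) \<le> C"
  "\<And>t x n y. G (t, x) = G (t + x n - y, x(n := y))"
 shows "tailfun G"
 unfolding tailfun_def bounded_iff using assms by blast

lemma tailfun_compose: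
 assumes G: "tailfun G" and f: "continuous_on UNIV (f :: complex \<Rightarrow> complex)"
 shows "tailfun (\<lambda>z. f (G z))"
proof -
 have "compact (closure (range G))" using G by (simp add: tailfun_def compact_closure)
 then have "bounded (f ` closure (range G))"
  using f by (intro compact_imp_bounded compact_continuous_image) (auto intro: continuous_on_subset)
 then have "bounded (range (\<lambda>z. f (G z)))"
  by (rule bounded_subset) (use closure_subset in fastforce)
 moreover have "(\<lambda>z. f (G z)) \<in> borel_measurable (borel \<Otimes>\<^sub>M PiM UNIV (\<lambda>_. borel))"
  using borel_measurable_continuous_on[OF f tailfun_measurable[OF G]] .
 moreover have "f (G (t, x)) = f (G (t + x n - y, x(n := y)))" for t x n y
  using tailfun_step[OF G, of t x n y] by simp
 ultimately show ?thesis unfolding tailfun_def by blast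
qed

lemma tailfun_add: assumes "tailfun F" "tailfun G" shows "tailfun (\<lambda>z. F z + G z)"
proof -
 from assms obtain C D where "\<And>z. cmod (F z) \<le> C" "\<And>z. cmod (G z) \<le> D" by (metis tailfun_boundedE)
 moreover have "F (t, x) + G (t, x) = F (t + x n - y, x(n := y)) + G (t + x n - y, x(n := y))" for t x n y
  using tailfun_step[OF assms(1), of t x n y] tailfun_step[OF assms(2), of t x n y] by simp
 ultimately show ?thesis using assms[THEN tailfun_measurable]
  by (intro tailfunI[where C="C + D"] borel_measurable_add norm_triangle_mono)
qed

lemma tailfun_mult: assumes "tailfun F" "tailfun G" shows "tailfun (\<lambda>z. F z * G z)"
proof -
 from assms obtain C D where "0 \<le> C" "\<And>z. cmod (F z) \<le> C" "\<And>z. cmod (G z) \<le> D" by (metis tailfun_boundedE)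
 then have "cmod (F z * G z) \<le> C * D" for z
  unfolding norm_mult by (intro mult_mono) auto
 moreover have "F (t, x) * G (t, x) = F (t + x n - y, x(n := y)) * G (t + x n - y, x(n := y))" for t x n y
  using tailfun_step[OF assms(1), of t x n y] tailfun_step[OF assms(2), of t x n y] by simp
 ultimately show ?thesis using assms[THEN tailfun_measurable]
  by (intro tailfunI[where C="C * D"] borel_measurable_times)
qed

lemma tailfun_translate: assumes G: "tailfun G" shows "tailfun (\<lambda>z. G (fst z + s, snd z))"
proof -
 have [measurable]: "G \<in> borel_measurable (borel \<Otimes>\<^sub>M PiM UNIV (\<lambda>_. borel))" by (rule tailfun_measurable[OF G])
 obtain C where "\<And>z. cmod (G z) \<le> C" using tailfun_boundedE[OF G] by metis
 moreover have "G (t + s, x) = G (t + x n - y + s, x(n := y))" for t x n y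
  using tailfun_step[OF G, of "t + s" x n y] by (simp add: algebra_simps)
 ultimately show ?thesis
  by (intro tailfunI[where C=C]) simp_all
qed

text \<open>Moving the first \<open>n\<close> coordinates into the time exhibits a tail function as
  a function of \<open>tail_map n\<close>.\<close>

lemma tailfun_head:
 assumes "tailfun G" shows "G (t, x) = G (t + (\<Sum>k<n. x k), \<lambda>k. if k < n then 0 else x k)"
proof (induction n)
 case (Suc n)
 have "(\<lambda>k. if k < n then 0 else x k)(n := 0) = (\<lambda>k. if k < Suc n then 0 else x k)"
  by (auto simp: fun_eq_iff less_Suc_eq)
 then show ?case
  using Suc tailfun_step[OF assms, of "t + (\<Sum>k<n. x k)" "\<lambda>k. if k < n then 0 else x k" n 0]
  by (simp add: add.assoc)
qed simp

lemma sets_path_space: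
 assumes "\<And>k. real_distribution (\<mu> k)"
 shows "sets (path_space \<mu>) = sets (borel \<Otimes>\<^sub>M PiM UNIV (\<lambda>_. borel))"
 unfolding path_space_def
 by (intro sets_pair_measure_cong sets_PiM_cong refl) (auto simp: real_distribution.events_eq_borel[OF assms])

lemma borel_measurable_path_space:
 assumes "\<And>k. real_distribution (\<mu> k)"
 shows "borel_measurable (path_space \<mu>) = borel_measurable (borel \<Otimes>\<^sub>M PiM UNIV (\<lambda>_. borel))"
 by (intro measurable_cong_sets sets_path_space[OF assms] refl)

text \<open>One inclusion writes zero into the first \<open>n\<close> coordinates. For the other,
  \<open>H\<close> is for each \<open>n\<close> a function of \<open>tail_map n\<close>, so
  averaging over the later coordinates leaves a function of
  \<open>t + (\<Sum>k<n. \<omega> k)\<close>, and Levy's theorem writes \<open>H\<close> as a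
  \<open>tail_lim\<close>.\<close>

lemma alg_tail_boundary_flow:
 assumes \<mu>: "\<And>k. real_distribution (\<mu> k)"
 shows "H \<in> alg (tail_boundary_flow \<mu>) \<longleftrightarrow>
  H \<in> borel_measurable (path_space \<mu>) \<and> (\<exists>G. tailfun G \<and> (AE z in path_space \<mu>. H z = G z))"
proof
 note bm = borel_measurable_path_space[OF \<mu>] borel_measurable_path_space[where \<mu>="\<lambda>k. \<mu> (n + k)" for n, OF \<mu>]
 assume "H \<in> borel_measurable (path_space \<mu>) \<and> (\<exists>G. tailfun G \<and> (AE z in path_space \<mu>. H z = G z))"
 then obtain G where H: "H \<in> borel_measurable (path_space \<mu>)" and G: "tailfun G" and HG: "AE z in path_space \<mu>. H z = G z" by blast
 obtain C where C: "\<And>z. cmod (G z) \<le> C" using tailfun_boundedE[OF G] by metis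
 have Gm[measurable]: "G \<in> borel_measurable (borel \<Otimes>\<^sub>M PiM UNIV (\<lambda>_. borel))" by (rule tailfun_measurable[OF G])
 have "H \<in> tail_algebra_at \<mu> n" for n
 proof -
  define F where "F z = G (fst z, \<lambda>k. if k < n then 0 else snd z (k - n))" for z
  have [measurable]: "(\<lambda>z k. if k < n then 0 else snd z (k - n)) \<in> measurable (borel \<Otimes>\<^sub>M PiM UNIV (\<lambda>_. borel)) (PiM UNIV (\<lambda>_. borel))"
   by (rule measurable_PiM_borelI) measurable
  have "F \<in> borel_measurable (borel \<Otimes>\<^sub>M PiM UNIV (\<lambda>_. borel))" unfolding F_def by measurable
  then have "F \<in> Linf (path_space (\<lambda>k. \<mu> (n + k)))"
   unfolding Linf_def bm using C by (auto simp: F_def)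
  moreover have "G z = F (tail_map n z)" for z
   using tailfun_head[OF G, of "fst z" "snd z" n] by (cases z) (simp add: F_def tail_map_def cong: if_cong)
  moreover have "H \<in> Linf (path_space \<mu>)" unfolding Linf_def
   using H HG C by (auto intro!: exI[of _ C] elim!: eventually_mono)
  ultimately show ?thesis using HG unfolding tail_algebra_at_def by auto
 qed
 then show "H \<in> alg (tail_boundary_flow \<mu>)" by (simp add: tail_boundary_flow_def)
next
 note bm = borel_measurable_path_space[OF \<mu>] borel_measurable_path_space[where \<mu>="\<lambda>k. \<mu> (n + k)" for n, OF \<mu>]
 assume "H \<in> alg (tail_boundary_flow \<mu>)"
 then have H: "H \<in> tail_algebra_at \<mu> n" for n by (simp add: tail_boundary_flow_def)
 from H[of 0] have Hm: "H \<in> borel_measurable (path_space \<mu>)" and "\<exists>C. AE z in path_space \<mu>. cmod (H z) \<le> C"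
  by (auto simp: tail_algebra_at_def Linf_def)
 then obtain C0 where C0: "AE z in path_space \<mu>. cmod (H z) \<le> C0" by blast
 define C where "C = \<bar>C0\<bar>"
 have C: "0 \<le> C" "AE z in path_space \<mu>. cmod (H z) \<le> C" using C0 unfolding C_def by (auto elim!: eventually_mono)
 \<comment> \<open>Essential boundedness becomes boundedness everywhere by setting large values to
   0, so that averages can be bounded pointwise.\<close>
 define tr where "tr z = (if cmod z \<le> C then z else 0)" for z
 have tr: "cmod (tr z) \<le> C" for z using C by (simp add: tr_def)
 have [measurable]: "tr \<in> borel_measurable borel" unfolding tr_def by measurable
 have \<mu>p: "prob_space (\<mu> k)" for k by (intro real_distribution.axioms(1) \<mu>)
 let ?P = "PiM UNIV \<mu>"
 interpret P: prob_space ?P by (intro prob_space_PiM \<mu>p)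
 interpret g: prob_space gauss by (rule prob_space_gauss)
 interpret gP: pair_prob_space gauss ?P ..
 interpret PP: pair_prob_space ?P ?P ..
 interpret gPP: pair_prob_space gauss "?P \<Otimes>\<^sub>M ?P" ..
 have setsP: "sets ?P = sets (PiM UNIV (\<lambda>_. borel))"
  by (intro sets_PiM_cong refl) (auto simp: real_distribution.events_eq_borel[OF \<mu>])
 have [measurable_cong]: "sets ?P = sets (PiM UNIV (\<lambda>_. borel))" by (rule setsP)
 define H' where "H' z = tr (H z)" for z
 have [measurable]: "H \<in> borel_measurable (borel \<Otimes>\<^sub>M ?P)"
  using Hm unfolding path_space_def by (simp cong: measurable_cong_sets)
 have H'm[measurable]: "H' \<in> borel_measurable (borel \<Otimes>\<^sub>M ?P)" unfolding H'_def by measurable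
 have HH': "AE z in path_space \<mu>. H z = H' z" using C(2) by eventually_elim (simp add: H'_def tr_def)
 have "\<exists>F. F \<in> borel_measurable (borel \<Otimes>\<^sub>M PiM UNIV (\<lambda>_. borel)) \<and> (\<forall>z. cmod (F z) \<le> C) \<and> (AE z in path_space \<mu>. H' z = F (tail_map n z))" for n
 proof -
  from H[of n] obtain F where F: "F \<in> borel_measurable (path_space (\<lambda>k. \<mu> (n + k)))" and AE: "AE z in path_space \<mu>. H z = F (tail_map n z)"
   by (auto simp: tail_algebra_at_def Linf_def)
  have [measurable]: "F \<in> borel_measurable (borel \<Otimes>\<^sub>M PiM UNIV (\<lambda>_. borel))"
   using F unfolding bm .
  show ?thesis
   using AE by (intro exI[of _ "\<lambda>z. tr (F z)"]) (auto simp: tr H'_def elim!: eventually_mono)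
 qed
 then obtain F where [measurable]: "\<And>n. F n \<in> borel_measurable (borel \<Otimes>\<^sub>M PiM UNIV (\<lambda>_. borel))"
  and FC: "\<And>n z. cmod (F n z) \<le> C" and HF: "\<And>n. AE z in path_space \<mu>. H' z = F n (tail_map n z)" by metis
 have [measurable]: "(\<lambda>z k. snd z (n + k)) \<in> measurable (borel \<Otimes>\<^sub>M PiM UNIV (\<lambda>_. borel)) (PiM UNIV (\<lambda>_. borel))" for n
  by (rule measurable_PiM_borelI) measurable
 have [measurable]: "(\<lambda>w k. w (n + k)) \<in> measurable (PiM UNIV (\<lambda>_. borel)) (PiM UNIV (\<lambda>_. borel :: real measure))" for n :: nat
  by (rule measurable_PiM_borelI) measurable
 define g where "g n x = (\<integral>w. F n (x, \<lambda>k. w (n + k)) \<partial>?P)" for n x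
 have g[measurable]: "g n \<in> borel_measurable borel" for n unfolding g_def by measurable
 have gC: "cmod (g n x) \<le> C" for n x unfolding g_def by (intro P.norm_expectation_le FC) measurable
 have [measurable]: "tail_map n \<in> measurable (borel \<Otimes>\<^sub>M PiM UNIV (\<lambda>_. borel)) (borel \<Otimes>\<^sub>M PiM UNIV (\<lambda>_. borel))" for n
  unfolding tail_map_def split_beta' by measurable
 define e where "e n z = (\<integral>w. H' (fst z, override_on w (snd z) {..<n}) \<partial>?P)" for n z
 have [measurable]: "e n \<in> borel_measurable (gauss \<Otimes>\<^sub>M ?P)" for n unfolding e_def by measurable
 \<comment> \<open>Since \<open>F n\<close> sees the first \<open>n\<close> coordinates only through
   their sum, integrating out the others gives \<open>g n\<close>.\<close>
 have E: "AE z in gauss \<Otimes>\<^sub>M ?P. e n z = g n (fst z + (\<Sum>k<n. snd z k))" for n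
 proof -
  have "AE z in gauss \<Otimes>\<^sub>M (?P \<Otimes>\<^sub>M ?P). H' (fst z + 0, override_on (snd (snd z)) (fst (snd z)) {..<n})
    = F n (tail_map n (fst z + 0, override_on (snd (snd z)) (fst (snd z)) {..<n}))"
  proof (subst AE_push[symmetric, where \<Omega>="?P \<Otimes>\<^sub>M ?P" and Z="\<lambda>_. 0" and M="?P"
     and X="\<lambda>z. override_on (snd z) (fst z) {..<n}" and P="\<lambda>z. H' z = F n (tail_map n z)"])
   show "prob_space (?P \<Otimes>\<^sub>M ?P)" by unfold_locales
   show "distr (?P \<Otimes>\<^sub>M ?P) ?P (\<lambda>z. override_on (snd z) (fst z) {..<n}) = ?P"
    using distr_override_on[OF \<mu>p, where U="{..<n}"] by (simp add: split_beta')
   show "AE z in gauss \<Otimes>\<^sub>M ?P. H' z = F n (tail_map n z)" using HF[of n] unfolding path_space_def .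
  qed measurable
  then have "AE t in gauss. AE x in ?P \<Otimes>\<^sub>M ?P. H' (t, override_on (snd x) (fst x) {..<n})
    = F n (tail_map n (t, override_on (snd x) (fst x) {..<n}))"
   using gPP.AE_pair by fastforce
  then have *: "AE t in gauss. AE x in ?P. AE y in ?P. H' (t, override_on y x {..<n})
    = F n (tail_map n (t, override_on y x {..<n}))"
   by eventually_elim (use PP.AE_pair in fastforce)
  have [measurable]: "(\<lambda>z. g n (fst z + (\<Sum>k<n. snd z k))) \<in> borel_measurable (gauss \<Otimes>\<^sub>M ?P)" by measurable
  have "{z \<in> space (gauss \<Otimes>\<^sub>M ?P). e n z = g n (fst z + (\<Sum>k<n. snd z k))} \<in> sets (gauss \<Otimes>\<^sub>M ?P)"
   by (rule measurable_equality_set) measurable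
  note iff = gP.AE_pair_iff[of "\<lambda>t x. e n (t, x) = g n (t + (\<Sum>k<n. x k))", simplified prod.collapse, OF this]
  have "AE t in gauss. AE x in ?P. e n (t, x) = g n (t + (\<Sum>k<n. x k))"
   using *
  proof eventually_elim
   case (elim t)
   have "AE x in ?P. x \<in> space ?P" by simp
   with elim show ?case
   proof eventually_elim
    case (elim x)
    have [measurable]: "x \<in> space ?P" by fact
    have "F n (tail_map n (t, override_on y x {..<n})) = F n (t + (\<Sum>k<n. x k), \<lambda>k. y (n + k))" for y
     by (simp add: tail_map_def override_on_def)
    with elim(1) show ?case
     unfolding e_def g_def by (intro integral_cong_AE) auto
   qed
  qed
  then show ?thesis
   by (simp only: iff)
 qed
 have "\<exists>r::nat \<Rightarrow> nat. strict_mono r \<and> (AE z in gauss \<Otimes>\<^sub>M ?P. (\<lambda>n. g (r n) (fst z + (\<Sum>k<r n. snd z k))) \<longlonglongrightarrow> H' z)"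
 proof (rule levy_subsequence[where U="\<lambda>n. {..<n}" and C=C])
  show "incseq (\<lambda>n::nat. {..<n})" by (auto simp: incseq_def)
  show "(\<Union>n::nat. {..<n}) = UNIV" by auto
  show "cmod (H' z) \<le> C" for z by (simp add: H'_def tr)
  show "AE z in gauss \<Otimes>\<^sub>M ?P. (\<integral>w. H' (fst z, override_on w (snd z) {..<n}) \<partial>?P) = g n (fst z + (\<Sum>k<n. snd z k))" for n
   using E[of n] unfolding e_def .
 qed (rule \<mu>p H'm)+
 then obtain r where r: "strict_mono r"
  and conv: "AE z in gauss \<Otimes>\<^sub>M ?P. (\<lambda>n. g (r n) (fst z + (\<Sum>k<r n. snd z k))) \<longlonglongrightarrow> H' z" by blast
 from conv have "AE z in path_space \<mu>. H' z = tail_lim r g z"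
  unfolding path_space_def by eventually_elim (simp add: tail_lim_def limI)
 with HH' have "AE z in path_space \<mu>. H z = tail_lim r g z" by eventually_elim simp
 moreover have "tailfun (tail_lim r g)" by (rule tailfun_tail_lim[OF g gC r])
 ultimately show "H \<in> borel_measurable (path_space \<mu>) \<and> (\<exists>G. tailfun G \<and> (AE z in path_space \<mu>. H z = G z))"
  using Hm by blast
qed

section \<open>Isomorphisms of actions\<close>

text \<open>The closure properties with which isomorphisms are composed and transported;
  \<open>isomorphic_actions\<close> says nothing about functions outside the algebras.\<close>

definition linf_algebra :: "'a linf_action \<Rightarrow> bool" where
 "linf_algebra Z \<longleftrightarrow> alg Z \<subseteq> borel_measurable (base Z) \<and> (\<forall>c. (\<lambda>_. c) \<in> alg Z) \<and>
   (\<forall>f\<in>alg Z. \<forall>g\<in>alg Z. (\<lambda>x. f x + g x) \<in> alg Z \<and> (\<lambda>x. f x * g x) \<in> alg Z) \<and>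
   (\<forall>f\<in>alg Z. (\<lambda>x. cnj (f x)) \<in> alg Z \<and> (\<forall>s. act Z s f \<in> alg Z))"

lemma linf_algebraD:
 assumes "linf_algebra Z"
 shows "f \<in> alg Z \<Longrightarrow> f \<in> borel_measurable (base Z)" "(\<lambda>_. c) \<in> alg Z"
  "f \<in> alg Z \<Longrightarrow> g \<in> alg Z \<Longrightarrow> (\<lambda>x. f x + g x) \<in> alg Z"
  "f \<in> alg Z \<Longrightarrow> g \<in> alg Z \<Longrightarrow> (\<lambda>x. f x * g x) \<in> alg Z"
  "f \<in> alg Z \<Longrightarrow> (\<lambda>x. cnj (f x)) \<in> alg Z" "f \<in> alg Z \<Longrightarrow> act Z s f \<in> alg Z"
 using assms by (auto simp: linf_algebra_def)

lemma linf_algebra_scale: "linf_algebra Z \<Longrightarrow> f \<in> alg Z \<Longrightarrow> (\<lambda>x. c * f x) \<in> alg Z"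
 using linf_algebraD(4)[of Z "\<lambda>_. c" f] linf_algebraD(2)[of Z] by simp

text \<open>An isomorphism read off from a joining: \<open>Q\<close> maps to both base spaces
  compatibly with null sets, and \<open>f\<close> is matched with \<open>h\<close> when
  \<open>f \<circ> \<alpha>\<close> and \<open>h \<circ> \<beta>\<close> agree almost everywhere.
  The matching determines \<open>h\<close> up to null sets and respects all pointwise operations, so
  any choice of \<open>h\<close> gives \<open>\<Phi>\<close>.\<close>

lemma isomorphic_actionsI:
 fixes \<alpha> :: "'q \<Rightarrow> 'a" and \<beta> :: "'q \<Rightarrow> 'b"
 assumes Z: "linf_algebra Z" and W: "linf_algebra W"
  and \<alpha>: "\<And>f g :: _ \<Rightarrow> complex. f \<in> borel_measurable (base Z) \<Longrightarrow> g \<in> borel_measurable (base Z) \<Longrightarrow>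
    (AE x in base Z. f x = g x) \<longleftrightarrow> (AE q in Q. f (\<alpha> q) = g (\<alpha> q))"
  and \<beta>: "\<And>f g :: _ \<Rightarrow> complex. f \<in> borel_measurable (base W) \<Longrightarrow> g \<in> borel_measurable (base W) \<Longrightarrow>
    (AE x in base W. f x = g x) \<longleftrightarrow> (AE q in Q. f (\<beta> q) = g (\<beta> q))"
  and ex1: "\<And>f. f \<in> alg Z \<Longrightarrow> \<exists>h\<in>alg W. AE q in Q. f (\<alpha> q) = h (\<beta> q)"
  and ex2: "\<And>h. h \<in> alg W \<Longrightarrow> \<exists>f\<in>alg Z. AE q in Q. f (\<alpha> q) = h (\<beta> q)"
  and eqv: "\<And>s f h. f \<in> alg Z \<Longrightarrow> h \<in> alg W \<Longrightarrow> AE q in Q. f (\<alpha> q) = h (\<beta> q) \<Longrightarrow>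
    AE q in Q. act Z s f (\<alpha> q) = act W s h (\<beta> q)"
 shows "isomorphic_actions Z W"
proof -
 note Zm = linf_algebraD(1)[OF Z] and Wm = linf_algebraD(1)[OF W]
 note closed = linf_algebraD(3-6)[OF Z] linf_algebraD(3-6)[OF W] linf_algebra_scale[OF Z] linf_algebra_scale[OF W]
 obtain \<Phi> where \<Phi>: "\<And>f. f \<in> alg Z \<Longrightarrow> \<Phi> f \<in> alg W" "\<And>f. f \<in> alg Z \<Longrightarrow> AE q in Q. f (\<alpha> q) = \<Phi> f (\<beta> q)"
  using ex1 by metis
 have inj: "(AE x in base Z. f x = g x) \<longleftrightarrow> (AE y in base W. \<Phi> f y = \<Phi> g y)" if "f \<in> alg Z" "g \<in> alg Z" for f g
 proof -
  have "(AE x in base Z. f x = g x) \<longleftrightarrow> (AE q in Q. f (\<alpha> q) = g (\<alpha> q))" using \<alpha>[OF Zm Zm] that by blast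
  also have "... \<longleftrightarrow> (AE q in Q. \<Phi> f (\<beta> q) = \<Phi> g (\<beta> q))"
  proof
   assume "AE q in Q. f (\<alpha> q) = g (\<alpha> q)"
   with \<Phi>(2)[OF that(1)] \<Phi>(2)[OF that(2)] show "AE q in Q. \<Phi> f (\<beta> q) = \<Phi> g (\<beta> q)" by eventually_elim simp
  next
   assume "AE q in Q. \<Phi> f (\<beta> q) = \<Phi> g (\<beta> q)"
   with \<Phi>(2)[OF that(1)] \<Phi>(2)[OF that(2)] show "AE q in Q. f (\<alpha> q) = g (\<alpha> q)" by eventually_elim simp
  qed
  also have "... \<longleftrightarrow> (AE y in base W. \<Phi> f y = \<Phi> g y)" using \<beta>[OF Wm Wm] \<Phi>(1) that by blast
  finally show ?thesis .
 qed
 have eq: "AE y in base W. \<Phi> f y = h y" if "f \<in> alg Z" "h \<in> alg W" "AE q in Q. f (\<alpha> q) = h (\<beta> q)" for f h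
  unfolding \<beta>[OF Wm[OF \<Phi>(1)[OF that(1)]] Wm[OF that(2)]]
  using that(3) \<Phi>(2)[OF that(1)] by eventually_elim simp
 show ?thesis
  unfolding isomorphic_actions_def
 proof (intro exI[of _ \<Phi>] conjI ballI allI)
  show "\<exists>f\<in>alg Z. AE y in base W. \<Phi> f y = h y" if "h \<in> alg W" for h
   using ex2[OF that] eq[OF _ that] by blast
  fix f assume f: "f \<in> alg Z"
  show "\<Phi> f \<in> alg W" using \<Phi> f by auto
  show "AE y in base W. \<Phi> (\<lambda>x. c * f x) y = c * \<Phi> f y" for c
   using f \<Phi>(2)[OF f] by (intro eq closed \<Phi>(1)) (auto elim!: eventually_mono)
  show "AE y in base W. \<Phi> (\<lambda>x. cnj (f x)) y = cnj (\<Phi> f y)"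
   using f \<Phi>(2)[OF f] by (intro eq closed \<Phi>(1)) (auto elim!: eventually_mono)
  show "AE y in base W. \<Phi> (act Z s f) y = act W s (\<Phi> f) y" for s
   using f \<Phi>[OF f] by (intro eq closed \<Phi>(1) eqv)
  fix g assume g: "g \<in> alg Z"
  show "(AE x in base Z. f x = g x) \<longleftrightarrow> (AE y in base W. \<Phi> f y = \<Phi> g y)" by (rule inj[OF f g])
  have fg: "AE q in Q. f (\<alpha> q) = \<Phi> f (\<beta> q) \<and> g (\<alpha> q) = \<Phi> g (\<beta> q)" using \<Phi>(2)[OF f] \<Phi>(2)[OF g] by eventually_elim simp
  show "AE y in base W. \<Phi> (\<lambda>x. f x + g x) y = \<Phi> f y + \<Phi> g y"
   by (rule eq[OF _ _ eventually_mono[OF fg]]) (intro closed \<Phi>(1) f g | simp)+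
  show "AE y in base W. \<Phi> (\<lambda>x. f x * g x) y = \<Phi> f y * \<Phi> g y"
   by (rule eq[OF _ _ eventually_mono[OF fg]]) (intro closed \<Phi>(1) f g | simp)+
 qed
qed

lemma isomorphic_actionsE:
 assumes "isomorphic_actions Z W"
 obtains \<Phi> where "\<And>f. f \<in> alg Z \<Longrightarrow> \<Phi> f \<in> alg W"
  "\<And>f g. f \<in> alg Z \<Longrightarrow> g \<in> alg Z \<Longrightarrow> (AE x in base Z. f x = g x) \<longleftrightarrow> (AE y in base W. \<Phi> f y = \<Phi> g y)"
  "\<And>h. h \<in> alg W \<Longrightarrow> \<exists>f\<in>alg Z. AE y in base W. \<Phi> f y = h y"
  "\<And>f g. f \<in> alg Z \<Longrightarrow> g \<in> alg Z \<Longrightarrow> AE y in base W. \<Phi> (\<lambda>x. f x + g x) y = \<Phi> f y + \<Phi> g y"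
  "\<And>f g. f \<in> alg Z \<Longrightarrow> g \<in> alg Z \<Longrightarrow> AE y in base W. \<Phi> (\<lambda>x. f x * g x) y = \<Phi> f y * \<Phi> g y"
  "\<And>c f. f \<in> alg Z \<Longrightarrow> AE y in base W. \<Phi> (\<lambda>x. c * f x) y = c * \<Phi> f y"
  "\<And>f. f \<in> alg Z \<Longrightarrow> AE y in base W. \<Phi> (\<lambda>x. cnj (f x)) y = cnj (\<Phi> f y)"
  "\<And>s f. f \<in> alg Z \<Longrightarrow> AE y in base W. \<Phi> (act Z s f) y = act W s (\<Phi> f) y"
proof -
 from assms[unfolded isomorphic_actions_def] show thesis
 proof (elim exE conjE, goal_cases)
  case (1 \<Phi>)
  note p = 1[rule_format]
  show thesis
   by (rule that[of \<Phi>]) (fact p)+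
 qed
qed

lemma isomorphic_actions_trans:
 assumes Z: "linf_algebra Z" and W: "linf_algebra W" and "isomorphic_actions Z W" "isomorphic_actions W V"
 shows "isomorphic_actions Z V"
proof -
 note closed = linf_algebraD(3-6)[OF Z] linf_algebraD(3-6)[OF W] linf_algebra_scale[OF Z] linf_algebra_scale[OF W]
 obtain \<Phi> where A: "\<And>f. f \<in> alg Z \<Longrightarrow> \<Phi> f \<in> alg W"
  "\<And>f g. f \<in> alg Z \<Longrightarrow> g \<in> alg Z \<Longrightarrow> (AE x in base Z. f x = g x) \<longleftrightarrow> (AE y in base W. \<Phi> f y = \<Phi> g y)"
  "\<And>h. h \<in> alg W \<Longrightarrow> \<exists>f\<in>alg Z. AE y in base W. \<Phi> f y = h y"
  "\<And>f g. f \<in> alg Z \<Longrightarrow> g \<in> alg Z \<Longrightarrow> AE y in base W. \<Phi> (\<lambda>x. f x + g x) y = \<Phi> f y + \<Phi> g y"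
  "\<And>f g. f \<in> alg Z \<Longrightarrow> g \<in> alg Z \<Longrightarrow> AE y in base W. \<Phi> (\<lambda>x. f x * g x) y = \<Phi> f y * \<Phi> g y"
  "\<And>c f. f \<in> alg Z \<Longrightarrow> AE y in base W. \<Phi> (\<lambda>x. c * f x) y = c * \<Phi> f y"
  "\<And>f. f \<in> alg Z \<Longrightarrow> AE y in base W. \<Phi> (\<lambda>x. cnj (f x)) y = cnj (\<Phi> f y)"
  "\<And>s f. f \<in> alg Z \<Longrightarrow> AE y in base W. \<Phi> (act Z s f) y = act W s (\<Phi> f) y"
  by (rule isomorphic_actionsE[OF assms(3)]) (rule that; assumption)
 obtain \<Psi> where B: "\<And>f. f \<in> alg W \<Longrightarrow> \<Psi> f \<in> alg V"
  "\<And>f g. f \<in> alg W \<Longrightarrow> g \<in> alg W \<Longrightarrow> (AE x in base W. f x = g x) \<longleftrightarrow> (AE y in base V. \<Psi> f y = \<Psi> g y)"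
  "\<And>h. h \<in> alg V \<Longrightarrow> \<exists>f\<in>alg W. AE y in base V. \<Psi> f y = h y"
  "\<And>f g. f \<in> alg W \<Longrightarrow> g \<in> alg W \<Longrightarrow> AE y in base V. \<Psi> (\<lambda>x. f x + g x) y = \<Psi> f y + \<Psi> g y"
  "\<And>f g. f \<in> alg W \<Longrightarrow> g \<in> alg W \<Longrightarrow> AE y in base V. \<Psi> (\<lambda>x. f x * g x) y = \<Psi> f y * \<Psi> g y"
  "\<And>c f. f \<in> alg W \<Longrightarrow> AE y in base V. \<Psi> (\<lambda>x. c * f x) y = c * \<Psi> f y"
  "\<And>f. f \<in> alg W \<Longrightarrow> AE y in base V. \<Psi> (\<lambda>x. cnj (f x)) y = cnj (\<Psi> f y)"
  "\<And>s f. f \<in> alg W \<Longrightarrow> AE y in base V. \<Psi> (act W s f) y = act V s (\<Psi> f) y"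
  by (rule isomorphic_actionsE[OF assms(4)]) (rule that; assumption)
 have eq: "AE y in base V. \<Psi> f y = k y" if "f \<in> alg W" "g \<in> alg W" "AE x in base W. f x = g x" "AE y in base V. \<Psi> g y = k y" for f g k
  using that(4) B(2)[OF that(1,2)] that(3) by auto
 show ?thesis
  unfolding isomorphic_actions_def
 proof (intro exI[of _ "\<lambda>f. \<Psi> (\<Phi> f)"] conjI ballI allI)
  show "\<exists>f\<in>alg Z. AE y in base V. \<Psi> (\<Phi> f) y = h y" if "h \<in> alg V" for h
  proof -
   from B(3)[OF that] obtain k where k: "k \<in> alg W" "AE y in base V. \<Psi> k y = h y" by blast
   from A(3)[OF k(1)] obtain f where f: "f \<in> alg Z" "AE y in base W. \<Phi> f y = k y" by blast
   from eq[OF A(1)[OF f(1)] k(1) f(2) k(2)] f(1) show ?thesis by blast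
  qed
  fix f assume f: "f \<in> alg Z"
  show "\<Psi> (\<Phi> f) \<in> alg V" using A B f by auto
  show "AE y in base V. \<Psi> (\<Phi> (\<lambda>x. c * f x)) y = c * \<Psi> (\<Phi> f) y" for c
   by (rule eq[OF _ _ A(6)[OF f] B(6)]) (intro A(1) closed f)+
  show "AE y in base V. \<Psi> (\<Phi> (\<lambda>x. cnj (f x))) y = cnj (\<Psi> (\<Phi> f) y)"
   by (rule eq[OF _ _ A(7)[OF f] B(7)]) (intro A(1) closed f)+
  show "AE y in base V. \<Psi> (\<Phi> (act Z s f)) y = act V s (\<Psi> (\<Phi> f)) y" for s
   by (rule eq[OF _ _ A(8)[OF f] B(8)]) (intro A(1) closed f)+
  fix g assume g: "g \<in> alg Z"
  show "(AE x in base Z. f x = g x) \<longleftrightarrow> (AE y in base V. \<Psi> (\<Phi> f) y = \<Psi> (\<Phi> g) y)"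
   using A(2)[OF f g] B(2)[OF A(1)[OF f] A(1)[OF g]] by simp
  show "AE y in base V. \<Psi> (\<Phi> (\<lambda>x. f x + g x)) y = \<Psi> (\<Phi> f) y + \<Psi> (\<Phi> g) y"
   by (rule eq[OF _ _ A(4)[OF f g] B(4)]) (intro A(1) closed f g)+
  show "AE y in base V. \<Psi> (\<Phi> (\<lambda>x. f x * g x)) y = \<Psi> (\<Phi> f) y * \<Psi> (\<Phi> g) y"
   by (rule eq[OF _ _ A(5)[OF f g] B(5)]) (intro A(1) closed f g)+
 qed
qed

text \<open>An invariant element is mapped to an invariant one, hence to a constant
  \<open>c\<close>. It remains to see that \<open>\<Phi>\<close> also maps the constant function
  \<open>c\<close> to \<open>c\<close>.\<close>

lemma ergodic_action_isomorphic:
 assumes Z: "linf_algebra Z" and W: "linf_algebra W" and iso: "isomorphic_actions Z W" and erg: "ergodic_action W"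
 shows "ergodic_action Z"
 unfolding ergodic_action_def
proof (intro ballI impI)
 obtain \<Phi> where A: "\<And>f. f \<in> alg Z \<Longrightarrow> \<Phi> f \<in> alg W"
  "\<And>f g. f \<in> alg Z \<Longrightarrow> g \<in> alg Z \<Longrightarrow> (AE x in base Z. f x = g x) \<longleftrightarrow> (AE y in base W. \<Phi> f y = \<Phi> g y)"
  "\<And>h. h \<in> alg W \<Longrightarrow> \<exists>f\<in>alg Z. AE y in base W. \<Phi> f y = h y"
  "\<And>f g. f \<in> alg Z \<Longrightarrow> g \<in> alg Z \<Longrightarrow> AE y in base W. \<Phi> (\<lambda>x. f x + g x) y = \<Phi> f y + \<Phi> g y"
  "\<And>f g. f \<in> alg Z \<Longrightarrow> g \<in> alg Z \<Longrightarrow> AE y in base W. \<Phi> (\<lambda>x. f x * g x) y = \<Phi> f y * \<Phi> g y"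
  "\<And>c f. f \<in> alg Z \<Longrightarrow> AE y in base W. \<Phi> (\<lambda>x. c * f x) y = c * \<Phi> f y"
  "\<And>f. f \<in> alg Z \<Longrightarrow> AE y in base W. \<Phi> (\<lambda>x. cnj (f x)) y = cnj (\<Phi> f y)"
  "\<And>s f. f \<in> alg Z \<Longrightarrow> AE y in base W. \<Phi> (act Z s f) y = act W s (\<Phi> f) y"
  by (rule isomorphic_actionsE[OF iso]) (rule that; assumption)
 fix f assume f: "f \<in> alg Z" and inv: "\<forall>s. AE x in base Z. act Z s f x = f x"
 have "AE y in base W. act W s (\<Phi> f) y = \<Phi> f y" for s
 proof -
  have "AE y in base W. \<Phi> (act Z s f) y = \<Phi> f y"
   using inv A(2)[OF linf_algebraD(6)[OF Z f] f] by auto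
  with A(8)[OF f, of s] show ?thesis by eventually_elim simp
 qed
 with erg A(1)[OF f] obtain c where c: "AE y in base W. \<Phi> f y = c" unfolding ergodic_action_def by blast
 note const = linf_algebraD(2)[OF Z]
 \<comment> \<open>That \<open>\<Phi>\<close> preserves the unit follows from surjectivity: some
   \<open>e\<close> is mapped to 1, and \<open>\<Phi> e\<close> equals \<open>\<Phi> 1\<close> times
   \<open>\<Phi> e\<close>.\<close>
 from A(3)[OF linf_algebraD(2)[OF W, of 1]] obtain e where e: "e \<in> alg Z" "AE y in base W. \<Phi> e y = 1" by blast
 have "AE y in base W. \<Phi> (\<lambda>x. 1 * e x) y = \<Phi> (\<lambda>_. 1) y * \<Phi> e y" by (rule A(5)[OF const e(1)])
 with e(2) have one: "AE y in base W. \<Phi> (\<lambda>_. 1) y = 1" by (simp, eventually_elim) simp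
 have "AE y in base W. \<Phi> (\<lambda>_. c * 1) y = c * \<Phi> (\<lambda>_. 1) y" by (rule A(6)[OF const])
 with one c have "AE y in base W. \<Phi> f y = \<Phi> (\<lambda>_. c) y" by (simp, eventually_elim) simp
 then have "AE x in base Z. f x = c" using A(2)[OF f const] by simp
 then show "\<exists>c. AE x in base Z. f x = c" ..
qed

lemma borel_measurable_cnj [measurable (raw)]:
 "f \<in> borel_measurable M \<Longrightarrow> (\<lambda>x. cnj (f x)) \<in> borel_measurable M"
 using borel_measurable_continuous_on[of cnj f] by (simp add: continuous_on_cnj)

lemma linf_algebra_flow_action:
 assumes "nonsingular_flow M T"
 shows "linf_algebra (flow_action M T)"
proof -
 have act: "(\<lambda>x. f (T s x)) \<in> Linf M" if f: "f \<in> Linf M" for f s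
 proof -
  have "(\<lambda>x. (s, x)) \<in> measurable M (borel \<Otimes>\<^sub>M M)" by measurable
  then have T[measurable]: "T s \<in> measurable M M"
   using assms measurable_compose[of "\<lambda>x. (s, x)" M "borel \<Otimes>\<^sub>M M" "\<lambda>(s, x). T s x" M] by (auto simp: nonsingular_flow_def)
  from f obtain C where [measurable]: "f \<in> borel_measurable M" and C: "AE x in M. cmod (f x) \<le> C" by (auto simp: Linf_def)
  \<comment> \<open>Nonsingularity carries the null set on which the bound fails to a null
    set.\<close>
  define N where "N = {x \<in> space M. \<not> cmod (f x) \<le> C}"
  have "N \<in> sets M" unfolding N_def by measurable
  moreover from this C have "N \<in> null_sets M"
   using AE_iff_null[of M "\<lambda>x. cmod (f x) \<le> C"] by (simp add: N_def)
  ultimately have "T s -` N \<inter> space M \<in> null_sets M" using assms by (auto simp: nonsingular_flow_def)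
  then have "AE x in M. cmod (f (T s x)) \<le> C"
   by (rule AE_I') (use measurable_space[OF T] in \<open>auto simp: N_def\<close>)
  then show ?thesis by (auto simp: Linf_def)
 qed
 have add: "(\<lambda>x. f x + g x) \<in> Linf M" if "f \<in> Linf M" "g \<in> Linf M" for f g
 proof -
  from that obtain C D where [measurable]: "f \<in> borel_measurable M" "g \<in> borel_measurable M"
   and "AE x in M. cmod (f x) \<le> C" "AE x in M. cmod (g x) \<le> D" by (auto simp: Linf_def)
  then have "AE x in M. cmod (f x + g x) \<le> C + D" by (auto elim!: eventually_elim2 intro: norm_triangle_mono)
  then show ?thesis by (auto simp: Linf_def)
 qed
 have mult: "(\<lambda>x. f x * g x) \<in> Linf M" if "f \<in> Linf M" "g \<in> Linf M" for f g
 proof -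
  from that obtain C D where [measurable]: "f \<in> borel_measurable M" "g \<in> borel_measurable M"
   and CD: "AE x in M. cmod (f x) \<le> C" "AE x in M. cmod (g x) \<le> D" by (auto simp: Linf_def)
  have "AE x in M. cmod (f x * g x) \<le> C * D"
   using CD by eventually_elim (auto simp: norm_mult intro!: mult_mono intro: order_trans[OF norm_ge_zero])
  then show ?thesis by (auto simp: Linf_def)
 qed
 show ?thesis
  unfolding linf_algebra_def using act add mult by (auto simp: flow_action_def) (auto simp: Linf_def borel_measurable_cnj)
qed

lemma AE_path_space_translate:
 assumes \<mu>: "\<And>k. real_distribution (\<mu> k)" and P: "{z \<in> space (path_space \<mu>). P z} \<in> sets (path_space \<mu>)"
 shows "(AE z in path_space \<mu>. P (fst z + s, snd z)) \<longleftrightarrow> (AE z in path_space \<mu>. P z)"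
proof -
 have p: "prob_space (PiM UNIV \<mu>)" by (intro prob_space_PiM real_distribution.axioms(1) \<mu>)
 show ?thesis
  using AE_push[OF p, of "\<lambda>x. x" "PiM UNIV \<mu>" "\<lambda>_. s" P] P unfolding path_space_def by (simp add: distr_id[unfolded id_def])
qed

lemma equality_sets_path_space:
 fixes f g :: "_ \<Rightarrow> complex"
 assumes "f \<in> borel_measurable (path_space \<mu>)" "g \<in> borel_measurable (path_space \<mu>)"
 shows "{z \<in> space (path_space \<mu>). f z = g z} \<in> sets (path_space \<mu>)"
 using assms by (rule measurable_equality_set)

lemma act_tail_boundary_flow: "act (tail_boundary_flow \<mu>) s F z = F (fst z - s, snd z)"
 by (simp add: tail_boundary_flow_def split_beta)

lemma base_tail_boundary_flow: "base (tail_boundary_flow \<mu>) = path_space \<mu>"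
 by (simp add: tail_boundary_flow_def)

lemma linf_algebra_tail_boundary_flow:
 assumes \<mu>: "\<And>k. real_distribution (\<mu> k)"
 shows "linf_algebra (tail_boundary_flow \<mu>)"
proof -
 note alg = alg_tail_boundary_flow[OF \<mu>]
 have c: "(\<lambda>_. c) \<in> alg (tail_boundary_flow \<mu>)" for c
  unfolding alg by (auto intro!: exI[of _ "\<lambda>_. c"] tailfunI[where C="cmod c"])
 have a: "(\<lambda>x. f x + g x) \<in> alg (tail_boundary_flow \<mu>)" "(\<lambda>x. f x * g x) \<in> alg (tail_boundary_flow \<mu>)"
  if fg: "f \<in> alg (tail_boundary_flow \<mu>)" "g \<in> alg (tail_boundary_flow \<mu>)" for f g
 proof -
  from fg obtain F G where f: "f \<in> borel_measurable (path_space \<mu>)" "tailfun F" "AE z in path_space \<mu>. f z = F z"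
   and g: "g \<in> borel_measurable (path_space \<mu>)" "tailfun G" "AE z in path_space \<mu>. g z = G z"
   unfolding alg by blast
  have "AE z in path_space \<mu>. f z + g z = F z + G z" "AE z in path_space \<mu>. f z * g z = F z * G z"
   using f(3) g(3) by (eventually_elim, simp)+
  then show "(\<lambda>x. f x + g x) \<in> alg (tail_boundary_flow \<mu>)" "(\<lambda>x. f x * g x) \<in> alg (tail_boundary_flow \<mu>)"
   using tailfun_add[OF f(2) g(2)] tailfun_mult[OF f(2) g(2)]
    borel_measurable_add[OF f(1) g(1)] borel_measurable_times[OF f(1) g(1)] by (auto simp: alg)
 qed
 have b: "(\<lambda>x. cnj (f x)) \<in> alg (tail_boundary_flow \<mu>)" "act (tail_boundary_flow \<mu>) s f \<in> alg (tail_boundary_flow \<mu>)"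
  if f: "f \<in> alg (tail_boundary_flow \<mu>)" for f s
 proof -
  from f obtain F where f: "f \<in> borel_measurable (path_space \<mu>)" "tailfun F" "AE z in path_space \<mu>. f z = F z"
   unfolding alg by blast
  have "AE z in path_space \<mu>. cnj (f z) = cnj (F z)" using f(3) by eventually_elim simp
  moreover have "tailfun (\<lambda>z. cnj (F z))" by (rule tailfun_compose[OF f(2)]) (intro continuous_intros)
  moreover have "(\<lambda>x. cnj (f x)) \<in> borel_measurable (path_space \<mu>)"
   using f(1) by (rule borel_measurable_cnj)
  ultimately show "(\<lambda>x. cnj (f x)) \<in> alg (tail_boundary_flow \<mu>)" unfolding alg by blast
  have eq: "act (tail_boundary_flow \<mu>) s f = (\<lambda>z. f (fst z + (- s), snd z))"
   by (simp add: fun_eq_iff act_tail_boundary_flow)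
  have [measurable]: "f \<in> borel_measurable (borel \<Otimes>\<^sub>M PiM UNIV (\<lambda>_. borel))" "F \<in> borel_measurable (borel \<Otimes>\<^sub>M PiM UNIV (\<lambda>_. borel))"
   using f(1) f(2)[THEN tailfun_measurable] by (simp_all add: borel_measurable_path_space[OF \<mu>])
  have "AE z in path_space \<mu>. f (fst z + (- s), snd z) = F (fst z + (- s), snd z)"
   using AE_path_space_translate[OF \<mu>, where P="\<lambda>z. f z = F z" and s="- s"] f(3)
    equality_sets_path_space[of f \<mu> F] f(1) f(2)[THEN tailfun_measurable]
   by (simp add: borel_measurable_path_space[OF \<mu>])
  moreover have "(\<lambda>z. f (fst z + (- s), snd z)) \<in> borel_measurable (path_space \<mu>)"
   unfolding borel_measurable_path_space[OF \<mu>] by measurable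
  ultimately show "act (tail_boundary_flow \<mu>) s f \<in> alg (tail_boundary_flow \<mu>)"
   using tailfun_translate[OF f(2), of "-s"] unfolding alg eq by blast
 qed
 show ?thesis
  unfolding linf_algebra_def using a b c by (auto simp: alg base_tail_boundary_flow)
qed

lemma sets_PiM_real:
 assumes "\<And>k. real_distribution (\<mu> k)"
 shows "sets (PiM UNIV \<mu>) = sets (PiM UNIV (\<lambda>_. borel))"
 by (intro sets_PiM_cong refl) (auto simp: real_distribution.events_eq_borel[OF assms])

lemma prob_space_PiM_real:
 "(\<And>k. real_distribution (\<mu> k)) \<Longrightarrow> prob_space (PiM UNIV \<mu>)"
 by (intro prob_space_PiM real_distribution.axioms(1))

lemma AE_time_translate:
 assumes \<Omega>: "prob_space \<Omega>" and f: "f \<in> borel_measurable (gauss \<Otimes>\<^sub>M \<Omega>)" "g \<in> borel_measurable (gauss \<Otimes>\<^sub>M \<Omega>)"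
  and AE: "AE z in gauss \<Otimes>\<^sub>M \<Omega>. f z = (g z :: complex)" and Z: "Z \<in> borel_measurable \<Omega>"
 shows "AE z in gauss \<Otimes>\<^sub>M \<Omega>. f (fst z + Z (snd z), snd z) = g (fst z + Z (snd z), snd z)"
 using AE_push[OF \<Omega>, of "\<lambda>x. x" \<Omega> Z "\<lambda>z. f z = g z"] measurable_equality_set[OF f] AE Z
 by (simp add: distr_id[unfolded id_def])

text \<open>The joining is \<open>gauss \<Otimes>\<^sub>M \<Omega>\<close> with the two maps
  \<open>(t + Z, X)\<close> and \<open>(t, Y)\<close>. Both commute with translations of
  \<open>t\<close>, which yields equivariance. Exact tail functions represent all elements, so only
  these have to be matched.\<close>

lemma isomorphic_tail_boundary_flowsI:
 assumes \<mu>: "\<And>k. real_distribution (\<mu> k)" and \<nu>: "\<And>k. real_distribution (\<nu> k)" and \<Omega>: "prob_space \<Omega>"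
  and X[measurable]: "X \<in> measurable \<Omega> (PiM UNIV \<mu>)" and dX: "distr \<Omega> (PiM UNIV \<mu>) X = PiM UNIV \<mu>"
  and Y[measurable]: "Y \<in> measurable \<Omega> (PiM UNIV \<nu>)" and dY: "distr \<Omega> (PiM UNIV \<nu>) Y = PiM UNIV \<nu>"
  and Z[measurable]: "Z \<in> borel_measurable \<Omega>"
  and ex1: "\<And>G. tailfun G \<Longrightarrow> \<exists>G'. tailfun G' \<and> (AE z in gauss \<Otimes>\<^sub>M \<Omega>. G (fst z + Z (snd z), X (snd z)) = G' (fst z, Y (snd z)))"
  and ex2: "\<And>G. tailfun G \<Longrightarrow> \<exists>G'. tailfun G' \<and> (AE z in gauss \<Otimes>\<^sub>M \<Omega>. G' (fst z + Z (snd z), X (snd z)) = G (fst z, Y (snd z)))"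
 shows "isomorphic_actions (tail_boundary_flow \<mu>) (tail_boundary_flow \<nu>)"
proof -
 let ?\<alpha> = "\<lambda>z. (fst z + Z (snd z), X (snd z))" and ?\<beta> = "\<lambda>z. (fst z, Y (snd z))"
 have \<alpha>: "(AE z in path_space \<mu>. f z = g z) \<longleftrightarrow> (AE q in gauss \<Otimes>\<^sub>M \<Omega>. f (?\<alpha> q) = g (?\<alpha> q))"
  if "f \<in> borel_measurable (path_space \<mu>)" "g \<in> borel_measurable (path_space \<mu>)" for f g :: "_ \<Rightarrow> complex"
  using AE_push[OF \<Omega> X dX Z, of "\<lambda>z. f z = g z"] equality_sets_path_space[OF that] unfolding path_space_def by simp
 have \<beta>: "(AE z in path_space \<nu>. f z = g z) \<longleftrightarrow> (AE q in gauss \<Otimes>\<^sub>M \<Omega>. f (?\<beta> q) = g (?\<beta> q))"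
  if "f \<in> borel_measurable (path_space \<nu>)" "g \<in> borel_measurable (path_space \<nu>)" for f g :: "_ \<Rightarrow> complex"
  using AE_push[OF \<Omega> Y dY, of "\<lambda>_. 0" "\<lambda>z. f z = g z"] equality_sets_path_space[OF that] unfolding path_space_def by simp
 have tm: "G \<in> borel_measurable (path_space \<mu>)" "G \<in> borel_measurable (path_space \<nu>)" if "tailfun G" for G
  using tailfun_measurable[OF that] by (simp_all add: borel_measurable_path_space \<mu> \<nu>)
 have m\<alpha>: "?\<alpha> \<in> measurable (gauss \<Otimes>\<^sub>M \<Omega>) (path_space \<mu>)" and m\<beta>: "?\<beta> \<in> measurable (gauss \<Otimes>\<^sub>M \<Omega>) (path_space \<nu>)"
  unfolding path_space_def by measurable
 show ?thesis
 proof (rule isomorphic_actionsI[where \<alpha>="?\<alpha>" and \<beta>="?\<beta>" and Q="gauss \<Otimes>\<^sub>M \<Omega>"];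
   (unfold base_tail_boundary_flow)?)
  show "linf_algebra (tail_boundary_flow \<mu>)" "linf_algebra (tail_boundary_flow \<nu>)"
   by (intro linf_algebra_tail_boundary_flow \<mu> \<nu>)+
  show "\<exists>h\<in>alg (tail_boundary_flow \<nu>). AE q in gauss \<Otimes>\<^sub>M \<Omega>. f (?\<alpha> q) = h (?\<beta> q)" if "f \<in> alg (tail_boundary_flow \<mu>)" for f
  proof -
   from that obtain F where f: "f \<in> borel_measurable (path_space \<mu>)" "tailfun F" "AE z in path_space \<mu>. f z = F z"
    unfolding alg_tail_boundary_flow[OF \<mu>] by blast
   from ex1[OF f(2)] obtain G where G: "tailfun G" "AE z in gauss \<Otimes>\<^sub>M \<Omega>. F (?\<alpha> z) = G (?\<beta> z)" by auto
   have "AE q in gauss \<Otimes>\<^sub>M \<Omega>. f (?\<alpha> q) = F (?\<alpha> q)" using \<alpha>[OF f(1) tm(1)[OF f(2)]] f(3) by simp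
   with G(2) have "AE q in gauss \<Otimes>\<^sub>M \<Omega>. f (?\<alpha> q) = G (?\<beta> q)" by eventually_elim simp
   moreover have "G \<in> alg (tail_boundary_flow \<nu>)" unfolding alg_tail_boundary_flow[OF \<nu>] using tm[OF G(1)] G(1) by auto
   ultimately show ?thesis by blast
  qed
  show "\<exists>f\<in>alg (tail_boundary_flow \<mu>). AE q in gauss \<Otimes>\<^sub>M \<Omega>. f (?\<alpha> q) = h (?\<beta> q)" if "h \<in> alg (tail_boundary_flow \<nu>)" for h
  proof -
   from that obtain F where f: "h \<in> borel_measurable (path_space \<nu>)" "tailfun F" "AE z in path_space \<nu>. h z = F z"
    unfolding alg_tail_boundary_flow[OF \<nu>] by blast
   from ex2[OF f(2)] obtain G where G: "tailfun G" "AE z in gauss \<Otimes>\<^sub>M \<Omega>. G (?\<alpha> z) = F (?\<beta> z)" by auto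
   have "AE q in gauss \<Otimes>\<^sub>M \<Omega>. h (?\<beta> q) = F (?\<beta> q)" using \<beta>[OF f(1) tm(2)[OF f(2)]] f(3) by simp
   with G(2) have "AE q in gauss \<Otimes>\<^sub>M \<Omega>. G (?\<alpha> q) = h (?\<beta> q)" by eventually_elim simp
   moreover have "G \<in> alg (tail_boundary_flow \<mu>)" unfolding alg_tail_boundary_flow[OF \<mu>] using tm[OF G(1)] G(1) by auto
   ultimately show ?thesis by blast
  qed
  fix s f h assume f: "f \<in> alg (tail_boundary_flow \<mu>)" and h: "h \<in> alg (tail_boundary_flow \<nu>)"
   and AE: "AE q in gauss \<Otimes>\<^sub>M \<Omega>. f (?\<alpha> q) = h (?\<beta> q)"
  have "f \<in> borel_measurable (path_space \<mu>)" "h \<in> borel_measurable (path_space \<nu>)"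
   using f h by (simp_all add: alg_tail_boundary_flow \<mu> \<nu>)
  note m = measurable_compose[OF m\<alpha> this(1)] measurable_compose[OF m\<beta> this(2)]
  from AE_time_translate[OF \<Omega> m AE, of "\<lambda>_. - s"]
  show "AE q in gauss \<Otimes>\<^sub>M \<Omega>. act (tail_boundary_flow \<mu>) s f (?\<alpha> q) = act (tail_boundary_flow \<nu>) s h (?\<beta> q)"
   by (simp add: act_tail_boundary_flow algebra_simps)
 qed (rule \<alpha> \<beta>; assumption)+
qed

section \<open>Ergodicity\<close>

text \<open>A zero-one law. Invariance makes \<open>G\<close> a function \<open>\<gamma>\<close> of
  the path alone; the averages \<open>g n\<close> from which \<open>G\<close> is recovered are then
  almost everywhere equal to the mean of \<open>\<gamma>\<close>.\<close>

lemma translation_invariant_AE_const: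
 assumes \<mu>: "\<And>k. real_distribution (\<mu> k)" and G: "tailfun G"
  and inv: "\<And>s. AE z in path_space \<mu>. G (fst z + s, snd z) = G z"
 shows "\<exists>c. AE z in path_space \<mu>. G z = c"
proof -
 have \<mu>p: "prob_space (\<mu> k)" for k by (intro real_distribution.axioms(1) \<mu>)
 let ?P = "PiM UNIV \<mu>"
 interpret P: prob_space ?P by (rule prob_space_PiM_real[OF \<mu>])
 interpret g: prob_space gauss by (rule prob_space_gauss)
 interpret gP: pair_prob_space gauss ?P ..
 interpret LP: pair_sigma_finite lborel ?P ..
 have [measurable_cong]: "sets ?P = sets (PiM UNIV (\<lambda>_. borel))" by (rule sets_PiM_real[OF \<mu>])
 have Gm[measurable]: "G \<in> borel_measurable (borel \<Otimes>\<^sub>M PiM UNIV (\<lambda>_. borel))" by (rule tailfun_measurable[OF G])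
 obtain C where C: "0 \<le> C" "\<And>z. cmod (G z) \<le> C" using tailfun_boundedE[OF G] by metis
 have m1: "{z \<in> space (gauss \<Otimes>\<^sub>M ?P). G (fst z + s, snd z) = G z} \<in> sets (gauss \<Otimes>\<^sub>M ?P)" for s
  by (rule measurable_equality_set) measurable
 have inv': "AE w in ?P. AE t in lborel. G (t + s, w) = G (t, w)" for s
  using inv[of s, unfolded path_space_def] unfolding AE_gauss_pair[OF P.prob_space_axioms m1[of s]] by simp
 \<comment> \<open>The exceptional null set of paths depends on \<open>s\<close>. \<open>D\<close>
   measures the failure of invariance for given \<open>s\<close> and path, so that Fubini's theorem
   exchanges the two quantifiers.\<close>
 define D where "D z = (\<integral>\<^sup>+t. ennreal (cmod (G (t + fst z, snd z) - G (t, snd z))) \<partial>gauss)" for z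
 have [measurable]: "D \<in> borel_measurable (borel \<Otimes>\<^sub>M ?P)" unfolding D_def by measurable
 have D0: "D (s, w) = 0 \<longleftrightarrow> (AE t in lborel. G (t + s, w) = G (t, w))" if "w \<in> space ?P" for s w
 proof -
  have [measurable]: "w \<in> space (PiM UNIV (\<lambda>_. borel :: real measure))" by (simp add: space_PiM)
  show ?thesis unfolding D_def by (subst nn_integral_0_iff_AE) (auto simp: AE_gauss)
 qed
 have "AE s in lborel. AE w in ?P. D (s, w) = 0"
 proof (rule AE_I2)
  fix s
  have "AE w in ?P. w \<in> space ?P" by simp
  with inv'[of s] show "AE w in ?P. D (s, w) = 0" by eventually_elim (simp add: D0)
 qed
 then have "AE w in ?P. AE s in lborel. D (s, w) = 0"
  by (subst (asm) LP.AE_commute) measurable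
 then have AEw: "AE w in ?P. \<exists>c. AE t in lborel. G (t, w) = c"
 proof -
  assume "AE w in ?P. AE s in lborel. D (s, w) = 0"
  moreover have "AE w in ?P. w \<in> space ?P" by simp
  ultimately show ?thesis
  proof eventually_elim
   case (elim w)
   have [measurable]: "w \<in> space (PiM UNIV (\<lambda>_. borel :: real measure))" by (simp add: space_PiM)
   from elim have "AE s in lborel. AE t in lborel. G (t + s, w) = G (t, w)" by (simp add: D0)
   then have "AE t in lborel. AE s in lborel. G (t + s, w) = G (t, w)"
   proof (subst (asm) lborel_pair.AE_commute)
    show "{x \<in> space (lborel \<Otimes>\<^sub>M lborel). G (snd x + fst x, w) = G (snd x, w)} \<in> sets (lborel \<Otimes>\<^sub>M lborel)"
     by (rule measurable_equality_set) measurable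
   qed
   then obtain t where t: "AE s in lborel. G (t + s, w) = G (t, w)"
    using eventually_happens'[OF g.ae_filter_bot] unfolding AE_gauss by blast
   have "{s. G (s, w) = G (t, w)} \<in> sets borel"
    using measurable_equality_set[of "\<lambda>s. G (s, w)" borel "\<lambda>s. G (t, w)"] by simp
   from AE_lborel_translate[OF this, of t] t have "AE s in lborel. G (s, w) = G (t, w)" by (simp add: add.commute)
   then show ?case ..
  qed
 qed
 define \<gamma> where "\<gamma> w = (\<integral>t. G (t, w) \<partial>gauss)" for w
 have [measurable]: "\<gamma> \<in> borel_measurable ?P" unfolding \<gamma>_def by measurable
 have AE\<gamma>: "AE w in ?P. AE t in lborel. G (t, w) = \<gamma> w"
  using AEw
 proof (eventually_elim, elim exE)
  fix w c assume c: "AE t in lborel. G (t, w) = c"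
  have [measurable]: "w \<in> space (PiM UNIV (\<lambda>_. borel :: real measure))" by (simp add: space_PiM)
  from c have "AE t in gauss. G (t, w) = c" by (simp add: AE_gauss)
  then have "\<gamma> w = (\<integral>t. c \<partial>gauss)" unfolding \<gamma>_def
   by (intro integral_cong_AE) (auto simp: AE_gauss)
  also have "... = c" using g.prob_space by simp
  finally show "AE t in lborel. G (t, w) = \<gamma> w" using c by simp
 qed
 define c where "c = (\<integral>w. \<gamma> w \<partial>?P)"
 have Gm': "G \<in> borel_measurable (borel \<Otimes>\<^sub>M ?P)" by measurable
 have stp: "step_invariant \<mu> (\<lambda>_ x. x) G"
  unfolding step_invariant_def using tailfun_step[OF G] by blast
 have idm: "(\<lambda>x. x) \<in> borel_measurable (\<mu> i)" for i
  by (simp add: measurable_cong_sets[OF real_distribution.events_eq_borel[OF \<mu>] refl])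
 obtain g r where g: "\<And>n. g n \<in> borel_measurable borel" "strict_mono r"
  "\<And>n x. g n x = (\<integral>w. G (x - (\<Sum>i\<in>(\<Union>j<n. {j}). w i), w) \<partial>?P)"
  "AE z in gauss \<Otimes>\<^sub>M ?P. (\<lambda>n. g (r n) (fst z + (\<Sum>j<r n. \<Sum>i\<in>{j}. snd z i))) \<longlonglongrightarrow> G z"
  by (rule step_invariant_AE_tailfun[of \<mu> "\<lambda>_ x. x" "\<lambda>j. {j}" G C, OF \<mu>p idm _ _ _ Gm' C(2) stp])
    (auto simp: disjoint_family_on_def)
 have gx: "g n x = (\<integral>w. G (x - (\<Sum>i<n. w i), w) \<partial>?P)" for n x using g(3) by simp
 \<comment> \<open>A time shift that depends on the path does not affect a function that is constant
   in time on almost every path.\<close>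
 have gc: "AE x in lborel. g n x = c" for n
 proof -
  have m: "{z \<in> space (lborel \<Otimes>\<^sub>M ?P). G (fst z + (\<Sum>i<n. - snd z i), snd z) = \<gamma> (snd z)} \<in> sets (lborel \<Otimes>\<^sub>M ?P)"
   by (rule measurable_equality_set) measurable
  have "AE w in ?P. AE x in lborel. G (x + (\<Sum>i<n. - w i), w) = \<gamma> w"
  proof -
   have "AE w in ?P. w \<in> space ?P" by simp
   with AE\<gamma> show ?thesis
   proof eventually_elim
    case (elim w)
    have [measurable]: "w \<in> space (PiM UNIV (\<lambda>_. borel :: real measure))" by (simp add: space_PiM)
    have "{t. G (t, w) = \<gamma> w} \<in> sets borel"
     using measurable_equality_set[of "\<lambda>s. G (s, w)" borel "\<lambda>s. \<gamma> w"] by simp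
    from AE_lborel_translate[OF this] elim(1) show ?case by blast
   qed
  qed
  then have "AE x in lborel. AE w in ?P. G (x + (\<Sum>i<n. - w i), w) = \<gamma> w"
   using LP.AE_commute[of "\<lambda>x w. G (x + (\<Sum>i<n. - w i), w) = \<gamma> w"] m by simp
  then show ?thesis
  proof eventually_elim
   case (elim x)
   have "g n x = (\<integral>w. \<gamma> w \<partial>?P)" unfolding gx
    by (rule integral_cong_AE) (use elim in \<open>auto simp: sum_negf\<close>)
   then show ?case by (simp add: c_def)
  qed
 qed
 have "AE z in gauss \<Otimes>\<^sub>M ?P. g n (fst z + (\<Sum>j<n. snd z j)) = c" for n
 proof -
  have [measurable]: "g n \<in> borel_measurable borel" by fact
  have "{z \<in> space (gauss \<Otimes>\<^sub>M ?P). g n (fst z + (\<Sum>j<n. snd z j)) = c} \<in> sets (gauss \<Otimes>\<^sub>M ?P)"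
   by (rule measurable_equality_set) measurable
  moreover have "AE t in lborel. g n (t + s) = c" for s
   using AE_lborel_translate[of "\<lambda>t. g n t = c" s] gc[of n] measurable_equality_set[of "g n" borel "\<lambda>_. c"] by simp
  ultimately show ?thesis by (subst AE_gauss_pair[OF P.prob_space_axioms]) auto
 qed
 then have "AE z in gauss \<Otimes>\<^sub>M ?P. \<forall>n. g n (fst z + (\<Sum>j<n. snd z j)) = c" by (simp add: AE_all_countable)
 with g(4) have "AE z in gauss \<Otimes>\<^sub>M ?P. G z = c"
  by eventually_elim (auto dest: LIMSEQ_unique[OF tendsto_const])
 then show ?thesis unfolding path_space_def ..
qed

lemma ergodic_tail_boundary_flow:
 assumes \<mu>: "\<And>k. real_distribution (\<mu> k)"
 shows "ergodic_action (tail_boundary_flow \<mu>)"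
 unfolding ergodic_action_def base_tail_boundary_flow act_tail_boundary_flow
proof (intro ballI impI)
 fix f assume "f \<in> alg (tail_boundary_flow \<mu>)" and inv: "\<forall>s. AE z in path_space \<mu>. f (fst z - s, snd z) = f z"
 then obtain F where f: "f \<in> borel_measurable (path_space \<mu>)" "tailfun F" "AE z in path_space \<mu>. f z = F z"
  unfolding alg_tail_boundary_flow[OF \<mu>] by blast
 have Fm: "F \<in> borel_measurable (path_space \<mu>)" using tailfun_measurable[OF f(2)] by (simp add: borel_measurable_path_space[OF \<mu>])
 have "AE z in path_space \<mu>. F (fst z + s, snd z) = F z" for s
 proof -
  have "AE z in path_space \<mu>. f (fst z + s, snd z) = F (fst z + s, snd z)"
   using f(3) AE_path_space_translate[OF \<mu>, where P="\<lambda>z. f z = F z" and s=s] equality_sets_path_space[OF f(1) Fm] by simp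
  with f(3) inv[rule_format, of "- s"] show ?thesis by eventually_elim simp
 qed
 from translation_invariant_AE_const[OF \<mu> f(2) this] obtain c where "AE z in path_space \<mu>. F z = c" ..
 with f(3) have "AE z in path_space \<mu>. f z = c" by eventually_elim simp
 then show "\<exists>c. AE z in path_space \<mu>. f z = c" ..
qed

section \<open>Periods of flows and couplings of sequences\<close>

definition time_periodic :: "(nat \<Rightarrow> real measure) \<Rightarrow> real \<Rightarrow> bool" where
 "time_periodic \<mu> a \<longleftrightarrow> (\<forall>G. tailfun G \<longrightarrow> (AE z in path_space \<mu>. G (fst z + a, snd z) = G z))"

lemma distr_pair_measure_snd:
 assumes "prob_space M" "prob_space N"
 shows "distr (M \<Otimes>\<^sub>M N) N snd = N"
proof (rule measure_eqI)
 interpret M: prob_space M by fact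
 interpret N: prob_space N by fact
 fix A assume "A \<in> sets (distr (M \<Otimes>\<^sub>M N) N snd)"
 then have A: "A \<in> sets N" by simp
 then have "snd -` A \<inter> space (M \<Otimes>\<^sub>M N) = space M \<times> A"
  using sets.sets_into_space[OF A] by (auto simp: space_pair_measure)
 then show "emeasure (distr (M \<Otimes>\<^sub>M N) N snd) A = emeasure N A"
  using A by (simp add: emeasure_distr N.emeasure_pair_measure_Times M.emeasure_space_1)
qed simp

text \<open>Ergodicity reduces both algebras to the constants, and the independent product is a
  joining that matches constants.\<close>

lemma trivial_flows_isomorphic:
 assumes \<mu>: "\<And>k. real_distribution (\<mu> k)" and \<nu>: "\<And>k. real_distribution (\<nu> k)"
  and per: "\<And>a. time_periodic \<mu> a" "\<And>a. time_periodic \<nu> a"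
 shows "isomorphic_actions (tail_boundary_flow \<mu>) (tail_boundary_flow \<nu>)"
proof -
 have const: "\<exists>c. AE z in path_space \<rho>. G z = c" if \<rho>: "\<And>k. real_distribution (\<rho> k)" and "\<And>a. time_periodic \<rho> a" "tailfun G" for \<rho> G
  by (rule translation_invariant_AE_const) (use that in \<open>auto simp: time_periodic_def\<close>)
 let ?P = "PiM UNIV \<mu>" and ?Q = "PiM UNIV \<nu>"
 interpret P: prob_space ?P by (rule prob_space_PiM_real[OF \<mu>])
 interpret Q: prob_space ?Q by (rule prob_space_PiM_real[OF \<nu>])
 interpret PQ: pair_prob_space ?P ?Q ..
 have d: "distr (?P \<Otimes>\<^sub>M ?Q) ?P fst = ?P" "distr (?P \<Otimes>\<^sub>M ?Q) ?Q snd = ?Q"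
  using Q.distr_pair_fst[of ?P] distr_pair_measure_snd[OF P.prob_space_axioms Q.prob_space_axioms] by simp_all
 show ?thesis
 proof (rule isomorphic_tail_boundary_flowsI[OF \<mu> \<nu> PQ.prob_space_axioms measurable_fst d(1) measurable_snd d(2), of "\<lambda>_. 0"])
  have m: "{z \<in> space (path_space \<rho>). G z = c} \<in> sets (path_space \<rho>)" if "\<And>k. real_distribution (\<rho> k)" "tailfun G" for c \<rho> G
   using tailfun_measurable[OF that(2)] by (intro measurable_equality_set) (auto simp: borel_measurable_path_space[OF that(1)])
  fix G assume G: "tailfun G"
  have cfun: "tailfun (\<lambda>_. c)" for c by (rule tailfunI[where C="cmod c"]) auto
  from const[OF \<mu> per(1) G] obtain c where c: "AE z in path_space \<mu>. G z = c" by blast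
  have "AE z in gauss \<Otimes>\<^sub>M (?P \<Otimes>\<^sub>M ?Q). G (fst z + 0, fst (snd z)) = c"
   using AE_push[OF PQ.prob_space_axioms measurable_fst d(1), of "\<lambda>_. 0" "\<lambda>z. G z = c"] c m[OF \<mu> G] unfolding path_space_def by simp
  then show "\<exists>G'. tailfun G' \<and> (AE z in gauss \<Otimes>\<^sub>M (?P \<Otimes>\<^sub>M ?Q). G (fst z + 0, fst (snd z)) = G' (fst z, snd (snd z)))"
   using cfun[of c] by blast
  from const[OF \<nu> per(2) G] obtain c where c: "AE z in path_space \<nu>. G z = c" by blast
  have "AE z in gauss \<Otimes>\<^sub>M (?P \<Otimes>\<^sub>M ?Q). G (fst z + 0, snd (snd z)) = c"
   using AE_push[OF PQ.prob_space_axioms measurable_snd d(2), of "\<lambda>_. 0" "\<lambda>z. G z = c"] c m[OF \<nu> G] unfolding path_space_def by simp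
  then have "AE z in gauss \<Otimes>\<^sub>M (?P \<Otimes>\<^sub>M ?Q). (\<lambda>_. c) (fst z + 0, fst (snd z)) = G (fst z, snd (snd z))"
   by eventually_elim simp
  then show "\<exists>G'. tailfun G' \<and> (AE z in gauss \<Otimes>\<^sub>M (?P \<Otimes>\<^sub>M ?Q). G' (fst z + 0, fst (snd z)) = G (fst z, snd (snd z)))"
   using cfun[of c] by blast
 qed simp
qed

lemma distr_PiM_map:
 fixes M :: "nat \<Rightarrow> 'b measure" and x :: "nat \<Rightarrow> 'b \<Rightarrow> real"
 assumes M: "\<And>k. prob_space (M k)" and x[measurable]: "\<And>k. x k \<in> borel_measurable (M k)"
 defines "\<mu> \<equiv> \<lambda>k. distr (M k) borel (x k)"
 shows "distr (PiM UNIV M) (PiM UNIV \<mu>) (\<lambda>w k. x k (w k)) = PiM UNIV \<mu>"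
  and "(\<lambda>w k. x k (w k)) \<in> measurable (PiM UNIV M) (PiM UNIV \<mu>)"
proof -
 have \<mu>p: "prob_space (\<mu> k)" for k unfolding \<mu>_def by (intro prob_space.prob_space_distr M x)
 show m[measurable]: "(\<lambda>w k. x k (w k)) \<in> measurable (PiM UNIV M) (PiM UNIV \<mu>)"
  by (rule measurable_PiM_single') (auto simp: \<mu>_def)
 show "distr (PiM UNIV M) (PiM UNIV \<mu>) (\<lambda>w k. x k (w k)) = PiM UNIV \<mu>"
 proof (rule measure_eqI_PiM_infinite[symmetric, OF refl])
  interpret prob_space "PiM UNIV \<mu>" by (intro prob_space_PiM \<mu>p)
  show "finite_measure (PiM UNIV \<mu>)" by unfold_locales
  fix A and J :: "nat set" assume J: "finite J" "J \<subseteq> UNIV" and A: "\<And>i. i \<in> J \<Longrightarrow> A i \<in> sets (\<mu> i)"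
  have Em: "prod_emb UNIV \<mu> J (Pi\<^sub>E J A) \<in> sets (PiM UNIV \<mu>)" using J A by (intro sets_PiM_I) auto
  have "distr (PiM UNIV M) (PiM UNIV \<mu>) (\<lambda>w k. x k (w k)) (prod_emb UNIV \<mu> J (Pi\<^sub>E J A))
   = emeasure (PiM UNIV M) ((\<lambda>w k. x k (w k)) -` prod_emb UNIV \<mu> J (Pi\<^sub>E J A) \<inter> space (PiM UNIV M))"
   by (rule emeasure_distr[OF m Em])
  also have "(\<lambda>w k. x k (w k)) -` prod_emb UNIV \<mu> J (Pi\<^sub>E J A) \<inter> space (PiM UNIV M)
    = prod_emb UNIV M J (Pi\<^sub>E J (\<lambda>k. x k -` A k \<inter> space (M k)))"
   by (auto simp: prod_emb_def space_PiM PiE_iff \<mu>_def)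
  also have "emeasure (PiM UNIV M) ... = (\<Prod>k\<in>J. emeasure (M k) (x k -` A k \<inter> space (M k)))"
   using J A M by (intro emeasure_PiM_emb) (auto simp: \<mu>_def)
  also have "... = (\<Prod>k\<in>J. emeasure (\<mu> k) (A k))"
   using A by (intro prod.cong refl) (auto simp: \<mu>_def emeasure_distr)
  also have "... = emeasure (PiM UNIV \<mu>) (prod_emb UNIV \<mu> J (Pi\<^sub>E J A))"
   using J A \<mu>p by (intro emeasure_PiM_emb[symmetric]) auto
  finally show "emeasure (PiM UNIV \<mu>) (prod_emb UNIV \<mu> J (Pi\<^sub>E J A)) =
   distr (PiM UNIV M) (PiM UNIV \<mu>) (\<lambda>w k. x k (w k)) (prod_emb UNIV \<mu> J (Pi\<^sub>E J A))" by simp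
 qed simp
qed

lemma AE_gauss_snd:
 assumes "prob_space \<Omega>" "AE w in \<Omega>. Q w"
 shows "AE z in gauss \<Otimes>\<^sub>M \<Omega>. Q (snd z)"
proof -
 have "AE w in distr (gauss \<Otimes>\<^sub>M \<Omega>) \<Omega> snd. Q w"
  unfolding distr_pair_measure_snd[OF prob_space_gauss assms(1)] by (rule assms(2))
 then show ?thesis by (rule AE_distrD[OF measurable_snd])
qed

lemma real_distribution_distr_map: "prob_space M \<Longrightarrow> f \<in> borel_measurable M \<Longrightarrow> real_distribution (distr M borel f)"
 by (intro prob_space.real_distribution_distr)

text \<open>Averaging over translates by multiples of \<open>a\<close> turns almost sure periodicity into exact periodicity.\<close>

lemma time_periodic_exact:
 assumes \<mu>: "\<And>k. real_distribution (\<mu> k)" and per: "time_periodic \<mu> a" and G: "tailfun G"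
 obtains G' where "tailfun G'" "AE z in path_space \<mu>. G z = G' z" "\<And>t x. G' (t + a, x) = G' (t, x)"
proof -
 have [measurable]: "G \<in> borel_measurable (borel \<Otimes>\<^sub>M PiM UNIV (\<lambda>_. borel))" by (rule tailfun_measurable[OF G])
 obtain C where C: "0 \<le> C" "\<And>z. cmod (G z) \<le> C" using tailfun_boundedE[OF G] by metis
 define A where "A n z = (\<Sum>i<n. G (fst z + real i * a, snd z)) / of_nat n" for n :: nat and z
 have [measurable]: "A n \<in> borel_measurable (borel \<Otimes>\<^sub>M PiM UNIV (\<lambda>_. borel))" for n unfolding A_def by measurable
 have AC: "cmod (A n z) \<le> C" for n z
 proof (cases "n = 0")
  case False
  have "cmod (\<Sum>i<n. G (fst z + real i * a, snd z)) \<le> (\<Sum>i<n. C)"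
   by (rule order_trans[OF norm_sum sum_mono]) (rule C)
  with False show ?thesis by (simp add: A_def norm_divide field_simps)
 qed (simp add: A_def C)
 define G' where "G' z = lim (\<lambda>n. A n z)" for z
 show thesis
 proof
  show "tailfun G'"
  proof (rule tailfunI[where C="max C (cmod (THE L. False))"])
   show "G' \<in> borel_measurable (borel \<Otimes>\<^sub>M PiM UNIV (\<lambda>_. borel))" unfolding G'_def by measurable
   show "cmod (G' z) \<le> max C (cmod (THE L. False))" for z unfolding G'_def by (rule norm_lim_le) (rule AC)
   fix t :: real and x :: "nat \<Rightarrow> real" and n y
   have "A m (t, x) = A m (t + x n - y, x(n := y))" for m
    unfolding A_def using tailfun_step[OF G, of "t + real i * a" x n y for i] by (simp add: algebra_simps)
   then show "G' (t, x) = G' (t + x n - y, x(n := y))" unfolding G'_def by simp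
  qed
  show "G' (t + a, x) = G' (t, x)" for t x
  proof -
   have "(\<lambda>n. A n (t + a, x) - A n (t, x)) \<longlonglongrightarrow> 0"
   proof (rule Lim_null_comparison)
    show "\<forall>\<^sub>F n in sequentially. norm (A n (t + a, x) - A n (t, x)) \<le> 2 * C / real n"
    proof (rule eventually_sequentiallyI)
     fix n :: nat assume n: "1 \<le> n"
     have "(\<Sum>i<n. G (t + a + real i * a, x)) = (\<Sum>i<n. G (t + real (Suc i) * a, x))"
      by (simp add: algebra_simps)
     also have "... = (\<Sum>i<Suc n. G (t + real i * a, x)) - G (t, x)"
      by (subst sum.lessThan_Suc_shift) simp
     finally have "A n (t + a, x) - A n (t, x) = (G (t + real n * a, x) - G (t, x)) / of_nat n"
      by (simp add: A_def diff_divide_distrib add_divide_distrib)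
     then have "norm (A n (t + a, x) - A n (t, x)) = cmod (G (t + real n * a, x) - G (t, x)) / real n"
      by (simp add: norm_divide)
     also have "... \<le> 2 * C / real n"
      using norm_triangle_ineq4[of "G (t + real n * a, x)" "G (t, x)"] C(2)[of "(t + real n * a, x)"] C(2)[of "(t, x)"]
      by (intro divide_right_mono) auto
     finally show "norm (A n (t + a, x) - A n (t, x)) \<le> 2 * C / real n" .
    qed
    show "(\<lambda>n. 2 * C / real n) \<longlonglongrightarrow> 0" by real_asymp
   qed
   then have "(\<lambda>n. A n (t + a, x)) \<longlonglongrightarrow> L \<longleftrightarrow> (\<lambda>n. A n (t, x)) \<longlonglongrightarrow> L" for L
    by (rule Lim_transform_eq)
   then show ?thesis unfolding G'_def lim_def by simp
  qed
  have "AE z in path_space \<mu>. G (fst z + real i * a, snd z) = G z" for i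
  proof (induction i)
   case (Suc i)
   have "tailfun (\<lambda>z. G (fst z + real i * a, snd z))" by (rule tailfun_translate[OF G])
   then have "AE z in path_space \<mu>. G (fst z + a + real i * a, snd z) = G (fst z + real i * a, snd z)"
    using per unfolding time_periodic_def by fastforce
   with Suc show ?case by eventually_elim (simp add: algebra_simps)
  qed simp
  then have "AE z in path_space \<mu>. \<forall>i. G (fst z + real i * a, snd z) = G z" by (simp add: AE_all_countable)
  then show "AE z in path_space \<mu>. G z = G' z"
  proof eventually_elim
   case (elim z)
   have "\<forall>\<^sub>F n in sequentially. A n z = G z"
    by (rule eventually_sequentiallyI[of 1]) (simp add: A_def elim)
   then show ?case unfolding G'_def by (intro limI[symmetric] tendsto_eventually)
  qed
 qed
qed

lemma eventually_shift_lim: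
 fixes X Y :: "nat \<Rightarrow> real"
 assumes "\<forall>\<^sub>F n in sequentially. Y n = X n + c" "convergent X"
 shows "convergent Y" "lim Y = lim X + c"
proof -
 have "X \<longlonglongrightarrow> lim X" using assms by (simp add: convergent_LIMSEQ_iff)
 then have "(\<lambda>n. X n + c) \<longlonglongrightarrow> lim X + c" by (intro tendsto_intros)
 then have "Y \<longlonglongrightarrow> lim X + c" by (rule Lim_transform_eventually) (use assms(1) in \<open>auto elim: eventually_mono\<close>)
 then show "convergent Y" "lim Y = lim X + c" by (auto simp: convergent_def limI)
qed

text \<open>The candidate is \<open>G (t - Z w, x w)\<close> as a function of \<open>(t, w)\<close>.
  Changing one coordinate of \<open>w\<close> changes \<open>x\<close> as it changes
  \<open>y\<close>, up to a change of \<open>e\<close>, which \<open>Z\<close> absorbs, and a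
  multiple of \<open>a\<close>, which \<open>G\<close> ignores; the constant \<open>b k\<close>
  cancels. So the candidate is step invariant for \<open>y\<close> and hence almost everywhere a
  tail function of the \<open>y\<close> walk.\<close>

lemma coupling_transfer:
 fixes M :: "nat \<Rightarrow> 'b measure" and b :: "nat \<Rightarrow> real" and x y e :: "nat \<Rightarrow> 'b \<Rightarrow> real" and i :: "nat \<Rightarrow> 'b \<Rightarrow> int"
 assumes M: "\<And>k. prob_space (M k)"
  and [measurable]: "\<And>k. x k \<in> borel_measurable (M k)" "\<And>k. y k \<in> borel_measurable (M k)" "\<And>k. e k \<in> borel_measurable (M k)"
  and xy: "\<And>k w. w \<in> space (M k) \<Longrightarrow> x k w - y k w = e k w + b k + a * of_int (i k w)"
  and r: "strict_mono r"
 defines "P \<equiv> PiM UNIV M"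
 defines "Z \<equiv> \<lambda>w. lim (\<lambda>n. \<Sum>k<r n. e k (w k))"
 assumes conv: "AE w in P. convergent (\<lambda>n. \<Sum>k<r n. e k (w k))"
  and G: "tailfun G" and Ga: "\<And>t x. G (t + a, x) = G (t, x)"
 obtains G' where "tailfun G'" "AE z in gauss \<Otimes>\<^sub>M P. G (fst z - Z (snd z), \<lambda>k. x k (snd z k)) = G' (fst z, \<lambda>k. y k (snd z k))"
proof -
 interpret P: prob_space P unfolding P_def by (intro prob_space_PiM M)
 interpret g: prob_space gauss by (rule prob_space_gauss)
 interpret gP: pair_prob_space gauss P ..
 have Ga_nat: "G (t + a * real n, x) = G (t, x)" for t x n
 proof (induction n)
  case (Suc n) then show ?case using Ga[of "t + a * real n" x] by (simp add: algebra_simps)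
 qed simp
 have Ga_int: "G (t + a * of_int j, x) = G (t, x)" for t x and j :: int
 proof (cases "0 \<le> j")
  case True then show ?thesis using Ga_nat[of t "nat j" x] by simp
 next
  case False then show ?thesis using Ga_nat[of "t + a * of_int j" "nat (- j)" x] by simp
 qed
 define S where "S w n = (\<Sum>k<r n. e k (w k))" for w :: "nat \<Rightarrow> 'b" and n
 have [measurable]: "(\<lambda>w. f k (w k)) \<in> borel_measurable P" if "f k \<in> borel_measurable (M k)" for k and f :: "nat \<Rightarrow> 'b \<Rightarrow> real"
  using that unfolding P_def by measurable
 have Sm[measurable]: "(\<lambda>w. S w n) \<in> borel_measurable P" for n unfolding S_def by measurable
 have Zm[measurable]: "Z \<in> borel_measurable P" unfolding Z_def S_def[symmetric] by measurable
 have Xm[measurable]: "(\<lambda>w k. x k (w k)) \<in> measurable P (PiM UNIV (\<lambda>_. borel))"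
  by (rule measurable_PiM_borelI) measurable
 have [measurable]: "G \<in> borel_measurable (borel \<Otimes>\<^sub>M PiM UNIV (\<lambda>_. borel))" by (rule tailfun_measurable[OF G])
 obtain C where C: "0 \<le> C" "\<And>z. cmod (G z) \<le> C" using tailfun_boundedE[OF G] by metis
 \<comment> \<open>Changing one coordinate does not affect convergence of the series, so the value 0
   on the divergence set keeps \<open>K\<close> invariant at every point.\<close>
 define K where "K z = (if Cauchy (S (snd z)) then G (fst z - Z (snd z), \<lambda>k. x k (snd z k)) else 0)" for z :: "real \<times> (nat \<Rightarrow> 'b)"
 have [measurable]: "{w \<in> space P. Cauchy (S w)} \<in> sets P" by measurable
 have Km: "K \<in> borel_measurable (borel \<Otimes>\<^sub>M P)"
 proof -
  have [measurable]: "Measurable.pred P (\<lambda>w. Cauchy (S w))" by (simp add: pred_def)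
  show ?thesis unfolding K_def by measurable
 qed
 have KC: "cmod (K z) \<le> C" for z using C by (simp add: K_def)
 have change: "Cauchy (S (w(n := v))) \<and> Z (w(n := v)) = Z w + (e n v - e n (w n))" if "Cauchy (S w)" for w n v
 proof -
  have "\<forall>\<^sub>F m in sequentially. S (w(n := v)) m = S w m + (e n v - e n (w n))"
  proof (rule eventually_sequentiallyI)
   fix m assume "Suc n \<le> m"
   then have n: "n < r m" using seq_suble[OF r, of m] by simp
   have "S (w(n := v)) m = e n v + (\<Sum>k\<in>{..<r m} - {n}. e k (w k))"
    unfolding S_def using n by (subst sum.remove[of _ n]) (auto intro!: sum.cong)
   moreover have "S w m = e n (w n) + (\<Sum>k\<in>{..<r m} - {n}. e k (w k))"
    unfolding S_def using n by (subst sum.remove[of _ n]) auto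
   ultimately show "S (w(n := v)) m = S w m + (e n v - e n (w n))" by simp
  qed
  from eventually_shift_lim[OF this] that show ?thesis
   by (auto simp: Cauchy_convergent_iff Z_def S_def[symmetric])
 qed
 have inv: "step_invariant M y K"
  unfolding step_invariant_def
 proof (intro allI ballI)
  fix t w n v assume w: "w \<in> space (PiM UNIV M)" and v: "v \<in> space (M n)"
  then have wn: "w n \<in> space (M n)" by (auto simp: space_PiM PiE_iff)
  show "K (t, w) = K (t + y n (w n) - y n v, w(n := v))"
  proof (cases "Cauchy (S w)")
   case True
   let ?w = "w(n := v)"
   note ch = change[OF True, of n v]
   let ?X = "\<lambda>w k. x k (w k)"
   have X: "?X ?w = (?X w)(n := x n v)" by auto
   have "K (t + y n (w n) - y n v, ?w) = G (t + y n (w n) - y n v - Z w - (e n v - e n (w n)), (?X w)(n := x n v))"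
   proof -
    have "K (t + y n (w n) - y n v, ?w) = G (t + y n (w n) - y n v - Z ?w, ?X ?w)"
     using ch unfolding K_def by (simp only: fst_conv snd_conv if_True simp_thms)
    also have "Z ?w = Z w + (e n v - e n (w n))" using ch by blast
    finally show ?thesis unfolding X by (simp only: diff_diff_eq add.assoc)
   qed
   also have "t + y n (w n) - y n v - Z w - (e n v - e n (w n)) = (t - Z w + ?X w n - x n v) + a * of_int (i n v - i n (w n))"
    using xy[OF v] xy[OF wn] by (simp add: algebra_simps)
   also have "G (..., (?X w)(n := x n v)) = G (t - Z w + ?X w n - x n v, (?X w)(n := x n v))" by (rule Ga_int)
   also have "... = G (t - Z w, ?X w)" by (rule tailfun_step[OF G, symmetric])
   also have "... = K (t, w)" using True by (simp add: K_def)
   finally show ?thesis ..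
  next
   case False
   have "\<not> Cauchy (S (w(n := v)))"
   proof
    assume "Cauchy (S (w(n := v)))"
    from change[OF this, of n "w n"] False show False by simp
   qed
   with False show ?thesis by (simp add: K_def)
  qed
 qed
 have J: "finite {j}" "disjoint_family (\<lambda>j::nat. {j})" "(\<Union>j::nat. {j}) = UNIV" for j :: nat
  by (auto simp: disjoint_family_on_def)
 have ym: "y k \<in> borel_measurable (M k)" for k by measurable
 obtain g r' where "tailfun (tail_lim r' g)" "AE z in gauss \<Otimes>\<^sub>M PiM UNIV M. K z = tail_lim r' g (fst z, \<lambda>j. \<Sum>i\<in>{j}. y i (snd z i))"
  by (rule step_invariant_AE_tailfun[OF M ym J Km[unfolded P_def] KC inv]) (rule that)
 then have G': "tailfun (tail_lim r' g)" "AE z in gauss \<Otimes>\<^sub>M P. K z = tail_lim r' g (fst z, \<lambda>j. y j (snd z j))"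
  unfolding P_def by simp_all
 have "AE w in P. Cauchy (S w)" using conv by (simp add: Cauchy_convergent_iff S_def[abs_def])
 then have "AE z in gauss \<Otimes>\<^sub>M P. Cauchy (S (snd z))"
  by (rule AE_gauss_snd[OF P.prob_space_axioms])
 with G'(2) have "AE z in gauss \<Otimes>\<^sub>M P. G (fst z - Z (snd z), \<lambda>k. x k (snd z k)) = tail_lim r' g (fst z, \<lambda>k. y k (snd z k))"
  by eventually_elim (simp add: K_def)
 with G'(1) show thesis by (rule that)
qed

text \<open>The centring constants \<open>b k\<close> need not be summable, since only differences of two values of the same coordinate matter.\<close>

lemma coupling_isomorphic:
 fixes M :: "nat \<Rightarrow> 'b measure" and b :: "nat \<Rightarrow> real" and x y e :: "nat \<Rightarrow> 'b \<Rightarrow> real" and i :: "nat \<Rightarrow> 'b \<Rightarrow> int"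
 assumes M: "\<And>k. prob_space (M k)"
  and m[measurable]: "\<And>k. x k \<in> borel_measurable (M k)" "\<And>k. y k \<in> borel_measurable (M k)" "\<And>k. e k \<in> borel_measurable (M k)"
  and xy: "\<And>k w. w \<in> space (M k) \<Longrightarrow> x k w - y k w = e k w + b k + a * of_int (i k w)"
  and r: "strict_mono r" and conv: "AE w in PiM UNIV M. convergent (\<lambda>n. \<Sum>k<r n. e k (w k))"
  and per: "time_periodic (\<lambda>k. distr (M k) borel (x k)) a" "time_periodic (\<lambda>k. distr (M k) borel (y k)) a"
 shows "isomorphic_actions (tail_boundary_flow (\<lambda>k. distr (M k) borel (x k))) (tail_boundary_flow (\<lambda>k. distr (M k) borel (y k)))"
proof -
 let ?P = "PiM UNIV M" and ?\<mu> = "\<lambda>k. distr (M k) borel (x k)" and ?\<nu> = "\<lambda>k. distr (M k) borel (y k)"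
 let ?Z = "\<lambda>w. lim (\<lambda>n. \<Sum>k<r n. e k (w k))"
 let ?X = "\<lambda>w k. x k (w k)" and ?Y = "\<lambda>w k. y k (w k)"
 have \<mu>: "real_distribution (?\<mu> k)" and \<nu>: "real_distribution (?\<nu> k)" for k
  by (intro real_distribution_distr_map M m)+
 have P: "prob_space ?P" by (intro prob_space_PiM M)
 have X: "?X \<in> measurable ?P (PiM UNIV ?\<mu>)" "distr ?P (PiM UNIV ?\<mu>) ?X = PiM UNIV ?\<mu>"
  and Y: "?Y \<in> measurable ?P (PiM UNIV ?\<nu>)" "distr ?P (PiM UNIV ?\<nu>) ?Y = PiM UNIV ?\<nu>"
  by (rule distr_PiM_map[OF M]; simp)+
 have Zm[measurable]: "?Z \<in> borel_measurable ?P" by measurable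
 have G\<mu>: "G \<in> borel_measurable (path_space ?\<mu>)" and G\<nu>: "G \<in> borel_measurable (path_space ?\<nu>)" if "tailfun G" for G
  using tailfun_measurable[OF that] by (simp_all add: borel_measurable_path_space \<mu> \<nu>)
 show ?thesis
 proof (rule isomorphic_tail_boundary_flowsI[OF \<mu> \<nu> P X Y, where Z="\<lambda>w. - ?Z w"])
  show "(\<lambda>w. - ?Z w) \<in> borel_measurable ?P" by measurable
  fix G assume G: "tailfun G"
  show "\<exists>G'. tailfun G' \<and> (AE z in gauss \<Otimes>\<^sub>M ?P. G (fst z + - ?Z (snd z), ?X (snd z)) = G' (fst z, ?Y (snd z)))"
  proof -
   obtain H where H: "tailfun H" "AE z in path_space ?\<mu>. G z = H z" "\<And>t x. H (t + a, x) = H (t, x)"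
    by (rule time_periodic_exact[OF \<mu> per(1) G]) (rule that)
   obtain G' where G': "tailfun G'" "AE z in gauss \<Otimes>\<^sub>M ?P. H (fst z - ?Z (snd z), ?X (snd z)) = G' (fst z, ?Y (snd z))"
    by (rule coupling_transfer[OF M m xy r conv H(1,3)])
   have "AE z in gauss \<Otimes>\<^sub>M ?P. G (fst z + - ?Z (snd z), ?X (snd z)) = H (fst z + - ?Z (snd z), ?X (snd z))"
    using AE_push[OF P X, where Z="\<lambda>w. - ?Z w" and P="\<lambda>z. G z = H z"] H(2) equality_sets_path_space[OF G\<mu>[OF G] G\<mu>[OF H(1)]]
    unfolding path_space_def by simp
   with G'(2) have "AE z in gauss \<Otimes>\<^sub>M ?P. G (fst z + - ?Z (snd z), ?X (snd z)) = G' (fst z, ?Y (snd z))"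
    by eventually_elim simp
   with G'(1) show ?thesis by blast
  qed
  show "\<exists>G'. tailfun G' \<and> (AE z in gauss \<Otimes>\<^sub>M ?P. G' (fst z + - ?Z (snd z), ?X (snd z)) = G (fst z, ?Y (snd z)))"
  proof -
   obtain H where H: "tailfun H" "AE z in path_space ?\<nu>. G z = H z" "\<And>t x. H (t + a, x) = H (t, x)"
    by (rule time_periodic_exact[OF \<nu> per(2) G]) (rule that)
   let ?Z' = "\<lambda>w. lim (\<lambda>n. \<Sum>k<r n. - e k (w k))"
   have conv': "AE w in ?P. convergent (\<lambda>n. \<Sum>k<r n. - e k (w k))"
    using conv by eventually_elim (simp add: sum_negf convergent_minus_iff[symmetric])
   have yx: "w \<in> space (M k) \<Longrightarrow> y k w - x k w = - e k w + - b k + a * of_int (- i k w)" for k w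
    using xy[of w k] by simp
   obtain G' where G': "tailfun G'" "AE z in gauss \<Otimes>\<^sub>M ?P. H (fst z - ?Z' (snd z), ?Y (snd z)) = G' (fst z, ?X (snd z))"
    by (rule coupling_transfer[OF M m(2,1) _ yx r conv' H(1,3)]) auto
   \<comment> \<open>Only almost surely: the value of \<open>lim\<close> on divergent sequences need
     not change sign.\<close>
   have ZZ: "AE w in ?P. ?Z' w = - ?Z w"
    using conv by eventually_elim (auto simp: sum_negf convergent_LIMSEQ_iff intro!: limI tendsto_minus)
   have mY: "(\<lambda>z. H (fst z - ?Z' (snd z), ?Y (snd z))) \<in> borel_measurable (gauss \<Otimes>\<^sub>M ?P)"
    using measurable_compose[OF _ G\<nu>[OF H(1)], of "\<lambda>z. (fst z - ?Z' (snd z), ?Y (snd z))" "gauss \<Otimes>\<^sub>M ?P"] Y(1)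
    unfolding path_space_def by measurable
   have mX: "(\<lambda>z. G' (fst z, ?X (snd z))) \<in> borel_measurable (gauss \<Otimes>\<^sub>M ?P)"
    using measurable_compose[OF _ G\<mu>[OF G'(1)], of "\<lambda>z. (fst z, ?X (snd z))" "gauss \<Otimes>\<^sub>M ?P"] X(1)
    unfolding path_space_def by measurable
   have "AE z in gauss \<Otimes>\<^sub>M ?P. H (fst z + - ?Z (snd z) - ?Z' (snd z), ?Y (snd z)) = G' (fst z + - ?Z (snd z), ?X (snd z))"
    using AE_time_translate[OF P mY mX G'(2), of "\<lambda>w. - ?Z w"] by simp
   moreover have "AE z in gauss \<Otimes>\<^sub>M ?P. ?Z' (snd z) = - ?Z (snd z)"
    using ZZ by (rule AE_gauss_snd[OF P])
   moreover have "AE z in gauss \<Otimes>\<^sub>M ?P. G (fst z + 0, ?Y (snd z)) = H (fst z + 0, ?Y (snd z))"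
    using AE_push[OF P Y, where Z="\<lambda>w. 0" and P="\<lambda>z. G z = H z"] H(2) equality_sets_path_space[OF G\<nu>[OF G] G\<nu>[OF H(1)]]
    unfolding path_space_def by simp
   ultimately have "AE z in gauss \<Otimes>\<^sub>M ?P. G' (fst z + - ?Z (snd z), ?X (snd z)) = G (fst z, ?Y (snd z))"
    by eventually_elim simp
   with G'(1) show ?thesis by blast
  qed
 qed
qed

lemma time_periodic_0: "time_periodic \<mu> 0"
 by (simp add: time_periodic_def)

lemma coupling_isomorphic_convergent:
 fixes M :: "nat \<Rightarrow> 'b measure" and x y :: "nat \<Rightarrow> 'b \<Rightarrow> real"
 assumes M: "\<And>k. prob_space (M k)"
  and m: "\<And>k. x k \<in> borel_measurable (M k)" "\<And>k. y k \<in> borel_measurable (M k)"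
  and conv: "AE w in PiM UNIV M. convergent (\<lambda>n. \<Sum>k<n. x k (w k) - y k (w k))"
 shows "isomorphic_actions (tail_boundary_flow (\<lambda>k. distr (M k) borel (x k))) (tail_boundary_flow (\<lambda>k. distr (M k) borel (y k)))"
 by (rule coupling_isomorphic[where M=M and x=x and y=y and e="\<lambda>k w. x k w - y k w" and i="\<lambda>_ _. 0" and a=0 and r="\<lambda>n. n" and b="\<lambda>_. 0"])
   (use assms in \<open>auto simp: strict_mono_def intro: time_periodic_0\<close>)

section \<open>Independence and regrouping of coordinates\<close>

lemma distr_PiM_real_component:
 assumes \<mu>: "\<And>k. real_distribution (\<mu> k)"
 shows "distr (PiM UNIV \<mu>) borel (\<lambda>w. w i) = \<mu> i"
proof -
 have "distr (PiM UNIV \<mu>) borel (\<lambda>w. w i) = distr (PiM UNIV \<mu>) (\<mu> i) (\<lambda>w. w i)"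
  by (rule distr_cong) (simp_all add: real_distribution.events_eq_borel[OF \<mu>])
 then show ?thesis
  using distr_PiM_component[of UNIV \<mu> i] real_distribution.axioms(1)[OF \<mu>] by simp
qed

lemma measurable_PiM_real_component:
 assumes \<mu>: "\<And>k. real_distribution (\<mu> k)"
 shows "(\<lambda>w. w i) \<in> borel_measurable (PiM UNIV \<mu>)"
 using measurable_component_singleton[of i UNIV \<mu>]
 by (simp add: measurable_cong_sets[OF refl real_distribution.events_eq_borel[OF \<mu>]])

lemma indep_vars_PiM_real:
 assumes \<mu>: "\<And>k. real_distribution (\<mu> k)"
 shows "prob_space.indep_vars (PiM UNIV \<mu>) (\<lambda>_. borel) (\<lambda>i w. w i) (UNIV :: nat set)"
proof -
 interpret P: prob_space "PiM UNIV \<mu>" by (rule prob_space_PiM_real[OF \<mu>])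
 show ?thesis
 proof (subst P.indep_vars_iff_distr_eq_PiM)
  show "distr (PiM UNIV \<mu>) (PiM UNIV (\<lambda>i. borel)) (\<lambda>x. \<lambda>i\<in>UNIV. x i) = PiM UNIV (\<lambda>i. distr (PiM UNIV \<mu>) borel (\<lambda>x. x i))"
   unfolding distr_PiM_real_component[OF \<mu>] restrict_UNIV by (rule distr_id2) (rule sets_PiM_real[OF \<mu>, symmetric])
 qed (auto intro: measurable_PiM_real_component[OF \<mu>])
qed

text \<open>A tail function of the block sums is one of the coordinates, since changing one
  coordinate changes one block sum by the same amount. Conversely,
  \<open>step_invariant_AE_tailfun\<close> writes a tail function of the coordinates as one of the
  block sums. Both directions are stated because blocks are later split as well as merged.\<close>

lemma regroup_isomorphic:
 fixes \<mu> :: "nat \<Rightarrow> real measure" and J :: "nat \<Rightarrow> nat set"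
 assumes \<mu>: "\<And>k. real_distribution (\<mu> k)" and J: "\<And>j. finite (J j)" "disjoint_family J" "(\<Union>j. J j) = UNIV"
 defines "\<nu> \<equiv> \<lambda>j. distr (PiM UNIV \<mu>) borel (\<lambda>w. \<Sum>i\<in>J j. w i)"
 shows "isomorphic_actions (tail_boundary_flow \<mu>) (tail_boundary_flow \<nu>)"
  and "isomorphic_actions (tail_boundary_flow \<nu>) (tail_boundary_flow \<mu>)"
proof -
 let ?P = "PiM UNIV \<mu>"
 interpret P: prob_space ?P by (rule prob_space_PiM_real[OF \<mu>])
 have [measurable_cong]: "sets ?P = sets (PiM UNIV (\<lambda>_. borel))" by (rule sets_PiM_real[OF \<mu>])
 have \<mu>p: "prob_space (\<mu> k)" for k by (intro real_distribution.axioms(1) \<mu>)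
 have [measurable]: "(\<lambda>w. w i) \<in> borel_measurable ?P" for i by measurable
 have \<nu>: "real_distribution (\<nu> j)" for j unfolding \<nu>_def
  by (intro real_distribution_distr_map P.prob_space_axioms) measurable
 have b\<mu>: "sets (\<mu> i) = sets borel" for i by (rule real_distribution.events_eq_borel[OF \<mu>])
 note ind = indep_vars_PiM_real[OF \<mu>]
 have indJ: "P.indep_vars (\<lambda>_. borel) (\<lambda>j w. \<Sum>i\<in>J j. w i) (UNIV :: nat set)"
 proof -
  have "P.indep_vars (\<lambda>j. PiM (J j) (\<lambda>_. borel)) (\<lambda>j w. restrict (\<lambda>i. w i) (J j)) UNIV"
   using J(2) by (intro P.indep_vars_restrict[OF ind]) auto
  then have "P.indep_vars (\<lambda>_. borel) (\<lambda>j w. (\<lambda>v. \<Sum>i\<in>J j. v i) (restrict (\<lambda>i. w i) (J j))) UNIV"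
   by (rule P.indep_vars_compose2) measurable
  then show ?thesis by simp
 qed
 let ?Y = "\<lambda>w j. \<Sum>i\<in>J j. (w i :: real)"
 have Ym0: "?Y \<in> measurable ?P (PiM UNIV (\<lambda>_. borel))" by (rule measurable_PiM_borelI) measurable
 have Y: "?Y \<in> measurable ?P (PiM UNIV \<nu>)" using Ym0 measurable_cong_sets[OF refl sets_PiM_real[of \<nu>, OF \<nu>]] by blast
 have dY: "distr ?P (PiM UNIV \<nu>) ?Y = PiM UNIV \<nu>"
 proof -
  have "distr ?P (PiM UNIV (\<lambda>_. borel)) ?Y = PiM UNIV \<nu>"
   using indJ by (subst (asm) P.indep_vars_iff_distr_eq_PiM) (auto simp: \<nu>_def restrict_UNIV)
  then show ?thesis using distr_cong[OF refl sets_PiM_real[OF \<nu>], of ?P ?Y ?Y] by simp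
 qed
 have idP: "distr ?P ?P (\<lambda>x. x) = ?P" by (simp add: distr_id[unfolded id_def])
 have idm: "(\<lambda>x. x) \<in> measurable ?P ?P" by simp
 have down: "\<exists>G'. tailfun G' \<and> (AE z in gauss \<Otimes>\<^sub>M ?P. G z = G' (fst z, ?Y (snd z)))" if G: "tailfun G" for G
 proof -
  obtain C where C: "0 \<le> C" "\<And>z. cmod (G z) \<le> C" using tailfun_boundedE[OF G] by metis
  have Gm: "G \<in> borel_measurable (borel \<Otimes>\<^sub>M ?P)"
   using tailfun_measurable[OF G] by measurable
  have inv: "step_invariant \<mu> (\<lambda>_ x. x) G"
   unfolding step_invariant_def using tailfun_step[OF G] by blast
  obtain g r where "tailfun (tail_lim r g)" "AE z in gauss \<Otimes>\<^sub>M ?P. G z = tail_lim r g (fst z, \<lambda>j. \<Sum>i\<in>J j. snd z i)"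
   by (rule step_invariant_AE_tailfun[of \<mu> "\<lambda>_ x. x" J G C, OF \<mu>p _ J Gm C(2) inv])
     (auto simp: measurable_cong_sets[OF b\<mu> refl])
  then show ?thesis by blast
 qed
 have up: "tailfun (\<lambda>z. G (fst z, ?Y (snd z)))" if G: "tailfun G" for G
 proof -
  obtain C where C: "0 \<le> C" "\<And>z. cmod (G z) \<le> C" using tailfun_boundedE[OF G] by metis
  have [measurable]: "G \<in> borel_measurable (borel \<Otimes>\<^sub>M PiM UNIV (\<lambda>_. borel))" by (rule tailfun_measurable[OF G])
  have [measurable]: "?Y \<in> measurable (PiM UNIV (\<lambda>_. borel)) (PiM UNIV (\<lambda>_. borel))"
   by (rule measurable_PiM_borelI) measurable
  show ?thesis
  proof (rule tailfunI[where C=C])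
   show "(\<lambda>z. G (fst z, ?Y (snd z))) \<in> borel_measurable (borel \<Otimes>\<^sub>M PiM UNIV (\<lambda>_. borel))" by measurable
   fix t :: real and x :: "nat \<Rightarrow> real" and n y
   from J(3) obtain j where j: "n \<in> J j" by auto
   have nj: "n \<notin> J j'" if "j' \<noteq> j" for j' using J(2) j that by (auto simp: disjoint_family_on_def)
   have "?Y (x(n := y)) = (?Y x)(j := ?Y x j - x n + y)"
   proof
    fix j'
    show "?Y (x(n := y)) j' = ((?Y x)(j := ?Y x j - x n + y)) j'"
    proof (cases "j' = j")
     case True
     have "(\<Sum>i\<in>J j. (x(n := y)) i) = y + (\<Sum>i\<in>J j - {n}. x i)"
      using j J(1) by (subst sum.remove[of _ n]) (auto intro!: sum.cong)
     moreover have "(\<Sum>i\<in>J j. x i) = x n + (\<Sum>i\<in>J j - {n}. x i)"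
      using j J(1) by (subst sum.remove[of _ n]) auto
     ultimately show ?thesis using True by simp
    next
     case False
     with nj[OF this] show ?thesis by (auto intro!: sum.cong)
    qed
   qed
   then show "G (fst (t, x), ?Y (snd (t, x))) = G (fst (t + x n - y, x(n := y)), ?Y (snd (t + x n - y, x(n := y))))"
    using tailfun_step[OF G, of t "?Y x" j "?Y x j - x n + y"] by (simp add: algebra_simps)
  qed (rule C)
 qed
 have Pm: "prob_space ?P" by unfold_locales
 show "isomorphic_actions (tail_boundary_flow \<mu>) (tail_boundary_flow \<nu>)"
 proof (rule isomorphic_tail_boundary_flowsI[OF \<mu> \<nu> Pm idm idP Y dY, where Z="\<lambda>_. 0"])
  fix G assume G: "tailfun G"
  show "\<exists>G'. tailfun G' \<and> (AE z in gauss \<Otimes>\<^sub>M ?P. G' (fst z + 0, snd z) = G (fst z, ?Y (snd z)))"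
   by (intro exI[of _ "\<lambda>z. G (fst z, ?Y (snd z))"] conjI up G) simp
  from down[OF G] obtain G' where "tailfun G'" "AE z in gauss \<Otimes>\<^sub>M ?P. G z = G' (fst z, ?Y (snd z))" by blast
  then show "\<exists>G'. tailfun G' \<and> (AE z in gauss \<Otimes>\<^sub>M ?P. G (fst z + 0, snd z) = G' (fst z, ?Y (snd z)))"
   by (intro exI[of _ G']) (auto elim: eventually_mono)
 qed simp
 show "isomorphic_actions (tail_boundary_flow \<nu>) (tail_boundary_flow \<mu>)"
 proof (rule isomorphic_tail_boundary_flowsI[OF \<nu> \<mu> Pm Y dY idm idP, where Z="\<lambda>_. 0"])
  fix G assume G: "tailfun G"
  show "\<exists>G'. tailfun G' \<and> (AE z in gauss \<Otimes>\<^sub>M ?P. G (fst z + 0, ?Y (snd z)) = G' (fst z, snd z))"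
   by (intro exI[of _ "\<lambda>z. G (fst z, ?Y (snd z))"] conjI up G) simp
  from down[OF G] obtain G' where "tailfun G'" "AE z in gauss \<Otimes>\<^sub>M ?P. G z = G' (fst z, ?Y (snd z))" by blast
  then show "\<exists>G'. tailfun G' \<and> (AE z in gauss \<Otimes>\<^sub>M ?P. G' (fst z + 0, ?Y (snd z)) = G (fst z, snd z))"
   by (intro exI[of _ G']) (auto elim: eventually_mono)
 qed simp
qed

section \<open>Compound Poisson distributions\<close>

lemma char_eq_imp_eq:
 assumes "real_distribution \<mu>" "real_distribution \<nu>" "\<And>s. char \<mu> s = char \<nu> s"
 shows "\<mu> = \<nu>"
 by (rule Levy_uniqueness) (use assms in auto)

lemma char_distr: "f \<in> borel_measurable M \<Longrightarrow> char (distr M borel f) s = (\<integral>x. iexp (s * f x) \<partial>M)"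
 by (simp add: char_def integral_distr)

lemma char_distr_sum_PiM:
 fixes \<mu> :: "nat \<Rightarrow> real measure"
 assumes \<mu>: "\<And>k. real_distribution (\<mu> k)"
 shows "char (distr (PiM UNIV \<mu>) borel (\<lambda>w. \<Sum>i\<in>J. w i)) s = (\<Prod>i\<in>J. char (\<mu> i) s)"
proof -
 interpret P: prob_space "PiM UNIV \<mu>" by (rule prob_space_PiM_real[OF \<mu>])
 have "P.indep_vars (\<lambda>_. borel) (\<lambda>i w. w i) J"
  by (rule P.indep_vars_subset[OF indep_vars_PiM_real[of \<mu>, OF \<mu>]]) auto
 from P.char_distr_sum[OF this] show ?thesis by (simp add: distr_PiM_real_component[OF \<mu>])
qed

text \<open>The counterpart of \<open>convolution_power\<close> for a probability law, realised by a
  random walk so that independence can be used.\<close>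

definition walk_law :: "real measure \<Rightarrow> nat \<Rightarrow> real measure" where
 "walk_law \<xi> k = distr (PiM UNIV (\<lambda>_. \<xi>)) borel (\<lambda>w. \<Sum>i<k. w i)"

lemma walk_law_convolution:
 assumes \<xi>: "real_distribution \<xi>"
 shows "walk_law \<xi> 0 = return borel 0" "walk_law \<xi> (Suc k) = convolution \<xi> (walk_law \<xi> k)"
proof -
 let ?P = "PiM UNIV (\<lambda>_::nat. \<xi>)"
 interpret P: prob_space ?P by (rule prob_space_PiM_real[OF \<xi>])
 have [measurable]: "(\<lambda>w. w i) \<in> borel_measurable ?P" for i by (rule measurable_PiM_real_component[OF \<xi>])
 show "walk_law \<xi> 0 = return borel 0"
  unfolding walk_law_def by (simp add: P.distr_const)
 have "P.indep_vars (\<lambda>_. borel) (\<lambda>i w. w i) (insert k {..<k})"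
  by (rule P.indep_vars_subset[OF indep_vars_PiM_real[of "\<lambda>_. \<xi>", OF \<xi>]]) auto
 then have "P.indep_var borel (\<lambda>w. w k) borel (\<lambda>w. \<Sum>i<k. w i)"
  by (intro P.indep_vars_sum) auto
 from P.sum_indep_random_variable[OF this]
 show "walk_law \<xi> (Suc k) = convolution \<xi> (walk_law \<xi> k)"
  unfolding walk_law_def using distr_PiM_real_component[of "\<lambda>_. \<xi>" k, OF \<xi>] by (simp add: add.commute)
qed

lemma real_distribution_walk_law: "real_distribution \<xi> \<Longrightarrow> real_distribution (walk_law \<xi> k)"
 unfolding walk_law_def
 by (intro real_distribution_distr_map prob_space_PiM_real borel_measurable_sum measurable_PiM_real_component)

text \<open>The mass \<open>m\<close> factors out of the convolution powers, which leaves laws of a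
  random walk. Most of the work is the measurability of the convolution integrand.\<close>

lemma convolution_power_scale:
 assumes \<xi>: "real_distribution \<xi>" and m: "0 \<le> m" and A: "A \<in> sets borel"
 defines "\<mu> \<equiv> scale_measure (ennreal m) \<xi>"
 shows "emeasure (convolution_power \<mu> k) A = ennreal (m ^ k) * emeasure (walk_law \<xi> k) A"
  and "sets (convolution_power \<mu> k) = sets borel" "finite_measure (convolution_power \<mu> k)"
proof -
 interpret \<xi>: real_distribution \<xi> by fact
 have \<mu>s: "sets \<mu> = sets borel" unfolding \<mu>_def by simp
 have \<mu>f: "finite_measure \<mu>"
  by (rule finite_measureI) (simp add: \<mu>_def space_scale_measure \<xi>.emeasure_space_1 ennreal_mult_eq_top_iff)
 have fin: "sets (convolution_power \<mu> k) = sets borel \<and> finite_measure (convolution_power \<mu> k)" for k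
 proof (induction k)
  case 0
  show ?case by (auto intro!: prob_space.finite_measure prob_space_return)
 next
  case (Suc k)
  then show ?case using \<mu>f \<mu>s by (simp add: convolution_finite)
 qed
 then show "sets (convolution_power \<mu> k) = sets borel" "finite_measure (convolution_power \<mu> k)" by auto
 show "emeasure (convolution_power \<mu> k) A = ennreal (m ^ k) * emeasure (walk_law \<xi> k) A"
  using A
 proof (induction k arbitrary: A)
  case 0
  then show ?case by (simp add: walk_law_convolution[OF \<xi>])
 next
  case (Suc k)
  have W: "real_distribution (walk_law \<xi> k)" by (rule real_distribution_walk_law[OF \<xi>])
  have [measurable_cong]: "sets (walk_law \<xi> k) = sets borel" by (rule real_distribution.events_eq_borel[OF W])
  have WP: "finite_measure (walk_law \<xi> k)" by (intro prob_space.finite_measure real_distribution.axioms(1) W)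
  interpret W: finite_measure "walk_law \<xi> k" by (rule WP)
  have sh: "{a. a + x \<in> A} \<in> sets borel" for x :: real
   using measurable_sets[of "\<lambda>a. a + x" borel borel A] Suc.prems by (simp add: vimage_def)
  have "emeasure (convolution_power \<mu> (Suc k)) A = (\<integral>\<^sup>+x. emeasure (convolution_power \<mu> k) {a. a + x \<in> A} \<partial>\<mu>)"
   unfolding convolution_power.simps using fin[of k] sets_eq_imp_space_eq[of "convolution_power \<mu> k" borel] sets_eq_imp_space_eq[OF \<mu>s]
   by (intro convolution_emeasure) (auto simp: \<mu>f \<mu>s Suc.prems)
  also have "... = (\<integral>\<^sup>+x. ennreal (m ^ k) * emeasure (walk_law \<xi> k) {a. a + x \<in> A} \<partial>\<mu>)"
   by (intro nn_integral_cong Suc.IH sh)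
  also have "... = ennreal m * (\<integral>\<^sup>+x. ennreal (m ^ k) * emeasure (walk_law \<xi> k) {a. a + x \<in> A} \<partial>\<xi>)"
   unfolding \<mu>_def
  proof (rule nn_integral_scale_measure)
   have [measurable]: "A \<in> sets borel" by fact
   have "(\<lambda>x. emeasure (walk_law \<xi> k) {a. a + x \<in> A}) = (\<lambda>x. emeasure (walk_law \<xi> k) (Pair x -` {z. snd z + fst z \<in> A}))"
    by (simp add: vimage_def)
   also have "... \<in> borel_measurable borel"
   proof (rule W.measurable_emeasure_Pair)
    have "(\<lambda>z::real\<times>real. snd z + fst z) \<in> measurable (borel \<Otimes>\<^sub>M walk_law \<xi> k) borel" by measurable
    from measurable_sets[OF this Suc.prems] show "{z. snd z + fst z \<in> A} \<in> sets (borel \<Otimes>\<^sub>M walk_law \<xi> k)"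
     by (simp add: vimage_def space_pair_measure W[THEN real_distribution.space_eq_univ])
   qed
   finally show "(\<lambda>x. ennreal (m ^ k) * emeasure (walk_law \<xi> k) {a. a + x \<in> A}) \<in> borel_measurable \<xi>"
    by (simp add: measurable_cong_sets[OF \<xi>.events_eq_borel refl])
  qed
  also have "(\<integral>\<^sup>+x. ennreal (m ^ k) * emeasure (walk_law \<xi> k) {a. a + x \<in> A} \<partial>\<xi>)
    = ennreal (m ^ k) * (\<integral>\<^sup>+x. emeasure (walk_law \<xi> k) {a. a + x \<in> A} \<partial>\<xi>)"
  proof (rule nn_integral_cmult)
   have [measurable]: "A \<in> sets borel" by fact
   have "(\<lambda>x. emeasure (walk_law \<xi> k) {a. a + x \<in> A}) = (\<lambda>x. emeasure (walk_law \<xi> k) (Pair x -` {z. snd z + fst z \<in> A}))"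
    by (simp add: vimage_def)
   also have "... \<in> borel_measurable \<xi>"
   proof (rule W.measurable_emeasure_Pair)
    have "(\<lambda>z::real\<times>real. snd z + fst z) \<in> measurable (\<xi> \<Otimes>\<^sub>M walk_law \<xi> k) borel" by measurable
    from measurable_sets[OF this Suc.prems] show "{z. snd z + fst z \<in> A} \<in> sets (\<xi> \<Otimes>\<^sub>M walk_law \<xi> k)"
     by (simp add: vimage_def space_pair_measure W[THEN real_distribution.space_eq_univ])
   qed
   finally show "(\<lambda>x. emeasure (walk_law \<xi> k) {a. a + x \<in> A}) \<in> borel_measurable \<xi>" .
  qed
  also have "(\<integral>\<^sup>+x. emeasure (walk_law \<xi> k) {a. a + x \<in> A} \<partial>\<xi>) = emeasure (walk_law \<xi> (Suc k)) A"
   unfolding walk_law_convolution(2)[OF \<xi>]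
   by (rule convolution_emeasure[symmetric])
     (use Suc.prems WP \<xi>.finite_measure_axioms \<xi>.events_eq_borel real_distribution.events_eq_borel[OF W]
      real_distribution.space_eq_univ[OF W] in auto)
  finally show ?case using m by (simp add: ennreal_mult mult.assoc)
 qed
qed

text \<open>The argument holds the number of jumps and the jumps themselves. Applying
  \<open>f\<close> to each jump couples a compound Poisson variable with the one whose jumps are
  rounded.\<close>

definition random_sum :: "(real \<Rightarrow> real) \<Rightarrow> nat \<times> (nat \<Rightarrow> real) \<Rightarrow> real" where
 "random_sum f z = (\<Sum>i<fst z. f (snd z i))"

abbreviation poisson_paths :: "real \<Rightarrow> real measure \<Rightarrow> (nat \<times> (nat \<Rightarrow> real)) measure" where
 "poisson_paths m \<xi> \<equiv> measure_pmf (poisson_pmf m) \<Otimes>\<^sub>M PiM UNIV (\<lambda>_. \<xi>)"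

lemma measurable_random_sum:
 assumes \<xi>: "real_distribution \<xi>" and [measurable]: "f \<in> borel_measurable borel"
 shows "random_sum f \<in> borel_measurable (measure_pmf p \<Otimes>\<^sub>M PiM UNIV (\<lambda>_. \<xi>))"
proof -
 have [measurable]: "(\<lambda>w. w i) \<in> borel_measurable (PiM UNIV (\<lambda>_. \<xi>))" for i
  by (rule measurable_PiM_real_component[OF \<xi>])
 have "(\<lambda>z. (\<lambda>n z. \<Sum>i<n. f (snd z i)) (fst z) z) \<in> borel_measurable (measure_pmf p \<Otimes>\<^sub>M PiM UNIV (\<lambda>_. \<xi>))"
 proof (rule measurable_compose_countable)
  show "fst \<in> measurable (measure_pmf p \<Otimes>\<^sub>M PiM UNIV (\<lambda>_. \<xi>)) (count_space UNIV)"
   using measurable_fst[of "measure_pmf p" "PiM UNIV (\<lambda>_. \<xi>)"] by simp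
 qed measurable
 then show ?thesis by (simp add: random_sum_def[abs_def])
qed

lemma prob_space_poisson_paths: "real_distribution \<xi> \<Longrightarrow> prob_space (poisson_paths m \<xi>)"
proof -
 assume \<xi>: "real_distribution \<xi>"
 interpret P: prob_space "PiM UNIV (\<lambda>_::nat. \<xi>)" by (rule prob_space_PiM_real[OF \<xi>])
 interpret Q: pair_prob_space "measure_pmf (poisson_pmf m)" "PiM UNIV (\<lambda>_::nat. \<xi>)" ..
 show "prob_space (poisson_paths m \<xi>)" by (rule Q.prob_space_axioms)
qed

text \<open>Conditioning on the Poisson number of jumps turns the law of the sum into the
  exponential series. Normalising the jump measure takes positive mass;
  \<open>compound_poisson_null\<close> covers mass zero.\<close>

lemma distr_random_sum:
 assumes \<mu>: "finite_borel_measure \<mu>" and m: "0 < measure \<mu> UNIV"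
 defines "m \<equiv> measure \<mu> UNIV" and "\<xi> \<equiv> scale_measure (ennreal (1 / measure \<mu> UNIV)) \<mu>"
 shows "real_distribution \<xi>" "distr (poisson_paths m \<xi>) borel (random_sum (\<lambda>x. x)) = compound_poisson \<mu>"
proof -
 interpret \<mu>: finite_borel_measure \<mu> by fact
 have m0: "0 < m" using m unfolding m_def .
 have sp: "space \<mu> = UNIV" using sets_eq_imp_space_eq[OF \<mu>.M_is_borel] by simp
 show \<xi>: "real_distribution \<xi>"
 proof (rule real_distribution.intro)
  show "prob_space \<xi>"
   by (rule prob_spaceI) (use m sp in \<open>simp add: \<xi>_def space_scale_measure \<mu>.emeasure_eq_measure flip: ennreal_mult\<close>)
  show "real_distribution_axioms \<xi>" by standard (simp_all add: \<xi>_def \<mu>.M_is_borel space_scale_measure sp)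
 qed
 have \<mu>\<xi>: "\<mu> = scale_measure (ennreal m) \<xi>"
  unfolding \<xi>_def m_def using m by (simp flip: ennreal_mult)
 let ?P = "PiM UNIV (\<lambda>_::nat. \<xi>)"
 interpret P: prob_space ?P by (rule prob_space_PiM_real[OF \<xi>])
 have [measurable]: "(\<lambda>w. w i) \<in> borel_measurable ?P" for i by (rule measurable_PiM_real_component[OF \<xi>])
 let ?N = "distr (poisson_paths m \<xi>) borel (random_sum (\<lambda>x. x))"
 note rs = measurable_random_sum[OF \<xi>, of "\<lambda>x. x" "poisson_pmf m"]
 have "emeasure ?N A = ennreal (exp (- measure \<mu> UNIV)) *
    (emeasure (return borel 0) A + (\<Sum>k. ennreal (1 / fact (Suc k)) * emeasure (convolution_power \<mu> (Suc k)) A))"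
  if A: "A \<in> sets borel" for A
 proof -
  have "emeasure ?N A = emeasure (poisson_paths m \<xi>) (random_sum (\<lambda>x. x) -` A \<inter> space (poisson_paths m \<xi>))"
   using rs A by (subst emeasure_distr) auto
  also have "... = (\<integral>\<^sup>+n. emeasure ?P (Pair n -` (random_sum (\<lambda>x. x) -` A \<inter> space (poisson_paths m \<xi>))) \<partial>measure_pmf (poisson_pmf m))"
   using rs A by (intro P.emeasure_pair_measure_alt measurable_sets) auto
  also have "... = (\<integral>\<^sup>+n. emeasure (walk_law \<xi> n) A \<partial>measure_pmf (poisson_pmf m))"
  proof (rule nn_integral_cong)
   fix n
   have "emeasure (walk_law \<xi> n) A = emeasure ?P ((\<lambda>w. \<Sum>i<n. w i) -` A \<inter> space ?P)"
    unfolding walk_law_def using A by (intro emeasure_distr) auto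
   then show "emeasure ?P (Pair n -` (random_sum (\<lambda>x. x) -` A \<inter> space (poisson_paths m \<xi>))) = emeasure (walk_law \<xi> n) A"
    by (auto simp: random_sum_def space_pair_measure intro!: arg_cong[where f="emeasure ?P"])
  qed
  also have "... = (\<Sum>n. ennreal (pmf (poisson_pmf m) n) * emeasure (walk_law \<xi> n) A)"
   by (simp add: nn_integral_measure_pmf nn_integral_count_space_nat)
  also have "... = (\<Sum>n. ennreal (exp (- m)) * (ennreal (1 / fact n) * emeasure (convolution_power \<mu> n) A))"
  proof (rule suminf_cong)
   fix n
   have "emeasure (convolution_power \<mu> n) A = ennreal (m ^ n) * emeasure (walk_law \<xi> n) A"
    using convolution_power_scale(1)[OF \<xi> less_imp_le[OF m0] A, of n] \<mu>\<xi> by simp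
   moreover have "ennreal (pmf (poisson_pmf m) n) = ennreal (exp (- m)) * (ennreal (1 / fact n) * ennreal (m ^ n))"
    using m0 by (simp add: pmf_poisson[OF m0] mult.commute flip: ennreal_mult)
   ultimately show "ennreal (pmf (poisson_pmf m) n) * emeasure (walk_law \<xi> n) A =
     ennreal (exp (- m)) * (ennreal (1 / fact n) * emeasure (convolution_power \<mu> n) A)"
    by (simp add: mult.assoc)
  qed
  also have "... = ennreal (exp (- m)) * (\<Sum>n. ennreal (1 / fact n) * emeasure (convolution_power \<mu> n) A)"
   by (rule ennreal_suminf_cmult)
  also have "(\<Sum>n. ennreal (1 / fact n) * emeasure (convolution_power \<mu> n) A) =
   emeasure (return borel 0) A + (\<Sum>k. ennreal (1 / fact (Suc k)) * emeasure (convolution_power \<mu> (Suc k)) A)"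
  proof (rule sums_unique[symmetric])
   have "(\<lambda>k. ennreal (1 / fact (Suc k)) * emeasure (convolution_power \<mu> (Suc k)) A) sums
     (\<Sum>k. ennreal (1 / fact (Suc k)) * emeasure (convolution_power \<mu> (Suc k)) A)"
    by (intro summable_sums summableI)
   from sums_Suc[of "\<lambda>k. ennreal (1 / fact k) * emeasure (convolution_power \<mu> k) A", OF this]
   show "(\<lambda>n. ennreal (1 / fact n) * emeasure (convolution_power \<mu> n) A) sums (emeasure (return borel 0) A +
     (\<Sum>k. ennreal (1 / fact (Suc k)) * emeasure (convolution_power \<mu> (Suc k)) A))"
    by (simp add: add.commute)
  qed
  finally show ?thesis by (simp add: m_def)
 qed
 then have "compound_poisson \<mu> = measure_of UNIV (sets borel) (emeasure ?N)"
  unfolding compound_poisson_def by (intro measure_of_eq) (auto simp: sigma_algebra.sigma_sets_eq[OF sets.sigma_algebra_axioms[of borel], simplified])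
 also have "... = ?N" using measure_of_of_measure[of ?N] by simp
 finally show "?N = compound_poisson \<mu>" by simp
qed

lemma integral_power_poisson:
 fixes z :: complex
 assumes m: "0 < m" and z: "cmod z \<le> 1"
 shows "(\<integral>n. z ^ n \<partial>measure_pmf (poisson_pmf m)) = exp (of_real m * (z - 1))"
proof -
 have 1: "integrable (measure_pmf (poisson_pmf m)) (\<lambda>n. z ^ n)"
  by (intro measure_pmf.integrable_const_bound[where B=1]) (auto simp: norm_power power_le_one z)
 then have "integrable (count_space UNIV) (\<lambda>n. pmf (poisson_pmf m) n *\<^sub>R z ^ n)"
  unfolding measure_pmf_eq_density by (subst (asm) integrable_density) auto
 from sums_integral_count_space_nat[OF this]
 have "(\<lambda>n. pmf (poisson_pmf m) n *\<^sub>R z ^ n) sums (\<integral>n. z ^ n \<partial>measure_pmf (poisson_pmf m))"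
  unfolding measure_pmf_eq_density by (subst integral_density) auto
 moreover have "(\<lambda>n. pmf (poisson_pmf m) n *\<^sub>R z ^ n) sums (exp (of_real (- m)) * exp (of_real m * z))"
 proof -
  have "(\<lambda>n. exp (of_real (- m)) * ((of_real m * z) ^ n /\<^sub>R fact n)) sums (exp (of_real (- m)) * exp (of_real m * z))"
   by (intro sums_mult exp_converges)
  then show ?thesis
   by (rule sums_cong[THEN iffD1, rotated])
     (simp add: pmf_poisson[OF m] scaleR_conv_of_real power_mult_distrib field_simps flip: exp_of_real)
 qed
 ultimately have "(\<integral>n. z ^ n \<partial>measure_pmf (poisson_pmf m)) = exp (of_real (- m)) * exp (of_real m * z)"
  by (rule sums_unique2)
 then show ?thesis by (simp add: algebra_simps flip: exp_add)
qed

lemma char_random_sum: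
 assumes \<xi>: "real_distribution \<xi>" and m: "0 < m" and f[measurable]: "f \<in> borel_measurable borel"
 shows "char (distr (poisson_paths m \<xi>) borel (random_sum f)) s = exp (of_real m * ((\<integral>x. iexp (s * f x) \<partial>\<xi>) - 1))"
proof -
 let ?P = "PiM UNIV (\<lambda>_::nat. \<xi>)"
 interpret \<xi>: real_distribution \<xi> by fact
 interpret P: prob_space ?P by (rule prob_space_PiM_real[OF \<xi>])
 interpret Q: pair_prob_space "measure_pmf (poisson_pmf m)" ?P ..
 have [measurable]: "(\<lambda>w. w i) \<in> borel_measurable ?P" for i by (rule measurable_PiM_real_component[OF \<xi>])
 note rs[measurable] = measurable_random_sum[OF \<xi> f, of "poisson_pmf m"]
 have int: "integrable (poisson_paths m \<xi>) (\<lambda>z. iexp (s * random_sum f z))"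
  by (intro Q.integrable_const_bound[where B=1]) auto
 have one: "(\<integral>w. iexp (s * (\<Sum>i<n. f (w i))) \<partial>?P) = (\<integral>x. iexp (s * f x) \<partial>\<xi>) ^ n" for n
 proof -
  have "P.indep_vars (\<lambda>_. borel) (\<lambda>i w. w i) {..<n}"
   by (rule P.indep_vars_subset[OF indep_vars_PiM_real[of "\<lambda>_. \<xi>", OF \<xi>]]) auto
  then have "P.indep_vars (\<lambda>_. borel) (\<lambda>i w. f (w i)) {..<n}"
   by (rule P.indep_vars_compose2) measurable
  from P.char_distr_sum[OF this, of s]
  have "char (distr ?P borel (\<lambda>w. \<Sum>i<n. f (w i))) s = (\<Prod>i<n. char (distr ?P borel (\<lambda>w. f (w i))) s)" .
  moreover have "char (distr ?P borel (\<lambda>w. f (w i))) s = (\<integral>x. iexp (s * f x) \<partial>\<xi>)" for i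
  proof -
   have "(\<integral>x. iexp (s * f x) \<partial>distr ?P borel (\<lambda>w. w i)) = (\<integral>w. iexp (s * f (w i)) \<partial>?P)"
    by (rule integral_distr) measurable
   moreover have "char (distr ?P borel (\<lambda>w. f (w i))) s = (\<integral>w. iexp (s * f (w i)) \<partial>?P)"
    by (rule char_distr) measurable
   ultimately show ?thesis by (simp only: distr_PiM_real_component[of "\<lambda>_. \<xi>", OF \<xi>])
  qed
  moreover have "char (distr ?P borel (\<lambda>w. \<Sum>i<n. f (w i))) s = (\<integral>w. iexp (s * (\<Sum>i<n. f (w i))) \<partial>?P)"
   by (rule char_distr) measurable
  ultimately show ?thesis by simp
 qed
 have "char (distr (poisson_paths m \<xi>) borel (random_sum f)) s = (\<integral>z. iexp (s * random_sum f z) \<partial>poisson_paths m \<xi>)"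
  by (rule char_distr) measurable
 also have "... = (\<integral>n. (\<integral>w. iexp (s * random_sum f (n, w)) \<partial>?P) \<partial>measure_pmf (poisson_pmf m))"
  using Q.integral_fst'[OF int] by simp
 also have "... = (\<integral>n. (\<integral>x. iexp (s * f x) \<partial>\<xi>) ^ n \<partial>measure_pmf (poisson_pmf m))"
  unfolding random_sum_def fst_conv snd_conv one ..
 also have "... = exp (of_real m * ((\<integral>x. iexp (s * f x) \<partial>\<xi>) - 1))"
 proof (rule integral_power_poisson[OF m])
  have "cmod (\<integral>x. iexp (s * f x) \<partial>\<xi>) \<le> 1"
   by (rule \<xi>.norm_expectation_le) (auto simp: measurable_cong_sets[OF \<xi>.events_eq_borel refl])
  then show "cmod (\<integral>x. iexp (s * f x) \<partial>\<xi>) \<le> 1" .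
 qed
 finally show ?thesis .
qed

lemma compound_poisson_null:
 assumes \<mu>: "finite_borel_measure \<mu>" and m: "measure \<mu> UNIV = 0"
 shows "compound_poisson \<mu> = return borel 0"
proof -
 interpret \<mu>: finite_borel_measure \<mu> by fact
 have sp: "space \<mu> = UNIV" using sets_eq_imp_space_eq[OF \<mu>.M_is_borel] by simp
 have e0: "emeasure \<mu> (space \<mu>) = 0" using m sp by (simp add: \<mu>.emeasure_eq_measure)
 have fin: "sets (convolution_power \<mu> k) = sets borel \<and> finite_measure (convolution_power \<mu> k)" for k
 proof (induction k)
  case 0
  show ?case by (auto intro!: prob_space.finite_measure prob_space_return)
 next
  case (Suc k)
  then show ?case by (simp add: convolution_finite \<mu>.M_is_borel \<mu>.finite_measure_axioms)
 qed
 have "emeasure (convolution_power \<mu> (Suc k)) A = 0" if "A \<in> sets borel" for k A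
 proof -
  have "emeasure (convolution_power \<mu> (Suc k)) A = (\<integral>\<^sup>+x. emeasure (convolution_power \<mu> k) {a. a + x \<in> A} \<partial>\<mu>)"
   unfolding convolution_power.simps using fin[of k] sets_eq_imp_space_eq[of "convolution_power \<mu> k" borel] sp
   by (intro convolution_emeasure) (auto simp: \<mu>.M_is_borel \<mu>.finite_measure_axioms that)
  also have "... = (\<integral>\<^sup>+x. 0 \<partial>\<mu>)"
   by (intro nn_integral_cong_AE AE_I[where N="space \<mu>"]) (auto simp: e0)
  finally show ?thesis by simp
 qed
 then have "compound_poisson \<mu> = measure_of UNIV (sets borel) (emeasure (return borel 0))"
  unfolding compound_poisson_def using m by (intro measure_of_eq) (auto simp: sigma_algebra.sigma_sets_eq[OF sets.sigma_algebra_axioms[of borel], simplified])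
 then show ?thesis using measure_of_of_measure[of "return borel (0::real)"] by simp
qed

text \<open>The Levy-Khintchine form, by which compound Poisson laws are recognised in
  \<open>is_compound_poissonI\<close>.\<close>

lemma compound_poisson_char:
 assumes \<mu>: "finite_borel_measure \<mu>"
 shows "real_distribution (compound_poisson \<mu>)" "char (compound_poisson \<mu>) s = exp (\<integral>x. iexp (s * x) - 1 \<partial>\<mu>)"
proof -
 interpret \<mu>: finite_borel_measure \<mu> by fact
 have sp: "space \<mu> = UNIV" using sets_eq_imp_space_eq[OF \<mu>.M_is_borel] by simp
 have "real_distribution (compound_poisson \<mu>) \<and> char (compound_poisson \<mu>) s = exp (\<integral>x. iexp (s * x) - 1 \<partial>\<mu>)"
 proof (cases "measure \<mu> UNIV = 0")
  case True
  have "emeasure \<mu> (space \<mu>) = 0" using True sp by (simp add: \<mu>.emeasure_eq_measure)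
  then have "AE x in \<mu>. iexp (s * x) - 1 = 0" by (intro AE_I[where N="space \<mu>"]) auto
  then have "(\<integral>x. iexp (s * x) - 1 \<partial>\<mu>) = 0" by (rule integral_eq_zero_AE)
  moreover have "real_distribution (return borel (0::real))"
   by (intro real_distribution.intro prob_space_return) (auto intro: real_distribution_axioms.intro)
  moreover have "char (return borel 0) s = 1" by (simp add: char_def integral_return)
  ultimately show ?thesis by (simp add: compound_poisson_null[OF \<mu> True])
 next
  case False
  then have m: "0 < measure \<mu> UNIV" using measure_nonneg[of \<mu> UNIV] by linarith
  let ?m = "measure \<mu> UNIV" and ?\<xi> = "scale_measure (ennreal (1 / measure \<mu> UNIV)) \<mu>"
  note d = distr_random_sum[OF \<mu> m]
  have "(\<lambda>x. iexp (s * x)) \<in> borel_measurable borel" by measurable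
  then have im[measurable]: "(\<lambda>x. iexp (s * x)) \<in> borel_measurable \<mu>"
   unfolding measurable_cong_sets[OF \<mu>.M_is_borel refl] .
  have int: "integrable \<mu> (\<lambda>x. iexp (s * x))"
   by (intro \<mu>.integrable_const_bound[where B=1] im) (simp add: norm_exp_i_times del: of_real_mult)
  have sc: "\<mu> = scale_measure (ennreal ?m) ?\<xi>" using m by (simp flip: ennreal_mult)
  have "(\<integral>x. iexp (s * x) \<partial>?\<xi>) = (1 / ?m) *\<^sub>R (\<integral>x. iexp (s * x) \<partial>\<mu>)"
  proof -
   have "?\<xi> = density \<mu> (\<lambda>_. ennreal (1 / ?m))"
    by (rule measure_eqI) (auto simp: emeasure_density_const)
   moreover have "(\<integral>x. iexp (s * x) \<partial>density \<mu> (\<lambda>_. ennreal (1 / ?m))) = (\<integral>x. (1 / ?m) *\<^sub>R iexp (s * x) \<partial>\<mu>)"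
    using m by (intro integral_density im) auto
   ultimately show ?thesis by (simp only: integral_scaleR_right)
  qed
  then have "of_real ?m * ((\<integral>x. iexp (s * x) \<partial>?\<xi>) - 1) = (\<integral>x. iexp (s * x) - 1 \<partial>\<mu>)"
   using m int sp by (simp add: scaleR_conv_of_real algebra_simps)
  with char_random_sum[OF d(1) m, of "\<lambda>x. x" s] d(2)
  have "char (compound_poisson \<mu>) s = exp (\<integral>x. iexp (s * x) - 1 \<partial>\<mu>)" by simp
  moreover have "real_distribution (compound_poisson \<mu>)"
   unfolding d(2)[symmetric] by (intro real_distribution_distr_map prob_space_poisson_paths d(1) measurable_random_sum) simp
  ultimately show ?thesis by simp
 qed
 then show "real_distribution (compound_poisson \<mu>)" "char (compound_poisson \<mu>) s = exp (\<integral>x. iexp (s * x) - 1 \<partial>\<mu>)" by auto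
qed

section \<open>Multiples of Bernoulli and Poisson variables\<close>

text \<open>Values in \<open>nat\<close> and not in \<open>bool\<close>, so that the law can be
  compared and coupled with a Poisson law on the same type.\<close>

definition bern :: "real \<Rightarrow> nat pmf" where
 "bern p = map_pmf of_bool (bernoulli_pmf p)"

definition nat_law :: "real \<Rightarrow> nat pmf \<Rightarrow> real measure" where
 "nat_law c p = distr (measure_pmf p) borel (\<lambda>n. c * real n)"

lemma real_distribution_nat_law: "real_distribution (nat_law c p)"
 unfolding nat_law_def by (intro real_distribution_distr_map measure_pmf.prob_space_axioms) simp

lemma char_nat_law: "char (nat_law c p) s = (\<integral>n. iexp (s * c) ^ n \<partial>measure_pmf p)"
proof -
 have "char (nat_law c p) s = (\<integral>n. iexp (s * (c * real n)) \<partial>measure_pmf p)"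
  unfolding nat_law_def by (rule char_distr) simp
 also have "... = (\<integral>n. iexp (s * c) ^ n \<partial>measure_pmf p)"
  by (intro Bochner_Integration.integral_cong refl) (simp add: exp_of_nat_mult[symmetric] mult_ac)
 finally show ?thesis .
qed

lemma char_nat_law_poisson: "0 < m \<Longrightarrow> char (nat_law c (poisson_pmf m)) s = exp (of_real m * (iexp (s * c) - 1))"
 unfolding char_nat_law by (intro integral_power_poisson) (simp_all add: norm_exp_i_times del: of_real_mult)

lemma integral_bern:
 fixes f :: "nat \<Rightarrow> 'b::{banach, second_countable_topology}"
 assumes "0 \<le> p" "p \<le> 1"
 shows "(\<integral>n. f n \<partial>measure_pmf (bern p)) = p *\<^sub>R f 1 + (1 - p) *\<^sub>R f 0"
proof -
 have "(\<integral>n. f n \<partial>measure_pmf (bern p)) = (\<integral>b. f (of_bool b) \<partial>measure_pmf (bernoulli_pmf p))"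
  unfolding bern_def by simp
 also have "... = (\<Sum>b\<in>UNIV. pmf (bernoulli_pmf p) b *\<^sub>R f (of_bool b))"
  by (rule integral_measure_pmf) auto
 finally show ?thesis using assms by (simp add: UNIV_bool add.commute)
qed

lemma char_nat_law_bern:
 assumes "0 \<le> p" "p \<le> 1"
 shows "char (nat_law c (bern p)) s = 1 + of_real p * (iexp (s * c) - 1)"
 unfolding char_nat_law integral_bern[OF assms] by (simp add: scaleR_conv_of_real algebra_simps)

lemma measure_bern:
 assumes "0 \<le> p" "p \<le> 1"
 shows "measure (bern p) A = p * indicator A 1 + (1 - p) * indicator A 0"
proof -
 have "measure (bern p) A = (\<integral>n. indicator A n \<partial>measure_pmf (bern p))" by simp
 also have "... = p * indicator A 1 + (1 - p) * indicator A 0" by (subst integral_bern[OF assms]) simp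
 finally show ?thesis .
qed

lemma measure_nat_law:
 assumes "A \<in> sets borel"
 shows "measure (nat_law c p) A = measure p {n. c * real n \<in> A}"
 unfolding nat_law_def using assms by (subst measure_distr) (auto simp: vimage_def)

lemma two_point_nat_law:
 assumes p: "0 < p" "p < 1" and c: "c \<noteq> 0"
 shows "measure_support (nat_law c (bern p)) = {0, c}"
  and "measure (nat_law c (bern p)) {0} = 1 - p" "measure (nat_law c (bern p)) {c} = p"
  and "prob_space.variance (nat_law c (bern p)) (\<lambda>x. x) = p * (1 - p) * c\<^sup>2"
proof -
 interpret N: real_distribution "nat_law c (bern p)" by (rule real_distribution_nat_law)
 have m: "measure (nat_law c (bern p)) A = p * indicator A c + (1 - p) * indicator A 0" if "A \<in> sets borel" for A
  using that p by (simp add: measure_nat_law measure_bern indicator_def)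
 show "measure (nat_law c (bern p)) {0} = 1 - p" "measure (nat_law c (bern p)) {c} = p"
  using c p by (simp_all add: m)
 have "x \<in> measure_support (nat_law c (bern p)) \<longleftrightarrow> x \<in> {0, c}" for x
 proof
  assume x: "x \<in> measure_support (nat_law c (bern p))"
  show "x \<in> {0, c}"
  proof (rule ccontr)
   assume "x \<notin> {0, c}"
   moreover have "open (- {0, c} :: real set)" by (intro open_Compl finite_imp_closed) auto
   ultimately have "0 < emeasure (nat_law c (bern p)) (- {0, c})" using x unfolding measure_support_def by blast
   moreover have "measure (nat_law c (bern p)) (- {0, c}) = 0" by (subst m) auto
   ultimately show False by (simp add: N.emeasure_eq_measure)
  qed
 next
  assume x: "x \<in> {0, c}"
  show "x \<in> measure_support (nat_law c (bern p))"
   unfolding measure_support_def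
  proof (intro CollectI allI impI)
   fix U :: "real set" assume U: "open U" "x \<in> U"
   have "0 < measure (nat_law c (bern p)) U"
    using x U p by (subst m) (auto simp: indicator_def)
   then show "0 < emeasure (nat_law c (bern p)) U" by (simp add: N.emeasure_eq_measure)
  qed
 qed
 then show "measure_support (nat_law c (bern p)) = {0, c}" by auto
 have ex: "integral\<^sup>L (nat_law c (bern p)) f = p * f c + (1 - p) * f 0" if "f \<in> borel_measurable borel" for f :: "real \<Rightarrow> real"
  unfolding nat_law_def using that p by (simp add: integral_distr integral_bern)
 show "N.variance (\<lambda>x. x) = p * (1 - p) * c\<^sup>2"
  by (simp add: ex power2_eq_square algebra_simps)
qed

text \<open>The jump measure is the image under \<open>c\<close> of a point measure on
  \<open>J\<close>, so coinciding jump sizes simply add their rates.\<close>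

lemma is_compound_poissonI:
 assumes \<nu>: "real_distribution \<nu>" and J: "finite J" "\<And>i. i \<in> J \<Longrightarrow> 0 \<le> p i"
  and ch: "\<And>s. char \<nu> s = exp (\<Sum>i\<in>J. of_real (p i) * (iexp (s * c i) - 1))"
 shows "is_compound_poisson \<nu>"
proof -
 let ?M = "point_measure J (\<lambda>i. ennreal (p i))"
 define \<mu> where "\<mu> = distr ?M borel c"
 have cm: "c \<in> borel_measurable ?M" by (simp add: point_measure_def)
 have "finite_measure ?M"
  by (rule finite_measureI) (simp add: J space_point_measure emeasure_point_measure_finite)
 then have "finite_measure \<mu>" unfolding \<mu>_def by (rule finite_measure.finite_measure_distr[OF _ cm])
 then have \<mu>: "finite_borel_measure \<mu>"
  by (intro finite_borel_measure.intro) (auto simp: finite_borel_measure_axioms_def \<mu>_def)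
 have "char (compound_poisson \<mu>) s = char \<nu> s" for s
 proof -
  have "(\<integral>x. iexp (s * x) - 1 \<partial>\<mu>) = (\<integral>i. iexp (s * c i) - 1 \<partial>?M)"
   unfolding \<mu>_def by (rule integral_distr[OF cm]) measurable
  also have "... = (\<Sum>i\<in>J. p i *\<^sub>R (iexp (s * c i) - 1))"
   by (rule lebesgue_integral_point_measure_finite) (auto simp: J)
  finally show ?thesis by (simp add: compound_poisson_char(2)[OF \<mu>] ch scaleR_conv_of_real)
 qed
 then have "compound_poisson \<mu> = \<nu>" by (intro char_eq_imp_eq compound_poisson_char(1) \<mu> \<nu>)
 then show ?thesis unfolding is_compound_poisson_def using \<mu> by auto
qed

text \<open>Borel-Cantelli: almost surely \<open>\<bar>e k (w k)\<bar> \<le> \<delta> k\<close> for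
  all large \<open>k\<close>, and then the series converges absolutely.\<close>

lemma AE_convergent_sum:
 fixes M :: "nat \<Rightarrow> 'b measure" and e :: "nat \<Rightarrow> 'b \<Rightarrow> real"
 assumes M: "\<And>k. prob_space (M k)" and e[measurable]: "\<And>k. e k \<in> borel_measurable (M k)"
  and B: "summable B" "\<And>k. measure (M k) {w \<in> space (M k). \<delta> k < \<bar>e k w\<bar>} \<le> B k" and \<delta>: "summable \<delta>"
 shows "AE w in PiM UNIV M. convergent (\<lambda>n. \<Sum>k<n. e k (w k))"
proof -
 interpret P: prob_space "PiM UNIV M" by (intro prob_space_PiM M)
 have m: "measure (PiM UNIV M) {w \<in> space (PiM UNIV M). \<delta> k < \<bar>e k (w k)\<bar>} = measure (M k) {w \<in> space (M k). \<delta> k < \<bar>e k w\<bar>}" for k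
 proof -
  have "measure (M k) {w \<in> space (M k). \<delta> k < \<bar>e k w\<bar>} = measure (distr (PiM UNIV M) (M k) (\<lambda>w. w k)) {w \<in> space (M k). \<delta> k < \<bar>e k w\<bar>}"
   using distr_PiM_component[of UNIV M k] M by simp
  also have "... = measure (PiM UNIV M) {w \<in> space (PiM UNIV M). \<delta> k < \<bar>e k (w k)\<bar>}"
   by (subst measure_distr) (auto intro!: arg_cong[where f="measure _"] simp: space_PiM PiE_iff)
  finally show ?thesis ..
 qed
 have "AE w in PiM UNIV M. \<forall>\<^sub>F k in sequentially. w \<in> space (PiM UNIV M) - {w \<in> space (PiM UNIV M). \<delta> k < \<bar>e k (w k)\<bar>}"
 proof (rule borel_cantelli_AE1)
  show "summable (\<lambda>k. measure (PiM UNIV M) {w \<in> space (PiM UNIV M). \<delta> k < \<bar>e k (w k)\<bar>})"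
   unfolding m by (rule summable_comparison_test[OF _ B(1)]) (use B(2) in \<open>auto simp: measure_nonneg\<close>)
 qed (auto simp: P.emeasure_eq_measure)
 then show ?thesis
 proof eventually_elim
  case (elim w)
  then have "\<forall>\<^sub>F k in sequentially. norm (e k (w k)) \<le> \<delta> k" by (auto elim!: eventually_mono)
  then have "summable (\<lambda>k. e k (w k))" by (rule summable_comparison_test_ev[OF _ \<delta>])
  then show ?case by (simp add: summable_iff_convergent)
 qed
qed

section \<open>Couplings of distributions on the natural numbers\<close>

lemma integral_pmf_count_space:
 fixes f :: "nat \<Rightarrow> real"
 assumes "\<And>n. \<bar>f n\<bar> \<le> C"
 shows "integrable (count_space UNIV) (\<lambda>n. pmf p n * f n)" "(\<integral>n. f n \<partial>measure_pmf p) = (\<integral>n. pmf p n * f n \<partial>count_space UNIV)"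
proof -
 have "integrable (measure_pmf p) f"
  by (intro measure_pmf.integrable_const_bound[where B=C]) (auto simp: assms)
 then show "integrable (count_space UNIV) (\<lambda>n. pmf p n * f n)"
  unfolding measure_pmf_eq_density by (subst (asm) integrable_density) auto
 show "(\<integral>n. f n \<partial>measure_pmf p) = (\<integral>n. pmf p n * f n \<partial>count_space UNIV)"
  unfolding measure_pmf_eq_density by (subst integral_density) auto
qed

lemma measure_bind_pmf:
 "measure (measure_pmf (bind_pmf p f)) A = (\<integral>x. measure (measure_pmf (f x)) A \<partial>measure_pmf p)"
proof -
 have "ennreal (measure (measure_pmf (bind_pmf p f)) A) = (\<integral>\<^sup>+x. ennreal (measure (measure_pmf (f x)) A) \<partial>measure_pmf p)"
  by (simp flip: measure_pmf.emeasure_eq_measure)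
 also have "... = ennreal (\<integral>x. measure (measure_pmf (f x)) A \<partial>measure_pmf p)"
  by (intro nn_integral_eq_integral measure_pmf.integrable_const_bound[where B=1]) auto
 finally show ?thesis by (simp add: integral_nonneg_AE)
qed

text \<open>A value \<open>i\<close> drawn from \<open>\<alpha>\<close> is kept with probability
  \<open>r i\<close>, the minimum of 1 and the ratio of the weights of \<open>\<beta>\<close> and
  \<open>\<alpha>\<close> at \<open>i\<close>, and otherwise redrawn from the normalised excess of
  \<open>\<beta>\<close> over \<open>\<alpha>\<close>. A one-sided bound suffices because the set
  \<open>A\<close> attains the total variation distance.\<close>

lemma maximal_coupling:
 fixes \<alpha> \<beta> :: "nat pmf"
 assumes le: "\<And>A. measure \<alpha> A - measure \<beta> A \<le> \<epsilon>"
 obtains \<gamma> where "map_pmf fst \<gamma> = \<alpha>" "map_pmf snd \<gamma> = \<beta>" "measure (measure_pmf \<gamma>) {z. fst z \<noteq> snd z} \<le> \<epsilon>"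
proof -
 define A where "A = {i. pmf \<beta> i < pmf \<alpha> i}"
 define \<delta> where "\<delta> = measure \<alpha> A - measure \<beta> A"
 define r where "r i = (if i \<in> A then pmf \<beta> i / pmf \<alpha> i else 1)" for i
 define d where "d i = (if i \<in> A then 0 else pmf \<beta> i - pmf \<alpha> i)" for i
 have r01: "0 \<le> r i" "r i \<le> 1" for i unfolding r_def A_def by (auto simp: divide_le_eq_1 pmf_nonneg)
 have d0: "0 \<le> d i" for i unfolding d_def A_def by auto
 have int: "integrable (count_space UNIV) (\<lambda>i. indicator B i * pmf q i)" "(\<integral>i. indicator B i * pmf q i \<partial>count_space UNIV) = measure q B" for B and q :: "nat pmf"
 proof -
  have "\<bar>indicator B n :: real\<bar> \<le> 1" for n by (simp add: indicator_def)
  from integral_pmf_count_space[where f="indicator B" and C=1 and p=q, OF this]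
  show "integrable (count_space UNIV) (\<lambda>i. indicator B i * pmf q i)" "(\<integral>i. indicator B i * pmf q i \<partial>count_space UNIV) = measure q B"
   by (simp_all add: mult.commute)
 qed
 have decomp: "d i = (1 - indicator A i) * pmf \<beta> i - (1 - indicator A i) * pmf \<alpha> i" for i unfolding d_def by auto
 have cA: "1 - indicator A i = (indicator (- A) i :: real)" for i by (auto simp: indicator_def)
 have di: "integrable (count_space UNIV) d" "integral\<^sup>L (count_space UNIV) d = \<delta>"
  unfolding decomp[abs_def] cA using int measure_pmf.prob_compl[of A \<alpha>] measure_pmf.prob_compl[of A \<beta>]
  by (auto simp: \<delta>_def Compl_eq_Diff_UNIV)
 have er: "(\<integral>i. 1 - r i \<partial>measure_pmf \<alpha>) = \<delta>"
 proof -
  have "(\<integral>i. 1 - r i \<partial>measure_pmf \<alpha>) = (\<integral>i. pmf \<alpha> i * (1 - r i) \<partial>count_space UNIV)"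
   by (rule integral_pmf_count_space[where C=1]) (use r01 in auto)
  also have "... = (\<integral>i. indicator A i * pmf \<alpha> i - indicator A i * pmf \<beta> i \<partial>count_space UNIV)"
  proof (intro Bochner_Integration.integral_cong refl)
   fix i show "pmf \<alpha> i * (1 - r i) = indicator A i * pmf \<alpha> i - indicator A i * pmf \<beta> i"
    using pmf_nonneg[of \<beta> i] by (auto simp: r_def A_def field_simps)
  qed
  also have "... = \<delta>" using int by (simp add: \<delta>_def)
  finally show ?thesis .
 qed
 have ir: "integrable (measure_pmf \<alpha>) (\<lambda>i. 1 - r i)"
 proof (intro measure_pmf.integrable_const_bound[where B=1] AE_I2)
  show "norm (1 - r i) \<le> 1" for i using r01[of i] by simp
 qed simp
 \<comment> \<open>For \<open>\<delta> = 0\<close> there is no excess to normalise, and the two laws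
   coincide.\<close>
 show thesis
 proof (cases "\<delta> = 0")
  case True
  have "pmf \<alpha> i = pmf \<beta> i" for i
  proof -
   have "AE i in count_space UNIV. d i = 0"
    using integral_nonneg_eq_0_iff_AE[OF di(1)] d0 di(2) True by auto
   then have dz: "d i = 0" for i by (simp add: AE_count_space)
   have "AE i in measure_pmf \<alpha>. 1 - r i = 0"
    using integral_nonneg_eq_0_iff_AE[of "measure_pmf \<alpha>" "\<lambda>i. 1 - r i"] r01 er True ir by simp
   then have "i \<in> set_pmf \<alpha> \<Longrightarrow> r i = 1" by (auto simp: AE_measure_pmf_iff)
   then have "i \<notin> A" using pmf_nonneg[of \<beta> i] by (cases "i \<in> set_pmf \<alpha>") (auto simp: r_def A_def set_pmf_eq)
   with dz[of i] show ?thesis by (simp add: d_def)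
  qed
  then have "\<alpha> = \<beta>" by (rule pmf_eqI)
  have "0 \<le> \<epsilon>" using le[of "{}"] by simp
  then show thesis using \<open>\<alpha> = \<beta>\<close>
   by (intro that[of "map_pmf (\<lambda>i. (i, i)) \<alpha>"]) (auto simp: pmf.map_comp comp_def vimage_def)
 next
  case False
  have "0 \<le> \<delta>" unfolding er[symmetric] using r01 by (intro integral_nonneg_AE) auto
  with False have \<delta>: "0 < \<delta>" by simp
  define \<rho> where "\<rho> = embed_pmf (\<lambda>j. d j / \<delta>)"
  have \<rho>: "pmf \<rho> j = d j / \<delta>" for j
   unfolding \<rho>_def
  proof (rule pmf_embed_pmf)
   show "(\<integral>\<^sup>+j. ennreal (d j / \<delta>) \<partial>count_space UNIV) = 1"
    using di \<delta> d0 by (subst nn_integral_eq_integral) auto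
  qed (use d0 \<delta> in auto)
  define \<kappa> where "\<kappa> i = bind_pmf (bernoulli_pmf (r i)) (\<lambda>b. if b then return_pmf (i, i) else map_pmf (Pair i) \<rho>)" for i
  define \<gamma> where "\<gamma> = bind_pmf \<alpha> \<kappa>"
  have "map_pmf fst (\<kappa> i) = return_pmf i" for i
   unfolding \<kappa>_def by (simp add: map_bind_pmf if_distrib pmf.map_comp comp_def map_pmf_const cong: if_cong)
  then have fst: "map_pmf fst \<gamma> = \<alpha>" unfolding \<gamma>_def by (simp add: map_bind_pmf bind_return_pmf')
  have \<kappa>s: "pmf (map_pmf snd (\<kappa> i)) j = r i * indicator {i} j + (1 - r i) * pmf \<rho> j" for i j
  proof -
   have "map_pmf snd (\<kappa> i) = bind_pmf (bernoulli_pmf (r i)) (\<lambda>b. if b then return_pmf i else \<rho>)"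
    unfolding \<kappa>_def by (simp add: map_bind_pmf if_distrib pmf.map_comp comp_def cong: if_cong)
   then show ?thesis using r01[of i] by (simp add: pmf_bind integral_bernoulli_pmf indicator_def)
  qed
  have snd: "map_pmf snd \<gamma> = \<beta>"
  proof (rule pmf_eqI)
   fix j
   have "pmf (map_pmf snd \<gamma>) j = (\<integral>i. r i * indicator {i} j + (1 - r i) * pmf \<rho> j \<partial>measure_pmf \<alpha>)"
    unfolding \<gamma>_def map_bind_pmf pmf_bind \<kappa>s ..
   also have "... = (\<integral>i. r j * indicator {j} i + (1 - r i) * pmf \<rho> j \<partial>measure_pmf \<alpha>)"
    by (intro Bochner_Integration.integral_cong refl) (auto simp: indicator_def)
   also have "... = (\<integral>i. r j * indicator {j} i \<partial>measure_pmf \<alpha>) + (\<integral>i. (1 - r i) * pmf \<rho> j \<partial>measure_pmf \<alpha>)"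
    by (intro Bochner_Integration.integral_add integrable_mult_right integrable_mult_left ir)
      (simp add: measure_pmf.emeasure_eq_measure)
   also have "... = r j * pmf \<alpha> j + \<delta> * pmf \<rho> j"
    unfolding integral_mult_left_zero integral_mult_right_zero er by (simp add: measure_pmf_single)
   also have "... = pmf \<beta> j"
    unfolding \<rho> using \<delta> pmf_nonneg[of \<beta> j] by (auto simp: r_def d_def A_def)
   finally show "pmf (map_pmf snd \<gamma>) j = pmf \<beta> j" .
  qed
  have "measure (measure_pmf \<gamma>) {z. fst z \<noteq> snd z} \<le> \<delta>"
  proof -
   have "measure (measure_pmf (\<kappa> i)) {z. fst z \<noteq> snd z} \<le> 1 - r i" for i
   proof -
    have "measure (measure_pmf (\<kappa> i)) {z. fst z \<noteq> snd z} = (1 - r i) * measure \<rho> {j. i \<noteq> j}"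
     unfolding \<kappa>_def measure_bind_pmf using r01[of i] by (simp add: integral_bernoulli_pmf vimage_def)
    also have "... \<le> (1 - r i) * 1" using r01[of i] by (intro mult_left_mono) auto
    finally show ?thesis by simp
   qed
   then have "(\<integral>i. measure (measure_pmf (\<kappa> i)) {z. fst z \<noteq> snd z} \<partial>measure_pmf \<alpha>) \<le> (\<integral>i. 1 - r i \<partial>measure_pmf \<alpha>)"
    using r01 by (intro integral_mono measure_pmf.integrable_const_bound[where B=1]) auto
   then show ?thesis unfolding \<gamma>_def measure_bind_pmf er .
  qed
  also have "\<delta> \<le> \<epsilon>" unfolding \<delta>_def by (rule le)
  finally show thesis by (rule that[OF fst snd])
 qed
qed

text \<open>\<open>bern p\<close> lives on 0 and 1. At 0 the Poisson law has at least as much mass,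
  so only the point 1 contributes, with \<open>p - p * exp (- p)\<close>.\<close>

lemma bern_poisson_le:
 assumes p: "0 < p" "p \<le> 1"
 shows "measure (bern p) A - measure (poisson_pmf p) A \<le> p\<^sup>2"
proof -
 have "measure (poisson_pmf p) (A \<inter> {0, 1}) \<le> measure (poisson_pmf p) A"
  by (intro measure_pmf.finite_measure_mono) auto
 moreover have "measure (poisson_pmf p) (A \<inter> {0, 1}) = (\<Sum>k\<in>A \<inter> {0, 1}. pmf (poisson_pmf p) k)"
  by (rule measure_measure_pmf_finite) auto
 moreover have "(\<Sum>k\<in>A \<inter> {0, 1}. pmf (poisson_pmf p) k) = indicator A 0 * exp (- p) + indicator A 1 * (p * exp (- p))"
  by (cases "(0::nat) \<in> A"; cases "(1::nat) \<in> A") (auto simp: Int_insert_right pmf_poisson[OF p(1)])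
 moreover have e: "1 - p \<le> exp (- p)" using exp_ge_add_one_self[of "- p"] by simp
 moreover have "p * (1 - p) \<le> p * exp (- p)" using p e by (intro mult_left_mono) auto
 then have e2: "p - p * exp (- p) \<le> p\<^sup>2" by (simp add: power2_eq_square algebra_simps)
 ultimately have "measure (bern p) A - measure (poisson_pmf p) A \<le>
   indicator A 0 * ((1 - p) - exp (- p)) + indicator A 1 * (p - p * exp (- p))"
  using p measure_bern[of p A] by (simp add: algebra_simps)
 also have "... \<le> indicator A 0 * 0 + indicator A 1 * p\<^sup>2"
  using e e2 by (intro add_mono mult_left_mono) auto
 also have "... \<le> p\<^sup>2" by (simp add: indicator_def)
 finally show ?thesis .
qed

text \<open>Under maximal couplings the two variables almost surely differ in only finitely many
  coordinates. The factors \<open>c k\<close> may therefore be arbitrarily large.\<close>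

lemma nat_laws_isomorphic:
 assumes d: "\<And>k A. measure (q k :: nat pmf) A - measure (q' k :: nat pmf) A \<le> B k" and B: "summable B"
 shows "isomorphic_actions (tail_boundary_flow (\<lambda>k. nat_law (c k) (q' k))) (tail_boundary_flow (\<lambda>k. nat_law (c k) (q k)))"
proof -
 have "\<exists>\<gamma>. map_pmf fst \<gamma> = q k \<and> map_pmf snd \<gamma> = q' k \<and> measure (measure_pmf \<gamma>) {z. fst z \<noteq> snd z} \<le> B k" for k
  using maximal_coupling[of "q k" "q' k" "B k", OF d] by metis
 then obtain \<gamma> where \<gamma>: "\<And>k. map_pmf fst (\<gamma> k) = q k" "\<And>k. map_pmf snd (\<gamma> k) = q' k"
  "\<And>k. measure (measure_pmf (\<gamma> k)) {z. fst z \<noteq> snd z} \<le> B k" by metis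
 have law: "nat_law c (map_pmf f g) = distr (measure_pmf g) borel (\<lambda>z. c * real (f z))" for c f and g :: "(nat \<times> nat) pmf"
  unfolding nat_law_def map_pmf_rep_eq by (subst distr_distr) (auto simp: comp_def)
 have laws: "nat_law (c k) (q k) = distr (measure_pmf (\<gamma> k)) borel (\<lambda>z. c k * real (fst z))"
   "nat_law (c k) (q' k) = distr (measure_pmf (\<gamma> k)) borel (\<lambda>z. c k * real (snd z))" for k
  unfolding \<gamma>(1,2)[symmetric] law by simp_all
 have conv: "AE w in PiM UNIV (\<lambda>k. measure_pmf (\<gamma> k)). convergent (\<lambda>n. \<Sum>k<n. e k (w k))"
  if e: "\<And>k z. fst z = snd z \<Longrightarrow> e k z = 0" for e :: "nat \<Rightarrow> nat \<times> nat \<Rightarrow> real"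
 proof (rule AE_convergent_sum[where \<delta>="\<lambda>_. 0" and B=B])
  show "measure (measure_pmf (\<gamma> k)) {w \<in> space (measure_pmf (\<gamma> k)). 0 < \<bar>e k w\<bar>} \<le> B k" for k
   by (rule order_trans[OF measure_pmf.finite_measure_mono \<gamma>(3)]) (use e in auto)
 qed (simp_all add: measure_pmf.prob_space_axioms B)
 show "isomorphic_actions (tail_boundary_flow (\<lambda>k. nat_law (c k) (q' k))) (tail_boundary_flow (\<lambda>k. nat_law (c k) (q k)))"
  unfolding laws
  by (rule coupling_isomorphic_convergent) (auto intro!: conv measure_pmf.prob_space_axioms)
qed

section \<open>From compound Poisson to two-point distributions\<close>

text \<open>The complement of the support is covered by null open sets, of which countably many
  suffice by Lindelof's theorem.\<close>

lemma AE_measure_support: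
 assumes \<nu>: "real_distribution \<nu>"
 shows "AE x in \<nu>. x \<in> measure_support \<nu>"
proof -
 interpret \<nu>: real_distribution \<nu> by fact
 define F where "F = {U. open U \<and> emeasure \<nu> U = 0}"
 obtain F' where F': "F' \<subseteq> F" "countable F'" "\<Union>F' = \<Union>F"
  by (rule Lindelof[of F]) (auto simp: F_def)
 have "(\<Union>U\<in>F'. U) \<in> null_sets \<nu>"
  using F' by (intro null_sets_UN') (auto simp: F_def null_sets_def)
 moreover have "- measure_support \<nu> \<subseteq> \<Union>F"
 proof
  fix x :: real assume "x \<in> - measure_support \<nu>"
  then obtain U where "open U" "x \<in> U" "\<not> emeasure \<nu> U > 0" unfolding measure_support_def by auto
  then show "x \<in> \<Union>F" unfolding F_def by auto
 qed
 ultimately show ?thesis using F'(3) by (intro AE_I'[of "\<Union>F'"]) auto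
qed

lemma AE_nonneg_of_support:
 assumes "real_distribution \<nu>" "measure_support \<nu> \<subseteq> {0..}"
 shows "AE x in \<nu>. 0 \<le> x"
 using AE_measure_support[OF assms(1)] by eventually_elim (use assms(2) in auto)

lemma support_nonneg_of_AE:
 assumes \<nu>: "real_distribution \<nu>" and AE: "AE x in \<nu>. 0 \<le> x"
 shows "measure_support \<nu> \<subseteq> {0..}"
proof
 interpret \<nu>: real_distribution \<nu> by fact
 fix x assume x: "x \<in> measure_support \<nu>"
 show "x \<in> {0..}"
 proof (rule ccontr)
  assume "x \<notin> {0..}"
  then have "0 < emeasure \<nu> {..<0}" using x unfolding measure_support_def by auto
  moreover have "emeasure \<nu> {..<0} = 0"
   using AE by (subst (asm) AE_iff_measurable[OF _ refl]) (auto simp: not_le lessThan_def)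
  ultimately show False by simp
 qed
qed

text \<open>The rate is positive even for the null measure, which is represented by jumps of size 0
  at rate 1. With positive probability there is exactly one jump, so a sum that is almost surely
  nonnegative forces nonnegative jumps.\<close>

lemma compound_poisson_random_sum:
 assumes "is_compound_poisson \<nu>"
 shows "\<exists>m \<xi>. 0 < m \<and> real_distribution \<xi> \<and> distr (poisson_paths m \<xi>) borel (random_sum (\<lambda>x. x)) = \<nu> \<and>
  (measure_support \<nu> \<subseteq> {0..} \<longrightarrow> (AE x in \<xi>. 0 \<le> x))"
proof -
 from assms obtain \<mu> where \<mu>: "finite_borel_measure \<mu>" "\<nu> = compound_poisson \<mu>" by (auto simp: is_compound_poisson_def)
 have \<nu>: "real_distribution \<nu>" unfolding \<mu>(2) by (rule compound_poisson_char(1)[OF \<mu>(1)])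
 have "\<exists>m \<xi>. 0 < m \<and> real_distribution \<xi> \<and> distr (poisson_paths m \<xi>) borel (random_sum (\<lambda>x. x)) = \<nu>"
 proof (cases "measure \<mu> UNIV = 0")
  case True
  let ?\<xi> = "return borel (0 :: real)"
  have \<xi>: "real_distribution ?\<xi>"
   by (intro real_distribution.intro prob_space_return) (auto intro: real_distribution_axioms.intro)
  have "distr (poisson_paths 1 ?\<xi>) borel (random_sum (\<lambda>x. x)) = \<nu>"
  proof (rule char_eq_imp_eq[OF _ \<nu>])
   show "real_distribution (distr (poisson_paths 1 ?\<xi>) borel (random_sum (\<lambda>x. x)))"
    by (intro real_distribution_distr_map prob_space_poisson_paths \<xi> measurable_random_sum) simp
   show "char (distr (poisson_paths 1 ?\<xi>) borel (random_sum (\<lambda>x. x))) s = char \<nu> s" for s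
   proof -
    have "char (return borel 0) s = 1" by (simp add: char_def integral_return)
    then show ?thesis
     by (simp add: char_random_sum[OF \<xi>] \<mu>(2) compound_poisson_null[OF \<mu>(1) True] integral_return)
   qed
  qed
  with \<xi> show ?thesis by (intro exI[of _ 1] exI[of _ ?\<xi>]) simp
 next
  case False
  then have m: "0 < measure \<mu> UNIV" using measure_nonneg[of \<mu> UNIV] by linarith
  show ?thesis using distr_random_sum[OF \<mu>(1) m] m \<mu>(2) by blast
 qed
 then obtain m \<xi> where *: "0 < m" "real_distribution \<xi>" "distr (poisson_paths m \<xi>) borel (random_sum (\<lambda>x. x)) = \<nu>" by blast
 have "AE x in \<xi>. 0 \<le> x" if "measure_support \<nu> \<subseteq> {0..}"
 proof -
  interpret \<xi>: real_distribution \<xi> by fact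
  interpret P: prob_space "PiM UNIV (\<lambda>_::nat. \<xi>)" by (rule prob_space_PiM_real[OF *(2)])
  interpret Q: pair_prob_space "measure_pmf (poisson_pmf m)" "PiM UNIV (\<lambda>_::nat. \<xi>)" ..
  have "AE x in distr (poisson_paths m \<xi>) borel (random_sum (\<lambda>x. x)). 0 \<le> x"
   unfolding *(3) by (rule AE_nonneg_of_support[OF \<nu> that])
  then have "AE z in poisson_paths m \<xi>. 0 \<le> random_sum (\<lambda>x. x) z"
   by (rule AE_distrD[OF measurable_random_sum[OF *(2)], rotated]) simp
  then have "AE n in measure_pmf (poisson_pmf m). AE w in PiM UNIV (\<lambda>_. \<xi>). 0 \<le> random_sum (\<lambda>x. x) (n, w)"
   by (rule Q.AE_pair)
  then have "AE w in PiM UNIV (\<lambda>_::nat. \<xi>). 0 \<le> random_sum (\<lambda>x. x) (1, w)"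
   by (simp add: AE_measure_pmf_iff set_pmf_poisson[OF *(1)])
  then have "AE w in PiM UNIV (\<lambda>_::nat. \<xi>). 0 \<le> w 0" by (simp add: random_sum_def)
  then have "AE x in distr (PiM UNIV (\<lambda>_::nat. \<xi>)) borel (\<lambda>w. w 0). 0 \<le> x"
   by (subst AE_distr_iff) (auto intro: measurable_PiM_real_component[OF *(2)])
  then show ?thesis unfolding distr_PiM_real_component[of "\<lambda>_. \<xi>", OF *(2)] .
 qed
 with * show ?thesis by blast
qed

text \<open>Rounding down to multiples of \<open>1 / 2 ^ n\<close> inside \<open>[- n, n]\<close>,
  and to 0 outside: the range is finite, and nonnegative numbers stay nonnegative, as positive type
  requires.\<close>

definition rounding :: "nat \<Rightarrow> real \<Rightarrow> real" where
 "rounding n x = (if \<bar>x\<bar> \<le> real n then of_int \<lfloor>x * 2 ^ n\<rfloor> / 2 ^ n else 0)"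

lemma rounding_measurable [measurable]: "rounding n \<in> borel_measurable borel"
 unfolding rounding_def by measurable

lemma rounding_nonneg: "0 \<le> x \<Longrightarrow> 0 \<le> rounding n x"
 by (simp add: rounding_def)

lemma finite_range_rounding: "finite (range (rounding n))"
proof -
 let ?N = "int n * 2 ^ n + 1"
 have "range (rounding n) \<subseteq> insert 0 ((\<lambda>k. of_int k / 2 ^ n) ` {- ?N..?N})"
 proof
  fix y assume "y \<in> range (rounding n)"
  then obtain x where y: "y = rounding n x" by auto
  show "y \<in> insert 0 ((\<lambda>k. of_int k / 2 ^ n) ` {- ?N..?N})"
  proof (cases "\<bar>x\<bar> \<le> real n")
   case True
   then have "x * 2 ^ n \<le> real n * 2 ^ n" "(- real n) * 2 ^ n \<le> x * 2 ^ n"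
    by (intro mult_right_mono; simp)+
   then have "x * 2 ^ n \<le> of_int (int n * 2 ^ n)" "of_int (- (int n * 2 ^ n)) \<le> x * 2 ^ n" by simp_all
   then have "\<lfloor>x * 2 ^ n\<rfloor> \<le> int n * 2 ^ n" "- (int n * 2 ^ n) \<le> \<lfloor>x * 2 ^ n\<rfloor>"
    by (metis floor_mono floor_of_int, metis le_floor_iff)
   then show ?thesis using True by (auto simp: y rounding_def)
  qed (simp add: y rounding_def)
 qed
 then show ?thesis by (rule finite_subset) auto
qed

lemma rounding_tendsto: "(\<lambda>n. rounding n x) \<longlonglongrightarrow> x"
proof -
 have "(\<lambda>n. rounding n x - x) \<longlonglongrightarrow> 0"
 proof (rule Lim_null_comparison)
  show "\<forall>\<^sub>F n in sequentially. norm (rounding n x - x) \<le> (1 / 2) ^ n"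
  proof (rule eventually_sequentiallyI)
   fix n assume "nat \<lceil>\<bar>x\<bar>\<rceil> \<le> n"
   then have "\<bar>x\<bar> \<le> real n" by linarith
   then have "rounding n x - x = (of_int \<lfloor>x * 2 ^ n\<rfloor> - x * 2 ^ n) / 2 ^ n" by (simp add: rounding_def field_simps)
   also have "norm ... \<le> 1 / 2 ^ n"
    unfolding norm_divide by (intro frac_le) (auto simp: abs_le_iff, linarith+)
   finally show "norm (rounding n x - x) \<le> (1 / 2) ^ n" by (simp add: power_one_over)
  qed
  show "(\<lambda>n. (1 / 2 :: real) ^ n) \<longlonglongrightarrow> 0" by (rule LIMSEQ_power_zero) simp
 qed
 then show ?thesis by (rule LIM_zero_cancel)
qed

lemma integral_finite_range:
 fixes h :: "real \<Rightarrow> complex"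
 assumes "prob_space M" and f[measurable]: "f \<in> borel_measurable M" and R: "finite R" "f ` space M \<subseteq> R"
 shows "(\<integral>x. h (f x) \<partial>M) = (\<Sum>v\<in>R. of_real (measure M {x \<in> space M. f x = v}) * h v)"
proof -
 interpret prob_space M by fact
 have "(\<integral>x. h (f x) \<partial>M) = (\<integral>x. (\<Sum>v\<in>R. indicator {x \<in> space M. f x = v} x *\<^sub>R h v) \<partial>M)"
 proof (intro Bochner_Integration.integral_cong refl)
  fix x assume x: "x \<in> space M"
  then have "(\<Sum>v\<in>R. indicator {x \<in> space M. f x = v} x *\<^sub>R h v) = (\<Sum>v\<in>R. if f x = v then h v else 0)"
   by (intro sum.cong) (auto simp: indicator_def)
  also have "... = h (f x)" using x R by (simp add: image_subset_iff)
  finally show "h (f x) = (\<Sum>v\<in>R. indicator {x \<in> space M. f x = v} x *\<^sub>R h v)" ..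
 qed
 also have "... = (\<Sum>v\<in>R. \<integral>x. indicator {x \<in> space M. f x = v} x *\<^sub>R h v \<partial>M)"
  by (intro Bochner_Integration.integral_sum integrable_scaleR_left) (simp add: emeasure_eq_measure)
 also have "... = (\<Sum>v\<in>R. of_real (measure M {x \<in> space M. f x = v}) * h v)"
  by (intro sum.cong refl) (simp add: scaleR_conv_of_real)
 finally show ?thesis .
qed

text \<open>One coordinate of the passage to finitely many jump sizes. \<open>x\<close> has the
  given law, and \<open>y\<close> has the rounded jumps plus an independent Poisson variable of
  small rate; \<open>p\<close> and \<open>c\<close> list the rates of \<open>y\<close>, cut into
  small parts, and the jump sizes.\<close>

lemma compound_poisson_stage:
 assumes \<nu>: "is_compound_poisson \<nu>" and \<epsilon>: "0 < \<epsilon>"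
 shows "\<exists>(M :: ((nat \<times> (nat \<Rightarrow> real)) \<times> nat) measure) x y (I :: (real \<times> nat) option set) p c.
  prob_space M \<and> x \<in> borel_measurable M \<and> y \<in> borel_measurable M \<and> distr M borel x = \<nu> \<and>
  (\<forall>s. char (distr M borel y) s = exp (\<Sum>l\<in>I. of_real (p l) * (iexp (s * c l) - 1))) \<and>
  measure M {w \<in> space M. \<epsilon> < \<bar>x w - y w\<bar>} \<le> 2 * \<epsilon> \<and> finite I \<and> I \<noteq> {} \<and>
  (\<forall>l\<in>I. 0 < p l \<and> p l \<le> 1 / 2 \<and> c l \<noteq> (0::real) \<and> p l * (c l)\<^sup>2 \<le> 1 \<and> (measure_support \<nu> \<subseteq> {0..} \<longrightarrow> 0 < c l)) \<and>
  (\<Sum>l\<in>I. (p l)\<^sup>2) \<le> 2 * \<epsilon>"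
proof -
 obtain m \<xi> where m: "0 < m" and \<xi>: "real_distribution \<xi>" and law: "distr (poisson_paths m \<xi>) borel (random_sum (\<lambda>x. x)) = \<nu>"
  and pos: "measure_support \<nu> \<subseteq> {0..} \<Longrightarrow> AE x in \<xi>. 0 \<le> x"
  using compound_poisson_random_sum[OF \<nu>] by blast
 interpret \<xi>: real_distribution \<xi> by fact
 let ?Q = "poisson_paths m \<xi>"
 interpret Q: prob_space ?Q by (rule prob_space_poisson_paths[OF \<xi>])
 note rm[measurable] = measurable_random_sum[OF \<xi>, of _ "poisson_pmf m"]
 have "(\<lambda>n. measure ?Q {z \<in> space ?Q. \<epsilon> < \<bar>random_sum (\<lambda>x. x) z - random_sum (rounding n) z\<bar>}) \<longlonglongrightarrow> 0"
 proof -
  let ?E = "\<lambda>n. {z \<in> space ?Q. \<epsilon> < \<bar>random_sum (\<lambda>x. x) z - random_sum (rounding n) z\<bar>}"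
  have "(\<lambda>n. \<integral>z. indicator (?E n) z \<partial>?Q) \<longlonglongrightarrow> (\<integral>z. (0::real) \<partial>?Q)"
  proof (rule integral_dominated_convergence[where w="\<lambda>_. 1"])
   show "AE z in ?Q. (\<lambda>n. indicator (?E n) z :: real) \<longlonglongrightarrow> 0"
   proof (rule AE_I2)
    fix z assume "z \<in> space ?Q"
    have "(\<lambda>n. random_sum (rounding n) z) \<longlonglongrightarrow> random_sum (\<lambda>x. x) z"
     unfolding random_sum_def by (intro tendsto_sum rounding_tendsto)
    then have "(\<lambda>n. \<bar>random_sum (\<lambda>x. x) z - random_sum (rounding n) z\<bar>) \<longlonglongrightarrow> \<bar>random_sum (\<lambda>x. x) z - random_sum (\<lambda>x. x) z\<bar>"
     by (intro tendsto_intros)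
    then have "\<forall>\<^sub>F n in sequentially. \<bar>random_sum (\<lambda>x. x) z - random_sum (rounding n) z\<bar> < \<epsilon>"
     using \<epsilon> by (intro order_tendstoD) auto
    then have "\<forall>\<^sub>F n in sequentially. indicator (?E n) z = (0::real)"
     by eventually_elim (auto simp: indicator_def)
    then show "(\<lambda>n. indicator (?E n) z :: real) \<longlonglongrightarrow> 0" by (rule tendsto_eventually)
   qed
  qed (auto simp: indicator_def)
  then show ?thesis by simp
 qed
 from LIMSEQ_D[OF this \<epsilon>] obtain n where n: "measure ?Q {z \<in> space ?Q. \<epsilon> < \<bar>random_sum (\<lambda>x. x) z - random_sum (rounding n) z\<bar>} < \<epsilon>"
  by auto
 let ?f = "rounding n"
 define lam where "lam v = m * measure \<xi> {x. ?f x = v}" for v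
 define R where "R = range ?f"
 have R: "finite R" unfolding R_def by (rule finite_range_rounding)
 define V where "V = {v \<in> R. v \<noteq> 0 \<and> 0 < lam v}"
 have V: "finite V" unfolding V_def using R by simp
 \<comment> \<open>The rate of additional unit jumps. They guarantee that the list of jump sizes is
   nonempty even if all rounded jumps vanish, and they occur with probability at most
   \<open>\<epsilon>\<close>. The bound \<open>1 / 2\<close> is there because
   \<open>\<delta>\<close> is itself one of the listed rates.\<close>
 define \<delta> where "\<delta> = min (1/2) \<epsilon>"
 have \<delta>: "0 < \<delta>" "\<delta> \<le> 1 / 2" "\<delta> \<le> \<epsilon>" using \<epsilon> by (auto simp: \<delta>_def)
 let ?D = "measure_pmf (poisson_pmf \<delta>)"
 interpret QD: pair_prob_space ?Q ?D ..
 let ?M = "?Q \<Otimes>\<^sub>M ?D"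
 define x where "x z = random_sum (\<lambda>x. x) (fst z)" for z :: "(nat \<times> (nat \<Rightarrow> real)) \<times> nat"
 define y where "y z = random_sum ?f (fst z) + real (snd z)" for z :: "(nat \<times> (nat \<Rightarrow> real)) \<times> nat"
 have [measurable]: "x \<in> borel_measurable ?M" "y \<in> borel_measurable ?M"
  unfolding x_def y_def by measurable
 have dx: "distr ?M borel x = \<nu>"
 proof -
  have "distr ?M borel x = distr (distr ?M ?Q fst) borel (random_sum (\<lambda>x. x))"
   by (subst distr_distr) (auto simp: comp_def x_def[abs_def])
  then show ?thesis by (simp add: measure_pmf.distr_pair_fst law)
 qed
 have chy: "char (distr ?M borel y) s = exp ((\<Sum>v\<in>V. of_real (lam v) * (iexp (s * v) - 1)) + of_real \<delta> * (iexp s - 1))" for s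
 proof -
  have int: "integrable ?M (\<lambda>z. iexp (s * y z))" by (intro QD.integrable_const_bound[where B=1]) auto
  have "char (distr ?M borel y) s = (\<integral>z. iexp (s * y z) \<partial>?M)" by (rule char_distr) measurable
  also have "... = (\<integral>u. (\<integral>k. iexp (s * y (u, k)) \<partial>?D) \<partial>?Q)" using QD.integral_fst'[OF int] by simp
  also have "... = (\<integral>u. (\<integral>k. iexp (s * random_sum ?f u) * iexp (s * real k) \<partial>?D) \<partial>?Q)"
   by (intro Bochner_Integration.integral_cong refl) (simp add: y_def ring_distribs exp_add)
  also have "... = (\<integral>u. iexp (s * random_sum ?f u) \<partial>?Q) * (\<integral>k. iexp (s * real k) \<partial>?D)" by simp
  also have "(\<integral>u. iexp (s * random_sum ?f u) \<partial>?Q) = char (distr ?Q borel (random_sum ?f)) s"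
   by (rule char_distr[symmetric]) measurable
  also have "... = exp (of_real m * ((\<integral>x. iexp (s * ?f x) \<partial>\<xi>) - 1))" by (rule char_random_sum[OF \<xi> m]) measurable
  also have "of_real m * ((\<integral>x. iexp (s * ?f x) \<partial>\<xi>) - 1) = of_real m * (\<integral>x. iexp (s * ?f x) - 1 \<partial>\<xi>)"
  proof -
   have "(\<lambda>x. iexp (s * ?f x)) \<in> borel_measurable borel" by measurable
   then have "integrable \<xi> (\<lambda>x. iexp (s * ?f x))"
    by (intro \<xi>.integrable_const_bound[where B=1]) (simp_all add: norm_exp_i_times measurable_cong_sets[OF \<xi>.events_eq_borel refl] del: of_real_mult)
   then show ?thesis using \<xi>.prob_space by simp
  qed
  also have "(\<integral>x. iexp (s * ?f x) - 1 \<partial>\<xi>) = (\<Sum>v\<in>R. of_real (measure \<xi> {x. ?f x = v}) * (iexp (s * v) - 1))"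
   using integral_finite_range[of \<xi> ?f R "\<lambda>v. iexp (s * v) - 1"] R \<xi>.prob_space_axioms
   by (simp add: R_def measurable_cong_sets[OF \<xi>.events_eq_borel refl])
  also have "of_real m * ... = (\<Sum>v\<in>R. of_real (lam v) * (iexp (s * v) - 1))"
   by (simp add: sum_distrib_left lam_def mult.assoc)
  also have "... = (\<Sum>v\<in>V. of_real (lam v) * (iexp (s * v) - 1))"
  proof (rule sum.mono_neutral_right[OF R])
   have "0 \<le> lam v" for v using m by (simp add: lam_def)
   then show "\<forall>v\<in>R - V. of_real (lam v) * (iexp (s * v) - 1) = 0"
    by (auto simp: V_def less_le)
  qed (auto simp: V_def)
  also have "(\<integral>k. iexp (s * real k) \<partial>?D) = exp (of_real \<delta> * (iexp s - 1))"
   using char_nat_law_poisson[OF \<delta>(1), of 1 s] unfolding nat_law_def by (subst (asm) char_distr) simp_all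
  finally show ?thesis by (simp add: exp_add)
 qed
 have small: "measure ?M {w \<in> space ?M. \<epsilon> < \<bar>x w - y w\<bar>} \<le> 2 * \<epsilon>"
 proof -
  let ?A = "{z \<in> space ?Q. \<epsilon> < \<bar>random_sum (\<lambda>x. x) z - random_sum ?f z\<bar>}"
  have "{w \<in> space ?M. \<epsilon> < \<bar>x w - y w\<bar>} \<subseteq> (?A \<times> UNIV) \<union> (space ?Q \<times> (- {0}))"
   by (auto simp: x_def y_def space_pair_measure)
  then have "measure ?M {w \<in> space ?M. \<epsilon> < \<bar>x w - y w\<bar>} \<le> measure ?M ((?A \<times> UNIV) \<union> (space ?Q \<times> (- {0})))"
   by (intro QD.finite_measure_mono) auto
  also have "... \<le> measure ?M (?A \<times> UNIV) + measure ?M (space ?Q \<times> (- {0}))"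
   by (intro measure_Un_le) auto
  also have "measure ?M (?A \<times> UNIV) = measure ?Q ?A"
   by (simp add: measure_def measure_pmf.emeasure_pair_measure_Times)
  also have "measure ?M (space ?Q \<times> (- {0})) = measure ?D (- {0})"
   by (simp add: measure_def measure_pmf.emeasure_pair_measure_Times Q.emeasure_space_1)
  also have "measure ?D (- {0}) = 1 - exp (- \<delta>)"
   using measure_pmf.prob_compl[of "{0}" "poisson_pmf \<delta>"] by (simp add: Compl_eq_Diff_UNIV measure_pmf_single pmf_poisson[OF \<delta>(1)])
  also have "1 - exp (- \<delta>) \<le> \<epsilon>" using exp_ge_add_one_self[of "- \<delta>"] \<delta> by simp
  finally show ?thesis using n by simp
 qed
 \<comment> \<open>One \<open>q\<close> for three purposes: the three summands make
   \<open>lam v / q\<close> at most \<open>1 / 2\<close>, make \<open>lam v / q * v\<^sup>2\<close>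
   at most 1, and bound the sum of the squared rates by \<open>\<epsilon>\<close>.\<close>
 obtain q :: nat where q: "(\<Sum>v\<in>V. 2 * lam v + lam v * v\<^sup>2 + (lam v)\<^sup>2 / \<epsilon>) < real q" using reals_Archimedean2 by blast
 have trm: "0 \<le> 2 * lam v + lam v * v\<^sup>2 + (lam v)\<^sup>2 / \<epsilon>" if "v \<in> V" for v
  using that \<epsilon> by (auto simp: V_def)
 have "0 \<le> (\<Sum>v\<in>V. 2 * lam v + lam v * v\<^sup>2 + (lam v)\<^sup>2 / \<epsilon>)" by (intro sum_nonneg trm)
 with q have q0: "0 < real q" by linarith
 have qv: "2 * lam v + lam v * v\<^sup>2 + (lam v)\<^sup>2 / \<epsilon> < real q" if "v \<in> V" for v
  using member_le_sum[OF that, of "\<lambda>v. 2 * lam v + lam v * v\<^sup>2 + (lam v)\<^sup>2 / \<epsilon>"] trm V q by fastforce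
 \<comment> \<open>\<open>None\<close> stands for the additional unit jump,
   \<open>Some (v, k)\<close> for the \<open>k\<close>-th of \<open>q\<close> equal parts of the
   rate of the jump \<open>v\<close>.\<close>
 define I where "I = insert None (Some ` (V \<times> {..<q}))"
 define p where "p l = (case l of None \<Rightarrow> \<delta> | Some vk \<Rightarrow> lam (fst vk) / real q)" for l :: "(real \<times> nat) option"
 define c where "c l = (case l of None \<Rightarrow> 1 | Some vk \<Rightarrow> fst vk)" for l :: "(real \<times> nat) option"
 have sumI: "(\<Sum>l\<in>I. g l) = g None + (\<Sum>v\<in>V. \<Sum>k<q. g (Some (v, k)))" for g :: "(real \<times> nat) option \<Rightarrow> 'z::comm_monoid_add"
  unfolding I_def using V by (subst sum.insert) (auto simp: sum.reindex sum.cartesian_product case_prod_beta)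
 have chI: "char (distr ?M borel y) s = exp (\<Sum>l\<in>I. of_real (p l) * (iexp (s * c l) - 1))" for s
  unfolding chy sumI using q0 by (simp add: p_def c_def add.commute)
 have fI: "finite I" "I \<noteq> {}" unfolding I_def using V by auto
 have perI: "0 < p l \<and> p l \<le> 1 / 2 \<and> c l \<noteq> 0 \<and> p l * (c l)\<^sup>2 \<le> 1 \<and> (measure_support \<nu> \<subseteq> {0..} \<longrightarrow> 0 < c l)" if "l \<in> I" for l
 proof (cases l)
  case None
  then show ?thesis using \<delta> by (simp add: p_def c_def)
 next
  case (Some vk)
  then have v: "fst vk \<in> V" using that by (auto simp: I_def)
  then have lv: "0 < lam (fst vk)" "fst vk \<noteq> 0" by (auto simp: V_def)
  have "0 \<le> lam (fst vk) * (fst vk)\<^sup>2" "0 \<le> (lam (fst vk))\<^sup>2 / \<epsilon>" using lv \<epsilon> by auto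
  with qv[OF v] lv have "2 * lam (fst vk) \<le> real q" "lam (fst vk) * (fst vk)\<^sup>2 \<le> real q" by linarith+
  \<comment> \<open>Nonnegative jumps are rounded to nonnegative values, so a negative
    \<open>v\<close> would have rate 0.\<close>
  moreover have "0 < fst vk" if "measure_support \<nu> \<subseteq> {0..}"
  proof (rule ccontr)
   assume "\<not> 0 < fst vk"
   then have "fst vk < 0" using lv by simp
   then have sub: "{x. ?f x = fst vk} \<subseteq> {x. \<not> 0 \<le> x}"
    using rounding_nonneg[of _ n] by fastforce
   have "AE x in \<xi>. 0 \<le> x" by (rule pos[OF that])
   then have "AE x in \<xi>. x \<notin> {x. ?f x = fst vk}" by eventually_elim (use sub in auto)
   then have "measure \<xi> {x. ?f x = fst vk} = 0"
    by (subst \<xi>.prob_eq_0) (auto simp: \<xi>.events_eq_borel)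
   with lv show False by (simp add: lam_def)
  qed
  ultimately show ?thesis using lv q0 Some by (auto simp: p_def c_def field_simps)
 qed
 have sqI: "(\<Sum>l\<in>I. (p l)\<^sup>2) \<le> 2 * \<epsilon>"
 proof -
  have "(\<Sum>v\<in>V. \<Sum>k<q. (lam v / real q)\<^sup>2) = (\<Sum>v\<in>V. (lam v)\<^sup>2) / real q"
   using q0 by (simp add: power_divide power2_eq_square sum_divide_distrib)
  also have "... \<le> \<epsilon>"
  proof -
   have "(\<Sum>v\<in>V. (lam v)\<^sup>2 / \<epsilon>) \<le> (\<Sum>v\<in>V. 2 * lam v + lam v * v\<^sup>2 + (lam v)\<^sup>2 / \<epsilon>)"
    by (intro sum_mono) (auto simp: V_def)
   with q have "(\<Sum>v\<in>V. (lam v)\<^sup>2) / \<epsilon> \<le> real q" by (simp add: sum_divide_distrib)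
   then show ?thesis using q0 \<epsilon> by (simp add: field_simps)
  qed
  finally have 1: "(\<Sum>v\<in>V. \<Sum>k<q. (lam v / real q)\<^sup>2) \<le> \<epsilon>" .
  have "\<delta>\<^sup>2 \<le> 1 * \<epsilon>" unfolding power2_eq_square using \<delta> \<epsilon> by (intro mult_mono) auto
  with 1 show ?thesis unfolding sumI by (simp add: p_def)
 qed
 have pM: "prob_space ?M" by unfold_locales
 have mxy: "x \<in> borel_measurable ?M" "y \<in> borel_measurable ?M" by measurable
 show ?thesis
  by (rule exI[of _ ?M], rule exI[of _ x], rule exI[of _ y], rule exI[of _ I], rule exI[of _ p], rule exI[of _ c], intro conjI)
    (rule pM mxy dx small fI sqI chI[THEN allI] ballI[OF perI] | assumption)+
qed

lemma real_distribution_compound_poisson: "is_compound_poisson \<nu> \<Longrightarrow> real_distribution \<nu>"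
 using compound_poisson_char(1) by (auto simp: is_compound_poisson_def)

lemma two_point_sequence_nat_law:
 assumes pc: "\<And>i. 0 < p i \<and> p i \<le> 1 / 2 \<and> c i \<noteq> 0 \<and> p i * (c i)\<^sup>2 \<le> 1"
 shows "two_point_sequence (\<lambda>i. nat_law (c i) (bern (p i)))" "bounded_variances (\<lambda>i. nat_law (c i) (bern (p i)))"
  and "(\<And>i. 0 < c i) \<Longrightarrow> left_heavy_two_point_sequence (\<lambda>i. nat_law (c i) (bern (p i)))"
proof -
 have p: "0 < p i" "p i < 1" "c i \<noteq> 0" for i using pc[of i] by auto
 note tp = two_point_nat_law[OF p]
 show "two_point_sequence (\<lambda>i. nat_law (c i) (bern (p i)))"
  unfolding two_point_sequence_def using real_distribution_nat_law p(3) by (auto simp: tp(1) card_insert_if)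
 show "bounded_variances (\<lambda>i. nat_law (c i) (bern (p i)))"
  unfolding bounded_variances_def tp(4)
 proof (rule bdd_aboveI2[where M=1])
  fix i
  have "p i * (1 - p i) * (c i)\<^sup>2 = (1 - p i) * (p i * (c i)\<^sup>2)" by simp
  also have "... \<le> 1 * 1" using pc[of i] by (intro mult_mono) auto
  finally show "p i * (1 - p i) * (c i)\<^sup>2 \<le> 1" by simp
 qed
 show "left_heavy_two_point_sequence (\<lambda>i. nat_law (c i) (bern (p i)))" if c: "\<And>i. 0 < c i"
  unfolding left_heavy_two_point_sequence_def
 proof (intro allI conjI real_distribution_nat_law exI)
  fix i
  show "0 < c i" by (rule c)
  show "measure_support (nat_law (c i) (bern (p i))) = {0, c i}" by (rule tp(1))
  show "measure (nat_law (c i) (bern (p i))) {c i} \<le> measure (nat_law (c i) (bern (p i))) {0}"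
   using pc[of i] by (simp add: tp(2,3))
 qed
qed

text \<open>Three changes of the sequence: jumps are rounded with summable errors
  \<open>\<epsilon> n\<close>; each rounded law is split into independent Poisson multiples, which
  is a regrouping read backwards; each Poisson variable is replaced by a Bernoulli variable.\<close>

lemma compound_poisson_to_two_point:
 assumes \<nu>: "\<And>n. is_compound_poisson (\<nu> n)"
 shows "\<exists>\<mu>. two_point_sequence \<mu> \<and> bounded_variances \<mu> \<and> isomorphic_actions (tail_boundary_flow \<nu>) (tail_boundary_flow \<mu>) \<and>
  ((\<forall>n. measure_support (\<nu> n) \<subseteq> {0..}) \<longrightarrow> left_heavy_two_point_sequence \<mu>)"
proof -
 define \<epsilon> where "\<epsilon> n = (1 / 2 :: real) ^ n" for n :: nat
 have \<epsilon>: "0 < \<epsilon> n" for n by (simp add: \<epsilon>_def)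
 have \<epsilon>s: "summable \<epsilon>" unfolding \<epsilon>_def by (rule summable_geometric) simp
 let ?P = "\<lambda>n (M :: ((nat \<times> (nat \<Rightarrow> real)) \<times> nat) measure, x, y, I :: (real \<times> nat) option set, p, c).
  prob_space M \<and> x \<in> borel_measurable M \<and> y \<in> borel_measurable M \<and> distr M borel x = \<nu> n \<and>
  (\<forall>s. char (distr M borel y) s = exp (\<Sum>l\<in>I. of_real (p l) * (iexp (s * c l) - 1))) \<and>
  measure M {w \<in> space M. \<epsilon> n < \<bar>x w - y w\<bar>} \<le> 2 * \<epsilon> n \<and> finite I \<and> I \<noteq> {} \<and>
  (\<forall>l\<in>I. 0 < p l \<and> p l \<le> 1 / 2 \<and> c l \<noteq> (0::real) \<and> p l * (c l)\<^sup>2 \<le> 1 \<and> (measure_support (\<nu> n) \<subseteq> {0..} \<longrightarrow> 0 < c l)) \<and>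
  (\<Sum>l\<in>I. (p l)\<^sup>2) \<le> 2 * \<epsilon> n"
 have "\<exists>X. ?P n X" for n
  using compound_poisson_stage[OF \<nu> \<epsilon>, of n n] by (auto simp: split_paired_Ex)
 then have "\<exists>X. \<forall>n. ?P n (X n)" by (intro choice allI)
 then obtain X where X: "\<And>n. ?P n (X n)" by blast
 define M where "M n = fst (X n)" for n
 define x where "x n = fst (snd (X n))" for n
 define y where "y n = fst (snd (snd (X n)))" for n
 define I where "I n = fst (snd (snd (snd (X n))))" for n
 define p where "p n = fst (snd (snd (snd (snd (X n)))))" for n
 define c where "c n = snd (snd (snd (snd (snd (X n)))))" for n
 have S: "prob_space (M n)" "x n \<in> borel_measurable (M n)" "y n \<in> borel_measurable (M n)" "distr (M n) borel (x n) = \<nu> n"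
  "char (distr (M n) borel (y n)) s = exp (\<Sum>l\<in>I n. of_real (p n l) * (iexp (s * c n l) - 1))"
  "measure (M n) {w \<in> space (M n). \<epsilon> n < \<bar>x n w - y n w\<bar>} \<le> 2 * \<epsilon> n" "finite (I n)" "I n \<noteq> {}"
  "(\<Sum>l\<in>I n. (p n l)\<^sup>2) \<le> 2 * \<epsilon> n" for n s
  using X[of n] by (auto simp: M_def x_def y_def I_def p_def c_def split_beta)
 have pc: "0 < p n l \<and> p n l \<le> 1 / 2 \<and> c n l \<noteq> (0::real) \<and> p n l * (c n l)\<^sup>2 \<le> 1"
  "measure_support (\<nu> n) \<subseteq> {0..} \<Longrightarrow> 0 < c n l" if "l \<in> I n" for n l
  using X[of n] that by (auto simp: M_def x_def y_def I_def p_def c_def split_beta)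
 let ?D = "\<lambda>n. distr (M n) borel (y n)"
 have D: "real_distribution (?D n)" for n by (intro real_distribution_distr_map S)
 have iso1: "isomorphic_actions (tail_boundary_flow \<nu>) (tail_boundary_flow ?D)"
  unfolding S(4)[symmetric]
 proof (rule coupling_isomorphic_convergent)
  show "AE w in PiM UNIV M. convergent (\<lambda>n. \<Sum>k<n. x k (w k) - y k (w k))"
   by (rule AE_convergent_sum[where \<delta>=\<epsilon> and B="\<lambda>n. 2 * \<epsilon> n"])
     (use S(1,2,3,6) \<epsilon>s in \<open>auto intro: summable_mult\<close>)
 qed (use S(1,2,3) in auto)
 \<comment> \<open>All parts of all coordinates in one list. Every \<open>I n\<close> is finite and
   nonempty, so \<open>A\<close> is countably infinite and can be enumerated by
   \<open>nat\<close>.\<close>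
 define A where "A = Sigma UNIV I"
 have "infinite A"
 proof
  assume "finite A"
  then have "finite (fst ` A)" by simp
  moreover have "fst ` A = UNIV" using S(8) unfolding A_def by (force simp: image_iff)
  ultimately show False by simp
 qed
 moreover have "countable A" unfolding A_def using S(7) by (auto intro: countable_finite)
 ultimately obtain h :: "nat \<Rightarrow> _" where h: "bij_betw h UNIV A"
  by (metis bij_betw_from_nat_into)
 define p' where "p' k = p (fst (h k)) (snd (h k))" for k
 define c' where "c' k = c (fst (h k)) (snd (h k))" for k
 have hA: "h k \<in> A" for k using h by (auto simp: bij_betw_def)
 have hI: "snd (h k) \<in> I (fst (h k))" for k using hA[of k] by (cases "h k") (auto simp: A_def)
 have pc': "0 < p' k \<and> p' k \<le> 1 / 2 \<and> c' k \<noteq> 0 \<and> p' k * (c' k)\<^sup>2 \<le> 1" for k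
  unfolding p'_def c'_def by (rule pc(1)[OF hI])
 let ?\<rho> = "\<lambda>k. nat_law (c' k) (poisson_pmf (p' k))"
 let ?\<mu> = "\<lambda>k. nat_law (c' k) (bern (p' k))"
 define J where "J n = {k. fst (h k) = n}" for n
 have hJ: "bij_betw h (J n) (Pair n ` I n)" for n
  unfolding bij_betw_def
 proof
  show "inj_on h (J n)" using h by (auto simp: bij_betw_def inj_on_def)
  show "h ` J n = Pair n ` I n"
  proof (intro equalityI subsetI)
   fix z assume "z \<in> h ` J n"
   then show "z \<in> Pair n ` I n" using hI by (force simp: J_def image_iff)
  next
   fix z assume z: "z \<in> Pair n ` I n"
   then have "z \<in> A" by (auto simp: A_def)
   then obtain k where "z = h k" using h by (auto simp: bij_betw_def)
   with z show "z \<in> h ` J n" by (auto simp: J_def)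
  qed
 qed
 have Jfin: "finite (J n)" for n using bij_betw_finite[OF hJ[of n]] S(7)[of n] by simp
 have Jdis: "disjoint_family J" by (auto simp: disjoint_family_on_def J_def)
 have Jun: "(\<Union>n. J n) = UNIV" by (auto simp: J_def)
 have sumJ: "(\<Sum>k\<in>J n. g (h k)) = (\<Sum>l\<in>I n. g (n, l))" for n and g :: "_ \<Rightarrow> 'z::comm_monoid_add"
  using sum.reindex_bij_betw[OF hJ, of g n] by (simp add: sum.reindex inj_on_def)
 have "distr (PiM UNIV ?\<rho>) borel (\<lambda>w. \<Sum>i\<in>J n. w i) = ?D n" for n
 proof (rule char_eq_imp_eq[OF _ D])
  show "real_distribution (distr (PiM UNIV ?\<rho>) borel (\<lambda>w. \<Sum>i\<in>J n. w i))"
   by (intro real_distribution_distr_map prob_space_PiM_real borel_measurable_sum measurable_PiM_real_component real_distribution_nat_law)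
  fix s
  have "char (distr (PiM UNIV ?\<rho>) borel (\<lambda>w. \<Sum>i\<in>J n. w i)) s = (\<Prod>k\<in>J n. exp (of_real (p' k) * (iexp (s * c' k) - 1)))"
   by (subst char_distr_sum_PiM) (use pc' in \<open>auto simp: real_distribution_nat_law char_nat_law_poisson\<close>)
  also have "... = exp (\<Sum>k\<in>J n. of_real (p' k) * (iexp (s * c' k) - 1))" using Jfin by (simp add: exp_sum)
  also have "(\<Sum>k\<in>J n. of_real (p' k) * (iexp (s * c' k) - 1)) = (\<Sum>l\<in>I n. of_real (p n l) * (iexp (s * c n l) - 1))"
   using sumJ[of "\<lambda>z. of_real (p (fst z) (snd z)) * (iexp (s * c (fst z) (snd z)) - 1)" n] by (simp add: p'_def c'_def)
  finally show "char (distr (PiM UNIV ?\<rho>) borel (\<lambda>w. \<Sum>i\<in>J n. w i)) s = char (?D n) s" by (simp add: S(5))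
 qed
 then have iso2: "isomorphic_actions (tail_boundary_flow ?D) (tail_boundary_flow ?\<rho>)"
  using regroup_isomorphic(2)[of ?\<rho> J, OF real_distribution_nat_law Jfin Jdis Jun] by simp
 \<comment> \<open>The enumeration \<open>h\<close> need not follow the order of the blocks, so an
   initial segment is enclosed in finitely many complete blocks.\<close>
 have sum2: "summable (\<lambda>k. (p' k)\<^sup>2)"
 proof (rule summableI_nonneg_bounded)
  fix N
  define B where "B = Suc (Max (insert 0 ((\<lambda>k. fst (h k)) ` {..<N})))"
  have "fst (h k) < B" if "k < N" for k
   unfolding B_def less_Suc_eq_le using that by (intro Max_ge) auto
  then have "{..<N} \<subseteq> (\<Union>n<B. J n)" by (auto simp: J_def)
  then have "(\<Sum>k<N. (p' k)\<^sup>2) \<le> (\<Sum>k\<in>(\<Union>n<B. J n). (p' k)\<^sup>2)"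
   using Jfin by (intro sum_mono2) auto
  also have "... = (\<Sum>n<B. \<Sum>k\<in>J n. (p' k)\<^sup>2)"
   using Jfin Jdis by (subst sum.UNION_disjoint) (auto simp: disjoint_family_on_def)
  also have "... = (\<Sum>n<B. \<Sum>l\<in>I n. (p n l)\<^sup>2)"
   using sumJ[of "\<lambda>z. (p (fst z) (snd z))\<^sup>2"] by (simp add: p'_def)
  also have "... \<le> (\<Sum>n<B. 2 * \<epsilon> n)" by (intro sum_mono S(9))
  also have "... \<le> (\<Sum>n. 2 * \<epsilon> n)" using \<epsilon>s \<epsilon> by (intro sum_le_suminf summable_mult) (auto intro: less_imp_le)
  finally show "(\<Sum>k<N. (p' k)\<^sup>2) \<le> (\<Sum>n. 2 * \<epsilon> n)" .
 qed simp
 have iso3: "isomorphic_actions (tail_boundary_flow ?\<rho>) (tail_boundary_flow ?\<mu>)"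
 proof (rule nat_laws_isomorphic[OF bern_poisson_le sum2])
  show "0 < p' k" "p' k \<le> 1" for k using pc'[of k] by auto
 qed
 note alg = linf_algebra_tail_boundary_flow
 have iso12: "isomorphic_actions (tail_boundary_flow \<nu>) (tail_boundary_flow ?\<rho>)"
  by (rule isomorphic_actions_trans[OF alg alg iso1 iso2]) (rule real_distribution_compound_poisson[OF \<nu>] D)+
 have "isomorphic_actions (tail_boundary_flow \<nu>) (tail_boundary_flow ?\<mu>)"
  by (rule isomorphic_actions_trans[OF alg alg iso12 iso3]) (rule real_distribution_compound_poisson[OF \<nu>] real_distribution_nat_law)+
 moreover have "left_heavy_two_point_sequence ?\<mu>" if "\<forall>n. measure_support (\<nu> n) \<subseteq> {0..}"
  by (rule two_point_sequence_nat_law(3)[OF pc']) (use that pc(2)[OF hI] in \<open>auto simp: c'_def\<close>)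
 ultimately show ?thesis using two_point_sequence_nat_law(1,2)[of p' c', OF pc'] by blast
qed

section \<open>An energy estimate\<close>

lemma (in prob_space) expectation_abs_le_sqrt:
 fixes Y :: "'a \<Rightarrow> real"
 assumes [measurable]: "Y \<in> borel_measurable M" and B: "\<And>w. \<bar>Y w\<bar> \<le> B"
 shows "expectation (\<lambda>w. \<bar>Y w\<bar>) \<le> sqrt (expectation (\<lambda>w. (Y w)\<^sup>2))"
proof -
 have i1: "integrable M (\<lambda>w. \<bar>Y w\<bar>)" by (intro integrable_const_bound[where B=B]) (auto simp: B)
 have "norm ((Y w)\<^sup>2) \<le> B\<^sup>2" for w using power_mono[OF B[of w], of 2] by simp
 then have i2: "integrable M (\<lambda>w. (Y w)\<^sup>2)" by (intro integrable_const_bound[where B="B\<^sup>2"]) auto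
 have "0 \<le> variance (\<lambda>w. \<bar>Y w\<bar>)" by (rule variance_positive)
 also have "... = expectation (\<lambda>w. (Y w)\<^sup>2) - (expectation (\<lambda>w. \<bar>Y w\<bar>))\<^sup>2"
  using i1 i2 by (subst variance_eq) auto
 finally show ?thesis by (intro real_le_rsqrt) simp
qed

text \<open>Pairing \<open>h\<close> with the linear statistic \<open>\<Sum>k. d k * \<xi> k\<close> produces, by the integration by parts
 formula \<open>ibp\<close>, the average of \<open>D\<close> with weight \<open>\<Sum>k. (d k)\<^sup>2 * indicator (E k)\<close>. That weight has mean \<open>W\<close>
 and fluctuations of order \<open>sqrt W\<close>, which is also the size of the linear statistic.\<close>

lemma (in prob_space) energy_estimate:
 fixes h D g :: "'a \<Rightarrow> complex" and h' :: "'i \<Rightarrow> 'a \<Rightarrow> complex" and \<xi> :: "'i \<Rightarrow> 'a \<Rightarrow> real" and d q :: "'i \<Rightarrow> real"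
 assumes F: "finite F"
  and [measurable]: "\<And>k. k \<in> F \<Longrightarrow> E k \<in> events" "\<And>k. k \<in> F \<Longrightarrow> \<xi> k \<in> borel_measurable M" "h \<in> borel_measurable M"
    "\<And>k. k \<in> F \<Longrightarrow> h' k \<in> borel_measurable M" "D \<in> borel_measurable M" "g \<in> borel_measurable M"
  and q: "\<And>k. k \<in> F \<Longrightarrow> prob (E k) = q k"
  and ind: "\<And>j k. j \<in> F \<Longrightarrow> k \<in> F \<Longrightarrow> j \<noteq> k \<Longrightarrow> prob (E j \<inter> E k) = q j * q k"
  and unc: "\<And>j k. j \<in> F \<Longrightarrow> k \<in> F \<Longrightarrow> j \<noteq> k \<Longrightarrow> expectation (\<lambda>w. \<xi> j w * \<xi> k w) = 0"
  and var: "\<And>k. k \<in> F \<Longrightarrow> expectation (\<lambda>w. (\<xi> k w)\<^sup>2) \<le> \<kappa> * q k" and xb: "\<And>k w. k \<in> F \<Longrightarrow> \<bar>\<xi> k w\<bar> \<le> X"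
  and ibp: "\<And>k. k \<in> F \<Longrightarrow> expectation (\<lambda>w. \<xi> k w *\<^sub>R (h w * g w)) = expectation (\<lambda>w. indicator (E k) w *\<^sub>R ((h w - h' k w) * g w))"
  and hB: "\<And>w. cmod (h w) \<le> B" and h'B: "\<And>k w. k \<in> F \<Longrightarrow> cmod (h' k w) \<le> B" and DB: "\<And>w. cmod (D w) \<le> B'" and gB: "\<And>w. cmod (g w) \<le> 1"
  and lin: "\<And>k. k \<in> F \<Longrightarrow> AE w in M. cmod (h w - h' k w - d k *\<^sub>R D w) \<le> \<epsilon> * \<bar>d k\<bar>"
  and dl: "\<And>k. k \<in> F \<Longrightarrow> \<bar>d k\<bar> \<le> l"
  and nn: "0 \<le> \<epsilon>" "0 \<le> l" "0 \<le> \<kappa>"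
 defines "W \<equiv> \<Sum>k\<in>F. q k * (d k)\<^sup>2"
 shows "W * cmod (expectation (\<lambda>w. D w * g w)) \<le> B * sqrt (\<kappa> * W) + \<epsilon> * W + B' * (l * sqrt W)"
proof -
 have B0: "0 \<le> B" "0 \<le> B'" using hB[of undefined] DB[of undefined] norm_ge_zero order_trans by blast+
 have q0: "0 \<le> q k" "q k \<le> 1" if "k \<in> F" for k using q[OF that] measure_nonneg[of M "E k"] by (auto simp flip: q[OF that])
 have W0: "0 \<le> W" unfolding W_def using q0 by (intro sum_nonneg) auto
 have hg: "cmod (h w * g w) \<le> B" for w
  using mult_mono[OF hB gB B0(1) norm_ge_zero] by (simp add: norm_mult)
 have Dg: "cmod (D w * g w) \<le> B'" for w
  using mult_mono[OF DB gB B0(2) norm_ge_zero] by (simp add: norm_mult)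
 have hh: "cmod (h w - h' k w) \<le> 2 * B" if "k \<in> F" for k w
  using norm_triangle_ineq4[of "h w" "h' k w"] hB[of w] h'B[OF that, of w] by linarith
 have hhg: "cmod ((h w - h' k w) * g w) \<le> 2 * B" if "k \<in> F" for k w
  using mult_mono[OF hh[OF that] gB _ norm_ge_zero] B0 by (simp add: norm_mult)
 define Y where "Y w = (\<Sum>k\<in>F. d k * \<xi> k w)" for w
 define T where "T w = (\<Sum>k\<in>F. (d k)\<^sup>2 * indicator (E k) w)" for w
 have [measurable]: "Y \<in> borel_measurable M" "T \<in> borel_measurable M" unfolding Y_def T_def by measurable
 have Yb: "\<bar>Y w\<bar> \<le> (\<Sum>k\<in>F. \<bar>d k\<bar> * X)" for w
  unfolding Y_def by (rule order_trans[OF sum_abs sum_mono]) (auto simp: abs_mult intro!: mult_left_mono xb)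
 have Tb: "\<bar>T w\<bar> \<le> (\<Sum>k\<in>F. (d k)\<^sup>2)" for w
  unfolding T_def by (rule order_trans[OF sum_abs sum_mono]) (auto simp: indicator_def)
 have ixx: "integrable M (\<lambda>w. \<xi> j w * \<xi> k w)" if "j \<in> F" "k \<in> F" for j k
 proof (intro integrable_const_bound[where B="X * X"] AE_I2)
  have "0 \<le> X" using xb[OF that(1)] abs_ge_zero order_trans by blast
  then show "norm (\<xi> j w * \<xi> k w) \<le> X * X" for w
   unfolding real_norm_def abs_mult using xb that by (intro mult_mono) auto
 qed (use that in measurable)
 \<comment> \<open>The mixed terms vanish because the \<open>\<xi> k\<close> are
   uncorrelated.\<close>
 have EY: "expectation (\<lambda>w. (Y w)\<^sup>2) \<le> \<kappa> * W"
 proof -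
  have "expectation (\<lambda>w. (Y w)\<^sup>2) = expectation (\<lambda>w. \<Sum>j\<in>F. \<Sum>k\<in>F. d j * d k * (\<xi> j w * \<xi> k w))"
   by (intro Bochner_Integration.integral_cong refl) (simp add: Y_def power2_eq_square sum_product mult_ac)
  also have "... = (\<Sum>j\<in>F. \<Sum>k\<in>F. d j * d k * expectation (\<lambda>w. \<xi> j w * \<xi> k w))"
   by (simp add: Bochner_Integration.integral_sum Bochner_Integration.integrable_sum ixx)
  also have "... = (\<Sum>j\<in>F. \<Sum>k\<in>F. if j = k then (d j)\<^sup>2 * expectation (\<lambda>w. (\<xi> j w)\<^sup>2) else 0)"
   by (intro sum.cong refl) (auto simp: unc power2_eq_square)
  also have "... = (\<Sum>j\<in>F. (d j)\<^sup>2 * expectation (\<lambda>w. (\<xi> j w)\<^sup>2))" using F by simp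
  also have "... \<le> (\<Sum>j\<in>F. (d j)\<^sup>2 * (\<kappa> * q j))" by (intro sum_mono mult_left_mono var) auto
  also have "... = \<kappa> * W" by (simp add: W_def sum_distrib_left mult_ac)
  finally show ?thesis .
 qed
 have iE: "integrable M (\<lambda>w. indicator (E k) w :: real)" if "k \<in> F" for k :: 'i
  using that by (intro integrable_real_indicator) (auto simp: emeasure_eq_measure)
 \<comment> \<open>Pairwise independence of the events reduces the variance of \<open>T\<close> to a
   sum of single variances; one of the two factors \<open>(d k)\<^sup>2\<close> is bounded by
   \<open>l\<^sup>2\<close>.\<close>
 have ET: "expectation (\<lambda>w. (T w - W)\<^sup>2) \<le> l\<^sup>2 * W"
 proof -
  let ?e = "\<lambda>k w. indicator (E k) w - q k"
  have iee: "integrable M (\<lambda>w. ?e j w * ?e k w)" if "j \<in> F" "k \<in> F" for j k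
  proof (intro integrable_const_bound[where B="1"] AE_I2)
   show "norm (?e j w * ?e k w) \<le> 1" for w
    unfolding norm_mult using q0[OF that(1)] q0[OF that(2)] by (intro mult_le_one) (auto simp: indicator_def)
  qed (use that in measurable)
  have cov: "expectation (\<lambda>w. ?e j w * ?e k w) = (if j = k then q k - (q k)\<^sup>2 else 0)" if jk: "j \<in> F" "k \<in> F" for j k
  proof -
   have ijk: "integrable M (\<lambda>w. indicator (E j \<inter> E k) w :: real)"
    using jk by (intro integrable_real_indicator) (auto simp: emeasure_eq_measure)
   have "expectation (\<lambda>w. ?e j w * ?e k w) = expectation (\<lambda>w. indicator (E j \<inter> E k) w - q k * indicator (E j) w - q j * indicator (E k) w + q j * q k)"
    by (intro Bochner_Integration.integral_cong refl) (auto simp: indicator_inter_arith algebra_simps)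
   also have "... = prob (E j \<inter> E k) - q k * q j - q j * q k + q j * q k"
    using iE[OF jk(1)] iE[OF jk(2)] ijk jk q by (simp add: prob_space)
   finally show ?thesis using ind[OF jk] q[OF jk(2)] by (auto simp: power2_eq_square)
  qed
  have "T w - W = (\<Sum>k\<in>F. (d k)\<^sup>2 * ?e k w)" for w
   unfolding T_def W_def by (simp add: sum_subtractf[symmetric] right_diff_distrib mult.commute)
  then have "expectation (\<lambda>w. (T w - W)\<^sup>2) = expectation (\<lambda>w. \<Sum>j\<in>F. \<Sum>k\<in>F. (d j)\<^sup>2 * (d k)\<^sup>2 * (?e j w * ?e k w))"
   by (intro Bochner_Integration.integral_cong refl) (simp add: power2_eq_square[of "sum _ _"] sum_product mult_ac)
  also have "... = (\<Sum>j\<in>F. \<Sum>k\<in>F. (d j)\<^sup>2 * (d k)\<^sup>2 * expectation (\<lambda>w. ?e j w * ?e k w))"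
   by (simp add: Bochner_Integration.integral_sum Bochner_Integration.integrable_sum iee)
  also have "... = (\<Sum>j\<in>F. \<Sum>k\<in>F. if j = k then (d j)\<^sup>2 * (d k)\<^sup>2 * (q k - (q k)\<^sup>2) else 0)"
   by (intro sum.cong refl) (simp add: cov)
  also have "... = (\<Sum>j\<in>F. (d j)\<^sup>2 * (d j)\<^sup>2 * (q j - (q j)\<^sup>2))" using F by simp
  also have "... \<le> (\<Sum>j\<in>F. (d j)\<^sup>2 * l\<^sup>2 * q j)"
  proof (rule sum_mono)
   fix j assume j: "j \<in> F"
   have "(d j)\<^sup>2 \<le> l\<^sup>2" using power_mono[OF dl[OF j], of 2] by simp
   moreover have "0 \<le> q j - (q j)\<^sup>2" "q j - (q j)\<^sup>2 \<le> q j"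
    using q0[OF j] by (auto simp: power2_eq_square mult_left_le)
   ultimately show "(d j)\<^sup>2 * (d j)\<^sup>2 * (q j - (q j)\<^sup>2) \<le> (d j)\<^sup>2 * l\<^sup>2 * q j"
    by (intro mult_mono mult_nonneg_nonneg) auto
  qed
  also have "... = l\<^sup>2 * W" by (simp add: W_def sum_distrib_left mult_ac)
  finally show ?thesis .
 qed
 have iB: "integrable M f" if "f \<in> borel_measurable M" "\<And>w. cmod (f w) \<le> K" for f K
  using that by (intro integrable_const_bound[where B=K]) auto
 have i1: "integrable M (\<lambda>w. \<xi> k w *\<^sub>R (h w * g w))" if "k \<in> F" for k
 proof (rule iB[of _ "X * B"])
  have "0 \<le> X" using xb[OF that(1)] abs_ge_zero order_trans by blast
  then show "cmod (\<xi> k w *\<^sub>R (h w * g w)) \<le> X * B" for w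
   using mult_mono[OF xb[OF that] hg] by simp
 qed (use that in measurable)
 have i2: "integrable M (\<lambda>w. indicator (E k) w *\<^sub>R ((h w - h' k w) * g w))" if "k \<in> F" for k
  by (rule iB[of _ "2 * B"]) (use that hhg B0 in \<open>auto simp: indicator_def\<close>)
 have i3: "integrable M (\<lambda>w. indicator (E k) w *\<^sub>R (d k *\<^sub>R D w * g w))" if "k \<in> F" for k
  by (rule iB[of _ "\<bar>d k\<bar> * B'"]) (use that Dg B0 in \<open>auto simp: indicator_def intro!: mult_left_mono\<close>)
 have iDg: "integrable M (\<lambda>w. D w * g w)" by (rule iB[OF _ Dg]) measurable
 have iTDg: "integrable M (\<lambda>w. T w *\<^sub>R (D w * g w))"
 proof (rule iB[of _ "(\<Sum>k\<in>F. (d k)\<^sup>2) * B'"])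
  show "cmod (T w *\<^sub>R (D w * g w)) \<le> (\<Sum>k\<in>F. (d k)\<^sup>2) * B'" for w
   using mult_mono[OF Tb Dg] by (simp add: sum_nonneg)
 qed measurable
 define R where "R k = expectation (\<lambda>w. indicator (E k) w *\<^sub>R ((h w - h' k w - d k *\<^sub>R D w) * g w))" for k
 have Rk: "cmod (R k) \<le> \<epsilon> * \<bar>d k\<bar> * q k" if k: "k \<in> F" for k
 proof -
  have [measurable]: "E k \<in> events" "h' k \<in> borel_measurable M" using k by auto
  have "cmod (R k) \<le> expectation (\<lambda>w. cmod (indicator (E k) w *\<^sub>R ((h w - h' k w - d k *\<^sub>R D w) * g w)))"
   unfolding R_def by (rule integral_norm_bound)
  also have "... \<le> expectation (\<lambda>w. \<epsilon> * \<bar>d k\<bar> * indicator (E k) w)"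
  proof (rule integral_mono_AE)
   have "integrable M (\<lambda>w. indicator (E k) w *\<^sub>R ((h w - h' k w) * g w) - indicator (E k) w *\<^sub>R (d k *\<^sub>R D w * g w))"
    using i2[OF k] i3[OF k] by (rule Bochner_Integration.integrable_diff)
   then show "integrable M (\<lambda>w. cmod (indicator (E k) w *\<^sub>R ((h w - h' k w - d k *\<^sub>R D w) * g w)))"
    by (intro integrable_norm) (simp add: algebra_simps scaleR_diff_right)
   show "integrable M (\<lambda>w. \<epsilon> * \<bar>d k\<bar> * indicator (E k) w)" using iE[OF k] by simp
   show "AE w in M. cmod (indicator (E k) w *\<^sub>R ((h w - h' k w - d k *\<^sub>R D w) * g w)) \<le> \<epsilon> * \<bar>d k\<bar> * indicator (E k) w"
    using lin[OF k]
   proof eventually_elim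
    case (elim w)
    have "cmod ((h w - h' k w - d k *\<^sub>R D w) * g w) \<le> (\<epsilon> * \<bar>d k\<bar>) * 1"
     unfolding norm_mult using elim gB nn by (intro mult_mono) auto
    then show ?case by (auto simp: indicator_def)
   qed
  qed
  also have "... = \<epsilon> * \<bar>d k\<bar> * q k" using q[OF k] by simp
  finally show ?thesis .
 qed
 \<comment> \<open>The formula \<open>ibp\<close> term by term, with \<open>h - h' k\<close>
   replaced by \<open>d k *\<^sub>R D\<close> at the cost of \<open>R k\<close>.\<close>
 have split: "expectation (\<lambda>w. Y w *\<^sub>R (h w * g w)) = expectation (\<lambda>w. T w *\<^sub>R (D w * g w)) + (\<Sum>k\<in>F. d k *\<^sub>R R k)"
 proof -
  have "expectation (\<lambda>w. Y w *\<^sub>R (h w * g w)) = expectation (\<lambda>w. \<Sum>k\<in>F. d k *\<^sub>R (\<xi> k w *\<^sub>R (h w * g w)))"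
   by (intro Bochner_Integration.integral_cong refl) (simp add: Y_def scaleR_sum_left)
  also have "... = (\<Sum>k\<in>F. d k *\<^sub>R expectation (\<lambda>w. \<xi> k w *\<^sub>R (h w * g w)))"
   by (subst Bochner_Integration.integral_sum, rule integrable_scaleR_right, erule i1) (simp only: integral_scaleR_right)
  also have "... = (\<Sum>k\<in>F. d k *\<^sub>R expectation (\<lambda>w. indicator (E k) w *\<^sub>R ((h w - h' k w) * g w)))"
   by (intro sum.cong refl) (simp add: ibp)
  also have "... = (\<Sum>k\<in>F. d k *\<^sub>R (R k + expectation (\<lambda>w. indicator (E k) w *\<^sub>R (d k *\<^sub>R D w * g w))))"
  proof (intro sum.cong refl arg_cong2[where f=scaleR])
   fix k assume k: "k \<in> F"
   have "R k = expectation (\<lambda>w. indicator (E k) w *\<^sub>R ((h w - h' k w) * g w) - indicator (E k) w *\<^sub>R (d k *\<^sub>R D w * g w))"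
    unfolding R_def by (intro Bochner_Integration.integral_cong refl) (simp add: algebra_simps scaleR_diff_right)
   also have "... = expectation (\<lambda>w. indicator (E k) w *\<^sub>R ((h w - h' k w) * g w)) - expectation (\<lambda>w. indicator (E k) w *\<^sub>R (d k *\<^sub>R D w * g w))"
    by (rule Bochner_Integration.integral_diff[OF i2[OF k] i3[OF k]])
   finally show "expectation (\<lambda>w. indicator (E k) w *\<^sub>R ((h w - h' k w) * g w)) = R k + expectation (\<lambda>w. indicator (E k) w *\<^sub>R (d k *\<^sub>R D w * g w))"
    by simp
  qed
  also have "... = (\<Sum>k\<in>F. d k *\<^sub>R R k) + (\<Sum>k\<in>F. d k *\<^sub>R expectation (\<lambda>w. indicator (E k) w *\<^sub>R (d k *\<^sub>R D w * g w)))"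
   by (simp add: scaleR_add_right sum.distrib)
  also have "(\<Sum>k\<in>F. d k *\<^sub>R expectation (\<lambda>w. indicator (E k) w *\<^sub>R (d k *\<^sub>R D w * g w))) = expectation (\<lambda>w. \<Sum>k\<in>F. d k *\<^sub>R (indicator (E k) w *\<^sub>R (d k *\<^sub>R D w * g w)))"
   by (subst Bochner_Integration.integral_sum, rule integrable_scaleR_right, erule i3) (simp only: integral_scaleR_right)
  also have "... = expectation (\<lambda>w. T w *\<^sub>R (D w * g w))"
   by (intro Bochner_Integration.integral_cong refl) (simp add: T_def scaleR_sum_left power2_eq_square mult_ac)
  finally show ?thesis by simp
 qed
 have b1: "cmod (expectation (\<lambda>w. Y w *\<^sub>R (h w * g w))) \<le> B * sqrt (\<kappa> * W)"
 proof -
  have "cmod (expectation (\<lambda>w. Y w *\<^sub>R (h w * g w))) \<le> expectation (\<lambda>w. cmod (Y w *\<^sub>R (h w * g w)))" by (rule integral_norm_bound)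
  also have "... \<le> expectation (\<lambda>w. B * \<bar>Y w\<bar>)"
  proof (rule integral_mono)
   have ptw: "cmod (Y w *\<^sub>R (h w * g w)) \<le> B * \<bar>Y w\<bar>" for w
    using mult_left_mono[OF hg, of "\<bar>Y w\<bar>" w] by (simp add: mult.commute)
   then show "cmod (Y w *\<^sub>R (h w * g w)) \<le> B * \<bar>Y w\<bar>" for w .
   show "integrable M (\<lambda>w. B * \<bar>Y w\<bar>)"
    by (intro integrable_mult_right integrable_const_bound[where B="\<Sum>k\<in>F. \<bar>d k\<bar> * X"]) (auto simp: Yb)
   then show "integrable M (\<lambda>w. cmod (Y w *\<^sub>R (h w * g w)))"
    by (rule Bochner_Integration.integrable_bound) (use ptw B0 in \<open>auto intro!: AE_I2 order_trans[OF ptw]\<close>)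
  qed
  also have "... = B * expectation (\<lambda>w. \<bar>Y w\<bar>)" by simp
  also have "... \<le> B * sqrt (expectation (\<lambda>w. (Y w)\<^sup>2))"
   by (intro mult_left_mono expectation_abs_le_sqrt[OF _ Yb] B0) measurable
  also have "... \<le> B * sqrt (\<kappa> * W)" using EY B0 by (intro mult_left_mono real_sqrt_le_mono) auto
  finally show ?thesis .
 qed
 have b2: "cmod (expectation (\<lambda>w. T w *\<^sub>R (D w * g w)) - W *\<^sub>R expectation (\<lambda>w. D w * g w)) \<le> B' * (l * sqrt W)"
 proof -
  have TWb: "\<bar>T w - W\<bar> \<le> (\<Sum>k\<in>F. (d k)\<^sup>2) + W" for w using Tb[of w] W0 by linarith
  have "expectation (\<lambda>w. T w *\<^sub>R (D w * g w)) - W *\<^sub>R expectation (\<lambda>w. D w * g w) = expectation (\<lambda>w. (T w - W) *\<^sub>R (D w * g w))"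
   using iTDg iDg by (simp add: scaleR_diff_left)
  also have "cmod ... \<le> expectation (\<lambda>w. cmod ((T w - W) *\<^sub>R (D w * g w)))" by (rule integral_norm_bound)
  also have "... \<le> expectation (\<lambda>w. B' * \<bar>T w - W\<bar>)"
  proof (rule integral_mono)
   have ptw: "cmod ((T w - W) *\<^sub>R (D w * g w)) \<le> B' * \<bar>T w - W\<bar>" for w
    using mult_left_mono[OF Dg, of "\<bar>T w - W\<bar>" w] by (simp add: mult.commute)
   then show "cmod ((T w - W) *\<^sub>R (D w * g w)) \<le> B' * \<bar>T w - W\<bar>" for w .
   show "integrable M (\<lambda>w. B' * \<bar>T w - W\<bar>)"
    by (intro integrable_mult_right integrable_const_bound[where B="(\<Sum>k\<in>F. (d k)\<^sup>2) + W"]) (auto simp: TWb)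
   show "integrable M (\<lambda>w. cmod ((T w - W) *\<^sub>R (D w * g w)))"
    using iTDg iDg by (simp add: scaleR_diff_left)
  qed
  also have "... = B' * expectation (\<lambda>w. \<bar>T w - W\<bar>)" by simp
  also have "... \<le> B' * sqrt (expectation (\<lambda>w. (T w - W)\<^sup>2))"
   by (intro mult_left_mono expectation_abs_le_sqrt[OF _ TWb] B0) measurable
  also have "... \<le> B' * sqrt (l\<^sup>2 * W)" using ET B0 by (intro mult_left_mono real_sqrt_le_mono) auto
  also have "... = B' * (l * sqrt W)" using nn by (simp add: real_sqrt_mult)
  finally show ?thesis .
 qed
 have b3: "cmod (\<Sum>k\<in>F. d k *\<^sub>R R k) \<le> \<epsilon> * W"
 proof -
  have "cmod (\<Sum>k\<in>F. d k *\<^sub>R R k) \<le> (\<Sum>k\<in>F. \<bar>d k\<bar> * (\<epsilon> * \<bar>d k\<bar> * q k))"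
   by (rule order_trans[OF norm_sum sum_mono]) (use Rk in \<open>auto intro!: mult_left_mono\<close>)
  also have "... = (\<Sum>k\<in>F. \<epsilon> * (q k * (d k)\<^sup>2))"
  proof (intro sum.cong refl)
   fix k
   have "\<bar>d k\<bar> * (\<epsilon> * \<bar>d k\<bar> * q k) = \<epsilon> * (q k * (\<bar>d k\<bar> * \<bar>d k\<bar>))" by simp
   then show "\<bar>d k\<bar> * (\<epsilon> * \<bar>d k\<bar> * q k) = \<epsilon> * (q k * (d k)\<^sup>2)" by (simp add: power2_eq_square)
  qed
  also have "... = \<epsilon> * W" by (simp add: W_def sum_distrib_left)
  finally show ?thesis .
 qed
 let ?a = "expectation (\<lambda>w. Y w *\<^sub>R (h w * g w))" and ?b = "expectation (\<lambda>w. T w *\<^sub>R (D w * g w))"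
  and ?c = "\<Sum>k\<in>F. d k *\<^sub>R R k" and ?e = "W *\<^sub>R expectation (\<lambda>w. D w * g w)"
 have "W * cmod (expectation (\<lambda>w. D w * g w)) = cmod ?e" using W0 by simp
 also have "?e = ?a - ?c - (?b - ?e)" using split by simp
 also have "cmod ... \<le> cmod ?a + cmod ?c + cmod (?b - ?e)"
  by (rule order_trans[OF norm_triangle_ineq4]) (simp add: norm_triangle_ineq4)
 finally show ?thesis using b1 b2 b3 by simp
qed

section \<open>Periods of tail functions\<close>

text \<open>Continuity in \<open>t\<close> gives meaning to the values at a fixed time and extends
  almost sure identities from rational times to all times.\<close>

definition lip_tailfun :: "(real \<times> (nat \<Rightarrow> real) \<Rightarrow> complex) \<Rightarrow> bool" where
 "lip_tailfun G \<longleftrightarrow> tailfun G \<and> (\<exists>L. \<forall>t s x. cmod (G (t, x) - G (s, x)) \<le> L * \<bar>t - s\<bar>)"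

text \<open>An identity at each fixed \<open>t\<close>, almost surely in the path, because the
  integration by parts takes place on the path space at a fixed time.
  \<open>time_periodic_of_period\<close> leads back to periods of the flow.\<close>

definition period :: "(nat \<Rightarrow> real measure) \<Rightarrow> real \<Rightarrow> bool" where
 "period \<rho> d \<longleftrightarrow> (\<forall>G t. lip_tailfun G \<longrightarrow> (AE w in PiM UNIV \<rho>. G (t + d, w) = G (t, w)))"

lemma periodD: "period \<rho> d \<Longrightarrow> lip_tailfun G \<Longrightarrow> AE w in PiM UNIV \<rho>. G (t + d, w) = G (t, w)"
 by (simp add: period_def)

lemma period_0: "period \<rho> 0"
 by (simp add: period_def)

lemma period_add: "period \<rho> a \<Longrightarrow> period \<rho> b \<Longrightarrow> period \<rho> (a + b)"
 unfolding period_def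
proof (intro allI impI)
 fix G t assume a: "\<forall>G t. lip_tailfun G \<longrightarrow> (AE w in PiM UNIV \<rho>. G (t + a, w) = G (t, w))"
  and b: "\<forall>G t. lip_tailfun G \<longrightarrow> (AE w in PiM UNIV \<rho>. G (t + b, w) = G (t, w))" and G: "lip_tailfun G"
 from a[rule_format, OF G, of t] b[rule_format, OF G, of "t + a"]
 show "AE w in PiM UNIV \<rho>. G (t + (a + b), w) = G (t, w)" by eventually_elim (simp add: add.assoc)
qed

lemma period_minus: "period \<rho> a \<Longrightarrow> period \<rho> (- a)"
 unfolding period_def
proof (intro allI impI)
 fix G t assume a: "\<forall>G t. lip_tailfun G \<longrightarrow> (AE w in PiM UNIV \<rho>. G (t + a, w) = G (t, w))" and G: "lip_tailfun G"
 from a[rule_format, OF G, of "t - a"]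
 show "AE w in PiM UNIV \<rho>. G (t + - a, w) = G (t, w)" by eventually_elim simp
qed

lemma period_diff: "period \<rho> a \<Longrightarrow> period \<rho> b \<Longrightarrow> period \<rho> (a - b)"
 using period_add[OF _ period_minus, of \<rho> a b] by simp

lemma period_of_nat: "period \<rho> a \<Longrightarrow> period \<rho> (a * real n)"
 by (induction n) (auto simp: period_0 distrib_left intro: period_add)

lemma period_of_int: "period \<rho> a \<Longrightarrow> period \<rho> (a * of_int n)"
 using period_of_nat[of \<rho> a "nat n"] period_minus[OF period_of_nat, of \<rho> a "nat (- n)"] by (cases "0 \<le> n") auto

lemma lip_tailfun_translate:
 assumes "lip_tailfun G" shows "lip_tailfun (\<lambda>z. G (fst z + s, snd z))"
proof -
 from assms obtain L where "\<And>t s x. cmod (G (t, x) - G (s, x)) \<le> L * \<bar>t - s\<bar>" by (auto simp: lip_tailfun_def)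
 from this[of "_ + s" _ "_ + s"] assms show ?thesis
  by (auto simp: lip_tailfun_def intro!: tailfun_translate exI[of _ L])
qed

section \<open>Cylinder events and cylinder functions\<close>

context
 fixes \<rho> :: "nat \<Rightarrow> real measure"
 assumes \<rho>: "\<And>k. real_distribution (\<rho> k)"
begin

abbreviation (input) "P\<rho> \<equiv> PiM UNIV \<rho>"

lemma prob_P\<rho>: "prob_space P\<rho>" by (rule prob_space_PiM_real[OF \<rho>])

lemma space_P\<rho>: "space P\<rho> = UNIV"
 by (simp add: space_PiM real_distribution.space_eq_univ[OF \<rho>])

lemma measurable_P\<rho>_cong: "borel_measurable P\<rho> = borel_measurable (PiM UNIV (\<lambda>_. borel))"
 by (intro measurable_cong_sets sets_PiM_real[OF \<rho>] refl)

lemma measurable_section_P\<rho>: "tailfun G \<Longrightarrow> (\<lambda>w. G (t, w)) \<in> borel_measurable P\<rho>"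
 unfolding measurable_P\<rho>_cong by (rule measurable_compose[OF measurable_Pair1' tailfun_measurable]) (auto simp: space_PiM)

lemma sets_cylinder: "finite C \<Longrightarrow> {w. \<forall>i\<in>C. w i = u i} \<in> sets P\<rho>"
proof -
 assume C: "finite C"
 have [measurable]: "(\<lambda>w. w i) \<in> borel_measurable P\<rho>" for i by (rule measurable_PiM_real_component[OF \<rho>])
 have "{w \<in> space P\<rho>. \<forall>i\<in>C. w i = u i} \<in> sets P\<rho>" using C by measurable
 then show ?thesis by (simp add: space_P\<rho>)
qed

lemma measure_cylinder:
 assumes C: "finite C"
 shows "measure P\<rho> {w. \<forall>i\<in>C. w i = u i} = (\<Prod>i\<in>C. measure (\<rho> i) {u i})"
proof -
 interpret R: real_distribution "\<rho> i" for i by (rule \<rho>)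
 interpret product_prob_space \<rho> UNIV by unfold_locales
 have "emeasure P\<rho> {x \<in> space P\<rho>. \<forall>i\<in>C. x i \<in> {u i}} = (\<Prod>i\<in>C. emeasure (\<rho> i) {u i})"
  by (rule emeasure_PiM_Collect) (use C in auto)
 then have "emeasure P\<rho> {w. \<forall>i\<in>C. w i = u i} = ennreal (\<Prod>i\<in>C. measure (\<rho> i) {u i})"
  by (simp add: space_P\<rho> R.emeasure_eq_measure prod_ennreal)
 then show ?thesis by (simp add: measure_def prod_nonneg)
qed

text \<open>By independence, restricting to a cylinder event has the same effect as overwriting the
  coordinates by \<open>u\<close> and multiplying by the probability of the event.\<close>

lemma integral_cylinder:
 fixes G :: "(nat \<Rightarrow> real) \<Rightarrow> complex"
 assumes C: "finite C" and G[measurable]: "G \<in> borel_measurable P\<rho>" and B: "\<And>w. cmod (G w) \<le> B"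
 shows "(\<integral>w. indicator {w. \<forall>i\<in>C. w i = u i} w *\<^sub>R G w \<partial>P\<rho>) = (\<Prod>i\<in>C. measure (\<rho> i) {u i}) *\<^sub>R (\<integral>w. G (override_on w u C) \<partial>P\<rho>)"
proof -
 interpret P: prob_space P\<rho> by (rule prob_P\<rho>)
 interpret PP: pair_prob_space P\<rho> P\<rho> ..
 let ?A = "{w. \<forall>i\<in>C. w i = u i}"
 have A[measurable]: "?A \<in> sets P\<rho>" by (rule sets_cylinder[OF C])
 have B0: "0 \<le> B" using B[of undefined] norm_ge_zero order_trans by blast
 have ov[measurable]: "(\<lambda>z. override_on (snd z) (fst z) C) \<in> measurable (P\<rho> \<Otimes>\<^sub>M P\<rho>) P\<rho>" by measurable
 have ou[measurable]: "(\<lambda>w. override_on w u C) \<in> measurable P\<rho> P\<rho>"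
  by (rule measurable_override_on) (auto simp: space_P\<rho>)
 have int: "integrable (P\<rho> \<Otimes>\<^sub>M P\<rho>) (\<lambda>z. indicator ?A (fst z) *\<^sub>R G (override_on (snd z) u C))"
 proof (intro PP.integrable_const_bound[where B=B] AE_I2)
  show "cmod (indicator ?A (fst z) *\<^sub>R G (override_on (snd z) u C)) \<le> B" for z by (auto simp: indicator_def B B0)
 qed measurable
 have "(\<integral>w. indicator ?A w *\<^sub>R G w \<partial>P\<rho>) = (\<integral>w. indicator ?A w *\<^sub>R G w \<partial>distr (P\<rho> \<Otimes>\<^sub>M P\<rho>) P\<rho> (\<lambda>(x, y). override_on y x C))"
  using distr_override_on[of \<rho> C] \<rho>[THEN real_distribution.axioms(1)] by simp
 also have "... = (\<integral>z. indicator ?A (override_on (snd z) (fst z) C) *\<^sub>R G (override_on (snd z) (fst z) C) \<partial>(P\<rho> \<Otimes>\<^sub>M P\<rho>))"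
  unfolding split_beta' by (rule integral_distr[OF ov]) measurable
 also have "... = (\<integral>z. indicator ?A (fst z) *\<^sub>R G (override_on (snd z) u C) \<partial>(P\<rho> \<Otimes>\<^sub>M P\<rho>))"
 proof (intro Bochner_Integration.integral_cong refl)
  fix z :: "(nat \<Rightarrow> real) \<times> (nat \<Rightarrow> real)"
  have "override_on (snd z) (fst z) C \<in> ?A \<longleftrightarrow> fst z \<in> ?A" by (auto simp: override_on_def)
  moreover have "override_on (snd z) (fst z) C = override_on (snd z) u C" if "fst z \<in> ?A"
   using that by (auto simp: override_on_def fun_eq_iff)
  ultimately show "indicator ?A (override_on (snd z) (fst z) C) *\<^sub>R G (override_on (snd z) (fst z) C) = indicator ?A (fst z) *\<^sub>R G (override_on (snd z) u C)"
   by (auto simp: indicator_def)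
 qed
 also have "... = (\<integral>x. (\<integral>y. indicator ?A x *\<^sub>R G (override_on y u C) \<partial>P\<rho>) \<partial>P\<rho>)"
  using PP.integral_fst'[OF int] by simp
 also have "... = (\<integral>x. indicator ?A x *\<^sub>R (\<integral>y. G (override_on y u C) \<partial>P\<rho>) \<partial>P\<rho>)" by simp
 also have "... = measure P\<rho> ?A *\<^sub>R (\<integral>y. G (override_on y u C) \<partial>P\<rho>)"
  by (simp add: P.emeasure_eq_measure)
 finally show ?thesis by (simp add: measure_cylinder[OF C])
qed

text \<open>Cylinder functions are dense. Tested against the conjugates of its own conditional
  expectations \<open>e n\<close>, the function \<open>D\<close> gives zero, so its squared L2 norm
  equals the pairing of \<open>D\<close> with \<open>D - e n\<close>, which tends to zero.\<close>

lemma AE_zero_of_cylinder: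
 fixes D :: "(nat \<Rightarrow> real) \<Rightarrow> complex"
 assumes D[measurable]: "D \<in> borel_measurable P\<rho>" and B: "\<And>w. cmod (D w) \<le> B"
  and zero: "\<And>n g. g \<in> borel_measurable P\<rho> \<Longrightarrow> (\<And>w. cmod (g w) \<le> 1) \<Longrightarrow>
    (\<And>w w'. (\<forall>i<n. w i = w' i) \<Longrightarrow> g w = g w') \<Longrightarrow> (\<integral>w. D w * g w \<partial>P\<rho>) = 0"
 shows "AE w in P\<rho>. D w = 0"
proof -
 interpret P: prob_space P\<rho> by (rule prob_P\<rho>)
 interpret PP: pair_prob_space P\<rho> P\<rho> ..
 have ov[measurable]: "(\<lambda>z. override_on (snd z) (fst z) U) \<in> measurable (P\<rho> \<Otimes>\<^sub>M P\<rho>) P\<rho>" for U by measurable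
 have ov'[measurable]: "(\<lambda>y. override_on y w U) \<in> measurable P\<rho> P\<rho>" for U w
  by (rule measurable_override_on) (auto simp: space_P\<rho>)
 have B0: "0 \<le> B" using B[of undefined] norm_ge_zero order_trans by blast
 \<comment> \<open>A bound that is strictly positive, since the test functions are divided by
   it.\<close>
 define B1 where "B1 = B + 1"
 have B1: "0 < B1" "cmod (D w) \<le> B1" for w using B0 B[of w] by (auto simp: B1_def)
 define e where "e n w = (\<integral>y. D (override_on y w {..<n}) \<partial>P\<rho>)" for n w
 have em[measurable]: "e n \<in> borel_measurable P\<rho>" for n unfolding e_def by measurable
 have eB: "cmod (e n w) \<le> B1" for n w unfolding e_def by (intro P.norm_expectation_le B1) measurable
 have "(\<integral>w. D w * (cnj (e n w) / of_real B1) \<partial>P\<rho>) = 0" for n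
 proof (rule zero[of _ n])
  show "cmod (cnj (e n w) / of_real B1) \<le> 1" for w using eB[of n w] B1 by (simp add: norm_divide)
  show "cnj (e n w) / of_real B1 = cnj (e n w') / of_real B1" if "\<forall>i<n. w i = w' i" for w w'
  proof -
   have "override_on y w {..<n} = override_on y w' {..<n}" for y using that by (auto simp: override_on_def fun_eq_iff)
   then show ?thesis by (simp add: e_def)
  qed
 qed measurable
 then have z: "(\<integral>w. D w * cnj (e n w) \<partial>P\<rho>) = 0" for n using B1 by simp
 define b where "b n = (\<integral>z. cmod (D (fst z) - D (override_on (snd z) (fst z) {..<n})) \<partial>(P\<rho> \<Otimes>\<^sub>M P\<rho>))" for n
 have "b \<longlonglongrightarrow> 0"
  unfolding b_def
  by (rule resample_tendsto_L1) (use \<rho>[THEN real_distribution.axioms(1)] B in \<open>auto simp: incseq_def intro!: P.integrable_const_bound[where B=B]\<close>)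
 have iD: "integrable P\<rho> D" by (intro P.integrable_const_bound[where B=B]) (auto simp: B)
 have le: "(\<integral>w. (cmod (D w))\<^sup>2 \<partial>P\<rho>) \<le> B1 * b n" for n
 proof -
  have iz: "integrable (P\<rho> \<Otimes>\<^sub>M P\<rho>) (\<lambda>z. cmod (D (fst z) - D (override_on (snd z) (fst z) {..<n})))"
  proof (intro PP.integrable_const_bound[where B="2 * B"] AE_I2)
   show "norm (cmod (D (fst z) - D (override_on (snd z) (fst z) {..<n}))) \<le> 2 * B" for z
    using norm_triangle_ineq4[of "D (fst z)" "D (override_on (snd z) (fst z) {..<n})"] B[of "fst z"] B[of "override_on (snd z) (fst z) {..<n}"] by simp
  qed measurable
  have iDD: "integrable P\<rho> (\<lambda>w. D w * cnj (f w))" if "f \<in> borel_measurable P\<rho>" "\<And>w. cmod (f w) \<le> B1" for f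
  proof (intro P.integrable_const_bound[where B="B1 * B1"] AE_I2)
   show "cmod (D w * cnj (f w)) \<le> B1 * B1" for w
    unfolding norm_mult using that(2)[of w] B1(2)[of w] B1(1) by (intro mult_mono) auto
  qed (use that in measurable)
  have "complex_of_real (\<integral>w. (cmod (D w))\<^sup>2 \<partial>P\<rho>) = (\<integral>w. D w * cnj (D w) \<partial>P\<rho>)"
   by (simp add: complex_norm_square[symmetric] flip: integral_complex_of_real)
  also have "... = (\<integral>w. D w * cnj (D w) \<partial>P\<rho>) - (\<integral>w. D w * cnj (e n w) \<partial>P\<rho>)" by (simp add: z)
  also have "... = (\<integral>w. D w * cnj (D w - e n w) \<partial>P\<rho>)"
   using iDD[OF D B1(2)] iDD[OF em eB] by (simp add: right_diff_distrib)
  finally have eq: "complex_of_real (\<integral>w. (cmod (D w))\<^sup>2 \<partial>P\<rho>) = (\<integral>w. D w * cnj (D w - e n w) \<partial>P\<rho>)" .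
  have DeB: "cmod (D w - e n w) \<le> (\<integral>y. cmod (D w - D (override_on y w {..<n})) \<partial>P\<rho>)" for w
  proof -
   have i: "integrable P\<rho> (\<lambda>y. D (override_on y w {..<n}))"
    by (intro P.integrable_const_bound[where B=B]) (auto simp: B)
   have "D w - e n w = (\<integral>y. D w - D (override_on y w {..<n}) \<partial>P\<rho>)"
    unfolding e_def using i P.prob_space by simp
   then show ?thesis by (simp add: integral_norm_bound)
  qed
  have ii: "integrable P\<rho> (\<lambda>w. \<integral>y. cmod (D w - D (override_on y w {..<n})) \<partial>P\<rho>)"
   using PP.integrable_fst'[OF iz] by simp
  have "(\<integral>w. (cmod (D w))\<^sup>2 \<partial>P\<rho>) = cmod (complex_of_real (\<integral>w. (cmod (D w))\<^sup>2 \<partial>P\<rho>))" by simp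
  also have "... \<le> (\<integral>w. cmod (D w * cnj (D w - e n w)) \<partial>P\<rho>)" unfolding eq by (rule integral_norm_bound)
  also have "... \<le> (\<integral>w. B1 * (\<integral>y. cmod (D w - D (override_on y w {..<n})) \<partial>P\<rho>) \<partial>P\<rho>)"
  proof (rule integral_mono)
   show pt: "cmod (D w * cnj (D w - e n w)) \<le> B1 * (\<integral>y. cmod (D w - D (override_on y w {..<n})) \<partial>P\<rho>)" for w
    unfolding norm_mult complex_mod_cnj using B1 DeB by (intro mult_mono) auto
   show i2: "integrable P\<rho> (\<lambda>w. B1 * (\<integral>y. cmod (D w - D (override_on y w {..<n})) \<partial>P\<rho>))"
    using ii by simp
   show "integrable P\<rho> (\<lambda>w. cmod (D w * cnj (D w - e n w)))"
   proof (rule Bochner_Integration.integrable_bound[OF i2])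
    show "AE w in P\<rho>. norm (cmod (D w * cnj (D w - e n w))) \<le> norm (B1 * (\<integral>y. cmod (D w - D (override_on y w {..<n})) \<partial>P\<rho>))"
     using order_trans[OF pt abs_ge_self] by (intro AE_I2) (simp only: real_norm_def abs_norm_cancel)
   qed measurable
  qed
  also have "... = B1 * b n"
   using PP.integral_fst'[OF iz] by (simp add: b_def)
  finally show ?thesis .
 qed
 have "(\<integral>w. (cmod (D w))\<^sup>2 \<partial>P\<rho>) \<le> B1 * 0"
  by (rule LIMSEQ_le_const[OF tendsto_mult[OF tendsto_const \<open>b \<longlonglongrightarrow> 0\<close>]]) (use le in auto)
 moreover have i: "integrable P\<rho> (\<lambda>w. (cmod (D w))\<^sup>2)"
  using power_mono[OF B norm_ge_zero, of _ 2] by (intro P.integrable_const_bound[where B="B\<^sup>2"]) auto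
 moreover have "0 \<le> (\<integral>w. (cmod (D w))\<^sup>2 \<partial>P\<rho>)" by simp
 ultimately have "(\<integral>w. (cmod (D w))\<^sup>2 \<partial>P\<rho>) = 0" by simp
 then have "AE w in P\<rho>. (cmod (D w))\<^sup>2 = 0" using integral_nonneg_eq_0_iff_AE[OF i] by simp
 then show ?thesis by eventually_elim simp
qed

end

text \<open>Applied to the energy \<open>W\<close> of a finite set of moves: a bound of order
  \<open>sqrt W\<close> limits \<open>W\<close> itself.\<close>

lemma le_power2_of_sqrt_bound:
 fixes m W A :: real
 assumes "m / 2 * W \<le> A * sqrt W" "0 < W" "0 < m"
 shows "W \<le> (2 * A / m)\<^sup>2"
proof -
 have W: "W = sqrt W * sqrt W" using assms(2) by simp
 have "m / 2 * sqrt W * sqrt W \<le> A * sqrt W" using assms(1) W by (metis mult.assoc)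
 then have "m / 2 * sqrt W \<le> A" using assms(2) by (simp add: mult_le_cancel_right)
 then have "sqrt W \<le> 2 * A / m" using assms(3) by (simp add: field_simps)
 then have "(sqrt W)\<^sup>2 \<le> (2 * A / m)\<^sup>2" using assms(2) by (intro power_mono) auto
 then show ?thesis using assms(2) by simp
qed

section \<open>Moves and their scores\<close>

context
 fixes \<rho> :: "nat \<Rightarrow> real measure"
 assumes \<rho>: "\<And>k. real_distribution (\<rho> k)"
begin

abbreviation (input) "PP\<rho> \<equiv> PiM UNIV \<rho>"

text \<open>A move on the coordinates in \<open>C\<close> replaces the values \<open>v\<close> by the values \<open>u\<close>; it changes the walk by \<open>\<Sum>i\<in>C. u i - v i\<close>.\<close>

definition move_prob :: "nat set \<Rightarrow> (nat \<Rightarrow> real) \<Rightarrow> real" where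
 "move_prob C u = (\<Prod>i\<in>C. measure (\<rho> i) {u i})"

text \<open>The factor of the second indicator makes the mean zero when \<open>v\<close> has
  positive probability. Integrating against the score compares the averages of a function after
  writing \<open>u\<close> and after writing \<open>v\<close> on \<open>C\<close>.\<close>

definition move_score :: "nat set \<Rightarrow> (nat \<Rightarrow> real) \<Rightarrow> (nat \<Rightarrow> real) \<Rightarrow> (nat \<Rightarrow> real) \<Rightarrow> real" where
 "move_score C u v w = indicator {w. \<forall>i\<in>C. w i = u i} w - move_prob C u / move_prob C v * indicator {w. \<forall>i\<in>C. w i = v i} w"

lemma move_prob_01: "0 \<le> move_prob C u" "move_prob C u \<le> 1"
proof -
 interpret R: real_distribution "\<rho> i" for i by (rule \<rho>)
 show "0 \<le> move_prob C u" "move_prob C u \<le> 1" unfolding move_prob_def by (auto intro!: prod_nonneg prod_le_1)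
qed

lemma integrable_bounded_P\<rho>:
 fixes G :: "(nat \<Rightarrow> real) \<Rightarrow> complex"
 assumes "G \<in> borel_measurable PP\<rho>" "\<And>w. cmod (G w) \<le> B"
 shows "integrable PP\<rho> G"
proof -
 interpret P: prob_space PP\<rho> by (rule prob_P\<rho>[OF \<rho>])
 show ?thesis using assms by (intro P.integrable_const_bound[where B=B]) auto
qed

lemma measurable_indicator_cylinder: "finite C \<Longrightarrow> (indicator {w. \<forall>i\<in>C. w i = u i} :: _ \<Rightarrow> real) \<in> borel_measurable PP\<rho>"
 using sets_cylinder[OF \<rho>] by (intro borel_measurable_indicator)

lemma measurable_move_score: "finite C \<Longrightarrow> move_score C u v \<in> borel_measurable PP\<rho>"
 unfolding move_score_def[abs_def]
 by (intro borel_measurable_diff borel_measurable_times measurable_indicator_cylinder) auto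

lemma integrable_indicator_cylinder:
 fixes G :: "(nat \<Rightarrow> real) \<Rightarrow> complex"
 assumes C: "finite C" and G: "G \<in> borel_measurable PP\<rho>" "\<And>w. cmod (G w) \<le> B"
 shows "integrable PP\<rho> (\<lambda>w. indicator {w. \<forall>i\<in>C. w i = u i} w *\<^sub>R G w)"
proof (rule integrable_bounded_P\<rho>)
 have "0 \<le> B" using G(2)[of undefined] norm_ge_zero order_trans by blast
 then show "cmod (indicator {w. \<forall>i\<in>C. w i = u i} w *\<^sub>R G w) \<le> B" for w using G(2) by (auto simp: indicator_def)
 show "(\<lambda>w. indicator {w. \<forall>i\<in>C. w i = u i} w *\<^sub>R G w) \<in> borel_measurable PP\<rho>"
  using measurable_indicator_cylinder[OF C] G(1) by (rule borel_measurable_scaleR)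
qed

lemma integral_move_score:
 fixes G :: "(nat \<Rightarrow> real) \<Rightarrow> complex"
 assumes C: "finite C" and G: "G \<in> borel_measurable PP\<rho>" "\<And>w. cmod (G w) \<le> B" and pos: "0 < move_prob C v"
 shows "(\<integral>w. move_score C u v w *\<^sub>R G w \<partial>PP\<rho>) = move_prob C u *\<^sub>R ((\<integral>w. G (override_on w u C) \<partial>PP\<rho>) - (\<integral>w. G (override_on w v C) \<partial>PP\<rho>))"
proof -
 note i = integrable_indicator_cylinder[OF C G]
 have "(\<integral>w. move_score C u v w *\<^sub>R G w \<partial>PP\<rho>) = (\<integral>w. indicator {w. \<forall>i\<in>C. w i = u i} w *\<^sub>R G w
   - (move_prob C u / move_prob C v) *\<^sub>R (indicator {w. \<forall>i\<in>C. w i = v i} w *\<^sub>R G w) \<partial>PP\<rho>)"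
  by (intro Bochner_Integration.integral_cong refl) (simp add: move_score_def scaleR_diff_left)
 also have "... = move_prob C u *\<^sub>R (\<integral>w. G (override_on w u C) \<partial>PP\<rho>) - (move_prob C u / move_prob C v) *\<^sub>R (move_prob C v *\<^sub>R (\<integral>w. G (override_on w v C) \<partial>PP\<rho>))"
  unfolding Bochner_Integration.integral_diff[OF i integrable_scaleR_right[OF i]] integral_scaleR_right
   integral_cylinder[OF \<rho> C G] move_prob_def ..
 finally show ?thesis using pos by (simp add: scaleR_diff_right)
qed

lemma integral_move_indicator:
 fixes G :: "(nat \<Rightarrow> real) \<Rightarrow> complex"
 assumes C: "finite C" and G: "G \<in> borel_measurable PP\<rho>" "\<And>w. cmod (G w) \<le> B"
 shows "(\<integral>w. indicator {w. \<forall>i\<in>C. w i = u i} w *\<^sub>R G w \<partial>PP\<rho>) = move_prob C u *\<^sub>R (\<integral>w. G (override_on w u C) \<partial>PP\<rho>)"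
 unfolding integral_cylinder[OF \<rho> C G] move_prob_def ..

lemma measurable_override_const: "(\<lambda>w. override_on w u C) \<in> measurable PP\<rho> PP\<rho>"
 by (rule measurable_override_on) (auto simp: space_P\<rho>[OF \<rho>])

text \<open>For a tail function, writing \<open>v\<close> instead of \<open>u\<close> on
  \<open>C\<close> is a time shift by the displacement, while \<open>g\<close> does not see
  \<open>C\<close>. Thus the difference of the two averages in the score becomes a difference in
  time on the event that \<open>u\<close> occurs.\<close>

lemma move_integration_by_parts:
 assumes C: "finite C" and G: "tailfun G" and g: "g \<in> borel_measurable PP\<rho>" "\<And>w. cmod (g w) \<le> 1"
  and dep: "\<And>w u. g (override_on w u C) = g w" and pos: "0 < move_prob C v"
 shows "(\<integral>w. move_score C u v w *\<^sub>R (G (t, w) * g w) \<partial>PP\<rho>) =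
  (\<integral>w. indicator {w. \<forall>i\<in>C. w i = u i} w *\<^sub>R ((G (t, w) - G (t - (\<Sum>i\<in>C. u i - v i), w)) * g w) \<partial>PP\<rho>)"
proof -
 obtain B where B: "0 \<le> B" "\<And>z. cmod (G z) \<le> B" using tailfun_boundedE[OF G] by metis
 note m = measurable_section_P\<rho>[OF \<rho> G]
 have Gg: "cmod (G (s, w) * g w) \<le> B" for s w
  using mult_mono[OF B(2) g(2) B(1) norm_ge_zero] by (simp add: norm_mult)
 have GGg: "cmod ((G (t, w) - G (s, w)) * g w) \<le> 2 * B" for s w
  using norm_triangle_ineq4[of "G (t, w)" "G (s, w)"] B(2)[of "(t, w)"] B(2)[of "(s, w)"] B(1)
   mult_mono[of "cmod (G (t, w) - G (s, w))" "2 * B" "cmod (g w)" 1] g(2)[of w] by (simp add: norm_mult)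
 have mg: "(\<lambda>w. G (s, w) * g w) \<in> borel_measurable PP\<rho>" for s using m g(1) by (rule borel_measurable_times)
 have mgg: "(\<lambda>w. (G (t, w) - G (s, w)) * g w) \<in> borel_measurable PP\<rho>" for s using m g(1) by (intro borel_measurable_times borel_measurable_diff)
 let ?d = "\<Sum>i\<in>C. u i - v i"
 have shift: "G (t, override_on w v C) = G (t - ?d, override_on w u C)" for w
 proof -
  have inv: "step_invariant (\<lambda>_. borel) (\<lambda>_ x. x) G"
   unfolding step_invariant_def using tailfun_step[OF G] by blast
  have sp: "x \<in> space (PiM UNIV (\<lambda>_. borel))" for x :: "nat \<Rightarrow> real" by (simp add: space_PiM)
  have "G (t, override_on w v C) = G (t + (\<Sum>i\<in>C. v i) - (\<Sum>i\<in>C. w i), w)"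
   by (rule step_invariant_override[OF inv sp sp C])
  also have "... = G (t - ?d, override_on w u C)"
   using step_invariant_override[OF inv sp sp C, of "t - ?d" w u] by (simp add: sum_subtractf algebra_simps)
  finally show ?thesis .
 qed
 have ov: "(\<lambda>w. f (override_on w u C)) \<in> borel_measurable PP\<rho>" if "f \<in> borel_measurable PP\<rho>" for f :: "_ \<Rightarrow> complex"
  by (rule measurable_compose[OF measurable_override_const that])
 have "(\<integral>w. move_score C u v w *\<^sub>R (G (t, w) * g w) \<partial>PP\<rho>) = move_prob C u *\<^sub>R
   ((\<integral>w. G (t, override_on w u C) * g w \<partial>PP\<rho>) - (\<integral>w. G (t - ?d, override_on w u C) * g w \<partial>PP\<rho>))"
  by (subst integral_move_score[OF C mg Gg pos]) (simp add: dep shift)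
 also have "... = move_prob C u *\<^sub>R (\<integral>w. (G (t, override_on w u C) - G (t - ?d, override_on w u C)) * g w \<partial>PP\<rho>)"
 proof -
  have i: "integrable PP\<rho> (\<lambda>w. G (s, override_on w u C) * g w)" for s
   using Gg[of s "override_on _ u C"] by (intro integrable_bounded_P\<rho>[where B=B]) (auto simp: dep intro!: borel_measurable_times ov m g)
  show ?thesis using Bochner_Integration.integral_diff[OF i i, of t "t - ?d"] by (simp add: left_diff_distrib)
 qed
 also have "... = (\<integral>w. indicator {w. \<forall>i\<in>C. w i = u i} w *\<^sub>R ((G (t, w) - G (t - ?d, w)) * g w) \<partial>PP\<rho>)"
  by (subst integral_move_indicator[OF C mgg GGg]) (simp add: dep)
 finally show ?thesis .
qed

text \<open>\<open>\<kappa>\<close> bounds the ratio of the two probabilities, hence the size of the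
  score and its variance relative to the probability of \<open>u\<close>.\<close>

lemma move_statistics:
 assumes C: "finite C" and pos: "0 < move_prob C v" and le: "move_prob C u \<le> \<kappa> * move_prob C v"
 shows "\<bar>move_score C u v w\<bar> \<le> 1 + \<kappa>"
  and "(\<integral>w. (move_score C u v w)\<^sup>2 \<partial>PP\<rho>) \<le> (2 * (1 + \<kappa>)) * move_prob C u"
  and "measure PP\<rho> {w. \<forall>i\<in>C. w i = u i} = move_prob C u"
proof -
 interpret P: prob_space PP\<rho> by (rule prob_P\<rho>[OF \<rho>])
 let ?r = "move_prob C u / move_prob C v"
 have r: "0 \<le> ?r" "?r \<le> \<kappa>" using pos le move_prob_01(1)[of C u] by (auto simp: divide_le_eq)
 have abs: "\<bar>move_score C u v w\<bar> \<le> 1 + \<kappa>" for w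
  unfolding move_score_def using r by (auto simp: indicator_def)
 then show "\<bar>move_score C u v w\<bar> \<le> 1 + \<kappa>" .
 show m: "measure PP\<rho> {w. \<forall>i\<in>C. w i = u i} = move_prob C u" for u
  unfolding measure_cylinder[OF \<rho> C] move_prob_def ..
 let ?I = "\<lambda>u. indicator {w. \<forall>i\<in>C. w i = u i} :: _ \<Rightarrow> real"
 have i: "integrable PP\<rho> (?I u)" for u
  by (intro integrable_real_indicator sets_cylinder[OF \<rho> C]) (simp add: P.emeasure_eq_measure)
 have pt: "(move_score C u v w)\<^sup>2 \<le> 2 * ?I u w + 2 * ?r\<^sup>2 * ?I v w" for w
 proof -
  have "(x - y)\<^sup>2 \<le> 2 * x\<^sup>2 + 2 * y\<^sup>2" for x y :: real
   using zero_le_power2[of "x + y"] by (simp add: power2_eq_square algebra_simps)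
  from this[of "?I u w" "?r * ?I v w"]
  have "(move_score C u v w)\<^sup>2 \<le> 2 * (?I u w)\<^sup>2 + 2 * (?r\<^sup>2 * (?I v w)\<^sup>2)"
   unfolding move_score_def power_mult_distrib .
  moreover have "(?I x w)\<^sup>2 = ?I x w" for x by (simp add: indicator_def)
  ultimately show ?thesis by (simp only: mult.assoc)
 qed
 have i2: "integrable PP\<rho> (\<lambda>w. (move_score C u v w)\<^sup>2)"
  using power_mono[OF abs abs_ge_zero, of _ 2] measurable_move_score[OF C]
  by (intro P.integrable_const_bound[where B="(1 + \<kappa>)\<^sup>2"]) auto
 have "(\<integral>w. (move_score C u v w)\<^sup>2 \<partial>PP\<rho>) \<le> (\<integral>w. 2 * ?I u w + 2 * ?r\<^sup>2 * ?I v w \<partial>PP\<rho>)"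
  using i i2 pt by (intro integral_mono) auto
 also have "... = 2 * move_prob C u + 2 * ?r\<^sup>2 * move_prob C v"
  using i by (simp add: m space_P\<rho>[OF \<rho>])
 also have "... = 2 * move_prob C u + 2 * ?r * move_prob C u" using pos by (simp add: power2_eq_square)
 also have "... \<le> 2 * move_prob C u + 2 * \<kappa> * move_prob C u"
  using r move_prob_01(1)[of C u] by (intro add_left_mono mult_right_mono mult_left_mono) auto
 finally show "(\<integral>w. (move_score C u v w)\<^sup>2 \<partial>PP\<rho>) \<le> (2 * (1 + \<kappa>)) * move_prob C u" by (simp add: algebra_simps)
qed

lemma move_uncorrelated:
 assumes C: "finite C" "finite C'" "C \<inter> C' = {}" and pos: "0 < move_prob C v" and le: "move_prob C' u' \<le> \<kappa> * move_prob C' v'" and pos': "0 < move_prob C' v'"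
 shows "(\<integral>w. move_score C' u' v' w * move_score C u v w \<partial>PP\<rho>) = 0"
  and "measure PP\<rho> ({w. \<forall>i\<in>C'. w i = u' i} \<inter> {w. \<forall>i\<in>C. w i = u i}) = move_prob C' u' * move_prob C u"
proof -
 have ind: "(indicator {w. \<forall>i\<in>C'. w i = x i} (override_on w y C) :: real) = indicator {w. \<forall>i\<in>C'. w i = x i} w" for x y w
  using C(3) by (auto simp: indicator_def override_on_def)
 have sc: "move_score C' u' v' (override_on w y C) = move_score C' u' v' w" for w y
  unfolding move_score_def ind ..
 have b: "cmod (complex_of_real (move_score C' u' v' w)) \<le> 1 + \<kappa>" for w
  using move_statistics(1)[OF C(2) pos' le] by simp
 have m: "(\<lambda>w. complex_of_real (move_score C' u' v' w)) \<in> borel_measurable PP\<rho>"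
  using measurable_move_score[OF C(2)] by simp
 from integral_move_score[OF C(1) m b pos, of u]
 have "(\<integral>w. move_score C u v w *\<^sub>R complex_of_real (move_score C' u' v' w) \<partial>PP\<rho>) = 0" by (simp add: sc)
 also have "(\<lambda>w. move_score C u v w *\<^sub>R complex_of_real (move_score C' u' v' w)) = (\<lambda>w. complex_of_real (move_score C' u' v' w * move_score C u v w))"
  by (simp add: scaleR_conv_of_real mult.commute)
 finally show "(\<integral>w. move_score C' u' v' w * move_score C u v w \<partial>PP\<rho>) = 0"
  unfolding integral_complex_of_real of_real_eq_0_iff .
 let ?w = "\<lambda>i. if i \<in> C then u i else u' i"
 have "{w. \<forall>i\<in>C'. w i = u' i} \<inter> {w. \<forall>i\<in>C. w i = u i} = {w. \<forall>i\<in>C' \<union> C. w i = ?w i}"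
  using C(3) by auto
 also have "measure PP\<rho> ... = (\<Prod>i\<in>C' \<union> C. measure (\<rho> i) {?w i})"
  by (rule measure_cylinder[OF \<rho>]) (use C in auto)
 also have "... = (\<Prod>i\<in>C'. measure (\<rho> i) {?w i}) * (\<Prod>i\<in>C. measure (\<rho> i) {?w i})"
  by (rule prod.union_disjoint) (use C in auto)
 also have "... = move_prob C' u' * move_prob C u"
  unfolding move_prob_def using C(3) by (intro arg_cong2[where f=times] prod.cong refl) (auto simp: disjoint_iff)
 finally show "measure PP\<rho> ({w. \<forall>i\<in>C'. w i = u' i} \<inter> {w. \<forall>i\<in>C. w i = u i}) = move_prob C' u' * move_prob C u" .
qed

text \<open>Suppose the mean of \<open>D\<close> against a cylinder function has modulus
  \<open>m > 0\<close>. With linearisation error \<open>m / 2\<close>, the energy estimate gives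
  \<open>m / 2 * W \<le> A * sqrt W\<close> for the energy \<open>W\<close> of every finite set of
  suitable moves with displacement near \<open>d0\<close>. This bounds \<open>W\<close> and
  contradicts the divergence.\<close>

lemma moves_linearization_zero:
 fixes S :: "nat set" and d :: "nat \<Rightarrow> real"
 assumes fin: "\<And>k. k \<in> S \<Longrightarrow> finite (C k)" and ne: "\<And>k. k \<in> S \<Longrightarrow> C k \<noteq> {}" and disj: "disjoint_family_on C S"
  and pos: "\<And>k. k \<in> S \<Longrightarrow> 0 < move_prob (C k) (v k)"
  and le: "\<And>k. k \<in> S \<Longrightarrow> move_prob (C k) (u k) \<le> \<kappa> * move_prob (C k) (v k)"
  and per: "\<And>k. k \<in> S \<Longrightarrow> period \<rho> ((\<Sum>i\<in>C k. u k i - v k i) - d k)"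
  and dl: "\<And>k. k \<in> S \<Longrightarrow> \<bar>d k\<bar> \<le> l"
  and div: "\<And>r. 0 < r \<Longrightarrow> \<not> (\<lambda>k. move_prob (C k) (u k) * (d k)\<^sup>2) summable_on {k\<in>S. \<bar>d k - d0\<bar> < r}"
  and G: "lip_tailfun G" and D: "D \<in> borel_measurable PP\<rho>" "\<And>w. cmod (D w) \<le> B'"
  and lin: "\<And>\<epsilon>. 0 < \<epsilon> \<Longrightarrow> \<exists>r>0. \<forall>d w. \<bar>d - d0\<bar> < r \<longrightarrow> cmod (G (t, w) - G (t - d, w) - d *\<^sub>R D w) \<le> \<epsilon> * \<bar>d\<bar>"
 shows "AE w in PP\<rho>. D w = 0"
proof (rule AE_zero_of_cylinder[OF \<rho> D])
 interpret P: prob_space PP\<rho> by (rule prob_P\<rho>[OF \<rho>])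
 fix n :: nat and g assume g: "g \<in> borel_measurable PP\<rho>" "\<And>w. cmod (g w) \<le> 1" and dep: "\<And>w w'. (\<forall>i<n. w i = w' i) \<Longrightarrow> g w = g w'"
 have Gt: "tailfun G" using G by (simp add: lip_tailfun_def)
 obtain B where B: "0 \<le> B" "\<And>z. cmod (G z) \<le> B" using tailfun_boundedE[OF Gt] by metis
 let ?m = "cmod (\<integral>w. D w * g w \<partial>PP\<rho>)"
 let ?q = "\<lambda>k. move_prob (C k) (u k)"
 show "(\<integral>w. D w * g w \<partial>PP\<rho>) = 0"
 proof (rule ccontr)
  assume "(\<integral>w. D w * g w \<partial>PP\<rho>) \<noteq> 0"
  then have m: "0 < ?m" by simp
  then obtain r where r: "0 < r" "\<And>d w. \<bar>d - d0\<bar> < r \<Longrightarrow> cmod (G (t, w) - G (t - d, w) - d *\<^sub>R D w) \<le> ?m / 2 * \<bar>d\<bar>"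
   using lin[of "?m / 2"] by auto
  define S' where "S' = {k\<in>S. \<bar>d k - d0\<bar> < r}"
  \<comment> \<open>\<open>g\<close> depends on the first \<open>n\<close> coordinates. As the sets
    \<open>C k\<close> are disjoint, only finitely many moves meet these, and discarding them does
    not affect the divergence.\<close>
  define bad where "bad = {k\<in>S'. C k \<inter> {..<n} \<noteq> {}}"
  have "finite bad"
  proof -
   have sel: "(SOME i. i \<in> C k \<inter> {..<n}) \<in> C k \<inter> {..<n}" if "k \<in> bad" for k
   proof -
    from that obtain i where "i \<in> C k \<inter> {..<n}" unfolding bad_def by blast
    then show ?thesis by (rule someI)
   qed
   have "inj_on (\<lambda>k. SOME i. i \<in> C k \<inter> {..<n}) bad"
   proof (rule inj_onI)
    fix j k assume jk: "j \<in> bad" "k \<in> bad" "(SOME i. i \<in> C j \<inter> {..<n}) = (SOME i. i \<in> C k \<inter> {..<n})"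
    from sel[OF jk(1)] sel[OF jk(2)] jk(3) have "C j \<inter> C k \<noteq> {}" by auto
    then show "j = k" using disj jk by (auto simp: disjoint_family_on_def bad_def S'_def)
   qed
   moreover have "(\<lambda>k. SOME i. i \<in> C k \<inter> {..<n}) ` bad \<subseteq> {..<n}"
    using sel by blast
   ultimately show ?thesis by (rule inj_on_finite) simp
  qed
  \<comment> \<open>\<open>A\<close> collects the two contributions of order \<open>sqrt W\<close>
    in the energy estimate, and \<open>K\<close> exceeds the bound for \<open>W\<close> that they
    imply.\<close>
  define A where "A = B * sqrt (2 * (1 + \<kappa>)) + B' * l"
  define K where "K = (2 * A / ?m)\<^sup>2 + 1"
  have nsum: "\<not> (\<lambda>k. ?q k * (d k)\<^sup>2) summable_on (S' - bad)"
  proof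
   assume "(\<lambda>k. ?q k * (d k)\<^sup>2) summable_on (S' - bad)"
   then have "(\<lambda>k. ?q k * (d k)\<^sup>2) summable_on ((S' - bad) \<union> bad)"
    using \<open>finite bad\<close> by (intro summable_on_union) auto
   moreover have "(S' - bad) \<union> bad = S'" by (auto simp: bad_def)
   ultimately show False using div[OF r(1)] by (simp add: S'_def)
  qed
  have "\<exists>F. finite F \<and> F \<subseteq> S' - bad \<and> K < (\<Sum>k\<in>F. ?q k * (d k)\<^sup>2)"
  proof (rule ccontr)
   assume "\<nexists>F. finite F \<and> F \<subseteq> S' - bad \<and> K < (\<Sum>k\<in>F. ?q k * (d k)\<^sup>2)"
   then have "(\<lambda>k. ?q k * (d k)\<^sup>2) summable_on (S' - bad)"
    by (intro nonneg_bounded_partial_sums_imp_summable_on[where C=K])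
      (auto simp: eventually_finite_subsets_at_top move_prob_01 not_less intro!: exI[of _ "{}"])
   with nsum show False ..
  qed
  then obtain F where F: "finite F" "F \<subseteq> S' - bad" and KF: "K < (\<Sum>k\<in>F. ?q k * (d k)\<^sup>2)" by blast
  let ?W = "\<Sum>k\<in>F. ?q k * (d k)\<^sup>2"
  have FS: "k \<in> S" "\<bar>d k - d0\<bar> < r" "C k \<inter> {..<n} = {}" if "k \<in> F" for k using that F(2) by (auto simp: S'_def bad_def)
  obtain k0 where k0: "k0 \<in> F"
  proof -
   have "0 < K" by (simp add: K_def add_nonneg_pos)
   with KF have "F \<noteq> {}" by auto
   then show thesis using that by blast
  qed
  have kap: "0 \<le> \<kappa>"
  proof (rule ccontr)
   assume "\<not> 0 \<le> \<kappa>"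
   then have "\<kappa> * move_prob (C k0) (v k0) < 0" using pos[OF FS(1)[OF k0]] by (intro mult_neg_pos) auto
   with le[OF FS(1)[OF k0]] move_prob_01(1)[of "C k0" "u k0"] show False by linarith
  qed
  have l0: "0 \<le> l" using dl[OF FS(1)[OF k0]] by linarith
  have gov: "g (override_on w x (C k)) = g w" if "k \<in> F" for k w x
   by (rule dep) (use FS(3)[OF that] in \<open>auto simp: override_on_def disjoint_iff\<close>)
  have CC: "C k \<inter> C j = {}" if "j \<in> F" "k \<in> F" "j \<noteq> k" for j k
   using disj FS(1)[OF that(1)] FS(1)[OF that(2)] that(3) by (auto simp: disjoint_family_on_def)
  have "?W * ?m \<le> B * sqrt ((2 * (1 + \<kappa>)) * ?W) + ?m / 2 * ?W + B' * (l * sqrt ?W)"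
  proof (rule P.energy_estimate[where E="\<lambda>k. {w. \<forall>i\<in>C k. w i = u k i}" and \<xi>="\<lambda>k. move_score (C k) (u k) (v k)"
     and h="\<lambda>w. G (t, w)" and h'="\<lambda>k w. G (t - (\<Sum>i\<in>C k. u k i - v k i), w)" and X="1 + \<kappa>"])
   fix k assume k: "k \<in> F"
   note S = FS(1)[OF k]
   show "{w. \<forall>i\<in>C k. w i = u k i} \<in> P.events" by (rule sets_cylinder[OF \<rho> fin[OF S]])
   show "move_score (C k) (u k) (v k) \<in> borel_measurable PP\<rho>" by (rule measurable_move_score[OF fin[OF S]])
   show "(\<lambda>w. G (t - (\<Sum>i\<in>C k. u k i - v k i), w)) \<in> borel_measurable PP\<rho>" by (rule measurable_section_P\<rho>[OF \<rho> Gt])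
   show "P.prob {w. \<forall>i\<in>C k. w i = u k i} = ?q k" by (rule move_statistics(3)[OF fin[OF S] pos[OF S] le[OF S]])
   show "P.expectation (\<lambda>w. (move_score (C k) (u k) (v k) w)\<^sup>2) \<le> (2 * (1 + \<kappa>)) * ?q k"
    by (rule move_statistics(2)[OF fin[OF S] pos[OF S] le[OF S]])
   show "\<bar>move_score (C k) (u k) (v k) w\<bar> \<le> 1 + \<kappa>" for w by (rule move_statistics(1)[OF fin[OF S] pos[OF S] le[OF S]])
   show "P.expectation (\<lambda>w. move_score (C k) (u k) (v k) w *\<^sub>R (G (t, w) * g w)) =
    P.expectation (\<lambda>w. indicator {w. \<forall>i\<in>C k. w i = u k i} w *\<^sub>R ((G (t, w) - G (t - (\<Sum>i\<in>C k. u k i - v k i), w)) * g w))"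
    by (rule move_integration_by_parts[OF fin[OF S] Gt g gov[OF k] pos[OF S]])
   show "cmod (G (t - (\<Sum>i\<in>C k. u k i - v k i), w)) \<le> B" for w by (rule B)
   show "\<bar>d k\<bar> \<le> l" by (rule dl[OF S])
   let ?\<delta> = "\<Sum>i\<in>C k. u k i - v k i"
   show "AE w in PP\<rho>. cmod (G (t, w) - G (t - ?\<delta>, w) - d k *\<^sub>R D w) \<le> ?m / 2 * \<bar>d k\<bar>"
    using periodD[OF per[OF S] G, of "t - ?\<delta>"]
   proof eventually_elim
    case (elim w)
    then have "G (t - ?\<delta>, w) = G (t - d k, w)" by simp
    then show ?case using r(2)[OF FS(2)[OF k], of w] by simp
   qed
   fix j assume j: "j \<in> F" "j \<noteq> k"
   note S' = FS(1)[OF j(1)]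
   show "P.prob ({w. \<forall>i\<in>C j. w i = u j i} \<inter> {w. \<forall>i\<in>C k. w i = u k i}) = ?q j * ?q k"
    by (rule move_uncorrelated(2)[OF fin[OF S] fin[OF S'] CC[OF j(1) k j(2)] pos[OF S] le[OF S'] pos[OF S']])
   show "P.expectation (\<lambda>w. move_score (C j) (u j) (v j) w * move_score (C k) (u k) (v k) w) = 0"
    by (rule move_uncorrelated(1)[OF fin[OF S] fin[OF S'] CC[OF j(1) k j(2)] pos[OF S] le[OF S'] pos[OF S']])
  qed (use F D g B m kap l0 measurable_section_P\<rho>[OF \<rho> Gt] in auto)
  also have "... = A * sqrt ?W + ?m / 2 * ?W"
  proof -
   have "B * (x * y) + z + B' * (l * y) = (B * x + B' * l) * y + z" for x y z :: real by (simp add: algebra_simps)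
   then show ?thesis unfolding A_def real_sqrt_mult[of "2 * (1 + \<kappa>)"] .
  qed
  finally have "?m / 2 * ?W \<le> A * sqrt ?W" by (simp add: algebra_simps)
  moreover have "0 < K" by (simp add: K_def add_nonneg_pos)
  with KF have W: "0 < ?W" by linarith
  ultimately have "?W \<le> (2 * A / ?m)\<^sup>2" by (intro le_power2_of_sqrt_bound m)
  with KF show False by (simp add: K_def)
 qed
qed

end

section \<open>Exponential smoothing\<close>

abbreviation expo :: "real measure" where
 "expo \<equiv> density lborel (exponential_density 1)"

lemma prob_space_expo: "prob_space expo"
 by (rule prob_space_exponential_density) simp

text \<open>Averaging over an exponential waiting time. For continuous \<open>g\<close> the
  derivative is simply \<open>smooth g\<close> minus \<open>g\<close>, and the operation is
  injective up to null sets; so tail functions can be made Lipschitz and the smoothing can be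
  undone.\<close>

definition smooth :: "(real \<Rightarrow> complex) \<Rightarrow> real \<Rightarrow> complex" where
 "smooth g t = (\<integral>r. g (t + r) \<partial>expo)"

lemma smooth_integrable:
 fixes g :: "real \<Rightarrow> 'b::{banach, second_countable_topology}"
 assumes [measurable]: "g \<in> borel_measurable borel" and C: "\<And>r. norm (g r) \<le> C"
 shows "integrable expo (\<lambda>r. g (t + r))"
  and "integrable lborel (\<lambda>r. exponential_density 1 (r - t) *\<^sub>R g r)"
  and "(\<integral>r. g (t + r) \<partial>expo) = (\<integral>r. exponential_density 1 (r - t) *\<^sub>R g r \<partial>lborel)"
proof -
 interpret prob_space expo by (rule prob_space_expo)
 show i: "integrable expo (\<lambda>r. g (t + r))"
  by (intro integrable_const_bound[where B=C]) (simp_all add: C)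
 then have "integrable lborel (\<lambda>r. exponential_density 1 r *\<^sub>R g (t + r))"
  by (subst (asm) integrable_density) (auto simp: exponential_density_nonneg)
 then have "integrable lborel (\<lambda>r. (\<lambda>r. exponential_density 1 (r - t) *\<^sub>R g r) (t + 1 * r))" by simp
 then show "integrable lborel (\<lambda>r. exponential_density 1 (r - t) *\<^sub>R g r)"
  by (subst (asm) lborel_integrable_real_affine_iff) auto
 have "(\<integral>r. g (t + r) \<partial>expo) = (\<integral>r. exponential_density 1 r *\<^sub>R g (t + r) \<partial>lborel)"
  by (rule integral_density) (auto simp: exponential_density_nonneg)
 also have "... = (\<integral>r. exponential_density 1 (r - t) *\<^sub>R g r \<partial>lborel)"
  by (subst lborel_integral_real_affine[where c=1 and t=t]) auto
 finally show "(\<integral>r. g (t + r) \<partial>expo) = (\<integral>r. exponential_density 1 (r - t) *\<^sub>R g r \<partial>lborel)" .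
qed

lemma smooth_bound:
 assumes [measurable]: "g \<in> borel_measurable borel" and C: "\<And>r. cmod (g r) \<le> C"
 shows "cmod (smooth g t) \<le> C"
 unfolding smooth_def by (intro prob_space.norm_expectation_le prob_space_expo C) measurable

text \<open>The exponential law has no memory: beyond \<open>t'\<close>, the smoothing at
  \<open>t\<close> is \<open>exp (t - t')\<close> times the smoothing at \<open>t'\<close>.\<close>

lemma smooth_diff:
 assumes [measurable]: "g \<in> borel_measurable borel" and C: "\<And>r. cmod (g r) \<le> C" and t: "t \<le> t'"
 shows "integrable lborel (\<lambda>r. indicator {t..t'} r *\<^sub>R (exp (t - r) *\<^sub>R g r))"
  and "smooth g t - exp (t - t') *\<^sub>R smooth g t' = (\<integral>r. indicator {t..t'} r *\<^sub>R (exp (t - r) *\<^sub>R g r) \<partial>lborel)"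
proof -
 note i = smooth_integrable(2)[OF assms(1) C]
 let ?f = "\<lambda>r. exponential_density 1 (r - t) *\<^sub>R g r - exp (t - t') *\<^sub>R (exponential_density 1 (r - t') *\<^sub>R g r)"
 have f: "integrable lborel ?f" using i by (intro Bochner_Integration.integrable_diff integrable_scaleR_right)
 have eq: "AE r in lborel. ?f r = indicator {t..t'} r *\<^sub>R (exp (t - r) *\<^sub>R g r)"
  using AE_lborel_singleton[of t']
 proof eventually_elim
  case (elim r)
  have "exp (t - t') * exp (t' - r) = exp (t - r)" by (simp flip: exp_add)
  with elim t show ?case by (auto simp: exponential_density_def)
 qed
 show "integrable lborel (\<lambda>r. indicator {t..t'} r *\<^sub>R (exp (t - r) *\<^sub>R g r))"
  using f by (rule integrable_cong_AE_imp) (use eq in \<open>auto elim: eventually_mono\<close>)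
 have "smooth g t - exp (t - t') *\<^sub>R smooth g t' = (\<integral>r. ?f r \<partial>lborel)"
  unfolding smooth_def smooth_integrable(3)[OF assms(1) C]
  unfolding Bochner_Integration.integral_diff[OF i integrable_scaleR_right[OF i]] integral_scaleR_right ..
 also have "... = (\<integral>r. indicator {t..t'} r *\<^sub>R (exp (t - r) *\<^sub>R g r) \<partial>lborel)"
  by (rule integral_cong_AE[OF _ _ eq]) measurable
 finally show "smooth g t - exp (t - t') *\<^sub>R smooth g t' = (\<integral>r. indicator {t..t'} r *\<^sub>R (exp (t - r) *\<^sub>R g r) \<partial>lborel)" .
qed

lemma smooth_Lipschitz:
 assumes g[measurable]: "g \<in> borel_measurable borel" and C: "\<And>r. cmod (g r) \<le> C"
 shows "cmod (smooth g t - smooth g t') \<le> 2 * C * \<bar>t - t'\<bar>"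
proof -
 have C0: "0 \<le> C" using C[of 0] norm_ge_zero order_trans by blast
 have le: "cmod (smooth g t - smooth g t') \<le> 2 * C * (t' - t)" if t: "t \<le> t'" for t t'
 proof -
  have "cmod (smooth g t - exp (t - t') *\<^sub>R smooth g t') \<le> (\<integral>r. cmod (indicator {t..t'} r *\<^sub>R (exp (t - r) *\<^sub>R g r)) \<partial>lborel)"
   unfolding smooth_diff(2)[OF g C t] by (rule integral_norm_bound)
  also have "... \<le> (\<integral>r. C * indicator {t..t'} r \<partial>lborel)"
  proof (rule integral_mono)
   show "integrable lborel (\<lambda>r. cmod (indicator {t..t'} r *\<^sub>R (exp (t - r) *\<^sub>R g r)))"
    using smooth_diff(1)[OF g C t] by (rule integrable_norm)
   show "integrable lborel (\<lambda>r. C * indicator {t..t'} r)"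
    by (intro integrable_mult_right integrable_real_indicator) (use t in auto)
   fix r
   show "cmod (indicator {t..t'} r *\<^sub>R (exp (t - r) *\<^sub>R g r)) \<le> C * indicator {t..t'} r"
    using C[of r] C0 mult_mono[of "exp (t - r)" 1 "cmod (g r)" C] by (auto simp: indicator_def)
  qed
  also have "... = C * (t' - t)" using t by simp
  finally have 1: "cmod (smooth g t - exp (t - t') *\<^sub>R smooth g t') \<le> C * (t' - t)" .
  have "cmod (exp (t - t') *\<^sub>R smooth g t' - smooth g t') = \<bar>exp (t - t') - 1\<bar> * cmod (smooth g t')"
   by (simp flip: norm_scaleR add: scaleR_diff_left)
  also have "... \<le> (t' - t) * C"
  proof (rule mult_mono)
   show "\<bar>exp (t - t') - 1\<bar> \<le> t' - t"
   proof -
    have "1 + (t - t') \<le> exp (t - t')" by (rule exp_ge_add_one_self)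
    moreover have "exp (t - t') \<le> 1" using t by simp
    ultimately show ?thesis by linarith
   qed
  qed (use t smooth_bound[OF g C] in auto)
  finally show ?thesis
   using 1 norm_triangle_ineq[of "smooth g t - exp (t - t') *\<^sub>R smooth g t'" "exp (t - t') *\<^sub>R smooth g t' - smooth g t'"]
   by (simp add: algebra_simps)
 qed
 show ?thesis
  using le[of t t'] le[of t' t] by (cases "t \<le> t'") (auto simp: norm_minus_commute abs_if)
qed

text \<open>\<open>exp (- t) *\<^sub>R smooth g t\<close> is the integral of
  \<open>exp (- r) *\<^sub>R g r\<close> over \<open>r > t\<close>, so adding an antiderivative
  \<open>F\<close> of the integrand gives a constant.\<close>

lemma smooth_derivative:
 assumes g: "continuous_on UNIV g" and C: "\<And>r. cmod (g r) \<le> C"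
 shows "(smooth g has_vector_derivative (smooth g t - g t)) (at t)"
proof -
 have gm: "g \<in> borel_measurable borel" by (rule borel_measurable_continuous_onI[OF g])
 have cont: "isCont (\<lambda>r. exp (- r) *\<^sub>R g r) r" for r
  using g by (intro continuous_intros) (auto simp: continuous_on_eq_continuous_at)
 obtain F where F: "\<And>r. (F has_vector_derivative exp (- r) *\<^sub>R g r) (at r)"
  using einterval_antiderivative[of "-\<infinity>" "\<infinity>" "\<lambda>r. exp (- r) *\<^sub>R g r"] cont by auto
 have d: "exp (- t) *\<^sub>R smooth g t + F t = exp (- t') *\<^sub>R smooth g t' + F t'" if t: "t \<le> t'" for t t'
 proof -
  have "has_bochner_integral lborel (\<lambda>r. indicator {t..t'} r *\<^sub>R (exp (- r) *\<^sub>R g r)) (F t' - F t)"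
   by (rule has_bochner_integral_FTC_Icc[OF t])
     (use F cont in \<open>auto intro: has_vector_derivative_at_within continuous_at_imp_continuous_on\<close>)
  then have "has_bochner_integral lborel (\<lambda>r. exp t *\<^sub>R (indicator {t..t'} r *\<^sub>R (exp (- r) *\<^sub>R g r))) (exp t *\<^sub>R (F t' - F t))"
   by (rule has_bochner_integral_scaleR_right)
  then have "(\<integral>r. indicator {t..t'} r *\<^sub>R (exp (t - r) *\<^sub>R g r) \<partial>lborel) = exp t *\<^sub>R (F t' - F t)"
   by (simp add: has_bochner_integral_integral_eq exp_diff exp_minus field_simps)
  with smooth_diff(2)[OF gm C t] have "exp (- t) *\<^sub>R (smooth g t - exp (t - t') *\<^sub>R smooth g t') = exp (- t) *\<^sub>R (exp t *\<^sub>R (F t' - F t))" by simp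
  moreover have "exp (- t) * exp (t - t') = exp (- t')" "exp (- t) * exp t = 1" by (simp_all flip: exp_add)
  ultimately have "exp (- t) *\<^sub>R smooth g t - exp (- t') *\<^sub>R smooth g t' = F t' - F t" by (simp add: scaleR_diff_right)
  then show ?thesis by (simp add: algebra_simps)
 qed
 define A where "A = exp (- 0) *\<^sub>R smooth g 0 + F 0"
 have "exp (- t) *\<^sub>R smooth g t + F t = A" for t
  unfolding A_def using d[of t 0] d[of 0 t] by (cases "t \<le> 0") auto
 then have "A - F t = exp (- t) *\<^sub>R smooth g t" for t by (metis add_diff_cancel_right')
 then have eq: "smooth g = (\<lambda>t. exp t *\<^sub>R (A - F t))" by (simp add: fun_eq_iff flip: exp_add)
 have "((\<lambda>t. exp t *\<^sub>R (A - F t)) has_vector_derivative (exp t *\<^sub>R (0 - exp (- t) *\<^sub>R g t) + exp t *\<^sub>R (A - F t))) (at t)"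
  by (intro has_vector_derivative_scaleR has_vector_derivative_diff has_vector_derivative_const F DERIV_exp)
 moreover have "exp t *\<^sub>R (0 - exp (- t) *\<^sub>R g t) + exp t *\<^sub>R (A - F t) = smooth g t - g t"
  unfolding eq by (simp add: scaleR_scaleR flip: exp_add)
 ultimately show ?thesis unfolding eq by simp
qed

lemma emeasure_exp_density:
 assumes [measurable]: "h \<in> borel_measurable borel" and C: "\<And>r. 0 \<le> h r" "\<And>r. h r \<le> C"
 shows "emeasure (density lborel (\<lambda>r. ennreal (exp (- r) * h r))) {x<..} = ennreal (exp (- x) * (\<integral>r. h (x + r) \<partial>expo))"
proof -
 have hb: "norm (h r) \<le> C" for r using C[of r] by simp
 note i = smooth_integrable(2,3)[OF assms(1) hb, of x]
 have "emeasure (density lborel (\<lambda>r. ennreal (exp (- r) * h r))) {x<..} = (\<integral>\<^sup>+r. ennreal (exp (- r) * h r) * indicator {x<..} r \<partial>lborel)"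
  by (rule emeasure_density) auto
 also have "... = (\<integral>\<^sup>+r. ennreal (exp (- x) * (exponential_density 1 (r - x) *\<^sub>R h r)) \<partial>lborel)"
 proof (intro nn_integral_cong_AE)
  show "AE r in lborel. ennreal (exp (- r) * h r) * indicator {x<..} r = ennreal (exp (- x) * (exponential_density 1 (r - x) *\<^sub>R h r))"
   using AE_lborel_singleton[of x]
  proof eventually_elim
   case (elim r)
   have "exp (- x) * exp (x - r) = exp (- r)" by (simp flip: exp_add)
   with elim show ?case by (auto simp: exponential_density_def indicator_def mult.assoc[symmetric])
  qed
 qed
 also have "... = ennreal (\<integral>r. exp (- x) * (exponential_density 1 (r - x) *\<^sub>R h r) \<partial>lborel)"
  using i(1) C by (intro nn_integral_eq_integral) (auto simp: exponential_density_nonneg)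
 also have "... = ennreal (exp (- x) * (\<integral>r. h (x + r) \<partial>expo))"
  unfolding i(2) by (subst integral_mult_right_zero) simp
 finally show ?thesis .
qed

text \<open>After adding \<open>C\<close>, the vanishing of all smoothings says that the measures
  with densities \<open>exp (- r) * (g r + C)\<close> and \<open>exp (- r) * C\<close> agree on all
  half-lines, hence coincide.\<close>

lemma smooth_real_zero:
 fixes g :: "real \<Rightarrow> real"
 assumes [measurable]: "g \<in> borel_measurable borel" and C: "\<And>r. \<bar>g r\<bar> \<le> C" and 0: "\<And>t. (\<integral>r. g (t + r) \<partial>expo) = 0"
 shows "AE r in lborel. g r = 0"
proof -
 interpret prob_space expo by (rule prob_space_expo)
 have C0: "0 \<le> C" using C[of 0] by linarith
 have gC: "0 \<le> g r + C" "g r + C \<le> 2 * C" for r using C[of r] by auto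
 have i: "integrable expo (\<lambda>r. g (t + r))" for t by (rule smooth_integrable(1)[where C=C]) (simp_all add: C)
 let ?M = "density lborel (\<lambda>r. ennreal (exp (- r) * (g r + C)))" and ?N = "density lborel (\<lambda>r. ennreal (exp (- r) * C))"
 have M: "emeasure ?M {x<..} = ennreal (exp (- x) * C)" for x
 proof -
  have "(\<integral>r. g (x + r) + C \<partial>expo) = C" using i 0 prob_space by simp
  then show ?thesis by (subst emeasure_exp_density[OF _ gC]) auto
 qed
 have N: "emeasure ?N {x<..} = ennreal (exp (- x) * C)" for x
  using prob_space C0 by (subst emeasure_exp_density[where C=C]) auto
 have "?M = ?N" by (rule measure_eqI_lessThan) (simp_all add: M N)
 then have "AE r in lborel. ennreal (exp (- r) * (g r + C)) = ennreal (exp (- r) * C)"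
  by (intro sigma_finite_measure.density_unique[OF sigma_finite_lborel]) auto
 then show ?thesis
  by eventually_elim (use gC C0 in \<open>auto simp: ennreal_inj\<close>)
qed

lemma smooth_zero:
 assumes g[measurable]: "g \<in> borel_measurable borel" and C: "\<And>r. cmod (g r) \<le> C" and 0: "\<And>t. smooth g t = 0"
 shows "AE r in lborel. g r = 0"
proof -
 have i: "integrable expo (\<lambda>r. g (t + r))" for t by (rule smooth_integrable(1)[OF g C])
 have "AE r in lborel. Re (g r) = 0"
 proof (rule smooth_real_zero)
  show "\<bar>Re (g r)\<bar> \<le> C" for r using abs_Re_le_cmod C order_trans by blast
  show "(\<integral>r. Re (g (t + r)) \<partial>expo) = 0" for t
   using 0[of t] integral_Re[OF i[of t]] by (simp add: smooth_def)
 qed measurable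
 moreover have "AE r in lborel. Im (g r) = 0"
 proof (rule smooth_real_zero)
  show "\<bar>Im (g r)\<bar> \<le> C" for r using abs_Im_le_cmod C order_trans by blast
  show "(\<integral>r. Im (g (t + r)) \<partial>expo) = 0" for t
   using 0[of t] integral_Im[OF i[of t]] by (simp add: smooth_def)
 qed measurable
 ultimately show ?thesis by eventually_elim (simp add: complex_eq_iff)
qed

definition smooth_tail :: "(real \<times> (nat \<Rightarrow> real) \<Rightarrow> complex) \<Rightarrow> real \<times> (nat \<Rightarrow> real) \<Rightarrow> complex" where
 "smooth_tail G z = smooth (\<lambda>t. G (t, snd z)) (fst z)"

lemma tailfun_section: "tailfun G \<Longrightarrow> (\<lambda>t. G (t, x)) \<in> borel_measurable borel"
 by (rule measurable_compose[OF measurable_Pair2' tailfun_measurable]) (auto simp: space_PiM)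

lemma lip_tailfun_smooth_tail:
 assumes G: "tailfun G"
 shows "lip_tailfun (smooth_tail G)"
proof -
 interpret E: prob_space expo by (rule prob_space_expo)
 have Gm[measurable]: "G \<in> borel_measurable (borel \<Otimes>\<^sub>M PiM UNIV (\<lambda>_. borel))" by (rule tailfun_measurable[OF G])
 obtain C where C: "0 \<le> C" "\<And>z. cmod (G z) \<le> C" using tailfun_boundedE[OF G] by metis
 note sec = tailfun_section[OF G]
 have "tailfun (smooth_tail G)"
 proof (rule tailfunI[where C=C])
  show "smooth_tail G \<in> borel_measurable (borel \<Otimes>\<^sub>M PiM UNIV (\<lambda>_. borel))"
   unfolding smooth_tail_def[abs_def] smooth_def by measurable
  show "cmod (smooth_tail G z) \<le> C" for z unfolding smooth_tail_def by (rule smooth_bound[OF sec C(2)])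
  fix t :: real and x :: "nat \<Rightarrow> real" and n y
  have "G (t + r, x) = G (t + x n - y + r, x(n := y))" for r
   using tailfun_step[OF G, of "t + r" x n y] by (simp add: algebra_simps)
  then show "smooth_tail G (t, x) = smooth_tail G (t + x n - y, x(n := y))" by (simp add: smooth_tail_def smooth_def)
 qed
 moreover have "cmod (smooth_tail G (t, x) - smooth_tail G (s, x)) \<le> 2 * C * \<bar>t - s\<bar>" for t s x
  unfolding smooth_tail_def fst_conv snd_conv by (rule smooth_Lipschitz[OF sec C(2)])
 ultimately show ?thesis unfolding lip_tailfun_def by blast
qed

lemma Lipschitz_continuous_on:
 fixes f :: "real \<Rightarrow> complex"
 assumes "\<And>t s. cmod (f t - f s) \<le> L * \<bar>t - s\<bar>"
 shows "continuous_on UNIV f"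
proof -
 have "(max L 0)-lipschitz_on UNIV f"
 proof (rule lipschitz_onI)
  show "dist (f x) (f y) \<le> max L 0 * dist x y" for x y
   using assms[of x y] mult_right_mono[of L "max L 0" "\<bar>x - y\<bar>"] by (simp add: dist_norm)
 qed simp
 then show ?thesis by (rule lipschitz_on_continuous_on)
qed

lemma lip_tailfunE:
 assumes "lip_tailfun G"
 obtains L C where "0 \<le> L" "\<And>t s x. cmod (G (t, x) - G (s, x)) \<le> L * \<bar>t - s\<bar>" "\<And>x. continuous_on UNIV (\<lambda>t. G (t, x))"
  "0 \<le> C" "\<And>z. cmod (G z) \<le> C" "tailfun G"
proof -
 from assms obtain L where L: "\<And>t s x. cmod (G (t, x) - G (s, x)) \<le> L * \<bar>t - s\<bar>" and t: "tailfun G"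
  by (auto simp: lip_tailfun_def)
 obtain C where C: "0 \<le> C" "\<And>z. cmod (G z) \<le> C" using tailfun_boundedE[OF t] by metis
 have "0 \<le> cmod (G (1, undefined) - G (0, undefined))" by simp
 also have "... \<le> L" using L[of 1 undefined 0] by simp
 finally show thesis using that[OF _ L Lipschitz_continuous_on[OF L] C t] by simp
qed

lemma continuous_eq_on_rats:
 fixes f g :: "real \<Rightarrow> complex"
 assumes "continuous_on UNIV f" "continuous_on UNIV g" "\<And>q. q \<in> \<rat> \<Longrightarrow> f q = g q"
 shows "f t = g t"
proof -
 have "closed {t \<in> UNIV. f t = g t}" using closed_Collect_eq[OF assms(1,2)] by simp
 then have "closure \<rat> \<subseteq> {t. f t = g t}" using assms(3) by (intro closure_minimal) auto
 then show ?thesis using Rats_closure_real by auto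
qed

text \<open>The countably many rational times share one null set, and continuity does the
  rest.\<close>

lemma AE_rats_imp_all:
 fixes f g :: "real \<Rightarrow> 'b \<Rightarrow> complex"
 assumes "\<And>t. AE w in M. f t w = g t w" "\<And>w. continuous_on UNIV (\<lambda>t. f t w)" "\<And>w. continuous_on UNIV (\<lambda>t. g t w)"
 shows "AE w in M. \<forall>t. f t w = g t w"
proof -
 have "AE w in M. \<forall>q\<in>\<rat>. f q w = g q w" using assms(1) by (subst AE_ball_countable) (auto simp: countable_rat)
 then show ?thesis
 proof eventually_elim
  case (elim w)
  then show ?case using continuous_eq_on_rats[OF assms(2,3)] by blast
 qed
qed

section \<open>The group of periods\<close>

context
 fixes \<rho> :: "nat \<Rightarrow> real measure"
 assumes \<rho>: "\<And>k. real_distribution (\<rho> k)"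
begin

text \<open>On almost every path the smoothed function has the period at all times simultaneously,
  by continuity; injectivity of the smoothing returns the identity for \<open>G\<close> at almost
  every time.\<close>

lemma time_periodic_of_period:
 assumes per: "period \<rho> a"
 shows "time_periodic \<rho> a"
 unfolding time_periodic_def
proof (intro allI impI)
 fix G assume G: "tailfun G"
 interpret P: prob_space "PiM UNIV \<rho>" by (rule prob_P\<rho>[OF \<rho>])
 obtain C where C: "0 \<le> C" "\<And>z. cmod (G z) \<le> C" using tailfun_boundedE[OF G] by metis
 have K: "lip_tailfun (smooth_tail G)" by (rule lip_tailfun_smooth_tail[OF G])
 obtain L' C' where cK: "\<And>x. continuous_on UNIV (\<lambda>t. smooth_tail G (t, x))" by (rule lip_tailfunE[OF K]) (rule that)
 obtain L2 C2 where cK2: "\<And>x. continuous_on UNIV (\<lambda>t. smooth_tail G (t + a, x))"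
  by (rule lip_tailfunE[OF lip_tailfun_translate[OF K, of a]]) (rule that, simp)
 have "AE w in PiM UNIV \<rho>. \<forall>t. smooth_tail G (t + a, w) = smooth_tail G (t, w)"
  by (rule AE_rats_imp_all[OF periodD[OF per K] cK2 cK])
 then have AEw: "AE w in PiM UNIV \<rho>. AE t in lborel. G (t + a, w) = G (t, w)"
 proof eventually_elim
  case (elim w)
  note [measurable] = tailfun_section[OF G, of w]
  have i: "integrable expo (\<lambda>r. G (t + r, w))" for t
   using smooth_integrable(1)[OF tailfun_section[OF G, of w] C(2)] .
  have "AE t in lborel. G (t + a, w) - G (t, w) = 0"
  proof (rule smooth_zero[where C="2 * C"])
   show "cmod (G (r + a, w) - G (r, w)) \<le> 2 * C" for r
    using norm_triangle_ineq4[of "G (r + a, w)" "G (r, w)"] C(2)[of "(r + a, w)"] C(2)[of "(r, w)"] by simp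
   fix t
   have "smooth (\<lambda>t. G (t + a, w) - G (t, w)) t = (\<integral>r. G (t + a + r, w) - G (t + r, w) \<partial>expo)"
    unfolding smooth_def by (simp add: algebra_simps)
   also have "... = smooth_tail G (t + a, w) - smooth_tail G (t, w)"
    using i[of "t + a"] i[of t] by (simp add: smooth_tail_def smooth_def)
   finally show "smooth (\<lambda>t. G (t + a, w) - G (t, w)) t = 0" using elim by simp
  qed measurable
  then show ?case by simp
 qed
 have Gm[measurable]: "G \<in> borel_measurable (borel \<Otimes>\<^sub>M PiM UNIV (\<lambda>_. borel))" by (rule tailfun_measurable[OF G])
 have [measurable_cong]: "sets (PiM UNIV \<rho>) = sets (PiM UNIV (\<lambda>_. borel))" by (rule sets_PiM_real[OF \<rho>])
 have "{z \<in> space (gauss \<Otimes>\<^sub>M PiM UNIV \<rho>). G (fst z + a, snd z) = G z} \<in> sets (gauss \<Otimes>\<^sub>M PiM UNIV \<rho>)"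
  by (rule measurable_equality_set) measurable
 then show "AE z in path_space \<rho>. G (fst z + a, snd z) = G z"
  unfolding path_space_def using AEw by (subst AE_gauss_pair[OF P.prob_space_axioms]) auto
qed

text \<open>Integer multiples of small periods come arbitrarily close to \<open>s\<close>, and
  Lipschitz continuity passes to the limit.\<close>

lemma period_of_small_periods:
 assumes small: "\<And>l. 0 < l \<Longrightarrow> \<exists>s. period \<rho> s \<and> s \<noteq> 0 \<and> \<bar>s\<bar> \<le> l"
 shows "period \<rho> s"
 unfolding period_def
proof (intro allI impI)
 fix G t assume G: "lip_tailfun G"
 have "\<exists>s. period \<rho> s \<and> 0 < s \<and> s \<le> l" if "0 < l" for l
 proof -
  from small[OF that] obtain s where "period \<rho> s" "s \<noteq> 0" "\<bar>s\<bar> \<le> l" by blast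
  then show ?thesis using period_minus[of \<rho> s] by (cases "0 < s") (auto intro: exI[of _ "- s"])
 qed
 then have "\<forall>n::nat. \<exists>s. period \<rho> s \<and> 0 < s \<and> s \<le> 1 / real (Suc n)" by simp
 then obtain q where q: "\<And>n. period \<rho> (q n)" "\<And>n. 0 < q n" "\<And>n. q n \<le> 1 / real (Suc n)" by metis
 obtain L C where L: "0 \<le> L" "\<And>t s x. cmod (G (t, x) - G (s, x)) \<le> L * \<bar>t - s\<bar>" by (rule lip_tailfunE[OF G]) (rule that)
 define m where "m n = q n * of_int \<lfloor>s / q n\<rfloor>" for n
 have "AE w in PiM UNIV \<rho>. \<forall>n. G (t + m n, w) = G (t, w)"
  unfolding AE_all_countable m_def by (intro allI periodD[OF period_of_int G] q)
 then show "AE w in PiM UNIV \<rho>. G (t + s, w) = G (t, w)"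
 proof eventually_elim
  case (elim w)
  have "(\<lambda>n. G (t + m n, w)) \<longlonglongrightarrow> G (t + s, w)"
  proof (rule Lim_null_comparison[THEN Lim_null[THEN iffD2]])
   show "\<forall>\<^sub>F n in sequentially. norm (G (t + m n, w) - G (t + s, w)) \<le> L * (1 / real (Suc n))"
   proof (rule always_eventually, rule allI)
    fix n
    have "s = q n * (s / q n)" using q(2)[of n] by simp
    then have "m n - s = - (q n * frac (s / q n))" by (simp only: m_def frac_def right_diff_distrib minus_diff_eq)
    then have "\<bar>m n - s\<bar> = q n * frac (s / q n)" using q(2)[of n] frac_ge_0[of "s / q n"] by (simp add: abs_mult)
    also have "... \<le> q n * 1" using q(2)[of n] frac_lt_1[of "s / q n"] by (intro mult_left_mono) auto
    also have "... \<le> 1 / real (Suc n)" using q(3)[of n] by simp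
    finally have "\<bar>(t + m n) - (t + s)\<bar> \<le> 1 / real (Suc n)" by simp
    then show "norm (G (t + m n, w) - G (t + s, w)) \<le> L * (1 / real (Suc n))"
     using L(2)[of "t + m n" w "t + s"] L(1) by (meson mult_left_mono order_trans)
   qed
   show "(\<lambda>n. L * (1 / real (Suc n))) \<longlonglongrightarrow> 0"
    using tendsto_mult_right_zero[OF lim_1_over_n[THEN LIMSEQ_Suc], of L] by simp
  qed
  with elim have "(\<lambda>n::nat. G (t, w)) \<longlonglongrightarrow> G (t + s, w)" by simp
  then show ?case by (simp add: LIMSEQ_const_iff)
 qed
qed

text \<open>\<open>a\<close> is the least positive period, attained because distinct periods differ
  by more than \<open>l\<close>, or 0 if there is none. The last clause is the form used for limit
  points of numbers reduced modulo \<open>a\<close>.\<close>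

lemma period_structure:
 assumes "\<not> (\<forall>s. period \<rho> s)"
 obtains a l where "0 \<le> a" "0 < l" "period \<rho> a" "\<And>s. period \<rho> s \<Longrightarrow> s \<noteq> 0 \<Longrightarrow> l < \<bar>s\<bar>"
  "\<And>s. period \<rho> s \<Longrightarrow> a = 0 \<or> 0 \<le> s \<and> s \<le> a \<Longrightarrow> s = 0 \<or> s = a"
proof -
 from assms period_of_small_periods obtain l where l: "0 < l" "\<And>s. period \<rho> s \<Longrightarrow> s \<noteq> 0 \<Longrightarrow> l < \<bar>s\<bar>"
  by (metis not_le)
 define A where "A = {s. period \<rho> s \<and> 0 < s}"
 show thesis
 proof (cases "A = {}")
  case True
  have "s = 0" if "period \<rho> s" for s
  proof (rule ccontr)
   assume "s \<noteq> 0"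
   with that period_minus[OF that] have "s \<in> A \<or> - s \<in> A" by (auto simp: A_def)
   with True show False by simp
  qed
  then show thesis using that[of 0 l] l period_0 by blast
 next
  case False
  have bdd: "bdd_below A" by (rule bdd_belowI[of _ 0]) (auto simp: A_def)
  define a where "a = Inf A"
  have lo: "a \<le> s" if "s \<in> A" for s unfolding a_def by (rule cInf_lower[OF that bdd])
  obtain s where s: "s \<in> A" "s < a + l"
   using cInf_lessD[OF False, of "a + l"] l(1) by (auto simp: a_def)
  have "s = a"
  proof (rule ccontr)
   assume "s \<noteq> a"
   then have "a < s" using lo[OF s(1)] by simp
   then obtain s' where s': "s' \<in> A" "s' < s" using cInf_lessD[OF False, of s] by (auto simp: a_def)
   then have "period \<rho> (s - s')" using s(1) by (auto simp: A_def intro: period_diff)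
   with l(2)[of "s - s'"] s s' lo[OF s'(1)] show False by auto
  qed
  with s have a: "period \<rho> a" "0 < a" by (auto simp: A_def)
  show thesis
  proof (rule that[of a l])
   fix s assume "period \<rho> s" "a = 0 \<or> 0 \<le> s \<and> s \<le> a"
   with a(2) lo[of s] show "s = 0 \<or> s = a" by (cases "s = 0") (auto simp: A_def)
  qed (use a l in auto)
 qed
qed

text \<open>\<open>d k\<close> is a displacement reduced modulo periods; Lipschitz tail functions
  almost surely do not distinguish it from the true one, and it is the reduced one that has to be
  bounded by \<open>l\<close>.\<close>

definition move_family :: "nat set \<Rightarrow> (nat \<Rightarrow> nat set) \<Rightarrow> (nat \<Rightarrow> nat \<Rightarrow> real) \<Rightarrow> (nat \<Rightarrow> nat \<Rightarrow> real) \<Rightarrow> real \<Rightarrow> (nat \<Rightarrow> real) \<Rightarrow> real \<Rightarrow> bool" where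
 "move_family S C u v \<kappa> d l \<longleftrightarrow> disjoint_family_on C S \<and>
   (\<forall>k\<in>S. finite (C k) \<and> C k \<noteq> {} \<and> 0 < move_prob \<rho> (C k) (v k) \<and> move_prob \<rho> (C k) (u k) \<le> \<kappa> * move_prob \<rho> (C k) (v k) \<and>
    period \<rho> ((\<Sum>i\<in>C k. u k i - v k i) - d k) \<and> \<bar>d k\<bar> \<le> l)"

lemma move_family_linearization_zero:
 assumes mf: "move_family S C u v \<kappa> d l"
  and div: "\<And>r. 0 < r \<Longrightarrow> \<not> (\<lambda>k. move_prob \<rho> (C k) (u k) * (d k)\<^sup>2) summable_on {k\<in>S. \<bar>d k - d0\<bar> < r}"
  and G: "lip_tailfun G" and D: "D \<in> borel_measurable (PiM UNIV \<rho>)" "\<And>w. cmod (D w) \<le> B'"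
  and lin: "\<And>\<epsilon>. 0 < \<epsilon> \<Longrightarrow> \<exists>r>0. \<forall>d w. \<bar>d - d0\<bar> < r \<longrightarrow> cmod (G (t, w) - G (t - d, w) - d *\<^sub>R D w) \<le> \<epsilon> * \<bar>d\<bar>"
 shows "AE w in PiM UNIV \<rho>. D w = 0"
 by (rule moves_linearization_zero[OF \<rho>, where S=S and C=C and u=u and v=v and \<kappa>=\<kappa> and d=d and l=l and ?d0.0=d0 and G=G and t=t and B'=B'])
   (use mf div G D lin in \<open>auto simp: move_family_def\<close>)

text \<open>Two linearisations. If \<open>d0\<close> is nonzero, \<open>D\<close> is the difference
  quotient of \<open>G\<close> for the step \<open>d0\<close>, and its vanishing makes
  \<open>d0\<close> a period. If \<open>d0 = 0\<close>, \<open>D\<close> is the time derivative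
  \<open>?K - G\<close> of the smoothed function \<open>?K\<close>; its vanishing gives
  \<open>?K = G\<close> with derivative zero, so \<open>G\<close> is constant in time on almost
  every path.\<close>

lemma period_of_divergence:
 assumes mf: "move_family S C u v \<kappa> d l"
  and div: "\<And>r. 0 < r \<Longrightarrow> \<not> (\<lambda>k. move_prob \<rho> (C k) (u k) * (d k)\<^sup>2) summable_on {k\<in>S. \<bar>d k - d0\<bar> < r}"
 shows "period \<rho> d0" "d0 = 0 \<Longrightarrow> period \<rho> s"
proof -
 have "period \<rho> (- d0)" if d0: "d0 \<noteq> 0"
  unfolding period_def
 proof (intro allI impI)
  fix G t assume G: "lip_tailfun G"
  obtain L C' where L: "0 \<le> L" "\<And>t s x. cmod (G (t, x) - G (s, x)) \<le> L * \<bar>t - s\<bar>" and Gt: "tailfun G"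
   by (rule lip_tailfunE[OF G]) (rule that)
  define D where "D w = (1 / d0) *\<^sub>R (G (t, w) - G (t - d0, w))" for w
  have DL: "cmod (D w) \<le> L" for w
   using L(2)[of t w "t - d0"] d0 by (simp add: D_def divide_le_eq)
  have "AE w in PiM UNIV \<rho>. D w = 0"
  proof (rule move_family_linearization_zero[OF mf div G _ DL])
   show "D \<in> borel_measurable (PiM UNIV \<rho>)"
    unfolding D_def[abs_def] by (intro borel_measurable_scaleR borel_measurable_diff measurable_section_P\<rho>[OF \<rho> Gt]) simp
   fix \<epsilon> :: real assume e: "0 < \<epsilon>"
   \<comment> \<open>The linearisation error is at most \<open>2 * L * \<bar>d - d0\<bar>\<close>.
     The first bound keeps \<open>\<bar>d\<bar>\<close> above \<open>\<bar>d0\<bar> / 2\<close>, so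
     that the second one makes the error at most \<open>\<epsilon> * \<bar>d\<bar>\<close>.\<close>
   define r where "r = min (\<bar>d0\<bar> / 2) (\<epsilon> * \<bar>d0\<bar> / (4 * (L + 1)))"
   have "0 < r" using e d0 L(1) by (simp add: r_def)
   moreover have "cmod (G (t, w) - G (t - d, w) - d *\<^sub>R D w) \<le> \<epsilon> * \<bar>d\<bar>" if d: "\<bar>d - d0\<bar> < r" for d w
   proof -
    have "d0 *\<^sub>R D w = G (t, w) - G (t - d0, w)" using d0 by (simp add: D_def)
    then have "G (t, w) - G (t - d, w) - d *\<^sub>R D w = (G (t - d0, w) - G (t - d, w)) - (d - d0) *\<^sub>R D w"
     by (simp add: scaleR_diff_left)
    also have "cmod ... \<le> L * \<bar>d - d0\<bar> + \<bar>d - d0\<bar> * L"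
    proof (rule order_trans[OF norm_triangle_ineq4 add_mono])
     show "cmod (G (t - d0, w) - G (t - d, w)) \<le> L * \<bar>d - d0\<bar>" using L(2)[of "t - d0" w "t - d"] by simp
     show "cmod ((d - d0) *\<^sub>R D w) \<le> \<bar>d - d0\<bar> * L" using mult_left_mono[OF DL[of w], of "\<bar>d - d0\<bar>"] by simp
    qed
    also have "... = 2 * L * \<bar>d - d0\<bar>" by simp
    also have "... \<le> 2 * (L + 1) * (\<epsilon> * \<bar>d0\<bar> / (4 * (L + 1)))"
     using d L(1) by (intro mult_mono) (auto simp: r_def)
    also have "... = \<epsilon> * (\<bar>d0\<bar> / 2)" using L(1) by (simp add: field_simps)
    also have "... \<le> \<epsilon> * \<bar>d\<bar>"
    proof (rule mult_left_mono)
     have "\<bar>d - d0\<bar> < \<bar>d0\<bar> / 2" using d by (simp add: r_def)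
     then show "\<bar>d0\<bar> / 2 \<le> \<bar>d\<bar>" by linarith
    qed (use e in simp)
    finally show ?thesis .
   qed
   ultimately show "\<exists>r>0. \<forall>d w. \<bar>d - d0\<bar> < r \<longrightarrow> cmod (G (t, w) - G (t - d, w) - d *\<^sub>R D w) \<le> \<epsilon> * \<bar>d\<bar>" by blast
  qed
  then show "AE w in PiM UNIV \<rho>. G (t + - d0, w) = G (t, w)"
   by eventually_elim (use d0 in \<open>simp add: D_def\<close>)
 qed
 then show "period \<rho> d0" using period_minus[of \<rho> "- d0"] period_0[of \<rho>] by (cases "d0 = 0") auto
 show "period \<rho> s" if d0: "d0 = 0"
  unfolding period_def
 proof (intro allI impI)
  fix G t0 assume G: "lip_tailfun G"
  obtain L C' where L: "0 \<le> L" "\<And>t s x. cmod (G (t, x) - G (s, x)) \<le> L * \<bar>t - s\<bar>" and c: "\<And>x. continuous_on UNIV (\<lambda>t. G (t, x))"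
   and C': "0 \<le> C'" "\<And>z. cmod (G z) \<le> C'" and Gt: "tailfun G"
   by (rule lip_tailfunE[OF G]) (rule that)
  let ?K = "smooth_tail G"
  have K: "lip_tailfun ?K" by (rule lip_tailfun_smooth_tail[OF Gt])
  obtain L2 C2 where L2: "0 \<le> L2" "\<And>t s x. cmod (?K (t, x) - ?K (s, x)) \<le> L2 * \<bar>t - s\<bar>" and cK: "\<And>x. continuous_on UNIV (\<lambda>t. ?K (t, x))"
   and C2: "0 \<le> C2" "\<And>z. cmod (?K z) \<le> C2" and Kt: "tailfun ?K"
   by (rule lip_tailfunE[OF K]) (rule that)
  have der: "((\<lambda>t. ?K (t, w)) has_vector_derivative (?K (t, w) - G (t, w))) (at t)" for t w
   using smooth_derivative[OF c[of w] C'(2), of t] by (simp add: smooth_tail_def[abs_def])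
  have "AE w in PiM UNIV \<rho>. ?K (t, w) - G (t, w) = 0" for t
  proof (rule move_family_linearization_zero[OF mf div K])
   show "(\<lambda>w. ?K (t, w) - G (t, w)) \<in> borel_measurable (PiM UNIV \<rho>)"
    by (intro borel_measurable_diff measurable_section_P\<rho>[OF \<rho>] Kt Gt)
   show "cmod (?K (t, w) - G (t, w)) \<le> C2 + C'" for w
    using norm_triangle_ineq4[of "?K (t, w)" "G (t, w)"] C2(2)[of "(t, w)"] C'(2)[of "(t, w)"] by simp
   fix \<epsilon> :: real assume e: "0 < \<epsilon>"
   define r where "r = \<epsilon> / (L + L2 + 1)"
   have "0 < r" using e L(1) L2(1) by (simp add: r_def)
   moreover have "cmod (?K (t, w) - ?K (t - d, w) - d *\<^sub>R (?K (t, w) - G (t, w))) \<le> \<epsilon> * \<bar>d\<bar>" if d: "\<bar>d - d0\<bar> < r" for d w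
   proof -
    \<comment> \<open>The mean value inequality is applied to \<open>?K\<close> minus the linear
      function with its slope at \<open>t\<close>; the derivative \<open>?K - G\<close> is Lipschitz
      with constant \<open>L + L2\<close>.\<close>
    define h where "h u = ?K (u, w) - u *\<^sub>R (?K (t, w) - G (t, w))" for u
    have hd: "(h has_derivative (\<lambda>x. x *\<^sub>R ((?K (u, w) - G (u, w)) - (?K (t, w) - G (t, w))))) (at u within closed_segment t (t - d))" for u
     unfolding h_def has_vector_derivative_def[symmetric]
     by (rule has_vector_derivative_at_within) (auto intro!: derivative_eq_intros der)
    have "norm (h t - h (t - d)) \<le> (L + L2 + 1) * \<bar>d\<bar> * norm (t - (t - d))"
    proof (rule differentiable_bound[OF convex_closed_segment hd])
     fix u assume "u \<in> closed_segment t (t - d)"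
     then have u: "\<bar>u - t\<bar> \<le> \<bar>d\<bar>" by (auto simp: closed_segment_eq_real_ivl split: if_splits)
     have "cmod ((?K (u, w) - G (u, w)) - (?K (t, w) - G (t, w))) \<le> cmod (?K (u, w) - ?K (t, w)) + cmod (G (u, w) - G (t, w))"
      using norm_triangle_ineq4[of "?K (u, w) - ?K (t, w)" "G (u, w) - G (t, w)"] by (simp add: algebra_simps)
     also have "... \<le> (L + L2) * \<bar>u - t\<bar>" using L(2)[of u w t] L2(2)[of u w t] by (simp add: algebra_simps)
     also have "... \<le> (L + L2 + 1) * \<bar>d\<bar>" using u L(1) L2(1) by (intro mult_mono) auto
     finally have le: "cmod ((?K (u, w) - G (u, w)) - (?K (t, w) - G (t, w))) \<le> (L + L2 + 1) * \<bar>d\<bar>" .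
     show "onorm (\<lambda>x. x *\<^sub>R ((?K (u, w) - G (u, w)) - (?K (t, w) - G (t, w)))) \<le> (L + L2 + 1) * \<bar>d\<bar>"
      by (rule onorm_le) (use mult_left_mono[OF le abs_ge_zero] in \<open>simp add: mult.commute\<close>)
    qed auto
    also have "... = (L + L2 + 1) * \<bar>d\<bar> * \<bar>d\<bar>" by simp
    also have "... \<le> \<epsilon> * \<bar>d\<bar>"
     using d L(1) L2(1) by (intro mult_right_mono) (auto simp: r_def d0 field_simps)
    finally show ?thesis by (simp add: h_def algebra_simps)
   qed
   ultimately show "\<exists>r>0. \<forall>d w. \<bar>d - d0\<bar> < r \<longrightarrow> cmod (?K (t, w) - ?K (t - d, w) - d *\<^sub>R (?K (t, w) - G (t, w))) \<le> \<epsilon> * \<bar>d\<bar>" by blast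
  qed
  then have "AE w in PiM UNIV \<rho>. ?K (t, w) = G (t, w)" for t by simp
  then have "AE w in PiM UNIV \<rho>. \<forall>t. ?K (t, w) = G (t, w)" by (rule AE_rats_imp_all[OF _ cK c])
  then show "AE w in PiM UNIV \<rho>. G (t0 + s, w) = G (t0, w)"
  proof eventually_elim
   case (elim w)
   have "((\<lambda>t. ?K (t, w)) has_vector_derivative 0) (at t)" for t using der[where t=t and w=w] elim by simp
   then have "((\<lambda>t. ?K (t, w)) has_derivative (\<lambda>_. 0)) (at t within UNIV)" for t by (simp add: has_vector_derivative_def)
   then obtain c where "\<And>t. ?K (t, w) = c" using has_derivative_zero_constant[of UNIV "\<lambda>t. ?K (t, w)"] by auto
   with elim show ?case by metis
  qed
 qed
qed

text \<open>A divergent energy would diverge near some point of the compact interval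
  \<open>[- l, l]\<close>. That point would be a period, which is impossible: a nonzero period
  exceeds \<open>l\<close> in absolute value, and the point 0 would make every number a
  period.\<close>

lemma move_family_summable:
 assumes mf: "move_family S C u v \<kappa> d l" and nt: "\<not> (\<forall>s. period \<rho> s)"
  and l: "\<And>s. period \<rho> s \<Longrightarrow> s \<noteq> 0 \<Longrightarrow> l < \<bar>s\<bar>"
 shows "(\<lambda>k. move_prob \<rho> (C k) (u k) * (d k)\<^sup>2) summable_on S"
proof -
 let ?f = "\<lambda>k. move_prob \<rho> (C k) (u k) * (d k)\<^sup>2"
 have "\<exists>r>0. ?f summable_on {k\<in>S. \<bar>d k - x\<bar> < r}" if "x \<in> {- l..l}" for x
 proof (rule ccontr)
  assume "\<not> (\<exists>r>0. ?f summable_on {k\<in>S. \<bar>d k - x\<bar> < r})"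
  then have div: "\<And>r. 0 < r \<Longrightarrow> \<not> ?f summable_on {k\<in>S. \<bar>d k - x\<bar> < r}" by blast
  from period_of_divergence[OF mf div] nt l[of x] that show False by (cases "x = 0") auto
 qed
 then have "\<forall>x\<in>{- l..l}. \<exists>r. 0 < r \<and> ?f summable_on {k\<in>S. \<bar>d k - x\<bar> < r}" by blast
 from bchoice[OF this] obtain r where r: "\<And>x. x \<in> {- l..l} \<Longrightarrow> 0 < r x" "\<And>x. x \<in> {- l..l} \<Longrightarrow> ?f summable_on {k\<in>S. \<bar>d k - x\<bar> < r x}" by blast
 have "{- l..l} \<subseteq> (\<Union>x\<in>{- l..l}. ball x (r x))" using r(1) by auto
 then obtain X where X: "X \<subseteq> {- l..l}" "finite X" "{- l..l} \<subseteq> (\<Union>x\<in>X. ball x (r x))"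
  by (rule compactE_image[where f="\<lambda>x. ball x (r x)", OF compact_Icc open_ball]) (rule that)
 have "?f summable_on (\<Union>x\<in>X. {k\<in>S. \<bar>d k - x\<bar> < r x})"
  using X(2,1)
 proof (induction X rule: finite_induct)
  case (insert x F)
  then show ?case unfolding UN_insert by (intro summable_on_union r(2)) auto
 qed simp
 moreover have "(\<Union>x\<in>X. {k\<in>S. \<bar>d k - x\<bar> < r x}) = S"
 proof -
  have "\<exists>x\<in>X. \<bar>d k - x\<bar> < r x" if "k \<in> S" for k
  proof -
   from mf that have "d k \<in> {- l..l}" by (force simp: move_family_def)
   with X(3) show ?thesis by (force simp: dist_real_def abs_minus_commute)
  qed
  then show ?thesis by auto
 qed
 ultimately show ?thesis by simp
qed

lemma not_summable_on_infinite:
 fixes f :: "nat \<Rightarrow> real"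
 assumes S: "infinite S" and m: "0 < m" "\<And>k. k \<in> S \<Longrightarrow> m \<le> f k"
 shows "\<not> f summable_on S"
proof
 assume f: "f summable_on S"
 obtain n :: nat where n: "infsum f S < real n * m" using reals_Archimedean3[OF m(1)] by blast
 obtain F where F: "F \<subseteq> S" "card F = n" "finite F" using infinite_arbitrarily_large[OF S] by blast
 have "real n * m \<le> sum f F" using sum_mono[of F "\<lambda>_. m" f] F m(2) by auto
 also have "... \<le> infsum f S"
  by (rule finite_sum_le_infsum[OF f F(3,1)]) (use m in \<open>auto intro: order_trans[OF less_imp_le]\<close>)
 finally show False using n by simp
qed

text \<open>Infinitely many moves with displacements near a nonzero \<open>x\<close> have energies
  bounded below, so their sum diverges.\<close>

lemma period_of_accumulation:
 assumes mf: "move_family S C u v \<kappa> d l" and m: "0 < m" "\<And>k. k \<in> S \<Longrightarrow> m \<le> move_prob \<rho> (C k) (u k)"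
  and acc: "\<And>r. 0 < r \<Longrightarrow> infinite {k\<in>S. \<bar>d k - x\<bar> < r}"
 shows "period \<rho> x"
proof (cases "x = 0")
 case False
 show ?thesis
 proof (rule period_of_divergence(1)[OF mf])
  fix r :: real assume r: "0 < r"
  let ?r = "min r (\<bar>x\<bar> / 2)"
  have inf: "infinite {k\<in>S. \<bar>d k - x\<bar> < ?r}" by (rule acc) (use r False in auto)
  have "\<not> (\<lambda>k. move_prob \<rho> (C k) (u k) * (d k)\<^sup>2) summable_on {k\<in>S. \<bar>d k - x\<bar> < ?r}"
  proof (rule not_summable_on_infinite[OF inf])
   show "0 < m * (\<bar>x\<bar> / 2)\<^sup>2" using m False by simp
   fix k assume "k \<in> {k\<in>S. \<bar>d k - x\<bar> < ?r}"
   then have k: "k \<in> S" and "\<bar>d k - x\<bar> < \<bar>x\<bar> / 2" by auto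
   then have xd: "\<bar>x\<bar> / 2 \<le> \<bar>d k\<bar>" by linarith
   have "(\<bar>x\<bar> / 2)\<^sup>2 \<le> (d k)\<^sup>2" using power_mono[OF xd, of 2] by simp
   then show "m * (\<bar>x\<bar> / 2)\<^sup>2 \<le> move_prob \<rho> (C k) (u k) * (d k)\<^sup>2"
    using m(2)[OF k] m(1) by (intro mult_mono) auto
  qed
  then show "\<not> (\<lambda>k. move_prob \<rho> (C k) (u k) * (d k)\<^sup>2) summable_on {k\<in>S. \<bar>d k - x\<bar> < r}"
   by (rule contrapos_nn) (auto elim: summable_on_subset_banach)
 qed
qed (simp add: period_0)

text \<open>The exchange of the atoms \<open>x k\<close> and \<open>x k + a\<close> is a move with
  displacement \<open>a\<close>, available in infinitely many coordinates with probability at least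
  \<open>m\<close>.\<close>

lemma period_of_atoms:
 assumes S: "infinite S" and m: "0 < m" "\<And>k. k \<in> S \<Longrightarrow> m \<le> measure (\<rho> k) {x k}" "\<And>k. k \<in> S \<Longrightarrow> m \<le> measure (\<rho> k) {x k + a}"
 shows "period \<rho> a"
proof (rule period_of_accumulation)
 interpret R: real_distribution "\<rho> k" for k by (rule \<rho>)
 have "measure (\<rho> k) {x k + a} \<le> 1 / m * measure (\<rho> k) {x k}" if "k \<in> S" for k
 proof -
  have "measure (\<rho> k) {x k + a} \<le> 1 / m * m" using m(1) R.prob_le_1[of k "{x k + a}"] by simp
  also have "... \<le> 1 / m * measure (\<rho> k) {x k}" using m(1) m(2)[OF that] by (intro mult_left_mono) auto
  finally show ?thesis .
 qed
 then show "move_family S (\<lambda>k. {k}) (\<lambda>k _. x k + a) (\<lambda>k _. x k) (1 / m) (\<lambda>_. a) \<bar>a\<bar>"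
  using m by (auto simp: move_family_def disjoint_family_on_def move_prob_def[OF \<rho>] period_0 intro: less_le_trans)
 show "m \<le> move_prob \<rho> {k} (\<lambda>_. x k + a)" if "k \<in> S" for k using m(3)[OF that] by (simp add: move_prob_def[OF \<rho>])
qed (use m S in auto)

end

section \<open>Sums of Bernoulli variables\<close>

definition bern_sum :: "(nat \<Rightarrow> real) \<Rightarrow> nat set \<Rightarrow> nat pmf" where
 "bern_sum p J = map_pmf (\<lambda>f. \<Sum>i\<in>J. f i) (Pi_pmf J 0 (\<lambda>i. bern (p i)))"

lemma finite_set_bern: "finite (set_pmf (bern p))" "set_pmf (bern p) \<subseteq> {0, 1}"
 by (auto simp: bern_def)

lemma finite_Pi_bern: "finite J \<Longrightarrow> finite (set_pmf (Pi_pmf J 0 (\<lambda>i. bern (p i))))"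
 using set_Pi_pmf_subset'[of J 0 "\<lambda>i. bern (p i)"]
 by (rule finite_subset[OF _ finite_PiE_dflt]) (auto simp: finite_set_bern)

lemma finite_bern_sum: "finite J \<Longrightarrow> finite (set_pmf (bern_sum p J))"
 by (simp add: bern_sum_def finite_Pi_bern)

lemma expectation_Pi_bern_insert:
 fixes \<Phi> :: "(nat \<Rightarrow> nat) \<Rightarrow> 'b::{banach, second_countable_topology}"
 assumes J: "finite J" "i \<notin> J" and p: "0 \<le> p i" "p i \<le> 1"
 shows "measure_pmf.expectation (Pi_pmf (insert i J) 0 (\<lambda>i. bern (p i))) \<Phi> =
  p i *\<^sub>R measure_pmf.expectation (Pi_pmf J 0 (\<lambda>i. bern (p i))) (\<lambda>f. \<Phi> (f(i := 1))) +
  (1 - p i) *\<^sub>R measure_pmf.expectation (Pi_pmf J 0 (\<lambda>i. bern (p i))) (\<lambda>f. \<Phi> (f(i := 0)))"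
proof -
 let ?P = "Pi_pmf J 0 (\<lambda>i. bern (p i))"
 have "measure_pmf.expectation (Pi_pmf (insert i J) 0 (\<lambda>i. bern (p i))) \<Phi> =
   measure_pmf.expectation (bern (p i) \<bind> (\<lambda>y. map_pmf (\<lambda>f. f(i := y)) ?P)) \<Phi>"
  unfolding Pi_pmf_insert'[OF J] by (simp add: map_pmf_def)
 also have "... = (\<Sum>y\<in>{0, 1}. pmf (bern (p i)) y *\<^sub>R measure_pmf.expectation (map_pmf (\<lambda>f. f(i := y)) ?P) \<Phi>)"
  by (rule pmf_expectation_bind) (use finite_set_bern(2)[of "p i"] in \<open>simp_all add: finite_Pi_bern J\<close>)
 finally have eq: "measure_pmf.expectation (Pi_pmf (insert i J) 0 (\<lambda>i. bern (p i))) \<Phi> =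
  (\<Sum>y\<in>{0, 1}. pmf (bern (p i)) y *\<^sub>R measure_pmf.expectation (map_pmf (\<lambda>f. f(i := y)) ?P) \<Phi>)" .
 have "pmf (bern (p i)) 0 = 1 - p i" "pmf (bern (p i)) 1 = p i"
  using measure_bern[OF p, of "{0}"] measure_bern[OF p, of "{1}"] by (simp_all add: measure_pmf_single)
 then show ?thesis unfolding eq by (simp add: add.commute)
qed

lemma sum_fun_upd: "finite J \<Longrightarrow> i \<notin> J \<Longrightarrow> (\<Sum>k\<in>insert i J. (f(i := y)) k) = y + (\<Sum>k\<in>J. f k)" for f :: "nat \<Rightarrow> nat"
 by (simp add: sum.insert) (rule sum.cong, auto)

lemma expectation_bern_sum_insert:
 fixes \<phi> :: "nat \<Rightarrow> 'b::{banach, second_countable_topology}"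
 assumes J: "finite J" "i \<notin> J" and p: "0 \<le> p i" "p i \<le> 1"
 shows "measure_pmf.expectation (bern_sum p (insert i J)) \<phi> =
  p i *\<^sub>R measure_pmf.expectation (bern_sum p J) (\<lambda>n. \<phi> (Suc n)) + (1 - p i) *\<^sub>R measure_pmf.expectation (bern_sum p J) \<phi>"
 unfolding bern_sum_def integral_map_pmf
 by (subst expectation_Pi_bern_insert[where p=p, OF J p]) (simp only: sum_fun_upd[OF J] plus_1_eq_Suc add_0)

lemma char_bern_sum:
 assumes J: "finite J" and p: "\<And>i. i \<in> J \<Longrightarrow> 0 \<le> p i \<and> p i \<le> 1"
 shows "char (nat_law c (bern_sum p J)) s = (\<Prod>i\<in>J. 1 + of_real (p i) * (iexp (s * c) - 1))"
proof -
 have "measure_pmf.expectation (bern_sum p J) (\<lambda>n. z ^ n) = (\<Prod>i\<in>J. 1 + of_real (p i) * (z - 1))" for z :: complex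
  using J p
 proof (induction J rule: finite_induct)
  case (insert i J)
  have "measure_pmf.expectation (bern_sum p (insert i J)) (\<lambda>n. z ^ n) =
    p i *\<^sub>R measure_pmf.expectation (bern_sum p J) (\<lambda>n. z * z ^ n) + (1 - p i) *\<^sub>R measure_pmf.expectation (bern_sum p J) (\<lambda>n. z ^ n)"
   using expectation_bern_sum_insert[where p=p, OF insert(1,2), where \<phi>="\<lambda>n. z ^ n"] insert.prems by simp
  also have "... = (of_real (p i) * z + (1 - of_real (p i))) * measure_pmf.expectation (bern_sum p J) (\<lambda>n. z ^ n)"
   by (simp add: scaleR_conv_of_real algebra_simps)
  also have "... = (1 + of_real (p i) * (z - 1)) * (\<Prod>i\<in>J. 1 + of_real (p i) * (z - 1))"
   using insert by (simp add: algebra_simps)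
  finally show ?case using insert by simp
 qed (simp add: bern_sum_def)
 then show ?thesis unfolding char_nat_law .
qed

text \<open>Separating the \<open>i\<close>-th variable from the sum of the others leaves a factor
  \<open>(p i)\<^sup>2\<close>, since the first order terms cancel. Compared with the usual Stein
  operator the argument of \<open>h\<close> is shifted by one; the truncated \<open>n - 1\<close> at
  \<open>n = 0\<close> is multiplied by 0.\<close>

lemma stein_identity:
 fixes h :: "nat \<Rightarrow> real"
 assumes J: "finite J" and p: "\<And>i. i \<in> J \<Longrightarrow> 0 \<le> p i \<and> p i \<le> 1"
 shows "measure_pmf.expectation (bern_sum p J) (\<lambda>n. (\<Sum>i\<in>J. p i) * h n - real n * h (n - 1)) =
  (\<Sum>i\<in>J. (p i)\<^sup>2 * measure_pmf.expectation (bern_sum p (J - {i})) (\<lambda>n. h (Suc n) - h n))"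
proof -
 let ?E = "\<lambda>J. measure_pmf.expectation (Pi_pmf J 0 (\<lambda>i. bern (p i)))"
 let ?W = "\<lambda>J f. \<Sum>k\<in>J. f k :: nat"
 have int: "integrable (measure_pmf (Pi_pmf J' 0 (\<lambda>i. bern (p i)))) \<Phi>" if "finite J'" for J' and \<Phi> :: "(nat \<Rightarrow> nat) \<Rightarrow> real"
  by (intro integrable_measure_pmf_finite finite_Pi_bern that)
 have "measure_pmf.expectation (bern_sum p J) (\<lambda>n. (\<Sum>i\<in>J. p i) * h n - real n * h (n - 1)) =
   ?E J (\<lambda>f. \<Sum>i\<in>J. p i * h (?W J f) - real (f i) * h (?W J f - 1))"
  unfolding bern_sum_def integral_map_pmf
  by (intro Bochner_Integration.integral_cong refl) (simp add: sum_subtractf sum_distrib_right)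
 also have "... = (\<Sum>i\<in>J. ?E J (\<lambda>f. p i * h (?W J f) - real (f i) * h (?W J f - 1)))"
  by (intro Bochner_Integration.integral_sum int J)
 also have "... = (\<Sum>i\<in>J. (p i)\<^sup>2 * measure_pmf.expectation (bern_sum p (J - {i})) (\<lambda>n. h (Suc n) - h n))"
 proof (intro sum.cong refl)
  fix i assume i: "i \<in> J"
  let ?J = "J - {i}"
  have J': "finite ?J" "i \<notin> ?J" "insert i ?J = J" using J i by auto
  define a where "a = ?E ?J (\<lambda>f. h (Suc (?W ?J f)))"
  define b where "b = ?E ?J (\<lambda>f. h (?W ?J f))"
  have "?E J (\<lambda>f. p i * h (?W J f) - real (f i) * h (?W J f - 1)) =
   p i * ?E ?J (\<lambda>f. p i * h (Suc (?W ?J f)) - h (?W ?J f)) + (1 - p i) * ?E ?J (\<lambda>f. p i * h (?W ?J f))"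
   using expectation_Pi_bern_insert[where p=p, OF J'(1,2), where \<Phi>="\<lambda>f. p i * h (?W J f) - real (f i) * h (?W J f - 1)"] p[OF i]
    sum_fun_upd[OF J'(1,2)] unfolding J'(3) by simp
  also have "?E ?J (\<lambda>f. p i * h (Suc (?W ?J f)) - h (?W ?J f)) = p i * a - b"
   unfolding a_def b_def using J'(1) by (simp add: int)
  also have "?E ?J (\<lambda>f. p i * h (?W ?J f)) = p i * b" unfolding b_def by simp
  also have "p i * (p i * a - b) + (1 - p i) * (p i * b) = (p i)\<^sup>2 * (a - b)"
   by (simp add: power2_eq_square algebra_simps)
  also have "a - b = measure_pmf.expectation (bern_sum p ?J) (\<lambda>n. h (Suc n) - h n)"
   unfolding a_def b_def bern_sum_def integral_map_pmf using J'(1) by (simp add: int)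
  finally show "?E J (\<lambda>f. p i * h (?W J f) - real (f i) * h (?W J f - 1)) =
   (p i)\<^sup>2 * measure_pmf.expectation (bern_sum p ?J) (\<lambda>n. h (Suc n) - h n)" .
 qed
 finally show ?thesis .
qed

section \<open>Stein's equation for the Poisson law\<close>

context
 fixes m :: real
 assumes m: "0 < m"
begin

abbreviation (input) "ps k \<equiv> pmf (poisson_pmf m) k"
abbreviation (input) "U k \<equiv> \<Sum>i\<le>k. pmf (poisson_pmf m) i"

lemma poisson_pos: "0 < ps k" using m by simp

lemma poisson_Suc: "real (Suc k) * ps (Suc k) = m * ps k"
proof -
 have "fact (Suc k) = real (Suc k) * fact k" by simp
 then show ?thesis using m by (simp add: field_simps del: fact_Suc of_nat_Suc)
qed

lemma poisson_sums: "(\<lambda>k. ps k) sums 1"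
proof -
 have "(\<lambda>k. (m ^ k / fact k) * exp (- m)) sums (exp m * exp (- m))"
  using exp_converges[of m] by (intro sums_mult2) (simp add: field_simps scaleR_conv_of_real)
 then show ?thesis using m by (simp add: mult_exp_exp)
qed

lemma poisson_lower_le: "m * U k \<le> real (Suc k) * (\<Sum>i\<le>k. ps (Suc i))"
proof -
 have "m * U k = (\<Sum>i\<le>k. real (Suc i) * ps (Suc i))" unfolding sum_distrib_left poisson_Suc ..
 also have "... \<le> (\<Sum>i\<le>k. real (Suc k) * ps (Suc i))" by (intro sum_mono mult_right_mono) auto
 finally show ?thesis by (simp add: sum_distrib_left)
qed

lemma poisson_lower_shift: "(\<Sum>i\<le>k. ps (Suc i)) = U (Suc k) - ps 0"
 by (subst sum.atMost_Suc_shift) simp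

text \<open>Equivalent to saying that the ratio of the lower tail \<open>U k\<close> to the weight
  \<open>ps k\<close> is nondecreasing in \<open>k\<close>.\<close>

lemma poisson_lower_mono: "m * U k \<le> real (Suc k) * U (Suc k)"
proof -
 have "real (Suc k) * (U (Suc k) - ps 0) \<le> real (Suc k) * U (Suc k)"
  using poisson_pos[of 0] by (intro mult_left_mono) auto
 with poisson_lower_le[of k] show ?thesis unfolding poisson_lower_shift by linarith
qed

text \<open>Equivalent to saying that the ratio of the upper tail \<open>1 - U k\<close> to the
  weight \<open>ps k\<close> is nonincreasing in \<open>k\<close>; the comparison holds term by
  term.\<close>

lemma poisson_upper_mono: "real (Suc k) * (1 - U (Suc k)) \<le> m * (1 - U k)"
proof -
 have V: "(\<lambda>i. ps (i + Suc k)) sums (1 - U k)" for k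
  using sums_split_initial_segment[OF poisson_sums, of "Suc k"] by (simp add: lessThan_Suc_atMost)
 have "(\<lambda>i. real (Suc k) * ps (i + Suc (Suc k))) sums (real (Suc k) * (1 - U (Suc k)))" by (intro sums_mult V)
 moreover have "(\<lambda>i. m * ps (i + Suc k)) sums (m * (1 - U k))" by (intro sums_mult V)
 moreover have "real (Suc k) * ps (i + Suc (Suc k)) \<le> m * ps (i + Suc k)" for i
  using poisson_Suc[of "i + Suc k"] mult_right_mono[of "real (Suc k)" "real (Suc (i + Suc k))" "ps (Suc (i + Suc k))"] by simp
 ultimately show ?thesis by (rule sums_le[rotated])
qed

text \<open>The solution of Stein's equation for the indicator of \<open>j\<close>, with its argument shifted by one.\<close>

definition stein :: "nat \<Rightarrow> nat \<Rightarrow> real" where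
 "stein j k = ps j * ((if j \<le> k then 1 else 0) - U k) / (m * ps k)"

lemma stein_equation: "m * stein j k - real k * stein j (k - 1) = (if k = j then 1 else 0) - ps j"
proof (cases k)
 case 0
 have "m * stein j 0 = ps j * ((if j = 0 then 1 else 0) - ps 0) / ps 0" using m by (simp add: stein_def)
 also have "... = (if j = 0 then 1 else 0) - ps j" using poisson_pos[of 0] by (auto simp: field_simps)
 finally show ?thesis using 0 by simp
next
 case (Suc i)
 have 1: "m * stein j k = ps j * ((if j \<le> k then 1 else 0) - U k) / ps k" using m by (simp add: stein_def)
 have "real k / (m * ps i) = 1 / ps k"
  using poisson_Suc[of i] poisson_pos[of i] poisson_pos[of k] m Suc by (simp add: field_simps del: of_nat_Suc pmf_poisson)
 moreover have "real k * stein j i = ps j * ((if j \<le> i then 1 else 0) - U i) * (real k / (m * ps i))"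
  by (simp add: stein_def del: pmf_poisson)
 ultimately have 2: "real k * stein j i = ps j * ((if j \<le> i then 1 else 0) - U i) / ps k"
  by (simp del: pmf_poisson)
 have "m * stein j k - real k * stein j i = ps j * (((if j \<le> k then 1 else 0) - U k) - ((if j \<le> i then 1 else 0) - U i)) / ps k"
  unfolding 1 2 by (simp add: diff_divide_distrib right_diff_distrib del: pmf_poisson)
 also have "((if j \<le> k then 1 else 0) - U k) - ((if j \<le> i then 1 else 0) - U i) = (if k = j then 1 else 0) - ps k"
  using Suc by (auto simp del: pmf_poisson)
 also have "ps j * ... / ps k = (if k = j then 1 else 0) - ps j"
  using poisson_pos[of k] by (auto simp: field_simps simp del: pmf_poisson)
 finally show ?thesis using Suc by simp
qed

text \<open>The monotone tail ratios make \<open>stein j\<close> nonincreasing at every step except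
  the one from \<open>j - 1\<close> to \<open>j\<close>, where the indicator jumps.\<close>

lemma stein_increment:
 shows "j \<noteq> Suc k \<Longrightarrow> stein j (Suc k) \<le> stein j k" "stein (Suc k) (Suc k) - stein (Suc k) k \<le> 1 / m"
proof -
 note pk = poisson_pos[of k] poisson_pos[of "Suc k"]
 have r: "1 / (m * ps k) = 1 / (real (Suc k) * ps (Suc k))" unfolding poisson_Suc ..
 have eq: "stein j (Suc k) - stein j k = ps j / (m * ps (Suc k)) * (((if j \<le> Suc k then 1 else 0) - U (Suc k)) - m / real (Suc k) * ((if j \<le> k then 1 else 0) - U k))" for j
 proof -
  have g: "x * t / (y * q) = x / (m * q) * (m / y * t)" for x t y q :: real
   using m by (cases "y = 0"; cases "q = 0") (simp_all add: field_simps)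
  have "stein j k = ps j * ((if j \<le> k then 1 else 0) - U k) / (real (Suc k) * ps (Suc k))"
   unfolding stein_def poisson_Suc ..
  also have "... = ps j / (m * ps (Suc k)) * (m / real (Suc k) * ((if j \<le> k then 1 else 0) - U k))" by (rule g)
  finally have "stein j k = ps j / (m * ps (Suc k)) * (m / real (Suc k) * ((if j \<le> k then 1 else 0) - U k))" .
  then show ?thesis unfolding stein_def by (simp add: right_diff_distrib diff_divide_distrib del: of_nat_Suc pmf_poisson sum.atMost_Suc)
 qed
 show "stein j (Suc k) \<le> stein j k" if j: "j \<noteq> Suc k"
 proof -
  have "((if j \<le> Suc k then 1 else 0) - U (Suc k)) - m / real (Suc k) * ((if j \<le> k then 1 else 0) - U k) \<le> 0"
  proof (cases "j \<le> k")
   case True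
   have "1 - U (Suc k) \<le> m / real (Suc k) * (1 - U k)"
    using poisson_upper_mono[of k] by (simp add: pos_le_divide_eq mult.commute del: of_nat_Suc pmf_poisson sum.atMost_Suc)
   with True show ?thesis by (simp del: of_nat_Suc pmf_poisson sum.atMost_Suc)
  next
   case False
   have "m / real (Suc k) * U k \<le> U (Suc k)"
    using poisson_lower_mono[of k] by (simp add: pos_divide_le_eq mult.commute del: of_nat_Suc pmf_poisson sum.atMost_Suc)
   with False j show ?thesis by (simp del: of_nat_Suc pmf_poisson sum.atMost_Suc)
  qed
  then have "stein j (Suc k) - stein j k \<le> 0"
   unfolding eq using pk m poisson_pos[of j] by (intro mult_nonneg_nonpos) auto
  then show ?thesis by simp
 qed
 have "stein (Suc k) (Suc k) - stein (Suc k) k = 1 / m * ((1 - U (Suc k)) + m / real (Suc k) * U k)"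
  unfolding eq using pk m by (simp del: of_nat_Suc pmf_poisson sum.atMost_Suc)
 also have "... \<le> 1 / m * 1"
 proof (rule mult_left_mono)
  have "m / real (Suc k) * U k \<le> U (Suc k) - ps 0"
   using poisson_lower_le[of k] unfolding poisson_lower_shift
   by (simp add: pos_divide_le_eq mult.commute del: of_nat_Suc pmf_poisson sum.atMost_Suc)
  then show "(1 - U (Suc k)) + m / real (Suc k) * U k \<le> 1" using poisson_pos[of 0] by linarith
 qed (use m in simp)
 finally show "stein (Suc k) (Suc k) - stein (Suc k) k \<le> 1 / m" by simp
qed

text \<open>At most one \<open>j\<close> in \<open>A\<close> contributes a positive increment, so
  the bound does not depend on the size of \<open>A\<close>.\<close>

lemma stein_sum_increment:
 assumes A: "finite A"
 shows "(\<Sum>j\<in>A. stein j (Suc k)) - (\<Sum>j\<in>A. stein j k) \<le> 1 / m"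
proof -
 have "(\<Sum>j\<in>A. stein j (Suc k)) - (\<Sum>j\<in>A. stein j k) = (\<Sum>j\<in>A. stein j (Suc k) - stein j k)" by (simp add: sum_subtractf)
 also have "... \<le> (\<Sum>j\<in>A. if j = Suc k then 1 / m else 0)"
  using stein_increment by (intro sum_mono) auto
 also have "... \<le> 1 / m" using A m by simp
 finally show ?thesis .
qed

end

text \<open>Stein's identity gives the bound \<open>(\<Sum>i\<in>J. (p i)\<^sup>2) / m\<close> with
  \<open>m = (\<Sum>i\<in>J. p i)\<close>, which is at most the largest \<open>p i\<close>. Unlike a
  sum of single errors \<open>(p i)\<^sup>2\<close>, it does not grow with the number of
  variables.\<close>

lemma bern_sum_poisson_le:
 assumes J: "finite J" "J \<noteq> {}" and p: "\<And>i. i \<in> J \<Longrightarrow> 0 < p i \<and> p i \<le> 1" and q: "\<And>i. i \<in> J \<Longrightarrow> p i \<le> q"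
 shows "measure (bern_sum p J) A - measure (poisson_pmf (\<Sum>i\<in>J. p i)) A \<le> q"
proof -
 define m where "m = (\<Sum>i\<in>J. p i)"
 have m: "0 < m" unfolding m_def using J p by (intro sum_pos) auto
 \<comment> \<open>\<open>A\<close> is cut down to the finite range of the sum so that
   \<open>h\<close> is a finite sum; this can only lower the Poisson mass.\<close>
 define B where "B = A \<inter> set_pmf (bern_sum p J)"
 have B: "finite B" using finite_bern_sum[OF J(1)] by (simp add: B_def)
 let ?E = "\<lambda>J. measure_pmf.expectation (bern_sum p J)"
 have int: "integrable (measure_pmf (bern_sum p J')) f" if "finite J'" for J' and f :: "nat \<Rightarrow> real"
  by (intro integrable_measure_pmf_finite finite_bern_sum that)
 define h where "h k = (\<Sum>j\<in>B. stein m j k)" for k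
 have st: "m * h k - real k * h (k - 1) = indicator B k - measure (poisson_pmf m) B" for k
 proof -
  have "m * h k - real k * h (k - 1) = (\<Sum>j\<in>B. (if k = j then 1 else 0) - pmf (poisson_pmf m) j)"
   unfolding h_def sum_distrib_left sum_subtractf[symmetric] stein_equation[OF m] ..
  also have "... = indicator B k - measure (poisson_pmf m) B"
   using B by (simp add: sum_subtractf measure_measure_pmf_finite indicator_def)
  finally show ?thesis .
 qed
 have "measure (bern_sum p J) A = measure (bern_sum p J) B"
  unfolding B_def by (rule measure_Int_set_pmf[symmetric])
 moreover have "measure (poisson_pmf m) B \<le> measure (poisson_pmf m) A"
  unfolding B_def by (intro measure_pmf.finite_measure_mono) auto
 ultimately have "measure (bern_sum p J) A - measure (poisson_pmf m) A \<le> measure (bern_sum p J) B - measure (poisson_pmf m) B" by simp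
 also have "... = ?E J (\<lambda>k. m * h k - real k * h (k - 1))"
  unfolding st using int[OF J(1)] by simp
 also have "... = (\<Sum>i\<in>J. (p i)\<^sup>2 * ?E (J - {i}) (\<lambda>n. h (Suc n) - h n))"
  unfolding m_def by (rule stein_identity[OF J(1)]) (use p in \<open>auto intro: less_imp_le\<close>)
 also have "... \<le> (\<Sum>i\<in>J. q * p i * (1 / m))"
 proof (rule sum_mono)
  fix i assume i: "i \<in> J"
  have "?E (J - {i}) (\<lambda>n. h (Suc n) - h n) \<le> ?E (J - {i}) (\<lambda>n. 1 / m)"
   using stein_sum_increment[OF m B] J(1) by (intro integral_mono int) (auto simp: h_def)
  then have "(p i)\<^sup>2 * ?E (J - {i}) (\<lambda>n. h (Suc n) - h n) \<le> (p i)\<^sup>2 * (1 / m)"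
   by (intro mult_left_mono) auto
  also have "... \<le> q * p i * (1 / m)"
   using p[OF i] q[OF i] m by (intro mult_right_mono) (auto simp: power2_eq_square)
  finally show "(p i)\<^sup>2 * ?E (J - {i}) (\<lambda>n. h (Suc n) - h n) \<le> q * p i * (1 / m)" .
 qed
 also have "... = q * m * (1 / m)" by (simp only: m_def sum_distrib_left sum_distrib_right)
 also have "... = q" using m by simp
 finally show ?thesis unfolding m_def .
qed

text \<open>Unlike \<open>poisson_pmf\<close>, this is specified for the rate 0.\<close>

definition pois :: "real \<Rightarrow> nat pmf" where
 "pois m = (if m = 0 then return_pmf 0 else poisson_pmf m)"

lemma char_pois: "0 \<le> m \<Longrightarrow> char (nat_law c (pois m)) s = exp (of_real m * (iexp (s * c) - 1))"
 unfolding pois_def by (auto simp: char_nat_law_poisson) (simp add: char_nat_law)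

lemma bern_sum_pois_le:
 assumes J: "finite J" and p: "\<And>i. i \<in> J \<Longrightarrow> 0 < p i \<and> p i \<le> 1" and q: "\<And>i. i \<in> J \<Longrightarrow> p i \<le> q" "0 \<le> q"
 shows "measure (bern_sum p J) A - measure (pois (\<Sum>i\<in>J. p i)) A \<le> q"
proof (cases "J = {}")
 case True
 then show ?thesis using q(2) by (simp add: bern_sum_def pois_def)
next
 case False
 have "0 < (\<Sum>i\<in>J. p i)" using J p False by (intro sum_pos) auto
 then show ?thesis using bern_sum_poisson_le[OF J False p q(1), where A=A] by (simp add: pois_def)
qed

section \<open>Pairing around a median\<close>

text \<open>The smallest and the largest value are paired and removed, and the induction continues
  inside. Tightening \<open>[lo, hi]\<close> to these two values places \<open>b\<close> between the
  members of every pair, whence \<open>(c i - b)\<^sup>2 + (c k - b)\<^sup>2 \<le> (c i - c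
  k)\<^sup>2\<close>. A single remaining value is chosen as \<open>b\<close>.\<close>

lemma median_pairing:
 fixes c :: "nat \<Rightarrow> real"
 assumes "finite F" "lo \<le> hi" "\<And>i. i \<in> F \<Longrightarrow> lo \<le> c i \<and> c i \<le> hi"
 shows "\<exists>I \<sigma> b. I \<subseteq> F \<and> \<sigma> ` I \<subseteq> F \<and> inj_on \<sigma> I \<and> \<sigma> ` I \<inter> I = {} \<and> lo \<le> b \<and> b \<le> hi \<and>
  (\<Sum>i\<in>F. (c i - b)\<^sup>2) \<le> (\<Sum>i\<in>I. (c i - c (\<sigma> i))\<^sup>2)"
 using assms
proof (induction "card F" arbitrary: F lo hi rule: less_induct)
 case less
 consider "F = {}" | x where "F = {x}" | x y where "x \<in> F" "y \<in> F" "x \<noteq> y" by blast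
 then show ?case
 proof cases
  case 1
  then show ?thesis using less.prems by (intro exI[of _ "{}"] exI[of _ id] exI[of _ lo]) auto
 next
  case (2 x)
  then show ?thesis using less.prems by (intro exI[of _ "{}"] exI[of _ id] exI[of _ "c x"]) auto
 next
  case (3 x y)
  obtain i where i: "i \<in> F" "\<And>j. j \<in> F \<Longrightarrow> c i \<le> c j"
   using finite_ne_induct less.prems(1) 3 ex_min_if_finite[of "c ` F"]
   by (metis (no_types, lifting) arg_min_if_finite(1) arg_min_least empty_iff)
  have Fi: "finite (F - {i})" "F - {i} \<noteq> {}" using less.prems(1) 3 i by auto
  obtain k where k: "k \<in> F - {i}" "\<And>j. j \<in> F - {i} \<Longrightarrow> c j \<le> c k"
  proof -
   have "k \<in> F - {i} \<and> (\<forall>j\<in>F - {i}. c j \<le> c k)" if "k = arg_min_on (\<lambda>j. - c j) (F - {i})" for k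
    using arg_min_if_finite(1)[OF Fi, of "\<lambda>j. - c j"] arg_min_least[OF Fi, of _ "\<lambda>j. - c j"] that by auto
   then show thesis using that by blast
  qed
  let ?F = "F - {i, k}"
  have card: "card ?F < card F" using i less.prems(1) by (intro psubset_card_mono) auto
  have ik: "c i \<le> c k" using i(2) k(1) by auto
  obtain I \<sigma> b where IH: "I \<subseteq> ?F" "\<sigma> ` I \<subseteq> ?F" "inj_on \<sigma> I" "\<sigma> ` I \<inter> I = {}" "c i \<le> b" "b \<le> c k"
   "(\<Sum>i\<in>?F. (c i - b)\<^sup>2) \<le> (\<Sum>i\<in>I. (c i - c (\<sigma> i))\<^sup>2)"
   using less.hyps[OF card _ ik] less.prems(1) i(2) k(2) by auto
  have Ii: "i \<notin> I" "k \<notin> I" "finite I" using IH(1) less.prems(1) by (auto intro: finite_subset)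
  let ?s = "\<sigma>(i := k)"
  have s: "?s x = \<sigma> x" if "x \<in> I" for x using that Ii by auto
  have "(\<Sum>j\<in>F. (c j - b)\<^sup>2) = (c i - b)\<^sup>2 + ((c k - b)\<^sup>2 + (\<Sum>j\<in>?F. (c j - b)\<^sup>2))"
  proof -
   have "F = insert i (insert k ?F)" using i k by auto
   moreover have "i \<notin> insert k ?F" "k \<notin> ?F" "finite ?F" using k less.prems(1) by auto
   ultimately show ?thesis by (metis (no_types, lifting) finite_insert sum.insert)
  qed
  also have "... \<le> (c i - c k)\<^sup>2 + (\<Sum>i\<in>I. (c i - c (\<sigma> i))\<^sup>2)"
  proof -
   have "0 \<le> 2 * ((b - c i) * (c k - b))" using IH(5,6) by simp
   then have "(c i - b)\<^sup>2 + (c k - b)\<^sup>2 \<le> (c i - c k)\<^sup>2" by (simp add: power2_eq_square algebra_simps)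
   with IH(7) show ?thesis by simp
  qed
  also have "... = (\<Sum>j\<in>insert i I. (c j - c (?s j))\<^sup>2)"
   using Ii s by (simp add: sum.insert)
  finally have 1: "(\<Sum>j\<in>F. (c j - b)\<^sup>2) \<le> (\<Sum>j\<in>insert i I. (c j - c (?s j))\<^sup>2)" .
  have 2: "?s ` insert i I = insert k (\<sigma> ` I)" using Ii by auto
  have 3: "inj_on ?s (insert i I)" using IH(2,3) Ii by (auto simp: inj_on_def image_subset_iff)
  have 4: "lo \<le> b" "b \<le> hi" using IH(5,6) less.prems(3)[OF i(1)] less.prems(3)[of k] k(1) by auto
  have 5: "insert i I \<subseteq> F" "insert k (\<sigma> ` I) \<subseteq> F" "insert k (\<sigma> ` I) \<inter> insert i I = {}"
   using IH(1,2,4) i(1) k(1) Ii by auto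
  show ?thesis
   by (rule exI[of _ "insert i I"], rule exI[of _ ?s], rule exI[of _ b]) (use 1 3 4 5 in \<open>simp only: 2 simp_thms\<close>)
 qed
qed

section \<open>Convergence of centred sums along a subsequence\<close>

text \<open>A subsequence is enough for \<open>coupling_isomorphic\<close>, so no maximal inequality
  is used: \<open>r\<close> is so sparse that the \<open>n\<close>-th block sum has variance below
  \<open>(1 / 8) ^ n\<close>, and Markov's inequality with Borel-Cantelli makes it eventually at
  most \<open>(1 / 2) ^ n\<close>.\<close>

lemma centred_sums_convergent:
 fixes \<mu> :: "nat \<Rightarrow> real measure"
 assumes \<mu>: "\<And>k. real_distribution (\<mu> k)" and sq: "\<And>k. integrable (\<mu> k) (\<lambda>x. x\<^sup>2)"
  and mean: "\<And>k. (\<integral>x. x \<partial>\<mu> k) = 0" and v: "summable (\<lambda>k. \<integral>x. x\<^sup>2 \<partial>\<mu> k)"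
 obtains r where "strict_mono r" "AE w in PiM UNIV \<mu>. convergent (\<lambda>n. \<Sum>k<r n. w k)"
proof -
 interpret P: prob_space "PiM UNIV \<mu>" by (rule prob_space_PiM_real[OF \<mu>])
 interpret R: real_distribution "\<mu> k" for k by (rule \<mu>)
 let ?v = "\<lambda>k. \<integral>x. x\<^sup>2 \<partial>\<mu> k"
 note [measurable] = measurable_PiM_real_component[OF \<mu>]
 have i1: "integrable (\<mu> k) (\<lambda>x. x)" for k
  by (rule R.square_integrable_imp_integrable[OF _ sq]) simp
 have comp: "integrable (\<mu> k) f \<Longrightarrow> integrable (PiM UNIV \<mu>) (\<lambda>w. f (w k))" "(\<integral>w. f (w k) \<partial>PiM UNIV \<mu>) = (\<integral>x. f x \<partial>\<mu> k)"
  if [measurable]: "f \<in> borel_measurable borel" for f :: "real \<Rightarrow> real" and k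
  using integrable_distr_eq[of "\<lambda>w. w k" "PiM UNIV \<mu>" borel f] integral_distr[of "\<lambda>w. w k" "PiM UNIV \<mu>" borel f]
  by (simp_all add: distr_PiM_real_component[OF \<mu>])
 have int0: "integrable (PiM UNIV \<mu>) (\<lambda>w. w k)" for k by (rule comp(1)[OF _ i1]) simp
 have m0: "(\<integral>w. w k \<partial>PiM UNIV \<mu>) = 0" for k using comp(2)[of "\<lambda>x. x" k] mean[of k] by simp
 have orth: "(\<integral>w. w j * w k \<partial>PiM UNIV \<mu>) = 0" if "j \<noteq> k" for j k
 proof -
  have "P.indep_vars (\<lambda>_. borel) (\<lambda>i w. w i) {j, k}"
   by (rule P.indep_vars_subset[OF indep_vars_PiM_real[OF \<mu>]]) simp
  then have "(\<integral>w. (\<Prod>i\<in>{j, k}. w i) \<partial>PiM UNIV \<mu>) = (\<Prod>i\<in>{j, k}. \<integral>w. w i \<partial>PiM UNIV \<mu>)"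
   by (intro P.indep_vars_lebesgue_integral int0) simp_all
  then show ?thesis using that by (simp add: m0)
 qed
 have ij: "integrable (PiM UNIV \<mu>) (\<lambda>w. w j * w k)" for j k
 proof (rule Bochner_Integration.integrable_bound)
  show "integrable (PiM UNIV \<mu>) (\<lambda>w. (w j)\<^sup>2 + (w k)\<^sup>2)"
   using comp(1)[of "\<lambda>x. x\<^sup>2", OF _ sq] by (intro Bochner_Integration.integrable_add) auto
  show "AE w in PiM UNIV \<mu>. norm (w j * w k) \<le> norm ((w j)\<^sup>2 + (w k)\<^sup>2)"
  proof (rule AE_I2)
   fix w :: "nat \<Rightarrow> real"
   have "0 \<le> (\<bar>w j\<bar> - \<bar>w k\<bar>)\<^sup>2 + \<bar>w j\<bar> ^ 2 + \<bar>w k\<bar> ^ 2" by simp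
   then have "\<bar>w j\<bar> * \<bar>w k\<bar> \<le> (w j)\<^sup>2 + (w k)\<^sup>2" by (simp add: power2_diff)
   then show "norm (w j * w k) \<le> norm ((w j)\<^sup>2 + (w k)\<^sup>2)" by (simp add: abs_mult)
  qed
 qed measurable
 have sq2: "(\<Sum>k\<in>F. w k)\<^sup>2 = (\<Sum>j\<in>F. \<Sum>k\<in>F. w j * w k)" for F and w :: "nat \<Rightarrow> real"
  by (simp add: power2_eq_square sum_product)
 have var: "(\<integral>w. (\<Sum>k\<in>F. w k)\<^sup>2 \<partial>PiM UNIV \<mu>) = (\<Sum>k\<in>F. ?v k)" if F: "finite F" for F
 proof -
  have "(\<integral>w. (\<Sum>k\<in>F. w k)\<^sup>2 \<partial>PiM UNIV \<mu>) = (\<Sum>j\<in>F. \<Sum>k\<in>F. \<integral>w. w j * w k \<partial>PiM UNIV \<mu>)"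
   unfolding sq2 by (simp add: ij)
  also have "... = (\<Sum>j\<in>F. \<Sum>k\<in>F. if j = k then ?v k else 0)"
   using orth comp(2)[of "\<lambda>x. x\<^sup>2"] by (intro sum.cong refl) (auto simp: power2_eq_square)
  also have "... = (\<Sum>k\<in>F. ?v k)" using F by simp
  finally show ?thesis .
 qed
 have isq: "integrable (PiM UNIV \<mu>) (\<lambda>w. (\<Sum>k\<in>F. w k)\<^sup>2)" for F unfolding sq2 by (simp add: ij)
 have "\<forall>n. \<exists>N. \<forall>m\<ge>N. \<forall>k. norm (sum ?v {m..<k}) < (1 / 8) ^ n"
  using v unfolding summable_Cauchy by simp
 then obtain N where N: "\<And>n m k. N n \<le> m \<Longrightarrow> norm (sum ?v {m..<k}) < (1 / 8) ^ n" by metis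
 \<comment> \<open>The summand \<open>n\<close> makes \<open>r\<close> strictly increasing, and the
   sum over \<open>i \<le> n\<close> dominates \<open>N n\<close>.\<close>
 define r where "r n = n + (\<Sum>i\<le>n. N i)" for n
 have r: "strict_mono r" unfolding strict_mono_Suc_iff r_def by simp
 have Nr: "N n \<le> r n" for n unfolding r_def using member_le_sum[of n "{..n}" N] by simp
 define D where "D n w = (\<Sum>k\<in>{r n..<r (Suc n)}. w k)" for n and w :: "nat \<Rightarrow> real"
 have [measurable]: "D n \<in> borel_measurable (PiM UNIV \<mu>)" for n unfolding D_def by measurable
 have prob: "measure (PiM UNIV \<mu>) {w \<in> space (PiM UNIV \<mu>). (1 / 4) ^ n \<le> (D n w)\<^sup>2} \<le> (1 / 2) ^ n" for n
 proof -
  have "measure (PiM UNIV \<mu>) {w \<in> space (PiM UNIV \<mu>). (1 / 4) ^ n \<le> (D n w)\<^sup>2} \<le> (\<integral>w. (D n w)\<^sup>2 \<partial>PiM UNIV \<mu>) / (1 / 4) ^ n"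
   by (rule integral_Markov_inequality_measure[where A="space (PiM UNIV \<mu>)"]) (auto simp: D_def isq)
  also have "... \<le> (1 / 8) ^ n / (1 / 4) ^ n"
   using N[OF Nr, of n "r (Suc n)"] unfolding D_def by (subst var) (auto intro!: divide_right_mono)
  also have "... = (1 / 2) ^ n" by (simp flip: power_divide)
  finally show ?thesis .
 qed
 have "AE w in PiM UNIV \<mu>. \<forall>\<^sub>F n in sequentially. w \<in> space (PiM UNIV \<mu>) - {w \<in> space (PiM UNIV \<mu>). (1 / 4) ^ n \<le> (D n w)\<^sup>2}"
 proof (rule borel_cantelli_AE1)
  show "summable (\<lambda>n. measure (PiM UNIV \<mu>) {w \<in> space (PiM UNIV \<mu>). (1 / 4) ^ n \<le> (D n w)\<^sup>2})"
   by (rule summable_comparison_test[OF _ summable_geometric[of "1/2 :: real"]]) (use prob in \<open>auto simp: measure_nonneg\<close>)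
 qed (auto simp: P.emeasure_eq_measure)
 then have "AE w in PiM UNIV \<mu>. convergent (\<lambda>n. \<Sum>k<r n. w k)"
 proof eventually_elim
  case (elim w)
  then have "\<forall>\<^sub>F n in sequentially. norm (D n w) \<le> (1 / 2) ^ n"
  proof (rule eventually_mono)
   fix n assume "w \<in> space (PiM UNIV \<mu>) - {w \<in> space (PiM UNIV \<mu>). (1 / 4) ^ n \<le> (D n w)\<^sup>2}"
   then have "(D n w)\<^sup>2 \<le> ((1 / 2) ^ n)\<^sup>2" by (auto simp: power_mult_distrib[symmetric] power2_eq_square)
   then show "norm (D n w) \<le> (1 / 2) ^ n" using power2_le_imp_le[of "\<bar>D n w\<bar>" "(1 / 2) ^ n"] by simp
  qed
  then have "summable (\<lambda>n. D n w)" by (rule summable_comparison_test_ev[OF _ summable_geometric]) simp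
  then have "convergent (\<lambda>n. (\<Sum>k<r 0. w k) + (\<Sum>i<n. D i w))"
   unfolding summable_iff_convergent by (intro convergent_add convergent_const)
  moreover have "(\<Sum>k<r 0. w k) + (\<Sum>i<n. D i w) = (\<Sum>k<r n. w k)" for n
  proof (induction n)
   case (Suc n)
   have "r n \<le> r (Suc n)" using r by (simp add: strict_mono_Suc_iff less_imp_le)
   then have "(\<Sum>k<r n. w k) + D n w = (\<Sum>k<r (Suc n). w k)"
    unfolding D_def lessThan_atLeast0 by (intro sum.atLeastLessThan_concat) auto
   with Suc show ?case by simp
  qed simp
  ultimately show ?case by simp
 qed
 with r show thesis by (rule that)
qed

section \<open>A trivial compound Poisson tail boundary\<close>

lemma measure_nat_law_atom: "c \<noteq> 0 \<Longrightarrow> measure (nat_law c q) {0} = pmf q 0" "c \<noteq> 0 \<Longrightarrow> measure (nat_law c q) {c} = pmf q 1"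
proof -
 assume c: "c \<noteq> 0"
 have "{n. c * real n \<in> {0}} = {0}" "{n. c * real n \<in> {c}} = {1}" using c by auto
 then show "measure (nat_law c q) {0} = pmf q 0" "measure (nat_law c q) {c} = pmf q 1"
  by (simp_all add: measure_nat_law measure_pmf_single)
qed

lemma AE_nat_law_nonneg: "0 \<le> c \<Longrightarrow> AE x in nat_law c q. 0 \<le> x"
 unfolding nat_law_def by (subst AE_distr_iff) auto

text \<open>Every \<open>(1 / 2) ^ j\<close> is the jump size in infinitely many coordinates, and
  the atoms at 0 and at the jump size both have mass \<open>exp (- 1)\<close>. So all these numbers
  are periods, and arbitrarily small periods make all numbers periods.\<close>

lemma trivial_compound_poisson:
 obtains \<nu> where "\<And>k. is_compound_poisson (\<nu> k)" "\<And>k. measure_support (\<nu> k) \<subseteq> {0..}" "\<And>s. time_periodic \<nu> s"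
proof
 define c where "c k = (1 / 2 :: real) ^ fst (prod_decode k)" for k
 let ?\<nu> = "\<lambda>k. nat_law (c k) (poisson_pmf 1)"
 have c: "0 < c k" for k by (simp add: c_def)
 have \<nu>: "real_distribution (?\<nu> k)" for k by (rule real_distribution_nat_law)
 show "is_compound_poisson (?\<nu> k)" for k
  by (rule is_compound_poissonI[OF \<nu>, where J="{()}" and p="\<lambda>_. 1" and c="\<lambda>_. c k"]) (simp_all add: char_nat_law_poisson)
 show "measure_support (?\<nu> k) \<subseteq> {0..}" for k
  by (intro support_nonneg_of_AE \<nu> AE_nat_law_nonneg less_imp_le c)
 have per: "period ?\<nu> ((1 / 2) ^ j)" for j :: nat
 proof (rule period_of_atoms[OF \<nu>])
  have "inj_on (\<lambda>i. prod_encode (j, i)) UNIV" by (auto intro!: inj_onI dest: inj_prod_encode[THEN injD])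
  then have "infinite ((\<lambda>i. prod_encode (j, i)) ` UNIV)" by (simp add: finite_image_iff)
  then show "infinite {k. fst (prod_decode k) = j}" by (rule infinite_super[rotated]) auto
  show "exp (- 1) \<le> measure (?\<nu> k) {0}" for k using c[of k] by (simp add: measure_nat_law_atom)
  show "exp (- 1) \<le> measure (?\<nu> k) {0 + (1 / 2) ^ j}" if "k \<in> {k. fst (prod_decode k) = j}" for k
  proof -
   have "c k = (1 / 2) ^ j" using that by (simp add: c_def)
   then show ?thesis using c[of k] measure_nat_law_atom(2)[of "c k" "poisson_pmf 1"] by simp
  qed
 qed simp
 show "time_periodic ?\<nu> s" for s
 proof (rule time_periodic_of_period[OF \<nu> period_of_small_periods[OF \<nu>]])
  fix l :: real assume "0 < l"
  then obtain j where "(1 / 2 :: real) ^ j < l" using real_arch_pow_inv[of l "1 / 2"] by auto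
  then show "\<exists>s. period ?\<nu> s \<and> s \<noteq> 0 \<and> \<bar>s\<bar> \<le> l" using per[of j] by (intro exI[of _ "(1 / 2) ^ j"]) auto
 qed
qed

section \<open>Decomposition of a two-point sequence into cells\<close>

text \<open>A Bolzano-Weierstrass statement that counts indices and not values, so that a value
  taken infinitely often is an accumulation point.\<close>

lemma accumulation_point:
 fixes f :: "nat \<Rightarrow> real"
 assumes S: "infinite S" "\<And>k. k \<in> S \<Longrightarrow> f k \<in> {lo..hi}"
 shows "\<exists>x\<in>{lo..hi}. \<forall>r>0. infinite {k\<in>S. \<bar>f k - x\<bar> < r}"
proof (rule ccontr)
 assume "\<not> ?thesis"
 then have "\<forall>x\<in>{lo..hi}. \<exists>r. 0 < r \<and> finite {k\<in>S. \<bar>f k - x\<bar> < r}" by blast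
 from bchoice[OF this] obtain r where r: "\<And>x. x \<in> {lo..hi} \<Longrightarrow> 0 < r x" "\<And>x. x \<in> {lo..hi} \<Longrightarrow> finite {k\<in>S. \<bar>f k - x\<bar> < r x}" by blast
 have "{lo..hi} \<subseteq> (\<Union>x\<in>{lo..hi}. ball x (r x))" using r(1) by auto
 then obtain X where X: "X \<subseteq> {lo..hi}" "finite X" "{lo..hi} \<subseteq> (\<Union>x\<in>X. ball x (r x))"
  by (rule compactE_image[where f="\<lambda>x. ball x (r x)", OF compact_Icc open_ball]) (rule that)
 have "S \<subseteq> (\<Union>x\<in>X. {k\<in>S. \<bar>f k - x\<bar> < r x})"
  using S(2) X(3) by (force simp: dist_real_def abs_minus_commute)
 moreover have "finite (\<Union>x\<in>X. {k\<in>S. \<bar>f k - x\<bar> < r x})" using X r(2) by auto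
 ultimately show False using S(1) finite_subset by blast
qed

lemma dyadic_level:
 assumes "0 < p" "p \<le> 1"
 shows "\<exists>j. (1 / 2 :: real) ^ Suc j < p \<and> p \<le> (1 / 2) ^ j"
proof -
 have "\<exists>n. (1 / 2 :: real) ^ n < p" using real_arch_pow_inv[of p "1 / 2"] assms by auto
 then have N: "(1 / 2 :: real) ^ (LEAST n. (1 / 2 :: real) ^ n < p) < p" by (rule LeastI_ex)
 then obtain j where j: "(LEAST n. (1 / 2 :: real) ^ n < p) = Suc j" using assms(2) by (cases "LEAST n. (1 / 2 :: real) ^ n < p") auto
 then have "\<not> (1 / 2 :: real) ^ j < p" using not_less_Least[of j "\<lambda>n. (1 / 2 :: real) ^ n < p"] by simp
 with N j show ?thesis by (intro exI[of _ j]) auto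
qed

text \<open>Level \<open>j\<close> has \<open>O((3 / 2) ^ j)\<close> cells of weight
  \<open>(1 / 2) ^ j\<close> and so contributes \<open>O((3 / 4) ^ j)\<close>.\<close>

lemma summable_on_cells:
 fixes K :: real
 assumes K: "0 \<le> K"
 shows "(\<lambda>(j, i). (1 / 2 :: real) ^ j) summable_on (SIGMA j:UNIV. {- \<lfloor>K * (3 / 2) ^ j\<rfloor>..\<lfloor>K * (3 / 2) ^ j\<rfloor>})"
proof (rule summable_on_SigmaI)
 let ?B = "\<lambda>j. {- \<lfloor>K * (3 / 2 :: real) ^ j\<rfloor>..\<lfloor>K * (3 / 2) ^ j\<rfloor>}"
 let ?g = "\<lambda>j. real (card (?B j)) * (1 / 2 :: real) ^ j"
 show "((\<lambda>i. case (j, i) of (j, i) \<Rightarrow> (1 / 2 :: real) ^ j) has_sum ?g j) (?B j)" for j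
  using has_sum_finite[of "?B j" "\<lambda>i. (1 / 2 :: real) ^ j"] by simp
 have "?g j \<le> 2 * K * (3 / 4) ^ j + (1 / 2) ^ j" for j
 proof -
  have K0: "0 \<le> \<lfloor>K * (3 / 2 :: real) ^ j\<rfloor>" using K by simp
  then have "real (card (?B j)) = 2 * of_int \<lfloor>K * (3 / 2 :: real) ^ j\<rfloor> + 1" by simp
  also have "... \<le> 2 * (K * (3 / 2) ^ j) + 1" by (intro add_mono mult_left_mono) auto
  finally have "?g j \<le> (2 * (K * (3 / 2) ^ j) + 1) * (1 / 2) ^ j" by (intro mult_right_mono) auto
  also have "... = 2 * K * ((3 / 2) ^ j * (1 / 2) ^ j) + (1 / 2) ^ j" by (simp add: algebra_simps)
  also have "(3 / 2) ^ j * (1 / 2) ^ j = (3 / 4 :: real) ^ j" by (simp flip: power_mult_distrib)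
  finally show ?thesis .
 qed
 then have "summable ?g"
  by (intro summable_comparison_test[of ?g "\<lambda>j. 2 * K * (3 / 4) ^ j + (1 / 2) ^ j"] summable_add summable_mult summable_geometric) (auto intro!: exI[of _ 0])
 then show "?g summable_on UNIV" by (subst summable_on_UNIV_nonneg_real_iff) auto
qed auto

text \<open>Modulo the multiples \<open>n k\<close> of the period \<open>a\<close>, the value
  \<open>c k\<close> can be replaced by \<open>b k\<close> at a finite total cost.
  \<open>rep\<close> labels finite groups on which \<open>b\<close> is constant, and
  \<open>B\<close> is a summable bound for the probabilities in groups with nonzero
  \<open>b\<close>. Infinite cells are dissolved into single coordinates with
  \<open>b = 0\<close>.\<close>

lemma two_point_cells:
 fixes p c :: "nat \<Rightarrow> real"
 assumes p: "\<And>k. 0 < p k" "\<And>k. p k \<le> 1 / 2" and c: "\<And>k. c k \<noteq> 0" and C: "\<And>k. p k * (c k)\<^sup>2 \<le> C"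
 defines "\<rho> \<equiv> \<lambda>k. nat_law (c k) (bern (p k))"
 assumes nt: "\<not> (\<forall>s. period \<rho> s)"
 obtains a b n rep B where "0 \<le> a" "period \<rho> a" "summable (\<lambda>k. p k * (c k - a * of_int (n k :: int) - b k)\<^sup>2)"
  "\<And>j. finite {k. rep k = (j :: nat)}" "\<And>k k'. rep k = rep k' \<Longrightarrow> b k = b k'"
  "\<And>k. b k \<noteq> 0 \<Longrightarrow> p k \<le> B (rep k)" "summable B" "\<And>j. 0 \<le> B j" "(\<forall>k. 0 < c k) \<longrightarrow> (\<forall>k. 0 \<le> b k)"
proof -
 have \<rho>: "real_distribution (\<rho> k)" for k unfolding \<rho>_def by (rule real_distribution_nat_law)
 have at: "measure (\<rho> k) {0} = 1 - p k" "measure (\<rho> k) {c k} = p k" for k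
  using two_point_nat_law(2,3)[of "p k" "c k"] p(1)[of k] p(2)[of k] c[of k] by (simp_all add: \<rho>_def)
 have mp: "move_prob \<rho> C u = (\<Prod>i\<in>C. measure (\<rho> i) {u i})" for C u by (rule move_prob_def[OF \<rho>])
 obtain a l where al: "0 \<le> a" "0 < l" "period \<rho> a" "\<And>s. period \<rho> s \<Longrightarrow> s \<noteq> 0 \<Longrightarrow> l < \<bar>s\<bar>"
  "\<And>s. period \<rho> s \<Longrightarrow> a = 0 \<or> 0 \<le> s \<and> s \<le> a \<Longrightarrow> s = 0 \<or> s = a"
  by (rule period_structure[OF \<rho> nt]) (rule that)
 \<comment> \<open>The remainder of \<open>c k\<close> modulo \<open>a\<close>. For
   \<open>a = 0\<close> it is \<open>c k\<close> itself.\<close>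
 define c' where "c' k = c k - a * of_int \<lfloor>c k / a\<rfloor>" for k
 have cc': "period \<rho> (c k - c' k)" for k unfolding c'_def using period_of_int[OF al(3), of "\<lfloor>c k / a\<rfloor>"] by simp
 have c'a: "0 \<le> c' k \<and> c' k \<le> a" if "a \<noteq> 0" for k
 proof -
  have "c k = a * (c k / a)" using that by simp
  then have "c' k = a * frac (c k / a)" by (simp only: c'_def frac_def right_diff_distrib)
  then show ?thesis using al(1) frac_ge_0[of "c k / a"] frac_lt_1[of "c k / a"] mult_left_mono[of "frac (c k / a)" 1 a] by auto
 qed
 have c'c: "\<bar>c' k\<bar> \<le> \<bar>c k\<bar> + a" for k using c'a[of k] al(1) by (cases "a = 0") (auto simp: c'_def)
 have "\<forall>k. \<exists>j. (1 / 2 :: real) ^ Suc j < p k \<and> p k \<le> (1 / 2) ^ j"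
 proof
  fix k show "\<exists>j. (1 / 2 :: real) ^ Suc j < p k \<and> p k \<le> (1 / 2) ^ j" using p(1,2)[of k] by (intro dyadic_level) auto
 qed
 then obtain lev where lev: "\<And>k. (1 / 2 :: real) ^ Suc (lev k) < p k" "\<And>k. p k \<le> (1 / 2) ^ lev k" by metis
 \<comment> \<open>A cell fixes the size of \<open>p\<close> up to a factor 2 and the value of
   \<open>c'\<close> up to \<open>l\<close>, the bound below all nonzero periods.\<close>
 define cell where "cell k = (lev k, \<lfloor>c' k / l\<rfloor>)" for k
 define X where "X q = {k. cell k = q}" for q
 have XI: "k \<in> X (cell k)" for k by (simp add: X_def)
 have cellD: "of_int (snd (cell k)) * l \<le> c' k \<and> c' k \<le> (of_int (snd (cell k)) + 1) * l" for k
  using floor_divide_lower[OF al(2), of "c' k"] floor_divide_upper[OF al(2), of "c' k"] by (simp add: cell_def)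
 have XD: "lev k = fst q" "of_int (snd q) * l \<le> c' k" "c' k \<le> of_int (snd q) * l + l" if "k \<in> X q" for k q
  using that cellD[of k] by (auto simp: X_def distrib_right) (simp add: cell_def)
 have near: "\<bar>c' k - c' k'\<bar> \<le> l" if "k \<in> X q" "k' \<in> X q" for k k' q
  using XD(2,3)[OF that(1)] XD(2,3)[OF that(2)] by linarith
 \<comment> \<open>In an infinite cell the probabilities are bounded below, so a limit point of the
   values is a period. For \<open>a \<noteq> 0\<close> it also lies in \<open>[0, a]\<close>, which
   leaves only 0 and \<open>a\<close>; for \<open>a = 0\<close> the only period is 0.\<close>
 have acc: "\<exists>x. period \<rho> x \<and> (x = 0 \<or> x = a) \<and> of_int (snd q) * l \<le> x \<and> x \<le> of_int (snd q) * l + l" if q: "infinite (X q)" for q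
 proof -
  let ?lo = "of_int (snd q) * l" and ?hi = "of_int (snd q) * l + l"
  obtain x where x: "x \<in> {?lo..?hi}" "\<And>r. 0 < r \<Longrightarrow> infinite {k\<in>X q. \<bar>c' k - x\<bar> < r}"
   using accumulation_point[OF q, of c' ?lo ?hi] XD(2,3)[of _ q] by auto
  have mf: "move_family \<rho> (X q) (\<lambda>k. {k}) (\<lambda>k _. c k) (\<lambda>k _. 0) 1 c' (\<bar>?lo\<bar> + l)"
   unfolding move_family_def[OF \<rho>]
  proof (intro conjI ballI)
   fix k assume k: "k \<in> X q"
   show "0 < move_prob \<rho> {k} (\<lambda>_. 0)" "move_prob \<rho> {k} (\<lambda>_. c k) \<le> 1 * move_prob \<rho> {k} (\<lambda>_. 0)"
    using p(2)[of k] by (simp_all add: mp at)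
   show "period \<rho> ((\<Sum>i\<in>{k}. c k - 0) - c' k)" using cc'[of k] by simp
   show "\<bar>c' k\<bar> \<le> \<bar>?lo\<bar> + l" using XD(2,3)[OF k] al(2) by linarith
  qed (auto simp: disjoint_family_on_def)
  have per: "period \<rho> x"
   using \<rho> mf
  proof (rule period_of_accumulation)
   show "0 < (1 / 2 :: real) ^ Suc (fst q)" by simp
   show "(1 / 2) ^ Suc (fst q) \<le> move_prob \<rho> {k} (\<lambda>_. c k)" if "k \<in> X q" for k
    using lev(1)[of k] XD(1)[OF that] by (simp add: mp at)
  qed (rule x(2))
  have "0 \<le> x \<and> x \<le> a" if a: "a \<noteq> 0"
  proof -
   have "\<exists>k. \<bar>c' k - x\<bar> < r" if "0 < r" for r using x(2)[OF that] infinite_imp_nonempty by blast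
   then have "- r < x \<and> x < a + r" if "0 < r" for r using c'a[OF a] that by (smt (verit))
   then show ?thesis by (meson field_le_epsilon less_imp_le linorder_not_le neg_0_less_iff_less less_irrefl minus_less_iff)
  qed
  then have "x = 0 \<or> x = a" using al(5)[OF per] by blast
  with per x(1) show ?thesis by auto
 qed
 then have "\<forall>q. \<exists>x. infinite (X q) \<longrightarrow> period \<rho> x \<and> (x = 0 \<or> x = a) \<and> of_int (snd q) * l \<le> x \<and> x \<le> of_int (snd q) * l + l" by blast
 then obtain xs where xs: "\<And>q. infinite (X q) \<Longrightarrow> period \<rho> (xs q)" "\<And>q. infinite (X q) \<Longrightarrow> xs q = 0 \<or> xs q = a"
   "\<And>q. infinite (X q) \<Longrightarrow> of_int (snd q) * l \<le> xs q" "\<And>q. infinite (X q) \<Longrightarrow> xs q \<le> of_int (snd q) * l + l" by metis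
 define Sinf where "Sinf = {k. infinite (X (cell k))}"
 \<comment> \<open>In infinite cells each coordinate alone is a move from 0 to \<open>c k\<close>,
   with the displacement taken relative to the limit point of its cell.\<close>
 have "move_family \<rho> Sinf (\<lambda>k. {k}) (\<lambda>k _. c k) (\<lambda>k _. 0) 1 (\<lambda>k. c' k - xs (cell k)) l"
  unfolding move_family_def[OF \<rho>]
 proof (intro conjI ballI)
  fix k assume k: "k \<in> Sinf"
  then have inf: "infinite (X (cell k))" by (simp add: Sinf_def)
  show "0 < move_prob \<rho> {k} (\<lambda>_. 0)" "move_prob \<rho> {k} (\<lambda>_. c k) \<le> 1 * move_prob \<rho> {k} (\<lambda>_. 0)"
   using p(2)[of k] by (simp_all add: mp at)
  show "period \<rho> ((\<Sum>i\<in>{k}. c k - 0) - (c' k - xs (cell k)))"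
   using period_add[OF cc'[of k] xs(1)[OF inf]] by (simp add: algebra_simps)
  show "\<bar>c' k - xs (cell k)\<bar> \<le> l" using XD(2,3)[OF XI[of k]] xs(3,4)[OF inf] by linarith
 qed (auto simp: disjoint_family_on_def)
 from move_family_summable[OF \<rho> this nt al(4)]
 have sum_inf: "(\<lambda>k. p k * (c' k - xs (cell k))\<^sup>2) summable_on Sinf" by (simp add: mp at)
 \<comment> \<open>Of the location of \<open>b\<close> only the lower bound is kept; it decides the
   sign of \<open>b\<close> when all \<open>c k\<close> are positive.\<close>
 define good where "good q I \<sigma> b \<longleftrightarrow> I \<subseteq> X q \<and> \<sigma> ` I \<subseteq> X q \<and> inj_on \<sigma> I \<and> \<sigma> ` I \<inter> I = {} \<and> of_int (snd q) * l \<le> b \<and>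
  (\<Sum>k\<in>X q. (c' k - b)\<^sup>2) \<le> (\<Sum>k\<in>I. (c' k - c' (\<sigma> k))\<^sup>2)" for q I and \<sigma> :: "nat \<Rightarrow> nat" and b :: real
 have "\<exists>I \<sigma> b. finite (X q) \<longrightarrow> good q I \<sigma> b" for q
 proof (cases "finite (X q)")
  case True
  have "of_int (snd q) * l \<le> of_int (snd q) * l + l" using al(2) by simp
  from median_pairing[OF True this, of c'] XD(2,3)[of _ q] show ?thesis unfolding good_def by meson
 qed simp
 then have "\<forall>q. \<exists>I \<sigma> b. finite (X q) \<longrightarrow> good q I \<sigma> b" by blast
 then obtain I \<sigma> bb where "\<forall>q. finite (X q) \<longrightarrow> good q (I q) (\<sigma> q) (bb q)" by metis
 then have gd: "good q (I q) (\<sigma> q) (bb q)" if "finite (X q)" for q using that by blast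
 define Sfin where "Sfin = {k. finite (X (cell k)) \<and> k \<in> I (cell k)}"
 let ?s = "\<lambda>k. \<sigma> (cell k) k"
 have fin: "k \<in> X (cell k)" "?s k \<in> X (cell k)" "cell (?s k) = cell k" "?s k \<noteq> k" "?s k \<notin> I (cell k)" "k \<in> I (cell k)" if "k \<in> Sfin" for k
  using that gd[of "cell k"] unfolding Sfin_def good_def by (auto simp: X_def)
 \<comment> \<open>In finite cells the members of a pair exchange their states: success at
   \<open>k\<close> and failure at \<open>?s k\<close>, against the converse. The displacement is,
   modulo periods, the difference of the two values. The factor 4 comes from
   \<open>p k \<le> 2 * p (?s k)\<close> on a common level and
   \<open>1 - p k \<ge> 1 / 2\<close>.\<close>
 have "move_family \<rho> Sfin (\<lambda>k. {k, ?s k}) (\<lambda>k i. if i = k then c k else 0) (\<lambda>k i. if i = k then 0 else c i) 4 (\<lambda>k. c' k - c' (?s k)) l"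
  unfolding move_family_def[OF \<rho>]
 proof (intro conjI ballI)
  show "disjoint_family_on (\<lambda>k. {k, ?s k}) Sfin"
   unfolding disjoint_family_on_def
  proof (intro ballI impI)
   fix k k' assume k: "k \<in> Sfin" "k' \<in> Sfin" "k \<noteq> k'"
   show "{k, ?s k} \<inter> {k', ?s k'} = {}"
   proof (cases "cell k = cell k'")
    case True
    have "inj_on (\<sigma> (cell k)) (I (cell k))" using k(1) gd[of "cell k"] by (simp add: Sfin_def good_def)
    then have "?s k \<noteq> ?s k'" using fin(6)[OF k(1)] fin(6)[OF k(2)] k(3) True by (auto dest: inj_onD)
    then show ?thesis using fin(5,6)[OF k(1)] fin(5,6)[OF k(2)] k(3) True by auto
   next
    case False
    then show ?thesis using fin(3)[OF k(1)] fin(3)[OF k(2)] by auto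
   qed
  qed
  fix k assume k: "k \<in> Sfin"
  have u: "move_prob \<rho> {k, ?s k} (\<lambda>i. if i = k then c k else 0) = p k * (1 - p (?s k))"
   and v: "move_prob \<rho> {k, ?s k} (\<lambda>i. if i = k then 0 else c i) = (1 - p k) * p (?s k)"
   using fin(4)[OF k] by (simp_all add: mp at)
  show "0 < move_prob \<rho> {k, ?s k} (\<lambda>i. if i = k then 0 else c i)"
   unfolding v using p(1)[of "?s k"] p(2)[of k] by simp
  have "lev (?s k) = lev k" using fin(3)[OF k] by (simp add: cell_def)
  then have "p k \<le> 2 * p (?s k)" using lev(2)[of k] lev(1)[of "?s k"] by simp
  moreover have "(1 / 2) * p (?s k) \<le> (1 - p k) * p (?s k)" using p(1)[of "?s k"] p(2)[of k] by (intro mult_right_mono) auto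
  moreover have "p k * (1 - p (?s k)) \<le> p k * 1" using p(1)[of k] p(1)[of "?s k"] by (intro mult_left_mono) auto
  ultimately show "move_prob \<rho> {k, ?s k} (\<lambda>i. if i = k then c k else 0) \<le> 4 * move_prob \<rho> {k, ?s k} (\<lambda>i. if i = k then 0 else c i)"
   unfolding u v by linarith
  show "period \<rho> ((\<Sum>i\<in>{k, ?s k}. (if i = k then c k else 0) - (if i = k then 0 else c i)) - (c' k - c' (?s k)))"
   using period_diff[OF cc'[of k] cc'[of "?s k"]] fin(4)[OF k] by (simp add: algebra_simps)
  show "\<bar>c' k - c' (?s k)\<bar> \<le> l" by (rule near[OF fin(1,2)[OF k]])
 qed auto
 from move_family_summable[OF \<rho> this nt al(4)]
 have "(\<lambda>k. 4 * (move_prob \<rho> {k, ?s k} (\<lambda>i. if i = k then c k else 0) * (c' k - c' (?s k))\<^sup>2)) summable_on Sfin"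
  by (rule summable_on_cmult_right)
 then have sum_fin: "(\<lambda>k. (1 / 2) ^ lev k * (c' k - c' (?s k))\<^sup>2) summable_on Sfin"
 proof (rule summable_on_comparison_test)
  fix k assume k: "k \<in> Sfin"
  have "(1 / 2) ^ lev k \<le> 2 * p k" using lev(1)[of k] by simp
  also have "2 * p k \<le> 4 * (p k * (1 - p (?s k)))"
   using mult_left_mono[of "1 / 2" "1 - p (?s k)" "p k"] p(1)[of k] p(2)[of "?s k"] by simp
  also have "... = 4 * move_prob \<rho> {k, ?s k} (\<lambda>i. if i = k then c k else 0)" using fin(4)[OF k] by (simp add: mp at)
  finally show "(1 / 2) ^ lev k * (c' k - c' (?s k))\<^sup>2 \<le> 4 * (move_prob \<rho> {k, ?s k} (\<lambda>i. if i = k then c k else 0) * (c' k - c' (?s k))\<^sup>2)"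
   unfolding mult.assoc[symmetric] by (intro mult_right_mono) auto
 qed simp
 \<comment> \<open>The pairing bounds the squared deviations of a whole finite cell by those of its
   pairs. The different weights \<open>p k\<close> are first replaced by the power of
   \<open>1 / 2\<close> that belongs to their common level.\<close>
 have sum_fin2: "(\<lambda>k. p k * (c' k - bb (cell k))\<^sup>2) summable_on (- Sinf)"
 proof (rule nonneg_bounded_partial_sums_imp_summable_on)
  let ?h = "\<lambda>k. (1 / 2) ^ lev k * (c' k - c' (?s k))\<^sup>2"
  show "0 \<le> p k * (c' k - bb (cell k))\<^sup>2" for k using p(1)[of k] by simp
  have "(\<Sum>k\<in>F. p k * (c' k - bb (cell k))\<^sup>2) \<le> infsum ?h Sfin" if F: "finite F" "F \<subseteq> - Sinf" for F
  proof -
   have fq: "finite (X q)" if "q \<in> cell ` F" for q using that F(2) by (auto simp: Sinf_def)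
   have fI: "finite (I q)" "I q \<subseteq> X q" if "q \<in> cell ` F" for q
    using gd[OF fq[OF that]] fq[OF that] by (auto simp: good_def intro: finite_subset)
   have "(\<Sum>k\<in>F. p k * (c' k - bb (cell k))\<^sup>2) \<le> (\<Sum>k\<in>(\<Union>q\<in>cell ` F. X q). p k * (c' k - bb (cell k))\<^sup>2)"
    using F(1) fq p(1) by (intro sum_mono2) (auto simp: X_def less_imp_le)
   also have "... = (\<Sum>q\<in>cell ` F. \<Sum>k\<in>X q. p k * (c' k - bb (cell k))\<^sup>2)"
    using F(1) fq by (intro sum.UNION_disjoint) (auto simp: X_def)
   also have "... \<le> (\<Sum>q\<in>cell ` F. \<Sum>k\<in>I q. ?h k)"
   proof (rule sum_mono)
    fix q assume q: "q \<in> cell ` F"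
    have "(\<Sum>k\<in>X q. p k * (c' k - bb (cell k))\<^sup>2) \<le> (\<Sum>k\<in>X q. (1 / 2) ^ fst q * (c' k - bb q)\<^sup>2)"
    proof (rule sum_mono)
     fix k assume k: "k \<in> X q"
     then have "cell k = q" by (simp add: X_def)
     then show "p k * (c' k - bb (cell k))\<^sup>2 \<le> (1 / 2) ^ fst q * (c' k - bb q)\<^sup>2"
      using lev(2)[of k] XD(1)[OF k] by (simp add: mult_right_mono)
    qed
    also have "... \<le> (1 / 2) ^ fst q * (\<Sum>k\<in>I q. (c' k - c' (\<sigma> q k))\<^sup>2)"
     unfolding sum_distrib_left[symmetric] using gd[OF fq[OF q]] by (intro mult_left_mono) (auto simp: good_def)
    also have "... = (\<Sum>k\<in>I q. ?h k)"
     unfolding sum_distrib_left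
    proof (intro sum.cong refl)
     fix k assume "k \<in> I q"
     then have k: "k \<in> X q" using fI(2)[OF q] by auto
     then have "cell k = q" by (simp add: X_def)
     then show "(1 / 2) ^ fst q * (c' k - c' (\<sigma> q k))\<^sup>2 = ?h k" using XD(1)[OF k] by simp
    qed
    finally show "(\<Sum>k\<in>X q. p k * (c' k - bb (cell k))\<^sup>2) \<le> (\<Sum>k\<in>I q. ?h k)" .
   qed
   also have "... = (\<Sum>k\<in>(\<Union>q\<in>cell ` F. I q). ?h k)"
   proof (rule sum.UNION_disjoint[symmetric])
    show "\<forall>q\<in>cell ` F. \<forall>q'\<in>cell ` F. q \<noteq> q' \<longrightarrow> I q \<inter> I q' = {}"
    proof (intro ballI impI)
     fix q q' assume q: "q \<in> cell ` F" "q' \<in> cell ` F" "q \<noteq> q'"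
     have "X q \<inter> X q' = {}" using q(3) by (auto simp: X_def)
     then show "I q \<inter> I q' = {}" using fI(2)[OF q(1)] fI(2)[OF q(2)] by blast
    qed
   qed (use F(1) fI in auto)
   also have "... \<le> infsum ?h Sfin"
   proof (rule finite_sum_le_infsum[OF sum_fin])
    show "finite (\<Union>q\<in>cell ` F. I q)" using F(1) fI by auto
    show "(\<Union>q\<in>cell ` F. I q) \<subseteq> Sfin"
    proof
     fix k assume "k \<in> (\<Union>q\<in>cell ` F. I q)"
     then obtain q where q: "q \<in> cell ` F" "k \<in> I q" by blast
     then have "cell k = q" using fI(2)[OF q(1)] by (auto simp: X_def)
     then show "k \<in> Sfin" using q fq[OF q(1)] by (simp add: Sfin_def)
    qed
   qed auto
   finally show ?thesis .
  qed
  then show "\<forall>\<^sub>F F in finite_subsets_at_top (- Sinf). (\<Sum>k\<in>F. p k * (c' k - bb (cell k))\<^sup>2) \<le> infsum ?h Sfin"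
   unfolding eventually_finite_subsets_at_top by (intro exI[of _ "{}"]) auto
 qed
 define b where "b k = (if k \<in> Sinf then 0 else bb (cell k))" for k
 \<comment> \<open>If the values of an infinite cell accumulate at \<open>a\<close> and not at 0,
   one more multiple of \<open>a\<close> is subtracted, so that the reduced values accumulate at
   0.\<close>
 define n where "n k = \<lfloor>c k / a\<rfloor> + (if k \<in> Sinf \<and> xs (cell k) \<noteq> 0 then 1 else 0)" for k
 define rep where "rep k = (if k \<in> Sinf then k else Min (X (cell k)))" for k
 have cell_rep: "cell (rep k) = cell k" for k
 proof (cases "k \<in> Sinf")
  case False
  then have "Min (X (cell k)) \<in> X (cell k)" using XI[of k] by (intro Min_in) (auto simp: Sinf_def)
  then show ?thesis using False by (simp add: rep_def X_def)
 qed (simp add: rep_def)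
 then have rep_cell: "cell k = cell k'" if "rep k = rep k'" for k k' using that by metis
 have Sinf_cell: "k \<in> Sinf \<longleftrightarrow> k' \<in> Sinf" if "cell k = cell k'" for k k' using that by (simp add: Sinf_def)
 define R where "R = {j. j \<notin> Sinf \<and> j = Min (X (cell j))}"
 \<comment> \<open>One weight for each finite cell, attached to its smallest element;
   \<open>(1 / 2) ^ lev j\<close> bounds all probabilities in the cell.\<close>
 define B where "B j = (if j \<in> R then (1 / 2 :: real) ^ lev j else 0)" for j
 have injR: "inj_on cell R" by (rule inj_onI) (auto simp: R_def)
 define K where "K = (sqrt (2 * C) + a) / l + 1"
 have C0: "0 \<le> C" using C[of 0] p(1)[of 0] by (meson less_imp_le mult_nonneg_nonneg order_trans zero_le_power2)
 have K0: "0 \<le> K" using C0 al(1,2) by (simp add: K_def)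
 have cellK: "cell k \<in> (SIGMA j:UNIV. {- \<lfloor>K * (3 / 2) ^ j\<rfloor>..\<lfloor>K * (3 / 2) ^ j\<rfloor>})" for k
 proof -
  \<comment> \<open>Since \<open>(3 / 2)\<^sup>2 = 9 / 4\<close> is at least 2, \<open>P\<close>
    dominates the square root of \<open>2 ^ lev k\<close>, the rate at which
    \<open>\<bar>c k\<bar>\<close> can grow, without fractional powers.\<close>
  define P where "P = (3 / 2 :: real) ^ lev k"
  have P1: "1 \<le> P" unfolding P_def by (rule one_le_power) simp
  have "(1 / 2) ^ Suc (lev k) * (c k)\<^sup>2 \<le> C"
   using C[of k] lev(1)[of k] mult_right_mono[of "(1 / 2) ^ Suc (lev k)" "p k" "(c k)\<^sup>2"] by simp
  then have "2 ^ Suc (lev k) * ((1 / 2) ^ Suc (lev k) * (c k)\<^sup>2) \<le> 2 ^ Suc (lev k) * C" by (intro mult_left_mono) auto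
  moreover have "2 ^ Suc (lev k) * (1 / 2 :: real) ^ Suc (lev k) = 1" by (simp flip: power_mult_distrib)
  ultimately have "(c k)\<^sup>2 \<le> 2 ^ Suc (lev k) * C" by (simp add: mult.assoc[symmetric] del: power_Suc)
  also have "... = 2 ^ lev k * (2 * C)" by simp
  also have "... \<le> (P * P) * (2 * C)"
  proof (rule mult_right_mono)
   have "P * P = (9 / 4) ^ lev k" unfolding P_def by (simp flip: power_mult_distrib)
   then show "2 ^ lev k \<le> P * P" using power_mono[of 2 "9 / 4 :: real" "lev k"] by simp
  qed (use C0 in simp)
  also have "... = (sqrt (2 * C) * P)\<^sup>2"
  proof -
   have "sqrt (2 * C) * sqrt (2 * C) = 2 * C" using C0 by simp
   moreover have "(y * y) * (x * x) = (x * y)\<^sup>2" for x y :: real by (simp add: power2_eq_square)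
   ultimately show ?thesis by metis
  qed
  finally have "\<bar>c k\<bar>\<^sup>2 \<le> (sqrt (2 * C) * P)\<^sup>2" unfolding power2_abs .
  moreover have "0 \<le> sqrt (2 * C) * P" using C0 P1 by simp
  ultimately have "\<bar>c k\<bar> \<le> sqrt (2 * C) * P" by (rule power2_le_imp_le)
  moreover have "a \<le> a * P" using al(1) P1 mult_left_mono[OF P1 al(1)] by simp
  ultimately have "\<bar>c' k\<bar> \<le> (sqrt (2 * C) + a) * P" using c'c[of k] by (simp add: distrib_right)
  then have "\<bar>c' k / l\<bar> \<le> (sqrt (2 * C) + a) / l * P"
   using al(2) by (simp add: abs_divide divide_right_mono)
  then have le: "\<bar>c' k / l\<bar> + 1 \<le> K * P" using P1 by (simp add: K_def distrib_right)
  have "of_int \<lfloor>c' k / l\<rfloor> \<le> K * P" "- of_int \<lfloor>c' k / l\<rfloor> \<le> K * P"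
   using le floor_correct[of "c' k / l"] by linarith+
  then have "\<lfloor>c' k / l\<rfloor> \<le> \<lfloor>K * P\<rfloor>" "- \<lfloor>c' k / l\<rfloor> \<le> \<lfloor>K * P\<rfloor>" by (simp_all add: le_floor_iff)
  then show ?thesis by (simp add: cell_def P_def)
 qed
 have "(\<lambda>(j, i). (1 / 2 :: real) ^ j) summable_on (cell ` R)"
  by (rule summable_on_subset_banach[OF summable_on_cells[OF K0]]) (use cellK in blast)
 then have "(\<lambda>j. (1 / 2 :: real) ^ lev j) summable_on R"
  unfolding summable_on_reindex[OF injR] by (simp add: comp_def cell_def)
 then have "B summable_on UNIV"
  by (subst (asm) summable_on_cong_neutral[of UNIV R B]) (auto simp: B_def)
 then have B: "summable B" "\<And>j. 0 \<le> B j" by (auto simp: summable_on_UNIV_nonneg_real_iff B_def)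
 show thesis
 proof (rule that[of a n b rep B])
  have eq1: "p k * (c k - a * of_int (n k) - b k)\<^sup>2 = p k * (c' k - xs (cell k))\<^sup>2" if "k \<in> Sinf" for k
  proof -
   have "c k - a * of_int (n k) - b k = c' k - xs (cell k)"
    using xs(2)[of "cell k"] that by (auto simp: n_def b_def c'_def Sinf_def algebra_simps)
   then show ?thesis by simp
  qed
  have eq2: "p k * (c k - a * of_int (n k) - b k)\<^sup>2 = p k * (c' k - bb (cell k))\<^sup>2" if "k \<in> - Sinf" for k
   using that by (simp add: n_def b_def c'_def)
  have "(\<lambda>k. p k * (c k - a * of_int (n k) - b k)\<^sup>2) summable_on (Sinf \<union> - Sinf)"
  proof (rule summable_on_union)
   show "(\<lambda>k. p k * (c k - a * of_int (n k) - b k)\<^sup>2) summable_on Sinf"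
    using sum_inf by (rule summable_on_cong[THEN iffD2, rotated]) (rule eq1)
   show "(\<lambda>k. p k * (c k - a * of_int (n k) - b k)\<^sup>2) summable_on - Sinf"
    using sum_fin2 by (rule summable_on_cong[THEN iffD2, rotated]) (rule eq2)
  qed
  then show "summable (\<lambda>k. p k * (c k - a * of_int (n k) - b k)\<^sup>2)"
   using p(1) by (simp add: summable_on_UNIV_nonneg_real_iff less_imp_le)
  show "finite {k. rep k = j}" for j
  proof (cases "j \<in> Sinf")
   case True
   have "k = j" if k: "rep k = j" for k
   proof -
    have "cell j = cell k" using cell_rep[of k] k by simp
    then have "k \<in> Sinf" using Sinf_cell[of j k] True by blast
    then show ?thesis using k by (simp add: rep_def)
   qed
   then have "{k. rep k = j} \<subseteq> {j}" by blast
   then show ?thesis by (rule finite_subset) simp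
  next
   case False
   have "k \<in> X (cell j)" if "rep k = j" for k using cell_rep[of k] that by (simp add: X_def)
   then have "{k. rep k = j} \<subseteq> X (cell j)" by blast
   then show ?thesis by (rule finite_subset) (use False in \<open>simp add: Sinf_def\<close>)
  qed
  show "b k = b k'" if "rep k = rep k'" for k k'
   using rep_cell[OF that] Sinf_cell[OF rep_cell[OF that]] by (simp add: b_def)
  show "p k \<le> B (rep k)" if bk: "b k \<noteq> 0" for k
  proof -
   have k: "k \<notin> Sinf" using bk by (auto simp: b_def)
   then have "rep k \<in> R" using Sinf_cell[OF cell_rep[of k]] cell_rep[of k] by (simp add: R_def rep_def)
   moreover have "lev (rep k) = lev k" using cell_rep[of k] by (simp add: cell_def)
   ultimately show ?thesis using lev(2)[of k] by (simp add: B_def)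
  qed
  show "(\<forall>k. 0 < c k) \<longrightarrow> (\<forall>k. 0 \<le> b k)"
  proof (intro impI allI)
   fix k assume pos: "\<forall>k. 0 < c k"
   show "0 \<le> b k"
   proof (cases "k \<in> Sinf")
    case False
    \<comment> \<open>With positive \<open>c k\<close> the remainders are nonnegative, hence so are
      the lower edge of the cell and the constant above it.\<close>
    have "0 \<le> c' k" using c'a[of k] pos by (cases "a = 0") (auto simp: c'_def less_imp_le)
    then have "0 \<le> of_int (snd (cell k)) * l" using al(2) by (simp add: cell_def)
    also have "... \<le> bb (cell k)" using gd[of "cell k"] False by (simp add: Sinf_def good_def)
    finally show ?thesis using False by (simp add: b_def)
   qed (simp add: b_def)
  qed
 qed (use al B in auto)
qed

section \<open>Independent pairs\<close>

lemma prob_space_pmf_pair: "prob_space (measure_pmf q \<Otimes>\<^sub>M measure_pmf r)"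
proof -
 interpret pair_prob_space "measure_pmf q" "measure_pmf r" ..
 show ?thesis by unfold_locales
qed

lemma measurable_pmf_pair:
 "(\<lambda>z. f (fst z)) \<in> borel_measurable (measure_pmf q \<Otimes>\<^sub>M measure_pmf r)" (is ?A)
 "(\<lambda>z. g (snd z)) \<in> borel_measurable (measure_pmf q \<Otimes>\<^sub>M measure_pmf r)" (is ?B)
 for f :: "_ \<Rightarrow> real" and g :: "_ \<Rightarrow> real"
proof -
 have "f \<in> borel_measurable (measure_pmf q)" "g \<in> borel_measurable (measure_pmf r)" by simp_all
 from measurable_compose[OF measurable_fst this(1)] measurable_compose[OF measurable_snd this(2)] show ?A ?B .
qed

lemma distr_pmf_pair: "distr (measure_pmf q \<Otimes>\<^sub>M measure_pmf r) (measure_pmf q) fst = measure_pmf q"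
 by (rule prob_space.distr_pair_fst[OF measure_pmf.prob_space_axioms])

lemma distr_pmf_pair_fst: "distr (measure_pmf q \<Otimes>\<^sub>M measure_pmf r) borel (\<lambda>z. f (fst z)) = distr (measure_pmf q) borel f" for f :: "_ \<Rightarrow> real"
proof -
 have "distr (measure_pmf q \<Otimes>\<^sub>M measure_pmf r) borel (\<lambda>z. f (fst z)) = distr (distr (measure_pmf q \<Otimes>\<^sub>M measure_pmf r) (measure_pmf q) fst) borel f"
  by (subst distr_distr) (simp_all add: comp_def)
 then show ?thesis by (simp add: distr_pmf_pair)
qed

lemma measure_pmf_pair_fst: "measure (measure_pmf q \<Otimes>\<^sub>M measure_pmf r) {z \<in> space (measure_pmf q \<Otimes>\<^sub>M measure_pmf r). Q (fst z)} = measure q {z. Q z}"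
proof -
 have "measure (measure_pmf q) {z. Q z} = measure (distr (measure_pmf q \<Otimes>\<^sub>M measure_pmf r) (measure_pmf q) fst) {z. Q z}"
  by (simp add: distr_pmf_pair)
 also have "... = measure (measure_pmf q \<Otimes>\<^sub>M measure_pmf r) {z \<in> space (measure_pmf q \<Otimes>\<^sub>M measure_pmf r). Q (fst z)}"
  by (subst measure_distr) (auto intro!: arg_cong[where f="measure _"])
 finally show ?thesis ..
qed

lemma char_pmf_pair:
 fixes f g :: "_ \<Rightarrow> real"
 shows "char (distr (measure_pmf q \<Otimes>\<^sub>M measure_pmf r) borel (\<lambda>z. f (fst z) + g (snd z))) s =
  char (distr (measure_pmf q) borel f) s * char (distr (measure_pmf r) borel g) s"
proof -
 interpret PP: pair_prob_space "measure_pmf q" "measure_pmf r" ..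
 note [measurable] = measurable_pmf_pair[of _ q r]
 have int: "integrable (measure_pmf q \<Otimes>\<^sub>M measure_pmf r) (\<lambda>z. iexp (s * (f (fst z) + g (snd z))))"
  by (intro PP.integrable_const_bound[where B=1]) (simp_all del: of_real_mult of_real_add)
 have "char (distr (measure_pmf q \<Otimes>\<^sub>M measure_pmf r) borel (\<lambda>z. f (fst z) + g (snd z))) s = (\<integral>z. iexp (s * (f (fst z) + g (snd z))) \<partial>(measure_pmf q \<Otimes>\<^sub>M measure_pmf r))"
  by (rule char_distr) measurable
 also have "... = (\<integral>x. (\<integral>y. iexp (s * (f x + g y)) \<partial>measure_pmf r) \<partial>measure_pmf q)"
  using PP.integral_fst'[OF int] by simp
 also have "... = (\<integral>x. iexp (s * f x) * (\<integral>y. iexp (s * g y) \<partial>measure_pmf r) \<partial>measure_pmf q)"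
 proof (intro Bochner_Integration.integral_cong refl)
  fix x
  have "iexp (s * (f x + g y)) = iexp (s * f x) * iexp (s * g y)" for y
   by (simp add: distrib_left exp_add)
  then show "(\<integral>y. iexp (s * (f x + g y)) \<partial>measure_pmf r) = iexp (s * f x) * (\<integral>y. iexp (s * g y) \<partial>measure_pmf r)" by simp
 qed
 also have "... = (\<integral>x. iexp (s * f x) \<partial>measure_pmf q) * (\<integral>y. iexp (s * g y) \<partial>measure_pmf r)" by simp
 finally show ?thesis by (simp add: char_distr)
qed

lemma pmf_pair_atom: "pmf q x * pmf r y \<le> measure (distr (measure_pmf q \<Otimes>\<^sub>M measure_pmf r) borel (\<lambda>z. f (fst z) + g (snd z))) {f x + g y}" for f g :: "_ \<Rightarrow> real"
proof -
 interpret PP: pair_prob_space "measure_pmf q" "measure_pmf r" ..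
 have [measurable]: "(\<lambda>z. f (fst z) + g (snd z)) \<in> borel_measurable (measure_pmf q \<Otimes>\<^sub>M measure_pmf r)"
  by (intro borel_measurable_add measurable_pmf_pair)
 have "emeasure (measure_pmf q \<Otimes>\<^sub>M measure_pmf r) ({x} \<times> {y}) = emeasure (measure_pmf q) {x} * emeasure (measure_pmf r) {y}"
  by (rule measure_pmf.emeasure_pair_measure_Times) auto
 then have 1: "measure (measure_pmf q \<Otimes>\<^sub>M measure_pmf r) ({x} \<times> {y}) = pmf q x * pmf r y"
  by (simp add: measure_def emeasure_pmf_single enn2real_mult)
 have "measure (measure_pmf q \<Otimes>\<^sub>M measure_pmf r) ({x} \<times> {y}) \<le> measure (measure_pmf q \<Otimes>\<^sub>M measure_pmf r) ((\<lambda>z. f (fst z) + g (snd z)) -` {f x + g y} \<inter> space (measure_pmf q \<Otimes>\<^sub>M measure_pmf r))"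
  by (intro PP.finite_measure_mono measurable_sets[OF _ borel_singleton]) (auto simp: space_pair_measure)
 then show ?thesis unfolding 1 by (subst measure_distr) auto
qed

section \<open>From two-point to compound Poisson distributions\<close>

text \<open>If all numbers are periods, any trivial Poisson flow serves. Otherwise the sequence
  passes through \<open>Y\<close>, where \<open>c k\<close> is replaced by \<open>b k\<close> and
  multiples of \<open>a\<close> are added, and through \<open>Z\<close>, where the groups of
  \<open>rep\<close> are summed, to \<open>\<nu>\<close>, where the number of successes in each
  group becomes Poisson.\<close>

lemma two_point_law_to_compound_poisson:
 fixes p c :: "nat \<Rightarrow> real"
 assumes p: "\<And>k. 0 < p k" "\<And>k. p k \<le> 1 / 2" and c: "\<And>k. c k \<noteq> 0" and C: "\<And>k. p k * (c k)\<^sup>2 \<le> C"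
 defines "\<rho> \<equiv> \<lambda>k. nat_law (c k) (bern (p k))"
 shows "\<exists>\<nu>. (\<forall>k. is_compound_poisson (\<nu> k)) \<and> isomorphic_actions (tail_boundary_flow \<rho>) (tail_boundary_flow \<nu>) \<and>
  ((\<forall>k. 0 < c k) \<longrightarrow> (\<forall>k. measure_support (\<nu> k) \<subseteq> {0..}))"
proof (cases "\<forall>s. period \<rho> s")
 case True
 have \<rho>: "real_distribution (\<rho> k)" for k unfolding \<rho>_def by (rule real_distribution_nat_law)
 obtain \<nu> where \<nu>: "\<And>k. is_compound_poisson (\<nu> k)" "\<And>k. measure_support (\<nu> k) \<subseteq> {0..}" "\<And>s. time_periodic \<nu> s"
  by (rule trivial_compound_poisson) (rule that)
 have "isomorphic_actions (tail_boundary_flow \<rho>) (tail_boundary_flow \<nu>)"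
  by (rule trivial_flows_isomorphic[OF \<rho> real_distribution_compound_poisson[OF \<nu>(1)] time_periodic_of_period[OF \<rho>] \<nu>(3)]) (use True in blast)
 with \<nu> show ?thesis by blast
next
 case False
 have \<rho>: "real_distribution (\<rho> k)" for k unfolding \<rho>_def by (rule real_distribution_nat_law)
 obtain a b n rep B where a: "0 \<le> a" "period \<rho> a" and sm: "summable (\<lambda>k. p k * (c k - a * of_int (n k :: int) - b k)\<^sup>2)"
  and rep: "\<And>j. finite {k. rep k = (j :: nat)}" "\<And>k k'. rep k = rep k' \<Longrightarrow> b k = b k'"
  and B: "\<And>k. b k \<noteq> 0 \<Longrightarrow> p k \<le> B (rep k)" "summable B" "\<And>j. 0 \<le> B j" and bpos: "(\<forall>k. 0 < c k) \<longrightarrow> (\<forall>k. 0 \<le> b k)"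
  by (rule two_point_cells[OF p c C False[unfolded \<rho>_def]]) (rule that, unfold \<rho>_def)
 define \<delta> where "\<delta> k = c k - a * of_int (n k) - b k" for k
 let ?M = "\<lambda>k. measure_pmf (bern (p k)) \<Otimes>\<^sub>M measure_pmf (poisson_pmf 1)"
 define x where "x k z = c k * real (fst z)" for k and z :: "nat \<times> nat"
 \<comment> \<open>The independent Poisson multiple of \<open>a\<close> is invisible to the
   coupling, which works modulo \<open>a\<close>, and it makes \<open>a\<close> a period of the new
   sequence as well.\<close>
 define y where "y k z = b k * real (fst z) + a * real (snd z)" for k and z :: "nat \<times> nat"
 \<comment> \<open>The replacement error after centring; the mean \<open>\<delta> k * p k\<close>
   becomes the centring constant of \<open>coupling_isomorphic\<close>.\<close>
 define e where "e k z = \<delta> k * (real (fst z) - p k)" for k and z :: "nat \<times> nat"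
 define Y where "Y k = distr (?M k) borel (y k)" for k
 have M: "prob_space (?M k)" for k by (rule prob_space_pmf_pair)
 have mx: "x k \<in> borel_measurable (?M k)" for k unfolding x_def[abs_def] by (rule measurable_pmf_pair)
 have me: "e k \<in> borel_measurable (?M k)" for k unfolding e_def[abs_def] by (rule measurable_pmf_pair)
 have my: "y k \<in> borel_measurable (?M k)" for k unfolding y_def[abs_def]
  by (intro borel_measurable_add measurable_pmf_pair)
 have p1: "0 \<le> p k" "p k \<le> 1" for k using p[of k] by (auto simp: less_imp_le)
 have lawx: "distr (?M k) borel (x k) = \<rho> k" for k
  unfolding x_def[abs_def] \<rho>_def nat_law_def by (rule distr_pmf_pair_fst)
 have Y: "real_distribution (Y k)" for k unfolding Y_def by (rule real_distribution_distr_map[OF M my])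
 define \<eta> where "\<eta> k = distr (?M k) borel (e k)" for k
 have \<eta>: "real_distribution (\<eta> k)" for k unfolding \<eta>_def by (rule real_distribution_distr_map[OF M me])
 have \<eta>': "\<eta> k = distr (measure_pmf (bern (p k))) borel (\<lambda>i. \<delta> k * (real i - p k))" for k
  unfolding \<eta>_def e_def[abs_def] by (rule distr_pmf_pair_fst)
 have \<eta>int: "integrable (\<eta> k) f" "(\<integral>t. f t \<partial>\<eta> k) = p k * f (\<delta> k * (1 - p k)) + (1 - p k) * f (\<delta> k * (0 - p k))"
  if [measurable]: "f \<in> borel_measurable borel" for f :: "real \<Rightarrow> real" and k
  unfolding \<eta>' by (simp_all add: integrable_distr_eq integral_distr integral_bern[OF p1] integrable_measure_pmf_finite finite_set_bern)
 obtain r where r: "strict_mono r" "AE w in PiM UNIV \<eta>. convergent (\<lambda>n. \<Sum>k<r n. w k)"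
 proof (rule centred_sums_convergent[OF \<eta>])
  show "integrable (\<eta> k) (\<lambda>t. t\<^sup>2)" "(\<integral>t. t \<partial>\<eta> k) = 0" for k
   by (rule \<eta>int, simp) (subst \<eta>int, simp_all add: algebra_simps)
  have v: "(\<integral>t. t\<^sup>2 \<partial>\<eta> k) = (1 - p k) * (p k * (\<delta> k)\<^sup>2)" for k
   by (subst \<eta>int) (simp_all add: power2_eq_square algebra_simps)
  show "summable (\<lambda>k. \<integral>t. t\<^sup>2 \<partial>\<eta> k)"
  proof (rule summable_comparison_test[OF _ sm])
   show "\<exists>N. \<forall>k\<ge>N. norm (\<integral>t. t\<^sup>2 \<partial>\<eta> k) \<le> p k * (c k - a * of_int (n k) - b k)\<^sup>2"
    unfolding v \<delta>_def[symmetric] using p1 mult_right_mono[of "1 - p _" 1 "p _ * (\<delta> _)\<^sup>2"] by (intro exI[of _ 0]) (auto simp: abs_mult)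
  qed
 qed (rule that)
 have conv: "AE w in PiM UNIV ?M. convergent (\<lambda>n. \<Sum>k<r n. e k (w k))"
 proof -
  note D = distr_PiM_map[where M="?M" and x=e, OF M me, folded \<eta>_def]
  have "AE w in distr (PiM UNIV ?M) (PiM UNIV \<eta>) (\<lambda>w k. e k (w k)). convergent (\<lambda>n. \<Sum>k<r n. w k)"
   unfolding D(1) by (rule r(2))
  from AE_distrD[OF D(2) this] show ?thesis .
 qed
 have perY: "time_periodic Y a"
 proof (rule time_periodic_of_period[OF Y period_of_atoms[OF Y]])
  have b0: "1 / 2 \<le> pmf (bern (p k)) 0" for k
   using measure_bern[OF p1, of k "{0}"] p(2)[of k] by (simp add: measure_pmf_single)
  have at: "1 / 2 * exp (- 1) \<le> measure (Y k) {b k * real 0 + a * real i}" if i: "i = 0 \<or> i = 1" for k i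
  proof -
   have "1 / 2 * exp (- 1) \<le> pmf (bern (p k)) 0 * pmf (poisson_pmf 1) i"
    using b0[of k] i by (intro mult_mono) auto
   also have "... \<le> measure (Y k) {b k * real 0 + a * real i}"
    unfolding Y_def y_def[abs_def] by (rule pmf_pair_atom[where f="\<lambda>i. b k * real i" and g="\<lambda>i. a * real i"])
   finally show ?thesis .
  qed
  show "1 / 2 * exp (- 1) \<le> measure (Y k) {0}" for k using at[of 0 k] by simp
  show "1 / 2 * exp (- 1) \<le> measure (Y k) {0 + a}" for k using at[of 1 k] by simp
 qed auto
 have iso1: "isomorphic_actions (tail_boundary_flow \<rho>) (tail_boundary_flow Y)"
 proof -
  have "isomorphic_actions (tail_boundary_flow (\<lambda>k. distr (?M k) borel (x k))) (tail_boundary_flow (\<lambda>k. distr (?M k) borel (y k)))"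
  proof (rule coupling_isomorphic[where M="?M" and x=x and y=y and e=e and a=a and r=r and b="\<lambda>k. \<delta> k * p k" and i="\<lambda>k z. n k * int (fst z) - int (snd z)"])
   show "x k w - y k w = e k w + \<delta> k * p k + a * of_int (n k * int (fst w) - int (snd w))" for k w
    by (simp add: x_def y_def e_def \<delta>_def algebra_simps)
   show "time_periodic (\<lambda>k. distr (?M k) borel (x k)) a" unfolding lawx using time_periodic_of_period[OF \<rho> a(2)] by simp
   show "time_periodic (\<lambda>k. distr (?M k) borel (y k)) a" using perY unfolding Y_def .
  qed (rule M mx my me r(1) conv)+
  then show ?thesis unfolding lawx Y_def by simp
 qed
 define J where "J j = {k. rep k = j}" for j
 have J: "finite (J j)" "disjoint_family J" "(\<Union>j. J j) = UNIV" for j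
  using rep(1) by (auto simp: J_def disjoint_family_on_def)
 define Z where "Z j = distr (PiM UNIV Y) borel (\<lambda>w. \<Sum>i\<in>J j. w i)" for j
 have iso2: "isomorphic_actions (tail_boundary_flow Y) (tail_boundary_flow Z)"
  unfolding Z_def by (rule regroup_isomorphic(1)[OF Y J])
 \<comment> \<open>The common value of \<open>b\<close> on the group. Groups may be empty, since
   \<open>rep\<close> need not be surjective; 0 is the default for them.\<close>
 define \<beta> where "\<beta> j = (if J j = {} then 0 else b (SOME k. k \<in> J j))" for j
 have \<beta>: "b k = \<beta> j" if k: "k \<in> J j" for k j
 proof -
  have "(SOME k. k \<in> J j) \<in> J j" using k by (rule someI)
  then have "b (SOME k. k \<in> J j) = b k" using k by (intro rep(2)) (simp add: J_def)
  then show ?thesis using k by (auto simp: \<beta>_def)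
 qed
 \<comment> \<open>For \<open>\<beta> j = 0\<close> the number of successes is multiplied by 0, so
   any coupling will do and the trivial bound 1 is used.\<close>
 have "\<exists>\<gamma>. map_pmf fst \<gamma> = bern_sum p (J j) \<and> map_pmf snd \<gamma> = pois (\<Sum>i\<in>J j. p i) \<and>
   measure (measure_pmf \<gamma>) {z. fst z \<noteq> snd z} \<le> (if \<beta> j = 0 then 1 else B j)" for j
 proof -
  have "measure (bern_sum p (J j)) A - measure (pois (\<Sum>i\<in>J j. p i)) A \<le> (if \<beta> j = 0 then 1 else B j)" for A
  proof (cases "\<beta> j = 0")
   case True
   have "measure (bern_sum p (J j)) A \<le> 1" "0 \<le> measure (pois (\<Sum>i\<in>J j. p i)) A" by simp_all
   then have "measure (bern_sum p (J j)) A - measure (pois (\<Sum>i\<in>J j. p i)) A \<le> 1" by linarith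
   then show ?thesis unfolding True by simp
  next
   case False
   have "measure (bern_sum p (J j)) A - measure (pois (\<Sum>i\<in>J j. p i)) A \<le> B j"
   proof (rule bern_sum_pois_le[OF J(1)])
    show "p i \<le> B j" if "i \<in> J j" for i using B(1)[of i] \<beta>[OF that] False that by (simp add: J_def)
   qed (use p(1) p1(2) B(3) in auto)
   then show ?thesis using False by simp
  qed
  from maximal_coupling[OF this] show ?thesis by metis
 qed
 then obtain \<gamma> where \<gamma>: "\<And>j. map_pmf fst (\<gamma> j) = bern_sum p (J j)" "\<And>j. map_pmf snd (\<gamma> j) = pois (\<Sum>i\<in>J j. p i)"
   "\<And>j. measure (measure_pmf (\<gamma> j)) {z. fst z \<noteq> snd z} \<le> (if \<beta> j = 0 then 1 else B j)" by metis
 \<comment> \<open>The Poisson multiples of \<open>a\<close> in a group add up to one of rate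
   \<open>card (J j)\<close>. It is the same variable in \<open>u\<close> and \<open>v\<close>, so
   it cancels in their difference.\<close>
 let ?N = "\<lambda>j. measure_pmf (\<gamma> j) \<Otimes>\<^sub>M measure_pmf (pois (real (card (J j))))"
 define u where "u j z = \<beta> j * real (fst (fst z)) + a * real (snd z)" for j and z :: "(nat \<times> nat) \<times> nat"
 define v where "v j z = \<beta> j * real (snd (fst z)) + a * real (snd z)" for j and z :: "(nat \<times> nat) \<times> nat"
 have N: "prob_space (?N j)" for j by (rule prob_space_pmf_pair)
 have mu: "u j \<in> borel_measurable (?N j)" "v j \<in> borel_measurable (?N j)" for j
  unfolding u_def[abs_def] v_def[abs_def]
  by (intro borel_measurable_add measurable_pmf_pair(1)[where f="\<lambda>z. \<beta> j * real (fst z)"] measurable_pmf_pair(1)[where f="\<lambda>z. \<beta> j * real (snd z)"] measurable_pmf_pair(2))+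
 define \<nu> where "\<nu> j = distr (?N j) borel (v j)" for j
 have \<nu>: "real_distribution (\<nu> j)" for j unfolding \<nu>_def by (rule real_distribution_distr_map[OF N mu(2)])
 have law: "nat_law c (map_pmf f g) = distr (measure_pmf g) borel (\<lambda>z. c * real (f z))" for c f and g :: "(nat \<times> nat) pmf"
  unfolding nat_law_def map_pmf_rep_eq by (subst distr_distr) (auto simp: comp_def)
 have chu: "char (distr (?N j) borel (u j)) s = char (nat_law (\<beta> j) (bern_sum p (J j))) s * char (nat_law a (pois (real (card (J j))))) s" for j s
  unfolding u_def[abs_def] \<gamma>(1)[symmetric] law unfolding nat_law_def
  by (rule char_pmf_pair[where f="\<lambda>z. \<beta> j * real (fst z)"])
 have chv: "char (\<nu> j) s = char (nat_law (\<beta> j) (pois (\<Sum>i\<in>J j. p i))) s * char (nat_law a (pois (real (card (J j))))) s" for j s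
  unfolding \<nu>_def v_def[abs_def] \<gamma>(2)[symmetric] law unfolding nat_law_def
  by (rule char_pmf_pair[where f="\<lambda>z. \<beta> j * real (snd z)"])
 have chY: "char (Y k) s = (1 + of_real (p k) * (iexp (s * b k) - 1)) * exp (iexp (s * a) - 1)" for k s
 proof -
  have "char (Y k) s = char (nat_law (b k) (bern (p k))) s * char (nat_law a (poisson_pmf 1)) s"
   unfolding Y_def y_def[abs_def] nat_law_def by (rule char_pmf_pair)
  then show ?thesis by (simp add: char_nat_law_bern[OF p1] char_nat_law_poisson)
 qed
 have Zu: "Z j = distr (?N j) borel (u j)" for j
 proof (rule char_eq_imp_eq)
  show "real_distribution (Z j)" unfolding Z_def
   by (intro real_distribution_distr_map prob_space_PiM_real Y borel_measurable_sum measurable_PiM_real_component)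
  show "real_distribution (distr (?N j) borel (u j))" by (rule real_distribution_distr_map[OF N mu(1)])
  fix s
  have "char (Z j) s = (\<Prod>k\<in>J j. (1 + of_real (p k) * (iexp (s * b k) - 1)) * exp (iexp (s * a) - 1))"
   unfolding Z_def char_distr_sum_PiM[OF Y] chY ..
  also have "... = (\<Prod>k\<in>J j. (1 + of_real (p k) * (iexp (s * \<beta> j) - 1)) * exp (iexp (s * a) - 1))"
   by (intro prod.cong refl) (simp add: \<beta>)
  also have "... = (\<Prod>k\<in>J j. 1 + of_real (p k) * (iexp (s * \<beta> j) - 1)) * exp (of_nat (card (J j)) * (iexp (s * a) - 1))"
   unfolding prod.distrib by (simp add: exp_of_nat_mult)
  also have "... = char (distr (?N j) borel (u j)) s"
   unfolding chu using char_bern_sum[OF J(1), of j p "\<beta> j" s] char_pois[of "real (card (J j))" a s] p1 by simp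
  finally show "char (Z j) s = char (distr (?N j) borel (u j)) s" .
 qed
 have iso3: "isomorphic_actions (tail_boundary_flow Z) (tail_boundary_flow \<nu>)"
  unfolding Zu \<nu>_def
 proof (rule coupling_isomorphic_convergent[OF N mu])
  show "AE w in PiM UNIV ?N. convergent (\<lambda>n. \<Sum>k<n. u k (w k) - v k (w k))"
  proof (rule AE_convergent_sum[where \<delta>="\<lambda>_. 0" and e="\<lambda>j z. u j z - v j z", OF N borel_measurable_diff[OF mu] B(2)])
   fix j
   let ?Q = "\<lambda>z. 0 < \<bar>\<beta> j * real (fst z) - \<beta> j * real (snd z)\<bar>"
   have "measure (?N j) {w \<in> space (?N j). 0 < \<bar>u j w - v j w\<bar>} = measure (\<gamma> j) {z. ?Q z}"
    using measure_pmf_pair_fst[where Q="?Q"] by (simp add: u_def v_def)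
   also have "... \<le> B j"
   proof (cases "\<beta> j = 0")
    case True
    then show ?thesis using B(3)[of j] by simp
   next
    case False
    have "measure (\<gamma> j) {z. ?Q z} \<le> measure (\<gamma> j) {z. fst z \<noteq> snd z}"
     by (intro measure_pmf.finite_measure_mono) auto
    with \<gamma>(3)[of j] False show ?thesis by simp
   qed
   finally show "measure (?N j) {w \<in> space (?N j). 0 < \<bar>u j w - v j w\<bar>} \<le> B j" .
  qed simp
 qed
 have cp: "is_compound_poisson (\<nu> j)" for j
 proof (rule is_compound_poissonI[OF \<nu>, where J="{0, 1 :: nat}" and p="\<lambda>i. if i = 0 then \<Sum>k\<in>J j. p k else real (card (J j))" and c="\<lambda>i. if i = 0 then \<beta> j else a"])
  have "0 \<le> (\<Sum>k\<in>J j. p k)" by (intro sum_nonneg p1)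
  then show "char (\<nu> j) s = exp (\<Sum>i\<in>{0, 1 :: nat}. of_real (if i = 0 then \<Sum>k\<in>J j. p k else real (card (J j))) * (iexp (s * (if i = 0 then \<beta> j else a)) - 1))" for s
   unfolding chv by (simp add: char_pois exp_add)
  show "0 \<le> (if i = 0 then \<Sum>k\<in>J j. p k else real (card (J j)))" for i :: nat by (simp add: sum_nonneg p1)
 qed simp
 have supp: "measure_support (\<nu> j) \<subseteq> {0..}" if "\<forall>k. 0 < c k" for j
 proof (rule support_nonneg_of_AE[OF \<nu>])
  have "0 \<le> \<beta> j" using bpos that by (simp add: \<beta>_def)
  then show "AE x in \<nu> j. 0 \<le> x"
   unfolding \<nu>_def using mu(2) a(1) by (subst AE_distr_iff) (auto simp: v_def)
 qed
 have Z: "real_distribution (Z j)" for j unfolding Zu by (rule real_distribution_distr_map[OF N mu(1)])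
 note tbf = linf_algebra_tail_boundary_flow
 have "isomorphic_actions (tail_boundary_flow \<rho>) (tail_boundary_flow \<nu>)"
  by (rule isomorphic_actions_trans[OF tbf[OF \<rho>] tbf[OF Z] isomorphic_actions_trans[OF tbf[OF \<rho>] tbf[OF Y] iso1 iso2] iso3])
 with cp supp show ?thesis by blast
qed

section \<open>Two-point distributions as translated Bernoulli distributions\<close>

lemma two_point_law:
 assumes \<nu>: "real_distribution \<nu>" and supp: "measure_support \<nu> = {x, y}" and xy: "x \<noteq> y"
 shows "0 < measure \<nu> {y}" "measure \<nu> {x} = 1 - measure \<nu> {y}"
  and "\<nu> = distr (measure_pmf (bern (measure \<nu> {y}))) borel (\<lambda>n. x + (y - x) * real n)"
  and "prob_space.variance \<nu> (\<lambda>t. t) = measure \<nu> {y} * (1 - measure \<nu> {y}) * (y - x)\<^sup>2"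
proof -
 interpret real_distribution \<nu> by fact
 let ?p = "measure \<nu> {y}"
 have AE: "AE t in \<nu>. t \<in> {x, y}" using AE_measure_support[OF \<nu>] unfolding supp .
 have m: "measure \<nu> A = ?p * indicator A y + measure \<nu> {x} * indicator A x" if A: "A \<in> sets borel" for A
 proof -
  have "measure \<nu> A = measure \<nu> (A \<inter> {x, y})"
   using AE A by (intro finite_measure_eq_AE) auto
  also have "A \<inter> {x, y} = (if x \<in> A then {x} else {}) \<union> (if y \<in> A then {y} else {})" by auto
  also have "measure \<nu> ... = measure \<nu> (if x \<in> A then {x} else {}) + measure \<nu> (if y \<in> A then {y} else {})"
   using xy by (intro finite_measure_Union) auto
  finally show ?thesis by (auto simp: indicator_def)
 qed
 have "measure \<nu> UNIV = 1" using prob_space by simp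
 then show mx: "measure \<nu> {x} = 1 - ?p" using m[of UNIV] by simp
 have "y \<in> measure_support \<nu>" unfolding supp by simp
 then have "0 < emeasure \<nu> (- {x})" using xy by (auto simp: measure_support_def)
 moreover have "measure \<nu> (- {x}) = ?p" using m[of "- {x}"] xy by simp
 ultimately show "0 < ?p" by (simp add: emeasure_eq_measure)
 have p: "0 \<le> ?p" "?p \<le> 1" by simp_all
 show law: "\<nu> = distr (measure_pmf (bern ?p)) borel (\<lambda>n. x + (y - x) * real n)" (is "_ = ?D")
 proof (rule measure_eqI)
  interpret D: prob_space ?D by (intro prob_space.prob_space_distr measure_pmf.prob_space_axioms) simp
  fix A assume "A \<in> sets \<nu>"
  then have A: "A \<in> sets borel" by simp
  have "measure ?D A = measure (bern ?p) {n. x + (y - x) * real n \<in> A}" using A by (subst measure_distr) (auto simp: vimage_def)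
  also have "... = measure \<nu> A" unfolding m[OF A] mx measure_bern[OF p] by (simp add: indicator_def)
  finally show "emeasure \<nu> A = emeasure ?D A" by (simp add: emeasure_eq_measure D.emeasure_eq_measure)
 qed simp
 have ex: "(\<integral>t. f t \<partial>\<nu>) = ?p * f y + (1 - ?p) * f x" if "f \<in> borel_measurable borel" for f :: "real \<Rightarrow> real"
 proof -
  have "(\<integral>t. f t \<partial>?D) = ?p * f y + (1 - ?p) * f x" using that by (simp add: integral_distr integral_bern[OF p])
  then show ?thesis unfolding law[symmetric] .
 qed
 show "variance (\<lambda>t. t) = ?p * (1 - ?p) * (y - x)\<^sup>2"
  by (simp add: ex power2_eq_square algebra_simps)
qed

text \<open>A lighter atom is taken as the success, so \<open>p \<le> 1 / 2\<close> and the variance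
  \<open>p * (1 - p) * c\<^sup>2\<close> controls \<open>p * c\<^sup>2\<close>. In the left heavy
  case the larger atom can be chosen for this role, which makes \<open>c\<close> positive.\<close>

lemma two_point_law_normal_form:
 assumes \<nu>: "real_distribution \<nu>" and card: "card (measure_support \<nu>) = 2"
 shows "\<exists>\<alpha> c p. 0 < p \<and> p \<le> 1 / 2 \<and> c \<noteq> 0 \<and> p * c\<^sup>2 \<le> 2 * prob_space.variance \<nu> (\<lambda>t. t) \<and>
  \<nu> = distr (measure_pmf (bern p)) borel (\<lambda>n. \<alpha> + c * real n) \<and>
  ((\<exists>a b. a < b \<and> measure_support \<nu> = {a, b} \<and> measure \<nu> {b} \<le> measure \<nu> {a}) \<longrightarrow> 0 < c)"
proof -
 define nf where "nf \<alpha> c p \<longleftrightarrow> 0 < p \<and> p \<le> 1 / 2 \<and> c \<noteq> 0 \<and> p * c\<^sup>2 \<le> 2 * prob_space.variance \<nu> (\<lambda>t. t) \<and>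
  \<nu> = distr (measure_pmf (bern p)) borel (\<lambda>n. \<alpha> + c * real n)" for \<alpha> c p
 define lh where "lh \<longleftrightarrow> (\<exists>a b. a < b \<and> measure_support \<nu> = {a, b} \<and> measure \<nu> {b} \<le> measure \<nu> {a})"
 have *: "nf x (y - x) (measure \<nu> {y})" if xy: "measure_support \<nu> = {x, y}" "x \<noteq> y" "measure \<nu> {y} \<le> measure \<nu> {x}" for x y
  unfolding nf_def
 proof (intro conjI)
  note t = two_point_law[OF \<nu> xy(1,2)]
  show "0 < measure \<nu> {y}" by (rule t(1))
  show p: "measure \<nu> {y} \<le> 1 / 2" using xy(3) t(2) by linarith
  show "y - x \<noteq> 0" using xy(2) by simp
  show "\<nu> = distr (measure_pmf (bern (measure \<nu> {y}))) borel (\<lambda>n. x + (y - x) * real n)" by (rule t(3))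
  have "1 / 2 * (measure \<nu> {y} * (y - x)\<^sup>2) \<le> (1 - measure \<nu> {y}) * (measure \<nu> {y} * (y - x)\<^sup>2)"
   using p by (intro mult_right_mono) auto
  then show "measure \<nu> {y} * (y - x)\<^sup>2 \<le> 2 * prob_space.variance \<nu> (\<lambda>t. t)" unfolding t(4) by (simp add: mult_ac)
 qed
 have "\<exists>\<alpha> c p. nf \<alpha> c p \<and> (lh \<longrightarrow> 0 < c)"
 proof (cases lh)
  case True
  then obtain a b where ab: "a < b" "measure_support \<nu> = {a, b}" "measure \<nu> {b} \<le> measure \<nu> {a}" unfolding lh_def by blast
  then have "nf a (b - a) (measure \<nu> {b})" "0 < b - a" using *[of a b] by auto
  then show ?thesis by blast
 next
  case False
  from card obtain x y where xy: "measure_support \<nu> = {x, y}" "x \<noteq> y" by (auto simp: card_2_iff)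
  have "measure_support \<nu> = {y, x}" using xy(1) by auto
  with *[of x y] *[of y x] xy have "\<exists>\<alpha> c p. nf \<alpha> c p" by (metis linear)
  with False show ?thesis by blast
 qed
 then show ?thesis unfolding nf_def lh_def conj_assoc .
qed

lemma two_point_to_compound_poisson:
 assumes \<mu>: "two_point_sequence \<mu>" "bounded_variances \<mu>"
 shows "\<exists>\<nu>. (\<forall>k. is_compound_poisson (\<nu> k)) \<and> isomorphic_actions (tail_boundary_flow \<mu>) (tail_boundary_flow \<nu>) \<and>
  (left_heavy_two_point_sequence \<mu> \<longrightarrow> (\<forall>k. measure_support (\<nu> k) \<subseteq> {0..}))"
proof -
 have rd: "real_distribution (\<mu> k)" for k using \<mu>(1) by (simp add: two_point_sequence_def)
 obtain V where V: "\<And>k. prob_space.variance (\<mu> k) (\<lambda>t. t) \<le> V"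
  using \<mu>(2) by (auto simp: bounded_variances_def bdd_above_def)
 have "\<forall>k. \<exists>\<alpha> c p. 0 < p \<and> p \<le> 1 / 2 \<and> c \<noteq> 0 \<and> p * c\<^sup>2 \<le> 2 * prob_space.variance (\<mu> k) (\<lambda>t. t) \<and>
  \<mu> k = distr (measure_pmf (bern p)) borel (\<lambda>n. \<alpha> + c * real n) \<and>
  ((\<exists>a b. a < b \<and> measure_support (\<mu> k) = {a, b} \<and> measure (\<mu> k) {b} \<le> measure (\<mu> k) {a}) \<longrightarrow> 0 < c)"
  using two_point_law_normal_form[OF rd] \<mu>(1) unfolding two_point_sequence_def by blast
 then obtain \<alpha> c p where pc: "\<And>k. 0 < p k" "\<And>k. p k \<le> 1 / 2" "\<And>k. c k \<noteq> 0" "\<And>k. p k * (c k)\<^sup>2 \<le> 2 * prob_space.variance (\<mu> k) (\<lambda>t. t)"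
  and law: "\<And>k. \<mu> k = distr (measure_pmf (bern (p k))) borel (\<lambda>n. \<alpha> k + c k * real n)"
  and pos: "\<And>k. (\<exists>a b. a < b \<and> measure_support (\<mu> k) = {a, b} \<and> measure (\<mu> k) {b} \<le> measure (\<mu> k) {a}) \<Longrightarrow> 0 < c k" by metis
 let ?\<rho> = "\<lambda>k. nat_law (c k) (bern (p k))"
 have C: "p k * (c k)\<^sup>2 \<le> 2 * V" for k using pc(4)[of k] V[of k] by linarith
 from two_point_law_to_compound_poisson[where p=p and c=c, OF pc(1-3) C]
 obtain \<nu> where \<nu>: "\<forall>k. is_compound_poisson (\<nu> k)" "isomorphic_actions (tail_boundary_flow ?\<rho>) (tail_boundary_flow \<nu>)"
  "(\<forall>k. 0 < c k) \<longrightarrow> (\<forall>k. measure_support (\<nu> k) \<subseteq> {0..})"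
  by (elim exE conjE)
 \<comment> \<open>The positions \<open>\<alpha> k\<close> of the other atoms are removed as
   centring constants.\<close>
 have "isomorphic_actions (tail_boundary_flow (\<lambda>k. distr (measure_pmf (bern (p k))) borel (\<lambda>n. \<alpha> k + c k * real n)))
   (tail_boundary_flow (\<lambda>k. distr (measure_pmf (bern (p k))) borel (\<lambda>n. c k * real n)))"
  by (rule coupling_isomorphic[where e="\<lambda>_ _. 0" and i="\<lambda>_ _. 0" and a=0 and b=\<alpha> and r="\<lambda>n. n"])
    (auto intro: measure_pmf.prob_space_axioms time_periodic_0 convergent_const simp: strict_mono_def)
 then have iso: "isomorphic_actions (tail_boundary_flow \<mu>) (tail_boundary_flow ?\<rho>)"
  unfolding law[symmetric] nat_law_def .
 have "isomorphic_actions (tail_boundary_flow \<mu>) (tail_boundary_flow \<nu>)"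
  by (rule isomorphic_actions_trans[OF linf_algebra_tail_boundary_flow[OF rd] linf_algebra_tail_boundary_flow[OF real_distribution_nat_law] iso \<nu>(2)])
 moreover have "\<forall>k. 0 < c k" if "left_heavy_two_point_sequence \<mu>"
  using that pos unfolding left_heavy_two_point_sequence_def by blast
 ultimately show ?thesis using \<nu>(1,3) by blast
qed

lemma left_heavy_imp_two_point: "left_heavy_two_point_sequence \<mu> \<Longrightarrow> two_point_sequence \<mu>"
 unfolding left_heavy_two_point_sequence_def two_point_sequence_def by (metis card_2_iff less_irrefl)

text \<open>The flag \<open>pos\<close> treats both parts at once. On the right-hand side ergodicity
  is automatic, because it is inherited from the tail boundary flow.\<close>

lemma compound_poisson_flow_iff:
 assumes Z: "linf_algebra Z"
 shows "ergodic_action Z \<and> (\<exists>\<nu>. (\<forall>n. is_compound_poisson (\<nu> n) \<and> (pos \<longrightarrow> measure_support (\<nu> n) \<subseteq> {0..})) \<and> isomorphic_actions Z (tail_boundary_flow \<nu>)) \<longleftrightarrow>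
  (\<exists>\<mu>. two_point_sequence \<mu> \<and> (pos \<longrightarrow> left_heavy_two_point_sequence \<mu>) \<and> bounded_variances \<mu> \<and> isomorphic_actions Z (tail_boundary_flow \<mu>))"
  (is "_ \<and> ?A \<longleftrightarrow> ?B")
proof
 assume "ergodic_action Z \<and> ?A"
 then obtain \<nu> where \<nu>: "\<And>n. is_compound_poisson (\<nu> n)" "\<And>n. pos \<Longrightarrow> measure_support (\<nu> n) \<subseteq> {0..}" "isomorphic_actions Z (tail_boundary_flow \<nu>)"
  by blast
 from compound_poisson_to_two_point[where \<nu>=\<nu>, OF \<nu>(1)] obtain \<mu> where \<mu>: "two_point_sequence \<mu>" "bounded_variances \<mu>"
  "isomorphic_actions (tail_boundary_flow \<nu>) (tail_boundary_flow \<mu>)"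
  "(\<forall>n. measure_support (\<nu> n) \<subseteq> {0..}) \<longrightarrow> left_heavy_two_point_sequence \<mu>"
  by (elim exE conjE)
 have "isomorphic_actions Z (tail_boundary_flow \<mu>)"
  by (rule isomorphic_actions_trans[OF Z linf_algebra_tail_boundary_flow[OF real_distribution_compound_poisson[OF \<nu>(1)]] \<nu>(3) \<mu>(3)])
 with \<mu> \<nu>(2) show ?B by blast
next
 assume ?B
 then obtain \<mu> where \<mu>: "two_point_sequence \<mu>" "bounded_variances \<mu>" "isomorphic_actions Z (tail_boundary_flow \<mu>)"
  "pos \<longrightarrow> left_heavy_two_point_sequence \<mu>" by blast
 have rd: "real_distribution (\<mu> k)" for k using \<mu>(1) by (simp add: two_point_sequence_def)
 note lin = linf_algebra_tail_boundary_flow[OF rd]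
 from two_point_to_compound_poisson[OF \<mu>(1,2)] obtain \<nu> where \<nu>: "\<forall>k. is_compound_poisson (\<nu> k)"
  "isomorphic_actions (tail_boundary_flow \<mu>) (tail_boundary_flow \<nu>)"
  "left_heavy_two_point_sequence \<mu> \<longrightarrow> (\<forall>k. measure_support (\<nu> k) \<subseteq> {0..})"
  by (elim exE conjE)
 have "isomorphic_actions Z (tail_boundary_flow \<nu>)" by (rule isomorphic_actions_trans[OF Z lin \<mu>(3) \<nu>(2)])
 moreover have "ergodic_action Z" by (rule ergodic_action_isomorphic[OF Z lin \<mu>(3) ergodic_tail_boundary_flow[OF rd]])
 ultimately show "ergodic_action Z \<and> ?A" using \<nu>(1,3) \<mu>(4) by blast
qed

lemma poisson_flow_iff:
 assumes "linf_algebra Z"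
 shows "poisson_flow Z \<longleftrightarrow> (\<exists>\<mu>. two_point_sequence \<mu> \<and> bounded_variances \<mu> \<and> isomorphic_actions Z (tail_boundary_flow \<mu>))"
  and "poisson_flow_positive_type Z \<longleftrightarrow> (\<exists>\<mu>. left_heavy_two_point_sequence \<mu> \<and> bounded_variances \<mu> \<and> isomorphic_actions Z (tail_boundary_flow \<mu>))"
 using compound_poisson_flow_iff[OF assms, of False] compound_poisson_flow_iff[OF assms, of True] left_heavy_imp_two_point
 unfolding poisson_flow_def poisson_flow_positive_type_def by (simp, meson)

theorem proposition3p11:
  fixes M :: "'a measure" and T :: "real \<Rightarrow> 'a \<Rightarrow> 'a" and \<eta> :: "nat \<Rightarrow> real measure"
  assumes "nonsingular_flow M T"
    and "\<forall>n. real_distribution (\<eta> n)"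
  shows
    "((poisson_flow (flow_action M T) \<longleftrightarrow>
        (\<exists>\<mu>. two_point_sequence \<mu> \<and> bounded_variances \<mu> \<and>
             isomorphic_actions (flow_action M T) (tail_boundary_flow \<mu>))) \<and>
      (poisson_flow (tail_boundary_flow \<eta>) \<longleftrightarrow>
        (\<exists>\<mu>. two_point_sequence \<mu> \<and> bounded_variances \<mu> \<and>
             isomorphic_actions (tail_boundary_flow \<eta>) (tail_boundary_flow \<mu>)))) \<and>
     ((poisson_flow_positive_type (flow_action M T) \<longleftrightarrow>
        (\<exists>\<mu>. left_heavy_two_point_sequence \<mu> \<and> bounded_variances \<mu> \<and>
             isomorphic_actions (flow_action M T) (tail_boundary_flow \<mu>))) \<and>
      (poisson_flow_positive_type (tail_boundary_flow \<eta>) \<longleftrightarrow>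
        (\<exists>\<mu>. left_heavy_two_point_sequence \<mu> \<and> bounded_variances \<mu> \<and>
             isomorphic_actions (tail_boundary_flow \<eta>) (tail_boundary_flow \<mu>))))"
proof -
  have Z: "linf_algebra (flow_action M T)" by (rule linf_algebra_flow_action[OF assms(1)])
  have W: "linf_algebra (tail_boundary_flow \<eta>)" using assms(2) by (intro linf_algebra_tail_boundary_flow) simp
  show ?thesis
    by (intro conjI poisson_flow_iff[OF Z] poisson_flow_iff[OF W])
qed

end
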